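(* Let $\mathfrak{G}$ be a contracting completely shift-invariant groupoid whose unit space $\mathcal{F}$ is the edge shift of a finite directed graph with edge set $\mathsf{X}$, and let $A$ be an abelian group. For $n\ge0$ let $\mathcal{D}^{(n)}$ be the direct limit of $A\mathcal{N}^{(n)}\xrightarrow{\varsigma_*}A\mathcal{N}^{(n)}\xrightarrow{\varsigma_*}\cdots$, where $\mathcal{N}^{(n)}$ is the $n$-dimensional nucleus of $\mathfrak{G}$. Then the natural homomorphisms $J\colon C_c(\mathfrak{G}^{(n)};A)\to\mathcal{D}^{(n)}$ induce isomorphisms of $H_n(\mathfrak{G};A)$ with the homology groups of the chain complex $$0\xleftarrow{\delta_0}\mathcal{D}^{(0)}\xleftarrow{\delta_1}\mathcal{D}^{(1)}\xleftarrow{\delta_2}\mathcal{D}^{(2)}\xleftarrow{\delta_3}\cdots.$$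
   Context: Groupoid conventions. $\mathsf{s}(g)=g^{-1}g$, $\mathsf{r}(g)=gg^{-1}$; $g_1g_2$ is defined iff $\mathsf{s}(g_1)=\mathsf{r}(g_2)$. Topological groupoids are locally compact with Hausdorff unit space (the groupoid itself need not be Hausdorff); ample means étale with a basis of compact open bisections (and second countable); a bisection is a subset on which $\mathsf{s}$ and $\mathsf{r}$ are homeomorphisms onto their images. An étale groupoid is effective if it is the groupoid of germs of the local homeomorphisms $\mathsf{s}(g)\mapsto\mathsf{r}(g)$ ($g\in F$) defined by its open bisections $F$. Shift-invariance. $\mathcal{F}$ is the space of infinite directed paths $x_1x_2\ldots$ in the graph, $\sigma(x_1x_2\ldots)=x_2x_3\ldots$; $S_x\colon w\mapsto xw$ on $\{w\in\mathcal{F}:xw\in\mathcal{F}\}$; $S_{x_1\ldots x_n}=S_{x_1}\cdots S_{x_n}$. Let $\mathfrak{G}$ be an effective étale groupoid with unit space $\mathcal{F}$. For $g\in\mathfrak{G}$ with $\mathsf{s}(g)=x_1x_2\ldots$, $\mathsf{r}(g)=y_1y_2\ldots$, put $\varsigma(g)=S_{y_1}^{-1}gS_{x_1}$. $\mathfrak{G}$ is completely shift-invariant if $\varsigma(\mathfrak{G})\subset\mathfrak{G}$ and $S_ygS_x^{-1}\in\mathfrak{G}$ whenever $g\in\mathfrak{G}$ and $x\,\mathsf{s}(g),y\,\mathsf{r}(g)\in\mathcal{F}$; then $\varsigma$ is a functor $\mathfrak{G}\to\mathfrak{G}$. It is contracting if there is a compact $C\subset\mathfrak{G}$ such that every $g\in\mathfrak{G}$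 satisfies $\varsigma^n(g)\in C$ for some $n$. Homology. $\mathfrak{G}^{(0)}=\mathcal{F}$ and, for $n\ge1$, $\mathfrak{G}^{(n)}\subset\mathfrak{G}^n$ is the space of sequences $(g_1,\ldots,g_n)$ with $\mathsf{s}(g_i)=\mathsf{r}(g_{i+1})$. Define $d_i\colon\mathfrak{G}^{(n)}\to\mathfrak{G}^{(n-1)}$, $0\le i\le n$, by $d_0(g_1,\ldots,g_n)=(g_2,\ldots,g_n)$, $d_n(g_1,\ldots,g_n)=(g_1,\ldots,g_{n-1})$, $d_i(g_1,\ldots,g_n)=(g_1,\ldots,g_ig_{i+1},\ldots,g_n)$ for $0<i<n$; for $n=1$, $d_0=\mathsf{r}$, $d_1=\mathsf{s}$ as printed in the paper. An ordered multisection of length $n$ is a sequence $(F_1,\ldots,F_n)$ of compact open bisections with $\mathsf{s}(F_i)=\mathsf{r}(F_{i+1})$, identified with the set of $(g_1,\ldots,g_n)\in\mathfrak{G}^{(n)}$ with $g_i\in F_i$ (for $n=0$: a compact open subset of $\mathfrak{G}^{(0)}$). For $a\in A$ and an ordered multisection $U$, $a_U$ is the function equal to $a$ on $U$ and $0$ elsewhere; $C_c(\mathfrak{G}^{(n)};A)$ is the group of functions generated by all $a_U$. Let $((d_i)_*f)(z)=\sum_{d_i(y)=z}f(y)$ and $\delta_n=\sum_{i=0}^n(-1)^i(d_i)_*$, $\delta_0=0$. $H_n(\mathfrak{G};A)=\ker\delta_n/\operatorname{im}\delta_{n+1}$. Multi-dimensional nucleus. For an ordered multisection $U=(F_1,\ldots,F_n)$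 and words $v_0,\ldots,v_n$ of the same length $k$, let $U|_{(v_0,\ldots,v_n)}$ be the image under $\varsigma^k$ (applied coordinatewise; $\varsigma=\sigma$ on $\mathfrak{G}^{(0)}$) of the set of $(g_1,\ldots,g_n)\in U$ such that $\mathsf{r}(g_1)$ begins with $v_0$ and $\mathsf{s}(g_i)$ begins with $v_i$, $i=1,\ldots,n$; it is an ordered multisection. The $n$-dimensional nucleus $\mathcal{N}^{(n)}$ is the smallest set of ordered multisections of length $n$ such that for every ordered multisection $U$ of length $n$ there is $m_0$ such that $U|_{(v_0,\ldots,v_n)}$ is empty or in $\mathcal{N}^{(n)}$ for all words $v_0,\ldots,v_n$ of equal length $m\ge m_0$ (it exists). $A\mathcal{N}^{(n)}$ is the subgroup of $C_c(\mathfrak{G}^{(n)};A)$ generated by $a_U$, $a\in A$, $U\in\mathcal{N}^{(n)}$. Let $(\varsigma_*f)(z)=\sum_{\varsigma(y)=z}f(y)$; it preserves $A\mathcal{N}^{(n)}$ and commutes with $\delta_n$. For every $f\in C_c(\mathfrak{G}^{(n)};A)$ there is $m$ with $\varsigma_*^m(f)\in A\mathcal{N}^{(n)}$; $J(f)\in\mathcal{D}^{(n)}$ is the element represented by $\varsigma_*^m(f)$ in the $m$-th copy (numbering from $0$) of $A\mathcal{N}^{(n)}$ in the direct system. The map $\delta_n\colon\mathcal{D}^{(n)}\to\mathcal{D}^{(n-1)}$ is induced by $\delta_n$: the class of $f$ in the $m$-th copy is sent to the class of $\varsigma_*^k(\delta_nf)$ in the $(m+k)$-th copy of $A\mathcal{N}^{(n-1)}$,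 for any $k$ with $\varsigma_*^k(\delta_nf)\in A\mathcal{N}^{(n-1)}$. *)

theory Defs
  imports
    "HOL-Analysis.Analysis"
    "HOL-Algebra.Generated_Groups"
    "Graph_Theory.Digraph"
begin

section \<open>Topological groupoids\<close>

text \<open>
  The carrier of a groupoid is the space of its topology; the unit space is a subset of it.
  The values of the multiplication outside the composable pairs are irrelevant.
\<close>

record 'g topgpd =
  gtop :: "'g topology"
  gmul :: "'g \<Rightarrow> 'g \<Rightarrow> 'g"
  ginv :: "'g \<Rightarrow> 'g"

definition src :: "'g topgpd \<Rightarrow> 'g \<Rightarrow> 'g" where
  "src G g = gmul G (ginv G g) g"

definition rng :: "'g topgpd \<Rightarrow> 'g \<Rightarrow> 'g" where
  "rng G g = gmul G g (ginv G g)"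

definition elts :: "'g topgpd \<Rightarrow> 'g set" where
  "elts G = topspace (gtop G)"

definition units :: "'g topgpd \<Rightarrow> 'g set" where
  "units G = src G ` elts G"

definition unit_top :: "'g topgpd \<Rightarrow> 'g topology" where
  "unit_top G = subtopology (gtop G) (units G)"

definition composable :: "'g topgpd \<Rightarrow> ('g \<times> 'g) set" where
  "composable G = {(g, h). g \<in> elts G \<and> h \<in> elts G \<and> src G g = rng G h}"

locale topological_groupoid =
  fixes G :: "'g topgpd"
  assumes inv_closed: "g \<in> elts G \<Longrightarrow> ginv G g \<in> elts G"
    and inv_inv: "g \<in> elts G \<Longrightarrow> ginv G (ginv G g) = g"
    and mul_closed: "(g, h) \<in> composable G \<Longrightarrow> gmul G g h \<in> elts G"
    and src_mul: "(g, h) \<in> composable G \<Longrightarrow> src G (gmul G g h) = src G h"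
    and rng_mul: "(g, h) \<in> composable G \<Longrightarrow> rng G (gmul G g h) = rng G g"
    and assoc: "\<lbrakk>(g, h) \<in> composable G; (h, k) \<in> composable G\<rbrakk>
      \<Longrightarrow> gmul G (gmul G g h) k = gmul G g (gmul G h k)"
    and cancel_left: "(g, h) \<in> composable G \<Longrightarrow> gmul G (ginv G g) (gmul G g h) = h"
    and cancel_right: "(g, h) \<in> composable G \<Longrightarrow> gmul G (gmul G g h) (ginv G h) = g"
    and continuous_inv: "continuous_map (gtop G) (gtop G) (ginv G)"
    and continuous_mul:
      "continuous_map (subtopology (prod_topology (gtop G) (gtop G)) (composable G)) (gtop G)
         (\<lambda>(g, h). gmul G g h)"
    and locally_compact: "locally_compact_space (gtop G)"
    and Hausdorff_units: "Hausdorff_space (unit_top G)"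

definition local_homeomorphism :: "'a topology \<Rightarrow> 'b topology \<Rightarrow> ('a \<Rightarrow> 'b) \<Rightarrow> bool" where
  "local_homeomorphism X Y f \<longleftrightarrow>
     (\<forall>x \<in> topspace X. \<exists>U. openin X U \<and> x \<in> U \<and> openin Y (f ` U) \<and>
        homeomorphic_map (subtopology X U) (subtopology Y (f ` U)) f)"

locale etale_groupoid = topological_groupoid +
  assumes local_homeo_src: "local_homeomorphism (gtop G) (unit_top G) (src G)"
    and local_homeo_rng: "local_homeomorphism (gtop G) (unit_top G) (rng G)"

definition bisection :: "'g topgpd \<Rightarrow> 'g set \<Rightarrow> bool" where
  "bisection G B \<longleftrightarrow> B \<subseteq> elts G \<and>
     homeomorphic_map (subtopology (gtop G) B) (subtopology (gtop G) (src G ` B)) (src G) \<and>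
     homeomorphic_map (subtopology (gtop G) B) (subtopology (gtop G) (rng G ` B)) (rng G)"

definition open_bisection :: "'g topgpd \<Rightarrow> 'g set \<Rightarrow> bool" where
  "open_bisection G B \<longleftrightarrow> bisection G B \<and> openin (gtop G) B"

definition compact_open_bisection :: "'g topgpd \<Rightarrow> 'g set \<Rightarrow> bool" where
  "compact_open_bisection G B \<longleftrightarrow> open_bisection G B \<and> compactin (gtop G) B"


section \<open>Germs and effective groupoids\<close>

text \<open>
  Partial maps are represented by their graphs. The germ of a partial map at a point \<open>x\<close> is
  \<open>x\<close> together with the class of all relations agreeing with the map over a neighbourhood of
  \<open>x\<close>. As relations are composed from left to right by \<open>O\<close>, the partial map
  \<open>\<alpha> \<circ> \<beta> \<circ> \<gamma>\<close> is written \<open>\<gamma> O \<beta> O \<alpha>\<close>.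
\<close>

definition germ :: "'a topology \<Rightarrow> ('a \<times> 'a) set \<Rightarrow> 'a \<Rightarrow> 'a \<times> ('a \<times> 'a) set set" where
  "germ X \<phi> x = (x, {\<psi>. \<exists>W. openin X W \<and> x \<in> W \<and> \<psi> \<inter> W \<times> UNIV = \<phi> \<inter> W \<times> UNIV})"

text \<open>The local homeomorphism \<open>s(g) \<mapsto> r(g)\<close>, \<open>g \<in> B\<close>, defined by a bisection \<open>B\<close>.\<close>

definition bis_map :: "'g topgpd \<Rightarrow> 'g set \<Rightarrow> ('g \<times> 'g) set" where
  "bis_map G B = (\<lambda>g. (src G g, rng G g)) ` B"

text \<open>
  The element \<open>g\<close> acts on the unit space as the germ \<open>\<gamma>\<close>. For an etale groupoid the germ so
  attached to \<open>g\<close> does not depend on the open bisection, and \<open>g \<mapsto> \<gamma>\<close> is a surjective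
  local homeomorphism onto the groupoid of germs of the maps \<open>bis_map G B\<close>. So the groupoid
  is the groupoid of germs exactly when this map is injective.
\<close>

definition acts_as :: "'g topgpd \<Rightarrow> 'g \<Rightarrow> 'g \<times> ('g \<times> 'g) set set \<Rightarrow> bool" where
  "acts_as G g \<gamma> \<longleftrightarrow>
     (\<exists>B. open_bisection G B \<and> g \<in> B \<and> germ (unit_top G) (bis_map G B) (src G g) = \<gamma>)"

definition effective :: "'g topgpd \<Rightarrow> bool" where
  "effective G \<longleftrightarrow> (\<forall>g h \<gamma>. acts_as G g \<gamma> \<and> acts_as G h \<gamma> \<longrightarrow> g = h)"


section \<open>Edge shifts\<close>

definition paths :: "('v, 'x) pre_digraph \<Rightarrow> (nat \<Rightarrow> 'x) set" where
  "paths D = {w. \<forall>i. w i \<in> arcs D \<and> head D (w i) = tail D (w (Suc i))}"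

definition edge_shift :: "('v, 'x) pre_digraph \<Rightarrow> (nat \<Rightarrow> 'x) topology" where
  "edge_shift D =
     subtopology (product_topology (\<lambda>_. discrete_topology (arcs D)) UNIV) (paths D)"

definition shift :: "(nat \<Rightarrow> 'x) \<Rightarrow> nat \<Rightarrow> 'x" where
  "shift w = (\<lambda>i. w (Suc i))"

definition prepend :: "'x \<Rightarrow> (nat \<Rightarrow> 'x) \<Rightarrow> nat \<Rightarrow> 'x" where
  "prepend x w = case_nat x w"

definition begins :: "(nat \<Rightarrow> 'x) \<Rightarrow> 'x list \<Rightarrow> bool" where
  "begins w v \<longleftrightarrow> (\<forall>i < length v. w i = v ! i)"


section \<open>Shift-invariant groupoids\<close>

text \<open>
  From here on \<open>\<pi>\<close> is the homeomorphism identifying the unit space of the groupoid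
  with the edge shift. The next constant is the graph of the partial map \<open>w \<mapsto> x w\<close>
  on the unit space.
\<close>

definition prefix_map :: "'g topgpd \<Rightarrow> ('g \<Rightarrow> nat \<Rightarrow> 'x) \<Rightarrow> 'x \<Rightarrow> ('g \<times> 'g) set" where
  "prefix_map G \<pi> x = {(u, v). u \<in> units G \<and> v \<in> units G \<and> \<pi> v = prepend x (\<pi> u)}"

text \<open>The element \<open>h\<close> is the germ \<open>S\<^sub>b\<inverse> g S\<^sub>a\<close> (\<open>a\<close>, \<open>b\<close> the first edges of \<open>s(g)\<close>, \<open>r(g)\<close>).\<close>

definition is_shifted :: "'g topgpd \<Rightarrow> ('g \<Rightarrow> nat \<Rightarrow> 'x) \<Rightarrow> 'g \<Rightarrow> 'g \<Rightarrow> bool" where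
  "is_shifted G \<pi> g h \<longleftrightarrow>
     (\<exists>B u. open_bisection G B \<and> g \<in> B \<and> u \<in> units G \<and> \<pi> u = shift (\<pi> (src G g)) \<and>
        acts_as G h
          (germ (unit_top G)
             (prefix_map G \<pi> (\<pi> (src G g) 0) O bis_map G B O (prefix_map G \<pi> (\<pi> (rng G g) 0))\<inverse>)
             u))"

text \<open>The element \<open>h\<close> is the germ \<open>S\<^sub>y g S\<^sub>x\<inverse>\<close>.\<close>

definition is_extended ::
  "'g topgpd \<Rightarrow> ('g \<Rightarrow> nat \<Rightarrow> 'x) \<Rightarrow> 'x \<Rightarrow> 'x \<Rightarrow> 'g \<Rightarrow> 'g \<Rightarrow> bool" where
  "is_extended G \<pi> y x g h \<longleftrightarrow>
     (\<exists>B u. open_bisection G B \<and> g \<in> B \<and> u \<in> units G \<and> \<pi> u = prepend x (\<pi> (src G g)) \<and>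
        acts_as G h
          (germ (unit_top G) ((prefix_map G \<pi> x)\<inverse> O bis_map G B O prefix_map G \<pi> y) u))"

definition completely_shift_invariant ::
  "('v, 'x) pre_digraph \<Rightarrow> 'g topgpd \<Rightarrow> ('g \<Rightarrow> nat \<Rightarrow> 'x) \<Rightarrow> bool" where
  "completely_shift_invariant D G \<pi> \<longleftrightarrow>
     (\<forall>g \<in> elts G. \<exists>h \<in> elts G. is_shifted G \<pi> g h) \<and>
     (\<forall>g \<in> elts G. \<forall>x y. prepend x (\<pi> (src G g)) \<in> paths D \<and> prepend y (\<pi> (rng G g)) \<in> paths D
        \<longrightarrow> (\<exists>h \<in> elts G. is_extended G \<pi> y x g h))"

definition gshift :: "'g topgpd \<Rightarrow> ('g \<Rightarrow> nat \<Rightarrow> 'x) \<Rightarrow> 'g \<Rightarrow> 'g" where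
  "gshift G \<pi> g = (THE h. h \<in> elts G \<and> is_shifted G \<pi> g h)"

definition contracting :: "'g topgpd \<Rightarrow> ('g \<Rightarrow> nat \<Rightarrow> 'x) \<Rightarrow> bool" where
  "contracting G \<pi> \<longleftrightarrow>
     (\<exists>C. compactin (gtop G) C \<and> (\<forall>g \<in> elts G. \<exists>n. (gshift G \<pi> ^^ n) g \<in> C))"


section \<open>Chain complexes and their homology\<close>

text \<open>
  A non-negatively graded complex is a family of groups \<open>C n\<close> with maps
  \<open>d n : C n \<rightarrow> C (n - 1)\<close>. As \<open>0 - 1 = 0\<close>, the map \<open>d 0\<close> into the zero group is rendered as
  the trivial map of \<open>C 0\<close> to itself.
\<close>

definition chain_complex :: "(nat \<Rightarrow> 'c monoid) \<Rightarrow> (nat \<Rightarrow> 'c \<Rightarrow> 'c) \<Rightarrow> bool" where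
  "chain_complex C d \<longleftrightarrow>
     (\<forall>n. comm_group (C n) \<and> d n \<in> hom (C n) (C (n - 1))) \<and>
     (\<forall>c \<in> carrier (C 0). d 0 c = \<one>\<^bsub>C 0\<^esub>) \<and>
     (\<forall>n. \<forall>c \<in> carrier (C (Suc n)). d n (d (Suc n) c) = \<one>\<^bsub>C (n - 1)\<^esub>)"

definition cycles :: "(nat \<Rightarrow> 'c monoid) \<Rightarrow> (nat \<Rightarrow> 'c \<Rightarrow> 'c) \<Rightarrow> nat \<Rightarrow> 'c set" where
  "cycles C d n = kernel (C n) (C (n - 1)) (d n)"

definition boundaries :: "(nat \<Rightarrow> 'c monoid) \<Rightarrow> (nat \<Rightarrow> 'c \<Rightarrow> 'c) \<Rightarrow> nat \<Rightarrow> 'c set" where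
  "boundaries C d n = d (Suc n) ` carrier (C (Suc n))"

definition homology :: "(nat \<Rightarrow> 'c monoid) \<Rightarrow> (nat \<Rightarrow> 'c \<Rightarrow> 'c) \<Rightarrow> nat \<Rightarrow> 'c set monoid" where
  "homology C d n = (C n)\<lparr>carrier := cycles C d n\<rparr> Mod boundaries C d n"


section \<open>Homology of ample groupoids\<close>

text \<open>
  Simplices of every dimension are lists of groupoid elements; points of the unit space
  are the lists \<open>[u]\<close> with \<open>u\<close> a unit. So both \<open>nerve G 0\<close> and \<open>nerve G 1\<close> consist of
  lists of length 1. The element written \<open>g\<^sub>i\<close> on paper is \<open>gs ! (i - 1)\<close>.
\<close>

definition nerve :: "'g topgpd \<Rightarrow> nat \<Rightarrow> 'g list set" where
  "nerve G n =
     (if n = 0 then (\<lambda>u. [u]) ` units G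
      else {gs. length gs = n \<and> set gs \<subseteq> elts G \<and>
                (\<forall>i. Suc i < n \<longrightarrow> src G (gs ! i) = rng G (gs ! Suc i))})"

definition face :: "'g topgpd \<Rightarrow> nat \<Rightarrow> nat \<Rightarrow> 'g list \<Rightarrow> 'g list" where
  "face G n i gs =
     (if n = 1 then (if i = 0 then [rng G (hd gs)] else [src G (hd gs)])
      else if i = 0 then tl gs
      else if i = n then butlast gs
      else take (i - 1) gs @ [gmul G (gs ! (i - 1)) (gs ! i)] @ drop (i + 1) gs)"

definition ordered_multisection :: "'g topgpd \<Rightarrow> 'g set list \<Rightarrow> bool" where
  "ordered_multisection G Fs \<longleftrightarrow>
     (\<forall>F \<in> set Fs. compact_open_bisection G F) \<and>
     (\<forall>i. Suc i < length Fs \<longrightarrow> src G ` (Fs ! i) = rng G ` (Fs ! Suc i))"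

text \<open>The ordered multisections of length \<open>n\<close>, as sets of simplices.\<close>

definition multisections :: "'g topgpd \<Rightarrow> nat \<Rightarrow> 'g list set set" where
  "multisections G n =
     (if n = 0 then {(\<lambda>u. [u]) ` K |K. openin (unit_top G) K \<and> compactin (unit_top G) K}
      else {{gs \<in> nerve G n. \<forall>i < n. gs ! i \<in> Fs ! i} |Fs.
              length Fs = n \<and> ordered_multisection G Fs})"

definition fun_group :: "('s \<Rightarrow> 'a::ab_group_add) monoid" where
  "fun_group = \<lparr>carrier = UNIV, mult = (\<lambda>f g x. f x + g x), one = (\<lambda>_. 0)\<rparr>"

definition const_on :: "'a::ab_group_add \<Rightarrow> 's set \<Rightarrow> 's \<Rightarrow> 'a" where
  "const_on a U = (\<lambda>x. if x \<in> U then a else 0)"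

definition Cc :: "'g topgpd \<Rightarrow> nat \<Rightarrow> ('g list \<Rightarrow> 'a::ab_group_add) monoid" where
  "Cc G n = subgroup_generated fun_group {const_on a U |a U. U \<in> multisections G n}"

text \<open>Push-forward; the sums over the fibres are finite for the functions in \<open>Cc G n\<close>.\<close>

definition push :: "('s \<Rightarrow> 't) \<Rightarrow> ('s \<Rightarrow> 'a::ab_group_add) \<Rightarrow> 't \<Rightarrow> 'a" where
  "push k f = (\<lambda>z. \<Sum>y | f y \<noteq> 0 \<and> k y = z. f y)"

definition bd :: "'g topgpd \<Rightarrow> nat \<Rightarrow> ('g list \<Rightarrow> 'a::ab_group_add) \<Rightarrow> 'g list \<Rightarrow> 'a" where
  "bd G n f =
     (if n = 0 then (\<lambda>_. 0)
      else (\<lambda>z. \<Sum>i\<le>n. if even i then push (face G n i) f z else - push (face G n i) f z))"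


section \<open>The multi-dimensional nucleus\<close>

text \<open>
  Applied to a point \<open>[u]\<close> of \<open>nerve G 0\<close>, the coordinatewise shift is the shift of the
  unit space, because \<open>gshift\<close> maps the unit at \<open>w\<close> to the unit at \<open>shift w\<close>.
\<close>

abbreviation nshift :: "'g topgpd \<Rightarrow> ('g \<Rightarrow> nat \<Rightarrow> 'x) \<Rightarrow> 'g list \<Rightarrow> 'g list" where
  "nshift G \<pi> \<equiv> map (gshift G \<pi>)"

text \<open>
  \<open>vs = [v\<^sub>0, \<dots>, v\<^sub>n]\<close> is a list of words of equal length. Words that are not paths
  yield the empty restriction.
\<close>

definition restriction ::
  "'g topgpd \<Rightarrow> ('g \<Rightarrow> nat \<Rightarrow> 'x) \<Rightarrow> 'g list set \<Rightarrow> 'x list list \<Rightarrow> 'g list set" where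
  "restriction G \<pi> U vs = (nshift G \<pi> ^^ length (hd vs)) `
     {gs \<in> U. begins (\<pi> (rng G (hd gs))) (vs ! 0) \<and>
              (\<forall>i. 1 \<le> i \<and> i < length vs \<longrightarrow> begins (\<pi> (src G (gs ! (i - 1)))) (vs ! i))}"

definition absorbs ::
  "'g topgpd \<Rightarrow> ('g \<Rightarrow> nat \<Rightarrow> 'x) \<Rightarrow> nat \<Rightarrow> 'g list set set \<Rightarrow> bool" where
  "absorbs G \<pi> n M \<longleftrightarrow>
     (\<forall>U \<in> multisections G n. \<exists>m0. \<forall>m \<ge> m0. \<forall>vs :: 'x list list.
        length vs = Suc n \<and> (\<forall>v \<in> set vs. length v = m) \<longrightarrow>
        restriction G \<pi> U vs = {} \<or> restriction G \<pi> U vs \<in> M)"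

text \<open>The smallest absorbing set of multisections; it exists for contracting groupoids.\<close>

definition nucleus :: "'g topgpd \<Rightarrow> ('g \<Rightarrow> nat \<Rightarrow> 'x) \<Rightarrow> nat \<Rightarrow> 'g list set set" where
  "nucleus G \<pi> n = \<Inter> {M. M \<subseteq> multisections G n \<and> absorbs G \<pi> n M}"

definition AN ::
  "'g topgpd \<Rightarrow> ('g \<Rightarrow> nat \<Rightarrow> 'x) \<Rightarrow> nat \<Rightarrow> ('g list \<Rightarrow> 'a::ab_group_add) monoid" where
  "AN G \<pi> n = subgroup_generated fun_group {const_on a U |a U. U \<in> nucleus G \<pi> n}"


section \<open>The direct limits\<close>

text \<open>
  The direct limit of \<open>H \<rightarrow> H \<rightarrow> \<cdots>\<close> under an endomorphism \<open>h\<close>. The pair \<open>(m, a)\<close> stands for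
  \<open>a\<close> in the \<open>m\<close>-th copy of \<open>H\<close>.
\<close>

definition dlim_rel :: "'c monoid \<Rightarrow> ('c \<Rightarrow> 'c) \<Rightarrow> ((nat \<times> 'c) \<times> (nat \<times> 'c)) set" where
  "dlim_rel H h = {((m, a), (m', b)). a \<in> carrier H \<and> b \<in> carrier H \<and>
     (\<exists>i j. m + i = m' + j \<and> (h ^^ i) a = (h ^^ j) b)}"

definition dlim :: "'c monoid \<Rightarrow> ('c \<Rightarrow> 'c) \<Rightarrow> (nat \<times> 'c) set monoid" where
  "dlim H h =
     \<lparr>carrier = (UNIV \<times> carrier H) // dlim_rel H h,
      mult = (\<lambda>P Q. \<Union>(m, a) \<in> P. \<Union>(m', b) \<in> Q.
                dlim_rel H h `` {(m + m', (h ^^ m') a \<otimes>\<^bsub>H\<^esub> (h ^^ m) b)}),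
      one = dlim_rel H h `` {(0, \<one>\<^bsub>H\<^esub>)}\<rparr>"

text \<open>
  Below, maps given through representatives are written as unions over all representatives,
  in the style of \<open>Equiv_Relations\<close>; all members of such a union are the same class.
\<close>

definition DN_rel :: "'g topgpd \<Rightarrow> ('g \<Rightarrow> nat \<Rightarrow> 'x) \<Rightarrow> nat \<Rightarrow>
    ((nat \<times> ('g list \<Rightarrow> 'a::ab_group_add)) \<times> (nat \<times> ('g list \<Rightarrow> 'a))) set" where
  "DN_rel G \<pi> n = dlim_rel (AN G \<pi> n) (push (nshift G \<pi>))"

definition DN :: "'g topgpd \<Rightarrow> ('g \<Rightarrow> nat \<Rightarrow> 'x) \<Rightarrow> nat \<Rightarrow>
    (nat \<times> ('g list \<Rightarrow> 'a::ab_group_add)) set monoid" where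
  "DN G \<pi> n = dlim (AN G \<pi> n) (push (nshift G \<pi>))"

definition DN_bd :: "'g topgpd \<Rightarrow> ('g \<Rightarrow> nat \<Rightarrow> 'x) \<Rightarrow> nat \<Rightarrow>
    (nat \<times> ('g list \<Rightarrow> 'a::ab_group_add)) set \<Rightarrow> (nat \<times> ('g list \<Rightarrow> 'a)) set" where
  "DN_bd G \<pi> n P =
     (if n = 0 then \<one>\<^bsub>DN G \<pi> 0\<^esub>
      else (\<Union>(m, f) \<in> P.
              \<Union>k \<in> {k. (push (nshift G \<pi>) ^^ k) (bd G n f) \<in> carrier (AN G \<pi> (n - 1))}.
                DN_rel G \<pi> (n - 1) `` {(m + k, (push (nshift G \<pi>) ^^ k) (bd G n f))}))"

definition J :: "'g topgpd \<Rightarrow> ('g \<Rightarrow> nat \<Rightarrow> 'x) \<Rightarrow> nat \<Rightarrow>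
    ('g list \<Rightarrow> 'a::ab_group_add) \<Rightarrow> (nat \<times> ('g list \<Rightarrow> 'a)) set" where
  "J G \<pi> n f =
     (\<Union>m \<in> {m. (push (nshift G \<pi>) ^^ m) f \<in> carrier (AN G \<pi> n)}.
        DN_rel G \<pi> n `` {(m, (push (nshift G \<pi>) ^^ m) f)})"

end

theory Submission
  imports Defs
begin

text \<open>The shift \<open>\<sigma>\<close> of a finite graph has, up to finitely many initial letters, a continuous
  section \<open>q\<close>: \<open>\<sigma>\<^sup>k\<^sup>+\<^sup>1 q = \<sigma>\<^sup>k\<close>. By complete shift-invariance \<open>\<varsigma>\<close> is a fully faithful local
  homeomorphism, so \<open>q\<close> lifts to an etale functor \<open>\<theta>\<close> of the groupoid, and the functors \<open>\<theta>\<varsigma>\<close> and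
  \<open>\<varsigma>\<theta>\<close> change only finitely many initial letters. Such functors are naturally isomorphic to the
  identity through bisections, hence act trivially on homology by the usual prism homotopy;
  therefore \<open>\<varsigma>\<^sub>*\<close> is bijective on \<open>H\<^sub>n\<close>. Contraction implies that a compact open bisection has only
  finitely many restrictions, so that the nucleus consists of the nonempty multisections occurring
  as restrictions \<open>U|\<^sub>v\<close> at infinitely many levels; it absorbs and is closed under restriction.
  Consequently \<open>\<D>\<close> is the direct limit of the chains of the groupoid along \<open>\<varsigma>\<^sub>*\<close>, whose homology is
  the direct limit of the groups \<open>H\<^sub>n\<close> along bijections.\<close>

section \<open>Local homeomorphisms\<close>

text \<open>The groupoid may fail to be Hausdorff, so two compact open bisections may have a
  non-compact intersection. Multisections are therefore cut only by clopen conditions on their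
  vertices, the unit space being compact Hausdorff; a multisection is a copy of the clopen set of
  its first vertices, and partition arguments become Lebesgue number arguments for cylinders.
  Effectiveness makes the shifted germ a single element, and makes an element recoverable from its
  shift and its two ends. The section \<open>q\<close> is only shown to be continuous; the functor
  built on it is a local homeomorphism by cancelling \<open>sft (Suc k)\<close>. The natural
  isomorphism comes from the same lifting: if \<open>u\<close> and \<open>\<phi> u\<close> have the
  same \<open>m\<close>-fold shift, the unit at that point lifts to an arrow from \<open>u\<close>
  to \<open>\<phi> u\<close>. On the contracting side the given compact set need not be invariant; a
  bound on return times enlarges it to a finite union of bisections that the shift maps into itself,
  and restrictions of these bisections by long words already occur for short ones.\<close>

lemma open_injective_imp_homeomorphic_map:
  assumes c: "continuous_map X Y f" and o: "open_map X Y f" and U: "openin X U" and inj: "inj_on f U"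
  shows "homeomorphic_map (subtopology X U) (subtopology Y (f ` U)) f"
proof (rule bijective_open_imp_homeomorphic_map)
  have top: "topspace (subtopology X U) = U"
    using U by (simp add: openin_subset Int_absorb1)
  have fU: "openin Y (f ` U)" using o U by (simp add: open_map_def)
  show "continuous_map (subtopology X U) (subtopology Y (f ` U)) f"
    using c top by (auto simp: continuous_map_in_subtopology continuous_map_from_subtopology)
  show "open_map (subtopology X U) (subtopology Y (f ` U)) f"
    using o U fU by (auto simp: open_map_def openin_open_subtopology)
  show "f ` topspace (subtopology X U) = topspace (subtopology Y (f ` U))"
    unfolding top using fU by (simp add: openin_subset Int_absorb1)
  show "inj_on f (topspace (subtopology X U))"
    using inj top by simp
qed

text \<open>Trades the subtopologies of the definition for three conditions that are easy to check
  for composites, lifts and restrictions. This is the form in which local homeomorphisms are used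
  below.\<close>

lemma local_homeomorphism_iff:
  "local_homeomorphism X Y f \<longleftrightarrow> continuous_map X Y f \<and> open_map X Y f \<and>
     (\<forall>x\<in>topspace X. \<exists>U. openin X U \<and> x \<in> U \<and> inj_on f U)" (is "?L = ?R")
proof
  assume L: ?L
  have im: "f x \<in> topspace Y" if "x \<in> topspace X" for x
    using L that openin_subset unfolding local_homeomorphism_def by blast
  have "openin X {x \<in> topspace X. f x \<in> V}" if V: "openin Y V" for V
  proof (subst openin_subopen, intro ballI)
    fix x assume "x \<in> {x \<in> topspace X. f x \<in> V}"
    then have x: "x \<in> topspace X" "f x \<in> V" by auto
    then obtain U where U: "openin X U" "x \<in> U" "openin Y (f ` U)"
      "homeomorphic_map (subtopology X U) (subtopology Y (f ` U)) f"
      using L unfolding local_homeomorphism_def by blast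
    have "continuous_map (subtopology X U) Y f"
      using U(4) homeomorphic_imp_continuous_map continuous_map_in_subtopology by blast
    then have "openin (subtopology X U) {x \<in> topspace (subtopology X U). f x \<in> V}"
      using V openin_continuous_map_preimage by blast
    then have "openin X {x \<in> topspace (subtopology X U). f x \<in> V}"
      using U(1) openin_trans_full by blast
    then show "\<exists>T. openin X T \<and> x \<in> T \<and> T \<subseteq> {x \<in> topspace X. f x \<in> V}"
      using x U by (intro exI[of _ "{x \<in> topspace (subtopology X U). f x \<in> V}"]) auto
  qed
  then have 1: "continuous_map X Y f" using im by (auto simp: continuous_map_def)
  have "openin Y (f ` W)" if W: "openin X W" for W
  proof (subst openin_subopen, intro ballI)
    fix y assume "y \<in> f ` W"
    then obtain x where x: "x \<in> W" "y = f x" by auto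
    then have "x \<in> topspace X" using W openin_subset by blast
    then obtain U where U: "openin X U" "x \<in> U" "openin Y (f ` U)"
      "homeomorphic_map (subtopology X U) (subtopology Y (f ` U)) f"
      using L unfolding local_homeomorphism_def by blast
    have "openin (subtopology X U) (W \<inter> U)"
      using W U openin_subtopology_Int by blast
    then have "openin (subtopology Y (f ` U)) (f ` (W \<inter> U))"
      using homeomorphic_imp_open_map[OF U(4)] unfolding open_map_def by blast
    then have "openin Y (f ` (W \<inter> U))" using U(3) openin_trans_full by blast
    then show "\<exists>T. openin Y T \<and> y \<in> T \<and> T \<subseteq> f ` W" using x U by blast
  qed
  then have 2: "open_map X Y f" by (simp add: open_map_def)
  have 3: "\<exists>U. openin X U \<and> x \<in> U \<and> inj_on f U" if "x \<in> topspace X" for x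
  proof -
    obtain U where U: "openin X U" "x \<in> U"
      "homeomorphic_map (subtopology X U) (subtopology Y (f ` U)) f"
      using L \<open>x \<in> topspace X\<close> unfolding local_homeomorphism_def by blast
    moreover have "topspace (subtopology X U) = U" using U(1) by (simp add: openin_subset Int_absorb1)
    ultimately show ?thesis using homeomorphic_imp_injective_map by metis
  qed
  show ?R using 1 2 3 by blast
next
  assume R: ?R
  show ?L unfolding local_homeomorphism_def
  proof
    fix x assume "x \<in> topspace X"
    then obtain U where U: "openin X U" "x \<in> U" "inj_on f U" using R by blast
    have "homeomorphic_map (subtopology X U) (subtopology Y (f ` U)) f"
      using R U by (intro open_injective_imp_homeomorphic_map) auto
    then show "\<exists>U. openin X U \<and> x \<in> U \<and> openin Y (f ` U) \<and>
        homeomorphic_map (subtopology X U) (subtopology Y (f ` U)) f"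
      using U R unfolding open_map_def by blast
  qed
qed

lemma local_homeomorphism_comp:
  assumes f: "local_homeomorphism X Y f" and g: "local_homeomorphism Y Z g"
  shows "local_homeomorphism X Z (g \<circ> f)"
  unfolding local_homeomorphism_iff
proof (intro conjI ballI)
  show "continuous_map X Z (g \<circ> f)" "open_map X Z (g \<circ> f)"
    using f g unfolding local_homeomorphism_iff by (auto intro: continuous_map_compose open_map_compose)
  fix x assume x: "x \<in> topspace X"
  have c: "continuous_map X Y f" using f unfolding local_homeomorphism_iff by blast
  then have "f x \<in> topspace Y" using x by (auto simp: continuous_map_def)
  then obtain V where V: "openin Y V" "f x \<in> V" "inj_on g V"
    using g unfolding local_homeomorphism_iff by blast
  obtain U where U: "openin X U" "x \<in> U" "inj_on f U"
    using f x unfolding local_homeomorphism_iff by blast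
  have "openin X (U \<inter> {x \<in> topspace X. f x \<in> V})"
    using U V c openin_continuous_map_preimage by blast
  moreover have "inj_on (g \<circ> f) (U \<inter> {x \<in> topspace X. f x \<in> V})"
    using U V by (auto simp: inj_on_def)
  ultimately show "\<exists>U. openin X U \<and> x \<in> U \<and> inj_on (g \<circ> f) U" using x U V by blast
qed

text \<open>Near \<open>f x\<close> the map \<open>g\<close> is injective, so a nearby point belongs
  to the image of \<open>W\<close> under \<open>f\<close> as soon as its \<open>g\<close>-value lies
  in the open image of a part of \<open>W\<close> under \<open>g \<circ> f\<close>. Continuous lifts
  through local homeomorphisms thereby become local homeomorphisms.\<close>

lemma local_homeomorphism_cancel:
  assumes c: "continuous_map X Y f" and g: "local_homeomorphism Y Z g"
    and gf: "local_homeomorphism X Z (g \<circ> f)"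
  shows "local_homeomorphism X Y f"
  unfolding local_homeomorphism_iff
proof (intro conjI ballI c)
  have gc: "continuous_map Y Z g" using g unfolding local_homeomorphism_iff by blast
  show "open_map X Y f" unfolding open_map_def
  proof (intro allI impI)
    fix W assume W: "openin X W"
    show "openin Y (f ` W)"
    proof (subst openin_subopen, intro ballI)
      fix y assume "y \<in> f ` W"
      then obtain x where x: "x \<in> W" "y = f x" by auto
      then have y: "y \<in> topspace Y" using W c openin_subset by (fastforce simp: continuous_map_def)
      then obtain V where V: "openin Y V" "y \<in> V" "inj_on g V"
        using g unfolding local_homeomorphism_iff by blast
      let ?W = "W \<inter> {x \<in> topspace X. f x \<in> V}"
      have "openin X ?W" using W V c openin_continuous_map_preimage by blast
      then have "openin Z ((g \<circ> f) ` ?W)"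
        using gf unfolding local_homeomorphism_iff open_map_def by blast
      then have o: "openin Y (V \<inter> {y \<in> topspace Y. g y \<in> (g \<circ> f) ` ?W})"
        using V gc openin_continuous_map_preimage by blast
      have "V \<inter> {y \<in> topspace Y. g y \<in> (g \<circ> f) ` ?W} \<subseteq> f ` W"
        using V by (auto dest: inj_onD)
      moreover have "y \<in> V \<inter> {y \<in> topspace Y. g y \<in> (g \<circ> f) ` ?W}"
        using x y V W openin_subset by fastforce
      ultimately show "\<exists>T. openin Y T \<and> y \<in> T \<and> T \<subseteq> f ` W" using o by blast
    qed
  qed
  fix x assume x: "x \<in> topspace X"
  then obtain U where "openin X U" "x \<in> U" "inj_on (g \<circ> f) U"
    using gf unfolding local_homeomorphism_iff by blast
  then show "\<exists>U. openin X U \<and> x \<in> U \<and> inj_on f U"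
    using inj_on_imageI2 by blast
qed

section \<open>Etale groupoids\<close>

context topological_groupoid
begin

lemma composableI: "g \<in> elts G \<Longrightarrow> h \<in> elts G \<Longrightarrow> src G g = rng G h \<Longrightarrow> (g, h) \<in> composable G"
  by (simp add: composable_def)

lemma src_inv [simp]: "g \<in> elts G \<Longrightarrow> src G (ginv G g) = rng G g"
  by (simp add: src_def rng_def inv_inv)

lemma rng_inv [simp]: "g \<in> elts G \<Longrightarrow> rng G (ginv G g) = src G g"
  by (simp add: src_def rng_def inv_inv)

lemma mul_elts [simp]:
  "g \<in> elts G \<Longrightarrow> h \<in> elts G \<Longrightarrow> src G g = rng G h \<Longrightarrow> gmul G g h \<in> elts G"
  by (simp add: composableI mul_closed)

lemma src_mul' [simp]:
  "g \<in> elts G \<Longrightarrow> h \<in> elts G \<Longrightarrow> src G g = rng G h \<Longrightarrow> src G (gmul G g h) = src G h"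
  by (simp add: composableI src_mul)

lemma rng_mul' [simp]:
  "g \<in> elts G \<Longrightarrow> h \<in> elts G \<Longrightarrow> src G g = rng G h \<Longrightarrow> rng G (gmul G g h) = rng G g"
  by (simp add: composableI rng_mul)

lemma src_elts [simp]: "g \<in> elts G \<Longrightarrow> src G g \<in> elts G"
  by (metis src_def mul_elts src_inv inv_closed)

lemma rng_elts [simp]: "g \<in> elts G \<Longrightarrow> rng G g \<in> elts G"
  by (metis src_elts src_inv inv_closed)

lemma src_src [simp]: "g \<in> elts G \<Longrightarrow> src G (src G g) = src G g"
  by (metis src_def src_mul' src_inv inv_closed)

lemma rng_src [simp]: "g \<in> elts G \<Longrightarrow> rng G (src G g) = src G g"
  by (metis src_def rng_mul' src_inv rng_inv inv_closed)

lemma src_rng [simp]: "g \<in> elts G \<Longrightarrow> src G (rng G g) = rng G g"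
  by (metis src_src src_inv inv_closed)

lemma rng_rng [simp]: "g \<in> elts G \<Longrightarrow> rng G (rng G g) = rng G g"
  by (metis rng_src src_inv inv_closed)

lemma src_units [simp]: "g \<in> elts G \<Longrightarrow> src G g \<in> units G"
  by (simp add: units_def)

lemma rng_units [simp]: "g \<in> elts G \<Longrightarrow> rng G g \<in> units G"
  using src_units[OF inv_closed, of g] by simp

lemma units_elts: "u \<in> units G \<Longrightarrow> u \<in> elts G"
  by (auto simp: units_def)

lemma src_unit [simp]: "u \<in> units G \<Longrightarrow> src G u = u"
  unfolding units_def by (erule imageE) simp

lemma rng_unit [simp]: "u \<in> units G \<Longrightarrow> rng G u = u"
  unfolding units_def by (erule imageE) simp

lemma mul_src [simp]: "g \<in> elts G \<Longrightarrow> gmul G g (src G g) = g"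
proof -
  assume g: "g \<in> elts G"
  have "gmul G (ginv G (ginv G g)) (gmul G (ginv G g) g) = g"
    by (rule cancel_left) (use g inv_closed in \<open>auto intro!: composableI\<close>)
  then show ?thesis using g by (simp only: inv_inv src_def)
qed

lemma mul_rng [simp]: "g \<in> elts G \<Longrightarrow> gmul G (rng G g) g = g"
proof -
  assume g: "g \<in> elts G"
  have "gmul G (gmul G g (ginv G g)) (ginv G (ginv G g)) = g"
    by (rule cancel_right) (use g inv_closed in \<open>auto intro!: composableI\<close>)
  then show ?thesis using g by (simp only: inv_inv rng_def)
qed

lemma mul_inv [simp]: "g \<in> elts G \<Longrightarrow> gmul G g (ginv G g) = rng G g"
  by (rule rng_def[symmetric])

lemma inv_mul [simp]: "g \<in> elts G \<Longrightarrow> gmul G (ginv G g) g = src G g"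
  by (rule src_def[symmetric])

lemma mul_assoc':
  "g \<in> elts G \<Longrightarrow> h \<in> elts G \<Longrightarrow> k \<in> elts G \<Longrightarrow> src G g = rng G h \<Longrightarrow> src G h = rng G k \<Longrightarrow>
     gmul G (gmul G g h) k = gmul G g (gmul G h k)"
  by (rule assoc) (auto intro: composableI)

lemma topspace_unit_top [simp]: "topspace (unit_top G) = units G"
  using units_elts by (auto simp: unit_top_def elts_def topspace_subtopology)

lemma topspace_gtop: "topspace (gtop G) = elts G"
  by (simp add: elts_def)

end

context etale_groupoid
begin

text \<open>Near a unit both \<open>x\<close> and \<open>src G x\<close> lie in one neighbourhood on
  which \<open>src G\<close> is injective. They have the same source, hence coincide.\<close>

lemma openin_units: "openin (gtop G) (units G)"
proof (subst openin_subopen, intro ballI)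
  fix u assume u: "u \<in> units G"
  then have "u \<in> topspace (gtop G)" using units_elts topspace_gtop by auto
  then obtain U where U: "openin (gtop G) U" "u \<in> U" "inj_on (src G) U"
    using local_homeo_src unfolding local_homeomorphism_iff by blast
  have c: "continuous_map (gtop G) (gtop G) (src G)"
    using local_homeo_src unfolding local_homeomorphism_iff unit_top_def
    by (simp add: continuous_map_in_subtopology)
  let ?V = "U \<inter> {x \<in> topspace (gtop G). src G x \<in> U}"
  have "openin (gtop G) ?V" using U c openin_continuous_map_preimage by blast
  moreover have "u \<in> ?V" using u U units_elts by (simp add: topspace_gtop)
  moreover have "?V \<subseteq> units G"
  proof
    fix x assume x: "x \<in> ?V"
    then have "src G x = x" using U(3) by (auto simp: topspace_gtop dest: inj_onD[where x = "src G x" and y = x])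
    then show "x \<in> units G" using x by (metis IntD2 mem_Collect_eq src_units topspace_gtop)
  qed
  ultimately show "\<exists>T. openin (gtop G) T \<and> u \<in> T \<and> T \<subseteq> units G" by blast
qed

lemma openin_unit_top: "openin (unit_top G) K \<longleftrightarrow> openin (gtop G) K \<and> K \<subseteq> units G"
  by (simp add: unit_top_def openin_open_subtopology openin_units)

lemma compactin_unit_top: "compactin (unit_top G) K \<longleftrightarrow> compactin (gtop G) K \<and> K \<subseteq> units G"
  by (simp add: unit_top_def compactin_subtopology)

lemma local_homeomorphism_into_units:
  "local_homeomorphism X (unit_top G) f \<Longrightarrow> local_homeomorphism X (gtop G) f"
  unfolding local_homeomorphism_iff open_map_def openin_unit_top
  by (auto simp: continuous_map_in_subtopology unit_top_def)

lemmas src_lh = local_homeomorphism_into_units[OF local_homeo_src]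
lemmas rng_lh = local_homeomorphism_into_units[OF local_homeo_rng]

lemma continuous_src: "continuous_map (gtop G) (unit_top G) (src G)"
  and open_src: "open_map (gtop G) (unit_top G) (src G)"
  and continuous_rng: "continuous_map (gtop G) (unit_top G) (rng G)"
  and open_rng: "open_map (gtop G) (unit_top G) (rng G)"
  using local_homeo_src local_homeo_rng unfolding local_homeomorphism_iff by auto

lemma openin_src_vimage:
  "openin (gtop G) B \<Longrightarrow> openin (unit_top G) K \<Longrightarrow> openin (gtop G) {g \<in> B. src G g \<in> K}"
proof -
  assume *: "openin (gtop G) B" "openin (unit_top G) K"
  have "{g \<in> B. src G g \<in> K} = B \<inter> {x \<in> topspace (gtop G). src G x \<in> K}"
    using * openin_subset by fastforce
  then show ?thesis using * continuous_src openin_continuous_map_preimage by fastforce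
qed

lemma openin_rng_vimage:
  "openin (gtop G) B \<Longrightarrow> openin (unit_top G) K \<Longrightarrow> openin (gtop G) {g \<in> B. rng G g \<in> K}"
proof -
  assume *: "openin (gtop G) B" "openin (unit_top G) K"
  have "{g \<in> B. rng G g \<in> K} = B \<inter> {x \<in> topspace (gtop G). rng G x \<in> K}"
    using * openin_subset by fastforce
  then show ?thesis using * continuous_rng openin_continuous_map_preimage by fastforce
qed

lemma openin_src_image: "openin (gtop G) B \<Longrightarrow> openin (unit_top G) (src G ` B)"
  and openin_rng_image: "openin (gtop G) B \<Longrightarrow> openin (unit_top G) (rng G ` B)"
  using open_src open_rng by (auto simp: open_map_def)

text \<open>On an open set the continuous open maps \<open>src G\<close> and \<open>rng G\<close>
  are homeomorphisms onto their images as soon as they are injective.\<close>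

lemma open_bisection_iff:
  "open_bisection G B \<longleftrightarrow> openin (gtop G) B \<and> inj_on (src G) B \<and> inj_on (rng G) B"
proof
  assume L: "open_bisection G B"
  then have "topspace (subtopology (gtop G) B) = B"
    by (simp add: open_bisection_def openin_subset Int_absorb1)
  then show "openin (gtop G) B \<and> inj_on (src G) B \<and> inj_on (rng G) B"
    using L unfolding open_bisection_def bisection_def
    by (metis homeomorphic_imp_injective_map)
next
  assume R: "openin (gtop G) B \<and> inj_on (src G) B \<and> inj_on (rng G) B"
  have "continuous_map (gtop G) (gtop G) (src G)" "open_map (gtop G) (gtop G) (src G)"
       "continuous_map (gtop G) (gtop G) (rng G)" "open_map (gtop G) (gtop G) (rng G)"
    using src_lh rng_lh unfolding local_homeomorphism_iff by auto
  then show "open_bisection G B"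
    using R open_injective_imp_homeomorphic_map openin_subset[of "gtop G" B]
    unfolding open_bisection_def bisection_def elts_def by blast
qed

abbreviation cob :: "'a set \<Rightarrow> bool" where
  "cob \<equiv> compact_open_bisection G"

abbreviation clopen :: "'a set \<Rightarrow> bool" where
  "clopen K \<equiv> openin (unit_top G) K \<and> compactin (unit_top G) K"

lemma cob_iff:
  "cob B \<longleftrightarrow> openin (gtop G) B \<and> compactin (gtop G) B \<and> inj_on (src G) B \<and> inj_on (rng G) B"
  by (auto simp: compact_open_bisection_def open_bisection_iff)

lemma cob_subset: "cob B \<Longrightarrow> B \<subseteq> elts G"
  by (simp add: cob_iff openin_subset topspace_gtop[symmetric])

lemma cob_src: "cob B \<Longrightarrow> clopen (src G ` B)"
  using openin_src_image[of B] image_compactin[OF _ continuous_src, of B] unfolding cob_iff by blast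

lemma cob_rng: "cob B \<Longrightarrow> clopen (rng G ` B)"
  using openin_rng_image[of B] image_compactin[OF _ continuous_rng, of B] unfolding cob_iff by blast

text \<open>A bisection is homeomorphic to its set of sources, so compactness can be tested in the
  unit space, where closedness arguments are available.\<close>

lemma compactin_if_src:
  assumes "openin (gtop G) B" "inj_on (src G) B" "compactin (unit_top G) (src G ` B)"
  shows "compactin (gtop G) B"
proof -
  have h: "homeomorphic_map (subtopology (gtop G) B) (subtopology (unit_top G) (src G ` B)) (src G)"
    using open_injective_imp_homeomorphic_map assms continuous_src open_src by blast
  have "compactin (subtopology (unit_top G) (src G ` B)) (src G ` B)"
    using assms by (simp add: compactin_subtopology)
  then have "compactin (subtopology (gtop G) B) B"
    using homeomorphic_map_compactness[OF h, of B] assms(1)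
    by (simp add: Int_absorb1 openin_subset)
  then show ?thesis by (simp add: compactin_subtopology)
qed

lemma compactin_if_rng:
  assumes "openin (gtop G) B" "inj_on (rng G) B" "compactin (unit_top G) (rng G ` B)"
  shows "compactin (gtop G) B"
proof -
  have h: "homeomorphic_map (subtopology (gtop G) B) (subtopology (unit_top G) (rng G ` B)) (rng G)"
    using open_injective_imp_homeomorphic_map assms continuous_rng open_rng by blast
  have "compactin (subtopology (unit_top G) (rng G ` B)) (rng G ` B)"
    using assms by (simp add: compactin_subtopology)
  then have "compactin (subtopology (gtop G) B) B"
    using homeomorphic_map_compactness[OF h, of B] assms(1)
    by (simp add: Int_absorb1 openin_subset)
  then show ?thesis by (simp add: compactin_subtopology)
qed

text \<open>Inside a fixed bisection \<open>F\<close> a subset is the preimage of its own set of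
  sources. Sub-bisections of \<open>F\<close> thus correspond to clopen sets of units.\<close>

lemma cob_sub_src: 
  assumes "cob F" "B \<subseteq> F" "clopen (src G ` B)"
  shows "cob B"
proof -
  have B: "B = {g \<in> F. src G g \<in> src G ` B}"
    using assms(1,2) by (auto simp: cob_iff dest: inj_onD)
  have "openin (gtop G) B" using assms openin_src_vimage by (subst B) (simp add: cob_iff)
  then show ?thesis
    using assms compactin_if_src[of B] inj_on_subset[of _ F B] unfolding cob_iff by blast
qed

lemma cob_sub_rng: 
  assumes "cob F" "B \<subseteq> F" "clopen (rng G ` B)"
  shows "cob B"
proof -
  have B: "B = {g \<in> F. rng G g \<in> rng G ` B}"
    using assms(1,2) by (auto simp: cob_iff dest: inj_onD)
  have "openin (gtop G) B" using assms openin_rng_vimage by (subst B) (simp add: cob_iff)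
  then show ?thesis
    using assms compactin_if_rng[of B] inj_on_subset[of _ F B] unfolding cob_iff by blast
qed

text \<open>This uses that the unit space is Hausdorff. The analogue for compact open bisections may
  fail, which is why bisections are restricted by conditions on source and range and are not
  intersected with each other.\<close>

lemma clopen_Int: "clopen K \<Longrightarrow> clopen L \<Longrightarrow> clopen (K \<inter> L)"
  using compact_Int_closedin[of "unit_top G" K L] compactin_imp_closedin[OF Hausdorff_units, of L] by blast

lemma cob_restrict_src: "cob F \<Longrightarrow> clopen K \<Longrightarrow> cob {g \<in> F. src G g \<in> K}"
proof (rule cob_sub_src)
  assume *: "cob F" "clopen K"
  have "src G ` {g \<in> F. src G g \<in> K} = src G ` F \<inter> K" by auto
  then show "clopen (src G ` {g \<in> F. src G g \<in> K})"
    using clopen_Int[OF cob_src, of F K] * by simp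
qed auto

lemma cob_restrict_rng: "cob F \<Longrightarrow> clopen K \<Longrightarrow> cob {g \<in> F. rng G g \<in> K}"
proof (rule cob_sub_rng)
  assume *: "cob F" "clopen K"
  have "rng G ` {g \<in> F. rng G g \<in> K} = rng G ` F \<inter> K" by auto
  then show "clopen (rng G ` {g \<in> F. rng G g \<in> K})"
    using clopen_Int[OF cob_rng, of F K] * by simp
qed auto

lemma cob_units_iff: "K \<subseteq> units G \<Longrightarrow> cob K \<longleftrightarrow> clopen K"
proof -
  assume K: "K \<subseteq> units G"
  have "inj_on (src G) K"
    by (rule inj_onI) (metis K src_unit subsetD)
  moreover have "inj_on (rng G) K"
    by (rule inj_onI) (metis K rng_unit subsetD)
  ultimately show ?thesis
    unfolding cob_iff openin_unit_top compactin_unit_top using K by blast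
qed

text \<open>Around a product \<open>x\<close> choose \<open>B\<close> on which \<open>src G\<close>
  is injective. By continuity, products of factors near the given ones stay in \<open>B\<close>;
  conversely an element of \<open>B\<close> is such a product once its source is the source of
  one.\<close>

lemma openin_mul_bisections:
  assumes "openin (gtop G) E" "openin (gtop G) F"
  shows "openin (gtop G) {gmul G g h |g h. g \<in> E \<and> h \<in> F \<and> src G g = rng G h}" (is "openin _ ?P")
proof (subst openin_subopen, intro ballI)
  fix x assume "x \<in> ?P"
  then obtain g h where gh: "g \<in> E" "h \<in> F" "src G g = rng G h" "x = gmul G g h" by auto
  have el: "g \<in> elts G" "h \<in> elts G"
    using gh(1,2) assms[THEN openin_subset] unfolding topspace_gtop by auto
  then have x: "x \<in> elts G" using gh(3,4) by simp
  then obtain B where B: "openin (gtop G) B" "x \<in> B" "inj_on (src G) B"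
    using local_homeo_src unfolding local_homeomorphism_iff topspace_gtop by blast
  let ?X = "subtopology (prod_topology (gtop G) (gtop G)) (composable G)"
  let ?V = "{p \<in> composable G. (\<lambda>(g, h). gmul G g h) p \<in> B}"
  have "topspace ?X = composable G"
    by (auto simp: composable_def elts_def)
  then have "openin ?X ?V"
    using openin_continuous_map_preimage[OF continuous_mul B(1)] by simp
  then obtain W where W: "openin (prod_topology (gtop G) (gtop G)) W" "?V = W \<inter> composable G"
    unfolding openin_subtopology by blast
  have "(g, h) \<in> composable G" using el gh(3) by (rule composableI)
  then have "(g, h) \<in> ?V" using gh(4) B(2) by simp
  then have "(g, h) \<in> W" using W(2) by blast
  then have "\<exists>U V. openin (gtop G) U \<and> openin (gtop G) V \<and> g \<in> U \<and> h \<in> V \<and> U \<times> V \<subseteq> W"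
    using W(1)[unfolded openin_prod_topology_alt, rule_format, of g h] by simp
  then obtain E' F' where E': "openin (gtop G) E'" "openin (gtop G) F'" "g \<in> E'" "h \<in> F'" "E' \<times> F' \<subseteq> W"
    by (elim exE conjE)
  let ?E = "E \<inter> E'" let ?F = "F \<inter> F'"
  let ?Q = "{gmul G g h |g h. g \<in> ?E \<and> h \<in> ?F \<and> src G g = rng G h}"
  have o: "openin (gtop G) ?E" "openin (gtop G) ?F" using assms E' by auto
  have QB: "?Q \<subseteq> B"
  proof
    fix y assume "y \<in> ?Q"
    then obtain a b where ab: "a \<in> ?E" "b \<in> ?F" "src G a = rng G b" "y = gmul G a b" by auto
    then have "a \<in> elts G" "b \<in> elts G" using o[THEN openin_subset] unfolding topspace_gtop by blast+
    then have "(a, b) \<in> composable G" using ab(3) by (rule composableI)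
    moreover have "(a, b) \<in> W" using ab(1,2) E'(5) by blast
    ultimately have "(a, b) \<in> ?V" using W(2) by blast
    then show "y \<in> B" using ab(4) by simp
  qed
  \<comment> \<open>The sources of products with factors in \<open>?E\<close> and \<open>?F\<close>.
    This set is open, and over it the injectivity of \<open>src G\<close> on \<open>B\<close>
    identifies every element of \<open>B\<close> with such a product.\<close>
  let ?S = "src G ` {h \<in> ?F. rng G h \<in> src G ` ?E}"
  have "openin (unit_top G) ?S" using o openin_src_image openin_rng_vimage by blast
  then have oT: "openin (gtop G) {x \<in> B. src G x \<in> ?S}" using B openin_src_vimage by blast
  have "{x \<in> B. src G x \<in> ?S} \<subseteq> ?Q"
  proof
    fix y assume y: "y \<in> {x \<in> B. src G x \<in> ?S}"
    then obtain b a where ab: "b \<in> ?F" "a \<in> ?E" "rng G b = src G a" "src G y = src G b" by auto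
    then have e: "a \<in> elts G" "b \<in> elts G" using o[THEN openin_subset] unfolding topspace_gtop by blast+
    have "gmul G a b \<in> ?Q" using ab(1-2) ab(3)[symmetric] by blast
    moreover have "src G (gmul G a b) = src G y" using ab e by simp
    moreover have "gmul G a b \<in> B" using QB calculation by blast
    ultimately have "gmul G a b = y" using y B(3) by (auto dest: inj_onD)
    then show "y \<in> ?Q" using \<open>gmul G a b \<in> ?Q\<close> by simp
  qed
  then have "{x \<in> B. src G x \<in> ?S} \<subseteq> ?P" by blast
  moreover have "src G x \<in> ?S"
  proof (rule image_eqI)
    show "src G x = src G h" using gh el by simp
    show "h \<in> {h \<in> ?F. rng G h \<in> src G ` ?E}" using gh(1,2) gh(3)[symmetric] E' by auto
  qed
  ultimately show "\<exists>T. openin (gtop G) T \<and> x \<in> T \<and> T \<subseteq> ?P"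
    using oT B(2) by (intro exI[of _ "{x \<in> B. src G x \<in> ?S}"]) auto
qed

lemma open_bisection_mul:
  assumes "open_bisection G E" "open_bisection G F"
  shows "open_bisection G {gmul G g h |g h. g \<in> E \<and> h \<in> F \<and> src G g = rng G h}" (is "open_bisection _ ?P")
proof -
  have EF: "E \<subseteq> elts G" "F \<subseteq> elts G" "openin (gtop G) E" "openin (gtop G) F"
    using assms by (auto simp: open_bisection_iff openin_subset topspace_gtop[symmetric] dest: openin_subset)
  have inj: "inj_on (src G) E" "inj_on (src G) F" "inj_on (rng G) E" "inj_on (rng G) F"
    using assms by (auto simp: open_bisection_iff)
  have "inj_on (src G) ?P"
  proof (rule inj_onI)
    fix x y assume "x \<in> ?P" "y \<in> ?P" and s: "src G x = src G y"
    then obtain a b c d where *: "a \<in> E" "b \<in> F" "src G a = rng G b" "x = gmul G a b"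
      "c \<in> E" "d \<in> F" "src G c = rng G d" "y = gmul G c d" by blast
    have "a \<in> elts G" "b \<in> elts G" "c \<in> elts G" "d \<in> elts G" using * EF by auto
    then have "src G b = src G d" using * s by simp
    then have "b = d" using inj * by (meson inj_onD)
    moreover then have "a = c" using inj * by (metis inj_onD)
    ultimately show "x = y" using * by simp
  qed
  moreover have "inj_on (rng G) ?P"
  proof (rule inj_onI)
    fix x y assume "x \<in> ?P" "y \<in> ?P" and s: "rng G x = rng G y"
    then obtain a b c d where *: "a \<in> E" "b \<in> F" "src G a = rng G b" "x = gmul G a b"
      "c \<in> E" "d \<in> F" "src G c = rng G d" "y = gmul G c d" by blast
    have "a \<in> elts G" "b \<in> elts G" "c \<in> elts G" "d \<in> elts G" using * EF by auto
    then have "rng G a = rng G c" using * s by simp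
    then have "a = c" using inj * by (meson inj_onD)
    moreover then have "b = d" using inj * by (metis inj_onD)
    ultimately show "x = y" using * by simp
  qed
  ultimately show ?thesis using openin_mul_bisections EF by (simp add: open_bisection_iff)
qed

lemma open_bisection_subset: "open_bisection G B \<Longrightarrow> B \<subseteq> elts G"
  by (simp add: open_bisection_iff openin_subset topspace_gtop[symmetric])

lemma ex_open_bisection:
  assumes "openin (gtop G) V" "g \<in> V"
  shows "\<exists>B. open_bisection G B \<and> g \<in> B \<and> B \<subseteq> V"
proof -
  have g: "g \<in> topspace (gtop G)" using assms openin_subset by blast
  obtain U1 where U1: "openin (gtop G) U1" "g \<in> U1" "inj_on (src G) U1"
    using local_homeo_src g unfolding local_homeomorphism_iff by blast
  obtain U2 where U2: "openin (gtop G) U2" "g \<in> U2" "inj_on (rng G) U2"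
    using local_homeo_rng g unfolding local_homeomorphism_iff by blast
  have "open_bisection G (V \<inter> U1 \<inter> U2)"
    using U1 U2 assms unfolding open_bisection_iff by (auto simp: inj_on_def)
  then show ?thesis using U1 U2 assms by blast
qed

lemma open_bisection_sub: "open_bisection G B \<Longrightarrow> openin (gtop G) C \<Longrightarrow> C \<subseteq> B \<Longrightarrow> open_bisection G C"
  unfolding open_bisection_iff using inj_on_subset by blast

end

section \<open>Germs\<close>

text \<open>A germ is encoded by the full class of relations agreeing with it locally. The relation
  itself belongs to its class, which gives one direction; intersecting two neighbourhoods gives the
  other.\<close>

lemma germ_eq_iff:
  assumes "x \<in> topspace X"
  shows "germ X \<phi> x = germ X \<psi> y \<longleftrightarrow>
    x = y \<and> (\<exists>W. openin X W \<and> x \<in> W \<and> \<phi> \<inter> W \<times> UNIV = \<psi> \<inter> W \<times> UNIV)"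
proof
  assume eq: "germ X \<phi> x = germ X \<psi> y"
  have "\<phi> \<in> {\<rho>. \<exists>W. openin X W \<and> x \<in> W \<and> \<rho> \<inter> W \<times> UNIV = \<phi> \<inter> W \<times> UNIV}"
    using assms by blast
  then have "\<phi> \<in> {\<rho>. \<exists>W. openin X W \<and> y \<in> W \<and> \<rho> \<inter> W \<times> UNIV = \<psi> \<inter> W \<times> UNIV}" "x = y"
    using eq by (auto simp: germ_def)
  then show "x = y \<and> (\<exists>W. openin X W \<and> x \<in> W \<and> \<phi> \<inter> W \<times> UNIV = \<psi> \<inter> W \<times> UNIV)" by blast
next
  assume R: "x = y \<and> (\<exists>W. openin X W \<and> x \<in> W \<and> \<phi> \<inter> W \<times> UNIV = \<psi> \<inter> W \<times> UNIV)"
  then obtain W where W: "openin X W" "x \<in> W" "\<phi> \<inter> W \<times> UNIV = \<psi> \<inter> W \<times> UNIV" by blast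
  have "\<exists>V. openin X V \<and> x \<in> V \<and> \<rho> \<inter> V \<times> UNIV = \<psi>' \<inter> V \<times> UNIV"
    if "openin X V" "x \<in> V" "\<rho> \<inter> V \<times> UNIV = \<phi>' \<inter> V \<times> UNIV" "\<phi>' \<inter> W \<times> UNIV = \<psi>' \<inter> W \<times> UNIV"
    for V \<rho> \<phi>' \<psi>'
  proof (intro exI[of _ "V \<inter> W"] conjI)
    show "openin X (V \<inter> W)" using that W by blast
    show "x \<in> V \<inter> W" using that W by blast
    show "\<rho> \<inter> (V \<inter> W) \<times> UNIV = \<psi>' \<inter> (V \<inter> W) \<times> UNIV" using that(3,4) by blast
  qed
  then show "germ X \<phi> x = germ X \<psi> y"
    using R W unfolding germ_def by (auto; metis)
qed

lemma prepend_eq_iff: "prepend x w = z \<longleftrightarrow> z 0 = x \<and> shift z = w"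
proof
  assume "prepend x w = z"
  then show "z 0 = x \<and> shift z = w" by (auto simp: prepend_def shift_def)
next
  assume "z 0 = x \<and> shift z = w"
  then show "prepend x w = z"
    by (auto simp: prepend_def shift_def fun_eq_iff split: nat.split)
qed

lemma eq_prepend_iff: "z = prepend x w \<longleftrightarrow> z 0 = x \<and> shift z = w"
  using prepend_eq_iff by metis

lemma shift_in_paths: "w \<in> paths D \<Longrightarrow> shift w \<in> paths D"
  by (simp add: paths_def shift_def)

lemma prepend_in_paths_iff:
  "w \<in> paths D \<Longrightarrow> prepend x w \<in> paths D \<longleftrightarrow> x \<in> arcs D \<and> head D x = tail D (w 0)"
  by (auto simp: paths_def prepend_def split: nat.split)

lemma local_homeomorphism_eq:
  assumes "local_homeomorphism X Y f" "\<And>x. x \<in> topspace X \<Longrightarrow> f x = g x"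
  shows "local_homeomorphism X Y g"
proof -
  have "g ` U = f ` U" "inj_on g U = inj_on f U" if "openin X U" for U
    using assms(2) openin_subset[OF that] by (auto intro!: image_cong inj_on_cong)
  moreover have "continuous_map X Y g" using assms continuous_map_eq local_homeomorphism_iff by blast
  ultimately show ?thesis using assms(1) unfolding local_homeomorphism_iff open_map_def by metis
qed

section \<open>The unit space as an edge shift\<close>

locale shift_groupoid = etale_groupoid G for G :: "'g topgpd" +
  fixes D :: "('v, 'x) pre_digraph" and \<pi> :: "'g \<Rightarrow> nat \<Rightarrow> 'x"
  assumes fin_digraph: "fin_digraph D"
    and effective: "effective G"
    and homeo: "homeomorphic_map (unit_top G) (edge_shift D) \<pi>"
    and shift_invariant: "completely_shift_invariant D G \<pi>"
begin

lemma finite_arcs: "finite (arcs D)"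
  using fin_digraph fin_digraph.finite_arcs by blast

lemma topspace_edge_shift: "topspace (edge_shift D) = paths D"
  by (auto simp: edge_shift_def paths_def)

lemma pi_inj: "inj_on \<pi> (units G)" and pi_image: "\<pi> ` units G = paths D"
  using homeomorphic_imp_injective_map[OF homeo] homeomorphic_imp_surjective_map[OF homeo]
  by (simp_all add: topspace_edge_shift)

lemma pi_paths: "u \<in> units G \<Longrightarrow> \<pi> u \<in> paths D"
  using pi_image by blast

lemma unit_eqI: "u \<in> units G \<Longrightarrow> v \<in> units G \<Longrightarrow> \<pi> u = \<pi> v \<Longrightarrow> u = v"
  using pi_inj by (rule inj_onD)

definition pt :: "(nat \<Rightarrow> 'x) \<Rightarrow> 'g" where "pt = inv_into (units G) \<pi>"

lemma pt_units: "w \<in> paths D \<Longrightarrow> pt w \<in> units G" and pi_pt: "w \<in> paths D \<Longrightarrow> \<pi> (pt w) = w"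
  using pi_image by (auto simp: pt_def inv_into_into f_inv_into_f)

text \<open>Cylinders are indexed by a point in place of a word. For a unit \<open>u\<close> they
  are never empty, and two of the same length either coincide or are disjoint, without any mention
  of which words are paths.\<close>

definition cyl :: "nat \<Rightarrow> 'g \<Rightarrow> 'g set" where
  "cyl M u = {v \<in> units G. \<forall>i<M. \<pi> v i = \<pi> u i}"

lemma in_cyl [intro]: "u \<in> units G \<Longrightarrow> u \<in> cyl M u"
  by (simp add: cyl_def)

lemma cyl_eq: "v \<in> cyl M u \<Longrightarrow> cyl M v = cyl M u"
  by (auto simp: cyl_def)

lemma cyl_mono: "M \<le> M' \<Longrightarrow> v \<in> cyl M u \<Longrightarrow> cyl M' v \<subseteq> cyl M u"
  by (auto simp: cyl_def)

lemma continuous_coordinate: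
  "continuous_map (unit_top G) (discrete_topology (arcs D)) (\<lambda>u. \<pi> u i)"
proof -
  have "continuous_map (product_topology (\<lambda>_. discrete_topology (arcs D)) UNIV) (discrete_topology (arcs D)) (\<lambda>w. w i)"
    by (rule continuous_map_product_projection) simp
  then have "continuous_map (edge_shift D) (discrete_topology (arcs D)) (\<lambda>w. w i)"
    unfolding edge_shift_def by (rule continuous_map_from_subtopology)
  then show ?thesis
    using continuous_map_compose[OF homeomorphic_imp_continuous_map[OF homeo]] by (simp add: comp_def)
qed

lemma cyl_Suc: "cyl (Suc M) u = cyl M u \<inter> {v \<in> units G. \<pi> v M = \<pi> u M}"
  by (auto simp: cyl_def less_Suc_eq)

lemma openin_cyl: "u \<in> units G \<Longrightarrow> openin (unit_top G) (cyl M u)"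
  and closedin_cyl: "u \<in> units G \<Longrightarrow> closedin (unit_top G) (cyl M u)"
proof (induction M)
  case 0
  { case 1 then show ?case using openin_topspace[of "unit_top G"] by (simp add: cyl_def) }
  { case 2 then show ?case using closedin_topspace[of "unit_top G"] by (simp add: cyl_def) }
next
  case (Suc M)
  have *: "{v \<in> units G. \<pi> v M = \<pi> u M} = {v \<in> topspace (unit_top G). \<pi> v M \<in> {\<pi> u M}}" by simp
  { case 1
    then have "\<pi> u M \<in> arcs D" using pi_paths by (auto simp: paths_def)
    then have "openin (unit_top G) {v \<in> units G. \<pi> v M = \<pi> u M}"
      unfolding * by (intro openin_continuous_map_preimage[OF continuous_coordinate]) auto
    then show ?case using Suc 1 by (simp add: cyl_Suc openin_Int) }
  { case 2
    then have "\<pi> u M \<in> arcs D" using pi_paths by (auto simp: paths_def)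
    then have "closedin (unit_top G) {v \<in> units G. \<pi> v M = \<pi> u M}"
      unfolding * by (intro closedin_continuous_map_preimage[OF continuous_coordinate]) auto
    then show ?case using Suc 2 by (simp add: cyl_Suc closedin_Int) }
qed

text \<open>A closed subspace of a product of finite discrete spaces: the path condition at one
  place concerns two coordinates and is a finite union of conditions fixing both.\<close>

lemma compact_edge_shift: "compact_space (edge_shift D)"
proof -
  let ?P = "product_topology (\<lambda>_::nat. discrete_topology (arcs D)) UNIV"
  let ?C = "\<lambda>i. {w \<in> topspace ?P. head D (w i) = tail D (w (Suc i))}"
  have "compact_space ?P"
    by (simp add: compact_space_product_topology compact_space_discrete_topology finite_arcs)
  moreover have "closedin ?P (?C i)" for i
  proof -
    have c: "closedin ?P {w \<in> topspace ?P. w j \<in> {a}}" if "a \<in> arcs D" for a j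
      by (rule closedin_continuous_map_preimage[OF continuous_map_product_projection]) (use that in auto)
    define I where "I = {(a, b) \<in> arcs D \<times> arcs D. head D a = tail D b}"
    define E where "E p = {w \<in> topspace ?P. w i \<in> {fst p}} \<inter> {w \<in> topspace ?P. w (Suc i) \<in> {snd p}}" for p
    have "w \<in> E (w i, w (Suc i)) \<and> (w i, w (Suc i)) \<in> I" if "w \<in> ?C i" for w
      using that by (simp add: E_def I_def PiE_iff)
    moreover have "w \<in> ?C i" if "w \<in> E p" "p \<in> I" for w p
      using that by (auto simp: E_def I_def)
    ultimately have "?C i = \<Union>(E ` I)" by blast
    moreover have "closedin ?P (\<Union>(E ` I))"
    proof (rule closedin_Union)
      have "I \<subseteq> arcs D \<times> arcs D" by (auto simp: I_def)
      then show "finite (E ` I)"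
        using finite_arcs by (meson finite_SigmaI finite_imageI finite_subset)
      fix T assume "T \<in> E ` I"
      then obtain p where "fst p \<in> arcs D" "snd p \<in> arcs D" "T = E p" by (auto simp: I_def)
      then show "closedin ?P T" using c unfolding E_def by (simp only: closedin_Int)
    qed
    ultimately show ?thesis by simp
  qed
  then have "closedin ?P (\<Inter>i. ?C i)" by (intro closedin_Inter) auto
  moreover have "(\<Inter>i. ?C i) = paths D" by (auto simp: paths_def)
  ultimately have "compactin ?P (paths D)" using closedin_compact_space[of ?P "paths D"] by simp
  then show ?thesis unfolding edge_shift_def by (simp add: compact_space_subtopology)
qed

lemma compact_units: "compact_space (unit_top G)"
  using homeomorphic_compact_space[OF homeomorphic_map_imp_homeomorphic_space[OF homeo]] compact_edge_shift by simp

lemma clopen_iff: "openin (unit_top G) K \<and> closedin (unit_top G) K \<longleftrightarrow> clopen K"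
  using closedin_compact_space[OF compact_units] compactin_imp_closedin[OF Hausdorff_units] by blast

lemma clopen_cyl: "u \<in> units G \<Longrightarrow> clopen (cyl M u)"
  using openin_cyl closedin_cyl clopen_iff by blast

lemma cyl_basis:
  assumes "openin (unit_top G) W" "u \<in> W"
  shows "\<exists>M. cyl M u \<subseteq> W"
proof -
  let ?P = "product_topology (\<lambda>_::nat. discrete_topology (arcs D)) UNIV"
  have u: "u \<in> units G" and Wu: "W \<subseteq> units G" using assms openin_subset by fastforce+
  have "openin (edge_shift D) (\<pi> ` W)"
    using homeomorphic_imp_open_map[OF homeo] assms by (simp add: open_map_def)
  then obtain S where S: "openin ?P S" "\<pi> ` W = S \<inter> paths D"
    unfolding edge_shift_def openin_subtopology by blast
  have "\<pi> u \<in> S" using S assms by blast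
  then obtain U where U: "finite {i. U i \<noteq> arcs D}" "\<pi> u \<in> Pi\<^sub>E UNIV U" "Pi\<^sub>E UNIV U \<subseteq> S"
    using S(1) unfolding openin_product_topology_alt by auto
  obtain M where M: "{i. U i \<noteq> arcs D} \<subseteq> {..<M}" using finite_nat_bounded[OF U(1)] by blast
  have "cyl M u \<subseteq> W"
  proof
    fix v assume v: "v \<in> cyl M u"
    then have vu: "v \<in> units G" by (simp add: cyl_def)
    have "\<pi> v i \<in> U i" for i
    proof (cases "i < M")
      case True
      then show ?thesis using v U(2) by (auto simp: cyl_def)
    next
      case False
      then have "U i = arcs D" using M by auto
      then show ?thesis using pi_paths[OF vu] by (simp add: paths_def)
    qed
    then have "\<pi> v \<in> S" using U(3) by blast
    then have "\<pi> v \<in> \<pi> ` W" using S(2) pi_paths[OF vu] by blast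
    then show "v \<in> W" using pi_inj vu Wu by (auto dest: inj_onD)
  qed
  then show ?thesis ..
qed

text \<open>A Lebesgue number: finitely many of the given cylinders cover the compact unit space,
  and every cylinder at least as long as all of them is contained in one of them.\<close>

lemma lebesgue:
  assumes P: "\<And>u. u \<in> units G \<Longrightarrow> \<exists>M. P (cyl M u)" and mono: "\<And>A B. P A \<Longrightarrow> B \<subseteq> A \<Longrightarrow> P B"
  shows "\<exists>M. \<forall>M'\<ge>M. \<forall>u\<in>units G. P (cyl M' u)"
proof -
  obtain m where m: "\<And>u. u \<in> units G \<Longrightarrow> P (cyl (m u) u)" using P by metis
  have "\<forall>U\<in>(\<lambda>u. cyl (m u) u) ` units G. openin (unit_top G) U" using openin_cyl by blast
  moreover have "topspace (unit_top G) \<subseteq> \<Union>((\<lambda>u. cyl (m u) u) ` units G)" by auto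
  ultimately obtain \<F> where F: "finite \<F>" "\<F> \<subseteq> (\<lambda>u. cyl (m u) u) ` units G" "units G \<subseteq> \<Union>\<F>"
    using compact_units[unfolded compact_space_alt, rule_format, of "(\<lambda>u. cyl (m u) u) ` units G"] by auto
  then obtain S where S: "finite S" "S \<subseteq> units G" "\<F> = (\<lambda>u. cyl (m u) u) ` S"
    by (meson finite_subset_image)
  have "P (cyl M' u)" if "M' \<ge> Max (insert 0 (m ` S))" "u \<in> units G" for M' u
  proof -
    obtain v where v: "v \<in> S" "u \<in> cyl (m v) v" using F(3) S(3) \<open>u \<in> units G\<close> by blast
    have "m v \<le> M'" using that v S(1) by simp
    then have "cyl M' u \<subseteq> cyl (m v) v" using cyl_mono v by blast
    then show ?thesis using m mono v S by blast
  qed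
  then show ?thesis by blast
qed

lemma finite_cyls: "finite (cyl M ` units G)"
proof -
  define f where "f l = {v \<in> units G. map (\<pi> v) [0..<M] = l}" for l
  define L where "L = {l. set l \<subseteq> arcs D \<and> length l = M}"
  have "cyl M ` units G \<subseteq> f ` L"
  proof (rule image_subsetI)
    fix u assume u: "u \<in> units G"
    have "cyl M u = f (map (\<pi> u) [0..<M])" by (auto simp: cyl_def f_def)
    moreover have "map (\<pi> u) [0..<M] \<in> L" using pi_paths[OF u] by (auto simp: L_def paths_def)
    ultimately show "cyl M u \<in> f ` L" by simp
  qed
  moreover have "finite (f ` L)" unfolding L_def by (intro finite_imageI finite_lists_length_eq finite_arcs)
  ultimately show ?thesis by (rule finite_subset)
qed

section \<open>The shift of a groupoid element\<close>

definition sh :: "'g \<Rightarrow> 'g" where "sh u = pt (shift (\<pi> u))"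

lemma sh_units [simp]: "u \<in> units G \<Longrightarrow> sh u \<in> units G"
  and pi_sh: "u \<in> units G \<Longrightarrow> \<pi> (sh u) = shift (\<pi> u)"
  by (simp_all add: sh_def pt_units pi_pt shift_in_paths pi_paths)

lemma pi_sh_nth: "u \<in> units G \<Longrightarrow> \<pi> (sh u) i = \<pi> u (Suc i)"
  by (simp add: pi_sh shift_def)

lemma sh_eqI: "u \<in> units G \<Longrightarrow> v \<in> units G \<Longrightarrow> \<pi> u 0 = \<pi> v 0 \<Longrightarrow> sh u = sh v \<Longrightarrow> u = v"
proof (rule unit_eqI)
  assume *: "u \<in> units G" "v \<in> units G" "\<pi> u 0 = \<pi> v 0" "sh u = sh v"
  show "\<pi> u = \<pi> v"
  proof
    fix i show "\<pi> u i = \<pi> v i"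
    proof (cases i)
      case (Suc j)
      then show ?thesis using pi_sh_nth[of u j] pi_sh_nth[of v j] * by simp
    qed (simp add: *)
  qed
qed

text \<open>Two fixed letters are required at the start. The first letter of the shifted path must
  be prescribed, since otherwise the first edge of \<open>u\<close> could not be put back in front
  of it.\<close>

lemma sh_cyl_image:
  assumes u: "u \<in> units G"
  shows "sh ` cyl (Suc (Suc M)) u = cyl (Suc M) (sh u)"
proof
  show "sh ` cyl (Suc (Suc M)) u \<subseteq> cyl (Suc M) (sh u)"
    using u by (auto simp: cyl_def pi_sh_nth)
  show "cyl (Suc M) (sh u) \<subseteq> sh ` cyl (Suc (Suc M)) u"
  proof
    fix v assume v: "v \<in> cyl (Suc M) (sh u)"
    then have vu: "v \<in> units G" by (simp add: cyl_def)
    let ?w = "prepend (\<pi> u 0) (\<pi> v)"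
    have "\<pi> v 0 = \<pi> u (Suc 0)" using v u by (auto simp: cyl_def pi_sh_nth)
    then have w: "?w \<in> paths D"
      using pi_paths[OF u] by (simp add: prepend_in_paths_iff[OF pi_paths[OF vu]]) (simp add: paths_def)
    have "sh (pt ?w) = v"
      using w vu by (intro unit_eqI) (auto simp: pi_sh pt_units pi_pt prepend_def shift_def)
    moreover have "pt ?w \<in> cyl (Suc (Suc M)) u"
      using v u w by (auto simp: cyl_def pt_units pi_pt prepend_def pi_sh_nth split: nat.split)
    ultimately show "v \<in> sh ` cyl (Suc (Suc M)) u" by (rule image_eqI[OF sym])
  qed
qed

lemma sh_lh: "local_homeomorphism (unit_top G) (unit_top G) sh"
  unfolding local_homeomorphism_iff
proof (intro conjI ballI)
  have "openin (unit_top G) {u \<in> units G. sh u \<in> W}" if W: "openin (unit_top G) W" for W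
  proof (subst openin_subopen, intro ballI)
    fix u assume u: "u \<in> {u \<in> units G. sh u \<in> W}"
    then obtain M where "cyl M (sh u) \<subseteq> W" using cyl_basis[OF W] by blast
    then have "cyl (Suc M) u \<subseteq> {u \<in> units G. sh u \<in> W}"
      using u by (auto simp: cyl_def pi_sh_nth)
    then show "\<exists>T. openin (unit_top G) T \<and> u \<in> T \<and> T \<subseteq> {u \<in> units G. sh u \<in> W}"
      using u openin_cyl[of u "Suc M"] by (intro exI[of _ "cyl (Suc M) u"] conjI in_cyl) simp_all
  qed
  then show "continuous_map (unit_top G) (unit_top G) sh"
    by (simp add: continuous_map_def)
  show "open_map (unit_top G) (unit_top G) sh" unfolding open_map_def
  proof (intro allI impI)
    fix W assume W: "openin (unit_top G) W"
    show "openin (unit_top G) (sh ` W)"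
    proof (subst openin_subopen, intro ballI)
      fix v assume "v \<in> sh ` W"
      then obtain u where u: "u \<in> W" "v = sh u" by blast
      then have uu: "u \<in> units G" using W openin_subset by fastforce
      obtain M where M: "cyl M u \<subseteq> W" using cyl_basis[OF W u(1)] by blast
      then have "cyl (Suc (Suc M)) u \<subseteq> W" by (auto simp: cyl_def)
      then have "cyl (Suc M) (sh u) \<subseteq> sh ` W" unfolding sh_cyl_image[OF uu, symmetric] by (rule image_mono)
      moreover have "v \<in> cyl (Suc M) (sh u)" using u uu by (simp add: in_cyl)
      moreover have "openin (unit_top G) (cyl (Suc M) (sh u))" using uu by (simp add: openin_cyl)
      ultimately show "\<exists>T. openin (unit_top G) T \<and> v \<in> T \<and> T \<subseteq> sh ` W"
        by (intro exI[of _ "cyl (Suc M) (sh u)"] conjI)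
    qed
  qed
  fix u assume "u \<in> topspace (unit_top G)"
  then have u: "u \<in> units G" by simp
  have "inj_on sh (cyl 1 u)"
  proof (rule inj_onI)
    fix a b assume "a \<in> cyl 1 u" "b \<in> cyl 1 u" "sh a = sh b"
    then show "a = b" using sh_eqI[of a b] by (simp add: cyl_def)
  qed
  then show "\<exists>U. openin (unit_top G) U \<and> u \<in> U \<and> inj_on sh U"
    using u openin_cyl[OF u, of 1] by (intro exI[of _ "cyl 1 u"] conjI in_cyl)
qed

text \<open>Effectiveness in the form used below: agreement over one neighbourhood of the source
  makes the two germs equal, and one germ belongs to one element.\<close>

lemma effectiveD:
  assumes "open_bisection G B" "open_bisection G C" "g \<in> B" "h \<in> C" "src G g = src G h"
    "openin (unit_top G) W" "src G g \<in> W"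
    and eq: "\<And>a b. a \<in> W \<Longrightarrow> (a, b) \<in> bis_map G B \<longleftrightarrow> (a, b) \<in> bis_map G C"
  shows "g = h"
proof -
  have "src G g \<in> topspace (unit_top G)" using assms(6,7) openin_subset by blast
  moreover have "bis_map G B \<inter> W \<times> UNIV = bis_map G C \<inter> W \<times> UNIV" using eq by blast
  ultimately have germ: "germ (unit_top G) (bis_map G B) (src G g) = germ (unit_top G) (bis_map G C) (src G h)"
    unfolding germ_eq_iff[OF \<open>src G g \<in> topspace (unit_top G)\<close>] using assms(5-7) by blast
  have "acts_as G g (germ (unit_top G) (bis_map G B) (src G g))"
    unfolding acts_as_def using assms(1,3) by (intro exI[of _ B] conjI refl)
  moreover have "acts_as G h (germ (unit_top G) (bis_map G B) (src G g))"
    unfolding acts_as_def germ using assms(2,4) by (intro exI[of _ C] conjI refl)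
  ultimately show ?thesis using effective[unfolded effective_def, rule_format] by simp
qed

text \<open>The bisection \<open>B'\<close> is the shift \<open>S\<^sub>y\<inverse> B S\<^sub>x\<close> of \<open>B\<close>.\<close>

definition corr :: "'x \<Rightarrow> 'x \<Rightarrow> 'g set \<Rightarrow> 'g set \<Rightarrow> bool" where
  "corr x y B B' \<longleftrightarrow> open_bisection G B \<and> open_bisection G B' \<and>
     (\<forall>g\<in>B. \<pi> (src G g) 0 = x \<and> \<pi> (rng G g) 0 = y) \<and>
     (\<forall>g\<in>B. \<exists>h\<in>B'. src G h = sh (src G g) \<and> rng G h = sh (rng G g)) \<and>
     (\<forall>h\<in>B'. \<exists>g\<in>B. src G h = sh (src G g) \<and> rng G h = sh (rng G g))"

lemma bisD: "open_bisection G B \<Longrightarrow> g \<in> B \<Longrightarrow> h \<in> B \<Longrightarrow> src G g = src G h \<Longrightarrow> g = h"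
  by (auto simp: open_bisection_iff dest: inj_onD)

lemma bis_elts: "open_bisection G B \<Longrightarrow> g \<in> B \<Longrightarrow> g \<in> elts G"
  using open_bisection_subset by blast

text \<open>The correspondence makes \<open>bis_map G B'\<close> equal to the composite relation
  that defines the shifted germ, so no further shrinking is required to compare germs.\<close>

lemma is_shiftedI:
  assumes c: "corr x y B B'" and g: "g \<in> B" and h: "h \<in> B'" and s: "src G h = sh (src G g)"
  shows "is_shifted G \<pi> g h"
proof -
  have B: "open_bisection G B" "open_bisection G B'" using c by (auto simp: corr_def)
  have ge: "g \<in> elts G" using B g bis_elts by blast
  have xy: "\<pi> (src G g) 0 = x" "\<pi> (rng G g) 0 = y" using c g by (auto simp: corr_def)
  have *: "(a, b) \<in> bis_map G B' \<longleftrightarrow> (a, b) \<in> prefix_map G \<pi> x O bis_map G B O (prefix_map G \<pi> y)\<inverse>" for a b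
  proof
    assume "(a, b) \<in> bis_map G B'"
    then obtain k where k: "k \<in> B'" "a = src G k" "b = rng G k" by (auto simp: bis_map_def)
    then obtain l where l: "l \<in> B" "a = sh (src G l)" "b = sh (rng G l)" using c unfolding corr_def by metis
    have le: "l \<in> elts G" "k \<in> elts G" using B l k bis_elts by blast+
    have xl: "\<pi> (src G l) 0 = x" "\<pi> (rng G l) 0 = y" using c l by (auto simp: corr_def)
    have "(a, src G l) \<in> prefix_map G \<pi> x" "(b, rng G l) \<in> prefix_map G \<pi> y"
      using l le xl by (auto simp: prefix_map_def eq_prepend_iff pi_sh)
    moreover have "(src G l, rng G l) \<in> bis_map G B" using l by (auto simp: bis_map_def)
    ultimately show "(a, b) \<in> prefix_map G \<pi> x O bis_map G B O (prefix_map G \<pi> y)\<inverse>" by blast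
  next
    assume "(a, b) \<in> prefix_map G \<pi> x O bis_map G B O (prefix_map G \<pi> y)\<inverse>"
    then obtain a' b' where ab: "(a, a') \<in> prefix_map G \<pi> x" "(a', b') \<in> bis_map G B" "(b, b') \<in> prefix_map G \<pi> y"
      by blast
    then have *: "a = sh a'" "b = sh b'" by (auto simp: prefix_map_def eq_prepend_iff pi_sh intro!: unit_eqI)
    obtain l where l: "l \<in> B" "a' = src G l" "b' = rng G l" using ab by (auto simp: bis_map_def)
    then obtain k where "k \<in> B'" "src G k = a" "rng G k = b" using c * unfolding corr_def by metis
    then show "(a, b) \<in> bis_map G B'" by (auto simp: bis_map_def)
  qed
  have "acts_as G h (germ (unit_top G) (bis_map G B') (src G h))"
    using h B unfolding acts_as_def by blast
  moreover have "bis_map G B' = prefix_map G \<pi> x O bis_map G B O (prefix_map G \<pi> y)\<inverse>"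
    using * by (auto simp only: set_eq_iff split_paired_all)
  moreover have "src G h \<in> units G" "\<pi> (src G h) = shift (\<pi> (src G g))"
    using s ge by (simp_all add: pi_sh)
  ultimately show ?thesis
    unfolding is_shifted_def using B g xy by metis
qed

lemma openin_first: "u \<in> units G \<Longrightarrow> openin (unit_top G) {v \<in> units G. \<pi> v 0 = \<pi> u 0}"
  using openin_cyl[of u 1] by (simp add: cyl_def)

lemma openin_sh_vimage: "openin (unit_top G) W \<Longrightarrow> openin (unit_top G) {v \<in> units G. sh v \<in> W}"
  using openin_continuous_map_preimage[of "unit_top G" "unit_top G" sh W] sh_lh
  by (simp add: local_homeomorphism_iff)

lemma openin_sh_image: "openin (unit_top G) W \<Longrightarrow> openin (unit_top G) (sh ` W)"
  using sh_lh by (simp add: local_homeomorphism_iff open_map_def)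

text \<open>The hypothesis leads from \<open>B\<close> to \<open>B'\<close> only. Keeping in
  \<open>B'\<close> just the elements over shifted sources of \<open>C\<close> yields the converse,
  because \<open>src G\<close> is injective on \<open>B'\<close>.\<close>

lemma corr_restrict:
  assumes B: "open_bisection G B" and B': "open_bisection G B'" and W: "openin (unit_top G) W"
    and xu: "u \<in> units G" "v \<in> units G"
    and m: "\<And>g. g \<in> B \<Longrightarrow> src G g \<in> W \<Longrightarrow> \<pi> (src G g) 0 = \<pi> u 0 \<Longrightarrow> \<pi> (rng G g) 0 = \<pi> v 0 \<Longrightarrow>
      \<exists>h\<in>B'. src G h = sh (src G g) \<and> rng G h = sh (rng G g)"
    and C: "C = {g \<in> B. src G g \<in> W \<and> \<pi> (src G g) 0 = \<pi> u 0 \<and> \<pi> (rng G g) 0 = \<pi> v 0}"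
    and C': "C' = {h \<in> B'. src G h \<in> sh ` src G ` C}"
  shows "corr (\<pi> u 0) (\<pi> v 0) C C'"
proof -
  let ?C = "{g \<in> B. src G g \<in> W \<and> \<pi> (src G g) 0 = \<pi> u 0 \<and> \<pi> (rng G g) 0 = \<pi> v 0}"
  let ?C' = "{h \<in> B'. src G h \<in> sh ` src G ` ?C}"
  have Be: "B \<subseteq> elts G" using B open_bisection_subset by blast
  have "?C = {g \<in> {g \<in> {g \<in> B. src G g \<in> W}. src G g \<in> {w \<in> units G. \<pi> w 0 = \<pi> u 0}}. rng G g \<in> {w \<in> units G. \<pi> w 0 = \<pi> v 0}}"
    using Be by auto
  then have oC: "openin (gtop G) ?C"
    using B W openin_first[OF xu(1)] openin_first[OF xu(2)]
    by (simp only:) (intro openin_rng_vimage openin_src_vimage; simp add: open_bisection_iff)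
  have oC': "openin (gtop G) ?C'"
    using B' openin_sh_image[OF openin_src_image[OF oC]] by (intro openin_src_vimage) (simp_all add: open_bisection_iff)
  show "corr (\<pi> u 0) (\<pi> v 0) C C'" unfolding corr_def C' C
  proof (intro conjI ballI)
    show "open_bisection G ?C" by (rule open_bisection_sub[OF B oC]) blast
    show "open_bisection G ?C'" by (rule open_bisection_sub[OF B' oC']) blast
  next
    fix g assume g: "g \<in> ?C"
    then show "\<pi> (src G g) 0 = \<pi> u 0" "\<pi> (rng G g) 0 = \<pi> v 0" by simp_all
    obtain h where h: "h \<in> B'" "src G h = sh (src G g)" "rng G h = sh (rng G g)" using m g by blast
    have "h \<in> ?C'" using h(1) h(2) g by blast
    then show "\<exists>h\<in>?C'. src G h = sh (src G g) \<and> rng G h = sh (rng G g)" using h by blast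
  next
    fix h assume h: "h \<in> ?C'"
    then obtain g where g: "g \<in> ?C" "src G h = sh (src G g)" by blast
    obtain k where k: "k \<in> B'" "src G k = sh (src G g)" "rng G k = sh (rng G g)" using m g by blast
    then have "h = k" using h g bisD[OF B', of h k] by simp
    then show "\<exists>g\<in>?C. src G h = sh (src G g) \<and> rng G h = sh (rng G g)" using g k by blast
  qed
qed

text \<open>Equality of germs holds over a neighbourhood \<open>W\<close> of the source of
  \<open>h\<close>. Pulling \<open>W\<close> back along \<open>sh\<close> and fixing the first edges
  on both sides gives bisections that correspond exactly.\<close>

lemma is_shiftedD:
  assumes g: "g \<in> elts G" and h: "is_shifted G \<pi> g h"
  shows "\<exists>B B'. corr (\<pi> (src G g) 0) (\<pi> (rng G g) 0) B B' \<and> g \<in> B \<and> h \<in> B' \<and> src G h = sh (src G g)"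
proof -
  let ?x = "\<pi> (src G g) 0" and ?y = "\<pi> (rng G g) 0"
  obtain B u where B: "open_bisection G B" "g \<in> B" "u \<in> units G" "\<pi> u = shift (\<pi> (src G g))"
    "acts_as G h (germ (unit_top G) (prefix_map G \<pi> ?x O bis_map G B O (prefix_map G \<pi> ?y)\<inverse>) u)"
    using h unfolding is_shifted_def by blast
  then obtain B' where B': "open_bisection G B'" "h \<in> B'"
    "germ (unit_top G) (bis_map G B') (src G h) =
     germ (unit_top G) (prefix_map G \<pi> ?x O bis_map G B O (prefix_map G \<pi> ?y)\<inverse>) u"
    unfolding acts_as_def by blast
  have he: "h \<in> elts G" using B' bis_elts by blast
  have us: "u = sh (src G g)" using B g by (intro unit_eqI) (auto simp: pi_sh)
  have "src G h \<in> topspace (unit_top G)" using he by simp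
  from germ_eq_iff[OF this, THEN iffD1, OF B'(3)]
  obtain W where W: "src G h = u" "openin (unit_top G) W" "u \<in> W"
    "bis_map G B' \<inter> W \<times> UNIV = (prefix_map G \<pi> ?x O bis_map G B O (prefix_map G \<pi> ?y)\<inverse>) \<inter> W \<times> UNIV"
    by auto
  let ?W = "{v \<in> units G. sh v \<in> W}"
  have m: "\<exists>h\<in>B'. src G h = sh (src G k) \<and> rng G h = sh (rng G k)"
    if k: "k \<in> B" "src G k \<in> ?W" "\<pi> (src G k) 0 = ?x" "\<pi> (rng G k) 0 = ?y" for k
  proof -
    have ke: "k \<in> elts G" using k B bis_elts by blast
    have "(sh (src G k), src G k) \<in> prefix_map G \<pi> ?x" "(sh (rng G k), rng G k) \<in> prefix_map G \<pi> ?y"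
      using k ke by (auto simp: prefix_map_def eq_prepend_iff pi_sh)
    moreover have "(src G k, rng G k) \<in> bis_map G B" using k by (auto simp: bis_map_def)
    ultimately have "(sh (src G k), sh (rng G k)) \<in> prefix_map G \<pi> ?x O bis_map G B O (prefix_map G \<pi> ?y)\<inverse>" by blast
    then have "(sh (src G k), sh (rng G k)) \<in> bis_map G B'" using W(4) k(2) by blast
    then show ?thesis by (auto simp: bis_map_def)
  qed
  define C where "C = {k \<in> B. src G k \<in> ?W \<and> \<pi> (src G k) 0 = ?x \<and> \<pi> (rng G k) 0 = ?y}"
  define C' where "C' = {h \<in> B'. src G h \<in> sh ` src G ` C}"
  have co: "corr ?x ?y C C'"
    by (rule corr_restrict[OF B(1) B'(1) openin_sh_vimage[OF W(2)] src_units[OF g] rng_units[OF g] m C_def C'_def])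
  have gC: "g \<in> C" using B g W us by (simp add: C_def)
  then have "sh (src G g) \<in> sh ` src G ` C" by (intro imageI)
  then have "h \<in> C'" using B' W us by (simp add: C'_def)
  then show ?thesis using co gC W us by blast
qed

text \<open>Two correspondences with the same first edges define the same partial map over the
  shifted sources of \<open>B \<inter> C\<close>: there an element of \<open>B\<close> is determined
  by its shifted source and its first edge. This justifies the definite description in
  \<open>gshift\<close>.\<close>

lemma is_shifted_unique:
  assumes g: "g \<in> elts G" and h: "is_shifted G \<pi> g h" and k: "is_shifted G \<pi> g k"
  shows "h = k"
proof -
  have *: "(a, b) \<in> bis_map G C'"
    if BB: "corr x y B B'" and CC: "corr x y C C'" and a: "a \<in> sh ` src G ` (B \<inter> C)"
      and ab: "(a, b) \<in> bis_map G B'" for B C B' C' a b x y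
  proof -
    obtain c where c: "c \<in> B" "c \<in> C" "a = sh (src G c)" using a by auto
    obtain p where p: "p \<in> B'" "a = src G p" "b = rng G p" using ab by (auto simp: bis_map_def)
    obtain l where l: "l \<in> B" "a = sh (src G l)" "b = sh (rng G l)" using BB p unfolding corr_def by metis
    have ob: "open_bisection G B" using BB by (simp add: corr_def)
    have e: "l \<in> elts G" "c \<in> elts G" using bis_elts[OF ob] c l by simp_all
    have "\<pi> (src G l) 0 = \<pi> (src G c) 0" using BB l c unfolding corr_def by metis
    then have "src G l = src G c" using e l c sh_eqI[of "src G l" "src G c"] by simp
    then have "l = c" using l c bisD[OF ob] by simp
    then obtain q where "q \<in> C'" "src G q = a" "rng G q = b" using CC c l unfolding corr_def by metis
    then show ?thesis by (auto simp: bis_map_def)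
  qed
  obtain B B' where B: "corr (\<pi> (src G g) 0) (\<pi> (rng G g) 0) B B'" "g \<in> B" "h \<in> B'" "src G h = sh (src G g)"
    using is_shiftedD[OF g h] by blast
  obtain C C' where C: "corr (\<pi> (src G g) 0) (\<pi> (rng G g) 0) C C'" "g \<in> C" "k \<in> C'" "src G k = sh (src G g)"
    using is_shiftedD[OF g k] by blast
  have ob: "open_bisection G B" "open_bisection G B'" "open_bisection G C" "open_bisection G C'"
    using B(1) C(1) by (auto simp: corr_def)
  let ?W = "sh ` src G ` (B \<inter> C)"
  have "openin (unit_top G) ?W"
    using ob by (intro openin_sh_image openin_src_image) (auto simp: open_bisection_iff)
  moreover have "src G h \<in> ?W" unfolding B(4) using B(2) C(2) by (intro imageI) simp
  moreover have "(a, b) \<in> bis_map G B' \<longleftrightarrow> (a, b) \<in> bis_map G C'" if "a \<in> ?W" for a b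
    using *[OF B(1) C(1), of a b] *[OF C(1) B(1), of a b] that by (metis Int_commute)
  moreover have "src G h = src G k" using B C by simp
  ultimately show ?thesis using effectiveD[OF ob(2,4) B(3) C(3)] by simp
qed

abbreviation gs :: "'g \<Rightarrow> 'g" where "gs \<equiv> gshift G \<pi>"

lemma gshift_eqI: "g \<in> elts G \<Longrightarrow> h \<in> elts G \<Longrightarrow> is_shifted G \<pi> g h \<Longrightarrow> gs g = h"
  unfolding gshift_def using is_shifted_unique by blast

lemma gshift_elts [simp]: "g \<in> elts G \<Longrightarrow> gs g \<in> elts G"
  and gshift_is_shifted: "g \<in> elts G \<Longrightarrow> is_shifted G \<pi> g (gs g)"
proof -
  assume g: "g \<in> elts G"
  then obtain h where "h \<in> elts G" "is_shifted G \<pi> g h"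
    using shift_invariant unfolding completely_shift_invariant_def by blast
  then show "gs g \<in> elts G" "is_shifted G \<pi> g (gs g)" using gshift_eqI g by auto
qed

lemma gshift_corr:
  assumes c: "corr x y B B'" and g: "g \<in> B"
  shows "gs g \<in> B' \<and> src G (gs g) = sh (src G g) \<and> rng G (gs g) = sh (rng G g)"
proof -
  obtain h where h: "h \<in> B'" "src G h = sh (src G g)" "rng G h = sh (rng G g)"
    using c g unfolding corr_def by metis
  have "g \<in> elts G" "h \<in> elts G" using c g h bis_elts unfolding corr_def by blast+
  then have "gs g = h" using is_shiftedI[OF c g h(1,2)] gshift_eqI by blast
  then show ?thesis using h by simp
qed

lemma ex_corr:
  assumes g: "g \<in> elts G"
  shows "\<exists>B B'. corr (\<pi> (src G g) 0) (\<pi> (rng G g) 0) B B' \<and> g \<in> B \<and> gs g \<in> B'"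
  using is_shiftedD[OF g gshift_is_shifted[OF g]] by blast

lemma src_gshift [simp]: "g \<in> elts G \<Longrightarrow> src G (gs g) = sh (src G g)"
  and rng_gshift [simp]: "g \<in> elts G \<Longrightarrow> rng G (gs g) = sh (rng G g)"
  using ex_corr gshift_corr by blast+

text \<open>Composed with \<open>src G\<close> the shift becomes \<open>sh\<close> after
  \<open>src G\<close>, a local homeomorphism. By cancellation only continuity remains, and it is
  read off from corresponding bisections.\<close>

lemma gshift_lh: "local_homeomorphism (gtop G) (gtop G) gs"
proof (rule local_homeomorphism_cancel)
  show "local_homeomorphism (gtop G) (unit_top G) (src G)" by (rule local_homeo_src)
  show "local_homeomorphism (gtop G) (unit_top G) (src G \<circ> gs)"
    by (rule local_homeomorphism_eq[OF local_homeomorphism_comp[OF local_homeo_src sh_lh]])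
      (simp add: topspace_gtop)
  have "openin (gtop G) {g \<in> elts G. gs g \<in> O'}" if O': "openin (gtop G) O'" for O'
  proof (subst openin_subopen, intro ballI)
    fix g assume g: "g \<in> {g \<in> elts G. gs g \<in> O'}"
    then obtain B B' where B: "corr (\<pi> (src G g) 0) (\<pi> (rng G g) 0) B B'" "g \<in> B" "gs g \<in> B'"
      using ex_corr by blast
    have ob: "open_bisection G B" "open_bisection G B'" using B by (auto simp: corr_def)
    \<comment> \<open>Elements of \<open>B\<close> over \<open>?K\<close> have a shift in
      \<open>B'\<close> with the same source as some element of \<open>O' \<inter> B'\<close>; since
      \<open>B'\<close> is a bisection the two agree, so the shift lies in
      \<open>O'\<close>.\<close>
    let ?K = "{v \<in> units G. sh v \<in> src G ` (O' \<inter> B')}"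
    let ?N = "{k \<in> B. src G k \<in> ?K}"
    have "openin (gtop G) ?N"
      using ob O' by (intro openin_src_vimage openin_sh_vimage openin_src_image) (auto simp: open_bisection_iff)
    moreover have "sh (src G g) \<in> src G ` (O' \<inter> B')"
      by (rule image_eqI[of _ _ "gs g"]) (use B g in simp_all)
    then have "g \<in> ?N" using B g by simp
    moreover have "?N \<subseteq> {g \<in> elts G. gs g \<in> O'}"
    proof
      fix k assume k: "k \<in> ?N"
      then have ke: "k \<in> elts G" "k \<in> B" using bis_elts[OF ob(1)] by simp_all
      obtain l where l: "l \<in> O'" "l \<in> B'" "src G l = sh (src G k)" using k by auto
      then have "gs k = l" using bisD[OF ob(2), of "gs k" l] gshift_corr[OF B(1) ke(2)] by simp
      then show "k \<in> {g \<in> elts G. gs g \<in> O'}" using l ke by simp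
    qed
    ultimately show "\<exists>T. openin (gtop G) T \<and> g \<in> T \<and> T \<subseteq> {g \<in> elts G. gs g \<in> O'}"
      using \<open>g \<in> ?N\<close> by (intro exI[of _ ?N] conjI)
  qed
  then show "continuous_map (gtop G) (gtop G) gs"
    by (simp add: continuous_map_def topspace_gtop)
qed

text \<open>The products of corresponding bisections correspond. For the converse direction the two
  factors are lifted separately; their middle ends have the same first edge and the same shift, so
  the lifts are composable.\<close>

lemma gshift_mul [simp]:
  assumes g: "g \<in> elts G" "h \<in> elts G" "src G g = rng G h"
  shows "gs (gmul G g h) = gmul G (gs g) (gs h)"
proof -
  obtain B B' where B: "corr (\<pi> (src G g) 0) (\<pi> (rng G g) 0) B B'" "g \<in> B" "gs g \<in> B'"
    using ex_corr[OF g(1)] by blast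
  obtain C C' where C: "corr (\<pi> (src G h) 0) (\<pi> (src G g) 0) C C'" "h \<in> C" "gs h \<in> C'"
    using ex_corr[OF g(2)] g(3) by metis
  have ob: "open_bisection G B" "open_bisection G B'" "open_bisection G C" "open_bisection G C'"
    using B(1) C(1) by (auto simp: corr_def)
  let ?P = "{gmul G a b |a b. a \<in> B \<and> b \<in> C \<and> src G a = rng G b}"
  let ?P' = "{gmul G a b |a b. a \<in> B' \<and> b \<in> C' \<and> src G a = rng G b}"
  have co: "corr (\<pi> (src G h) 0) (\<pi> (rng G g) 0) ?P ?P'" unfolding corr_def
  proof (intro conjI ballI)
    show "open_bisection G ?P" "open_bisection G ?P'" using open_bisection_mul ob by auto
  next
    fix p assume "p \<in> ?P"
    then obtain a b where ab: "a \<in> B" "b \<in> C" "src G a = rng G b" "p = gmul G a b" by blast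
    have e: "a \<in> elts G" "b \<in> elts G" using ab ob bis_elts by blast+
    have p: "src G p = src G b" "rng G p = rng G a" using ab e by simp_all
    show "\<pi> (src G p) 0 = \<pi> (src G h) 0" "\<pi> (rng G p) 0 = \<pi> (rng G g) 0"
      using p ab B(1) C(1) unfolding corr_def by metis+
    have "gs a \<in> B'" "gs b \<in> C'" using gshift_corr B(1) C(1) ab by blast+
    moreover have "src G (gs a) = rng G (gs b)" using e ab(3) by simp
    ultimately have "gmul G (gs a) (gs b) \<in> ?P'" by blast
    moreover have "src G (gmul G (gs a) (gs b)) = sh (src G p) \<and> rng G (gmul G (gs a) (gs b)) = sh (rng G p)"
      using e ab(3) p by simp
    ultimately show "\<exists>h\<in>?P'. src G h = sh (src G p) \<and> rng G h = sh (rng G p)" by blast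
  next
    fix p assume "p \<in> ?P'"
    then obtain k l where kl: "k \<in> B'" "l \<in> C'" "src G k = rng G l" "p = gmul G k l" by blast
    have e: "k \<in> elts G" "l \<in> elts G" using kl ob bis_elts by blast+
    obtain a where a: "a \<in> B" "src G k = sh (src G a)" "rng G k = sh (rng G a)" using B(1) kl unfolding corr_def by metis
    obtain b where b: "b \<in> C" "src G l = sh (src G b)" "rng G l = sh (rng G b)" using C(1) kl unfolding corr_def by metis
    have ab: "a \<in> elts G" "b \<in> elts G" using a b ob bis_elts by blast+
    have "\<pi> (src G a) 0 = \<pi> (rng G b) 0" using a b B(1) C(1) unfolding corr_def by metis
    then have s: "src G a = rng G b" using kl a b ab sh_eqI[of "src G a" "rng G b"] by simp
    then have "gmul G a b \<in> ?P" using a b by blast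
    moreover have "src G p = sh (src G (gmul G a b)) \<and> rng G p = sh (rng G (gmul G a b))"
      using s ab kl e a b by simp
    ultimately show "\<exists>g\<in>?P. src G p = sh (src G g) \<and> rng G p = sh (rng G g)" by blast
  qed
  have ss: "src G (gs g) = rng G (gs h)" using g by simp
  have "gmul G g h \<in> ?P" using B C g by blast
  moreover have "gmul G (gs g) (gs h) \<in> ?P'" using B C ss by blast
  moreover have "src G (gmul G (gs g) (gs h)) = sh (src G (gmul G g h))" using g ss by simp
  ultimately have "is_shifted G \<pi> (gmul G g h) (gmul G (gs g) (gs h))" by (rule is_shiftedI[OF co])
  then show ?thesis using gshift_eqI g ss by simp
qed

text \<open>Multiplicativity makes the shift of a unit idempotent, and an idempotent of a groupoid
  is a unit.\<close>

lemma gshift_unit: "u \<in> units G \<Longrightarrow> gs u = sh u"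
proof -
  assume u: "u \<in> units G"
  then have e: "u \<in> elts G" by (rule units_elts)
  let ?k = "gs u"
  have k: "?k \<in> elts G" "src G ?k = sh u" "rng G ?k = sh u" using e u by simp_all
  have "gmul G u u = u" using mul_src[OF e] u by simp
  then have kk: "gmul G ?k ?k = ?k" using gshift_mul[of u u] e u by simp
  have "gmul G (ginv G ?k) (gmul G ?k ?k) = ?k" using k by (intro cancel_left composableI) auto
  then have "src G ?k = ?k" using kk k by simp
  then show ?thesis using k by simp
qed

text \<open>Fullness of \<open>gshift\<close>, obtained from the second half of complete
  shift-invariance: the lift is the germ of \<open>h\<close> with the first edges of
  \<open>a\<close> and \<open>b\<close> put back in front.\<close>

lemma gshift_lift:
  assumes ab: "a \<in> units G" "b \<in> units G" and h: "h \<in> elts G" "src G h = sh a" "rng G h = sh b"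
  shows "\<exists>g\<in>elts G. src G g = a \<and> rng G g = b \<and> gs g = h"
proof -
  let ?x = "\<pi> a 0" and ?y = "\<pi> b 0"
  have p: "prepend ?x (\<pi> (src G h)) = \<pi> a" "prepend ?y (\<pi> (rng G h)) = \<pi> b"
    using ab h by (auto simp: prepend_eq_iff pi_sh)
  then obtain g where g: "is_extended G \<pi> ?y ?x h g"
    using shift_invariant ab h pi_paths unfolding completely_shift_invariant_def by metis
  then obtain B u where B: "open_bisection G B" "h \<in> B" "u \<in> units G" "\<pi> u = prepend ?x (\<pi> (src G h))"
    "acts_as G g (germ (unit_top G) ((prefix_map G \<pi> ?x)\<inverse> O bis_map G B O prefix_map G \<pi> ?y) u)"
    unfolding is_extended_def by blast
  then have ua: "u = a" using p ab by (intro unit_eqI) auto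
  obtain C where C: "open_bisection G C" "g \<in> C"
    "germ (unit_top G) (bis_map G C) (src G g) =
     germ (unit_top G) ((prefix_map G \<pi> ?x)\<inverse> O bis_map G B O prefix_map G \<pi> ?y) u"
    using B(5) unfolding acts_as_def by blast
  have ge: "g \<in> elts G" using C bis_elts by blast
  have "src G g \<in> topspace (unit_top G)" using ge by simp
  from germ_eq_iff[OF this, THEN iffD1, OF C(3)] ua
  obtain W where W: "src G g = a" "openin (unit_top G) W" "a \<in> W"
    "bis_map G C \<inter> W \<times> UNIV = ((prefix_map G \<pi> ?x)\<inverse> O bis_map G B O prefix_map G \<pi> ?y) \<inter> W \<times> UNIV"
    by auto
  have m: "\<exists>h\<in>B. src G h = sh (src G k) \<and> rng G h = sh (rng G k) \<and> \<pi> (rng G k) 0 = ?y"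
    if k: "k \<in> C" "src G k \<in> W" for k
  proof -
    have ke: "k \<in> elts G" using k C bis_elts by blast
    have "(src G k, rng G k) \<in> bis_map G C" using k by (auto simp: bis_map_def)
    then have "(src G k, rng G k) \<in> (prefix_map G \<pi> ?x)\<inverse> O bis_map G B O prefix_map G \<pi> ?y" using W k by blast
    then obtain a' b' where a': "(a', src G k) \<in> prefix_map G \<pi> ?x" "(a', b') \<in> bis_map G B" "(b', rng G k) \<in> prefix_map G \<pi> ?y"
      by blast
    then have "a' = sh (src G k)" "b' = sh (rng G k)" "\<pi> (rng G k) 0 = ?y"
      using ke by (auto simp: prefix_map_def eq_prepend_iff pi_sh intro!: unit_eqI)
    then show ?thesis using a'(2) by (auto simp: bis_map_def)
  qed
  obtain h' where h': "h' \<in> B" "src G h' = sh a" "rng G h' = sh (rng G g)" "\<pi> (rng G g) 0 = ?y"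
    using m[OF C(2)] W by metis
  then have "h' = h" using bisD[OF B(1), of h' h] B h by simp
  then have rg: "rng G g = b" using h' h ge ab sh_eqI[of "rng G g" "b"] by simp
  define E where "E = {k \<in> C. src G k \<in> W \<and> \<pi> (src G k) 0 = ?x \<and> \<pi> (rng G k) 0 = ?y}"
  define E' where "E' = {h \<in> B. src G h \<in> sh ` src G ` E}"
  have m': "\<exists>h\<in>B. src G h = sh (src G k) \<and> rng G h = sh (rng G k)" if "k \<in> C" "src G k \<in> W" for k
    using m[OF that] by blast
  have co: "corr ?x ?y E E'"
    by (rule corr_restrict[OF C(1) B(1) W(2) ab m' E_def E'_def])
  have gE: "g \<in> E" using C W rg by (simp add: E_def)
  then have "gs g \<in> E'" "src G (gs g) = sh a" using gshift_corr[OF co gE] W by auto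
  then have "gs g = h" using B h bisD[OF B(1), of "gs g" h] by (simp add: E'_def)
  then show ?thesis using ge W rg by blast
qed

text \<open>Near its source an element is the partial map that removes the first edge, applies the
  shifted element and prefixes the first edge of the range. The ends and the shift therefore
  determine its germ, and by effectiveness the element.\<close>

lemma gshift_faithful:
  assumes e: "g \<in> elts G" "k \<in> elts G"
    and eq: "src G g = src G k" "rng G g = rng G k" "gs g = gs k"
  shows "g = k"
proof -
  have *: "(a, b) \<in> bis_map G C"
    if c: "corr x y B B'" "corr x y C C'" and a: "\<pi> a 0 = x" "sh a \<in> src G ` (B' \<inter> C')" "(a, b) \<in> bis_map G B" for B C B' C' a b x y
  proof -
    obtain c where c': "c \<in> B'" "c \<in> C'" "sh a = src G c" using a by auto
    obtain l where l: "l \<in> B" "a = src G l" "b = rng G l" using a by (auto simp: bis_map_def)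
    have ob: "open_bisection G B" "open_bisection G B'" "open_bisection G C" using c by (auto simp: corr_def)
    have le: "l \<in> elts G" using ob l bis_elts by blast
    have "gs l \<in> B'" "src G (gs l) = sh a" "rng G (gs l) = sh b" using gshift_corr[OF c(1) l(1)] l by simp_all
    then have "gs l = c" using bisD[OF ob(2)] c' by metis
    then obtain g where g: "g \<in> C" "sh a = sh (src G g)" "sh b = sh (rng G g)"
      using c(2) c'(2) \<open>rng G (gs l) = sh b\<close> \<open>src G (gs l) = sh a\<close> unfolding corr_def by metis
    have ge: "g \<in> elts G" using ob g bis_elts by blast
    have "\<pi> (src G g) 0 = x" "\<pi> (rng G g) 0 = y" "\<pi> b 0 = y" using c g l unfolding corr_def by metis+
    then have "src G g = a" using a(1) g ge l le sh_eqI[of "src G g" "a"] by simp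
    moreover have "rng G g = b"
      using \<open>\<pi> (rng G g) 0 = y\<close> \<open>\<pi> b 0 = y\<close> g ge l le sh_eqI[of "rng G g" b] by simp
    ultimately have "src G g = a" "rng G g = b" by simp_all
    then show ?thesis using g by (auto simp: bis_map_def)
  qed
  obtain B B' where B: "corr (\<pi> (src G g) 0) (\<pi> (rng G g) 0) B B'" "g \<in> B" "gs g \<in> B'"
    using ex_corr[OF e(1)] by blast
  obtain C C' where C: "corr (\<pi> (src G g) 0) (\<pi> (rng G g) 0) C C'" "k \<in> C" "gs g \<in> C'"
    using ex_corr[OF e(2)] eq by metis
  have ob: "open_bisection G B" "open_bisection G B'" "open_bisection G C" "open_bisection G C'"
    using B(1) C(1) by (auto simp: corr_def)
  let ?W = "{v \<in> units G. \<pi> v 0 = \<pi> (src G g) 0} \<inter> {v \<in> units G. sh v \<in> src G ` (B' \<inter> C')}"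
  have "openin (unit_top G) ?W"
    using ob e by (intro openin_Int openin_first openin_sh_vimage openin_src_image) (auto simp: open_bisection_iff)
  moreover have "sh (src G g) \<in> src G ` (B' \<inter> C')"
    by (rule image_eqI[of _ _ "gs g"]) (use B C e in simp_all)
  then have "src G g \<in> ?W" using e by simp
  moreover have "(a, b) \<in> bis_map G B \<longleftrightarrow> (a, b) \<in> bis_map G C" if "a \<in> ?W" for a b
    using *[OF B(1) C(1), of a b] *[OF C(1) B(1), of a b] that by (auto simp: Int_commute)
  ultimately show ?thesis using effectiveD[OF ob(1,3) B(2) C(2) eq(1)] by blast
qed

end

section \<open>Function groups and push-forwards\<close>

lemma comm_group_fun_group: "comm_group (fun_group :: ('s \<Rightarrow> 'a::ab_group_add) monoid)"
proof (rule comm_groupI)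
  fix f :: "'s \<Rightarrow> 'a" assume "f \<in> carrier fun_group"
  show "\<exists>g\<in>carrier fun_group. g \<otimes>\<^bsub>fun_group\<^esub> f = \<one>\<^bsub>fun_group\<^esub>"
    by (rule bexI[of _ "\<lambda>x. - f x"]) (simp_all add: fun_group_def)
qed (simp_all add: fun_group_def ac_simps)

lemma inv_fun_group: "inv\<^bsub>fun_group\<^esub> f = (\<lambda>x. - f x)"
proof -
  interpret comm_group fun_group by (rule comm_group_fun_group)
  show ?thesis by (rule inv_equality) (simp_all add: fun_group_def)
qed

text \<open>The common form of the carriers of \<open>Cc\<close> and \<open>AN\<close>, so that
  induction over generators is set up once for both.\<close>

definition const_span :: "'s set set \<Rightarrow> ('s \<Rightarrow> 'a::ab_group_add) set" where
  "const_span S = carrier (subgroup_generated fun_group {const_on a U |a U. U \<in> S})"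

lemma const_span_eq: "const_span S = generate fun_group {const_on a U |a U. U \<in> S}"
  by (simp add: const_span_def carrier_subgroup_generated fun_group_def)

lemma const_span_zero: "(\<lambda>_. 0) \<in> const_span S"
  using generate.one[of fun_group] by (simp add: const_span_eq fun_group_def)

lemma const_span_add: "f \<in> const_span S \<Longrightarrow> g \<in> const_span S \<Longrightarrow> (\<lambda>x. f x + g x) \<in> const_span S"
  using generate.eng[of f fun_group _ g] by (simp add: const_span_eq fun_group_def)

lemma const_span_const: "U \<in> S \<Longrightarrow> const_on a U \<in> const_span S"
  unfolding const_span_eq by (rule generate.incl) blast

text \<open>There is no case for inverses because the negative of \<open>const_on a U\<close> is
  again a generator, with value \<open>- a\<close>.\<close>

lemma const_span_induct [consumes 1, case_names zero const add]:
  assumes f: "f \<in> const_span S"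
    and zero: "P (\<lambda>_. 0)" and const: "\<And>a U. U \<in> S \<Longrightarrow> P (const_on a U)"
    and add: "\<And>f g. f \<in> const_span S \<Longrightarrow> g \<in> const_span S \<Longrightarrow> P f \<Longrightarrow> P g \<Longrightarrow> P (\<lambda>x. f x + g x)"
  shows "P f"
  using f unfolding const_span_eq
proof (induction rule: generate.induct)
  case one
  then show ?case using zero by (simp add: fun_group_def)
next
  case (incl h)
  then show ?case using const by blast
next
  case (inv h)
  then obtain a U where h: "h = const_on a U" "U \<in> S" by blast
  then have "inv\<^bsub>fun_group\<^esub> h = const_on (- a) U" by (auto simp: inv_fun_group const_on_def fun_eq_iff)
  then show ?case using const h by simp
next
  case (eng h1 h2)
  then show ?case using add by (simp add: fun_group_def const_span_eq)
qed

lemma const_span_uminus: "f \<in> const_span S \<Longrightarrow> (\<lambda>x. - f x) \<in> const_span S"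
proof (induction rule: const_span_induct)
  case zero
  show ?case using const_span_zero by simp
next
  case (const a U)
  have "(\<lambda>x. - const_on a U x) = const_on (- a) U" by (auto simp: const_on_def)
  then show ?case using const_span_const const by metis
next
  case (add f g)
  then show ?case using const_span_add[of "\<lambda>x. - f x" S "\<lambda>x. - g x"] by simp
qed

lemma const_span_sum: "finite I \<Longrightarrow> (\<And>i. i \<in> I \<Longrightarrow> f i \<in> const_span S) \<Longrightarrow> (\<lambda>x. \<Sum>i\<in>I. f i x) \<in> const_span S"
  by (induction I rule: finite_induct) (auto intro: const_span_zero const_span_add)

lemma const_span_mono:
  assumes "S \<subseteq> T" "f \<in> const_span S"
  shows "f \<in> const_span T"
  using assms(2)
proof (induction rule: const_span_induct)
  case (const a U)
  then show ?case using assms(1) by (intro const_span_const) blast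
qed (simp_all add: const_span_zero const_span_add)

lemma const_on_partition:
  assumes "finite \<P>" "disjoint \<P>"
  shows "const_on a (\<Union>\<P>) = (\<lambda>x. \<Sum>V\<in>\<P>. const_on a V x)"
proof
  fix x
  show "const_on a (\<Union>\<P>) x = (\<Sum>V\<in>\<P>. const_on a V x)"
  proof (cases "x \<in> \<Union>\<P>")
    case True
    then obtain W where W: "W \<in> \<P>" "x \<in> W" by blast
    have "(\<Sum>V\<in>\<P>. const_on a V x) = (\<Sum>V\<in>{W}. const_on a V x)"
    proof (rule sum.mono_neutral_right)
      show "\<forall>V\<in>\<P> - {W}. const_on a V x = 0"
        using W assms(2) by (auto simp: const_on_def disjoint_def)
    qed (use W assms in auto)
    then show ?thesis using True W by (simp add: const_on_def)
  next
    case False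
    then show ?thesis by (auto simp: const_on_def intro!: sum.neutral[symmetric])
  qed
qed

text \<open>Over an infinite index set the sum in \<open>push\<close> is 0 by convention, so
  additivity and functoriality of \<open>push\<close> rest on this finiteness of fibres inside the
  support.\<close>

definition ffib :: "('s \<Rightarrow> 't) \<Rightarrow> ('s \<Rightarrow> 'a::zero) \<Rightarrow> bool" where
  "ffib k f \<longleftrightarrow> (\<forall>z. finite {y. f y \<noteq> 0 \<and> k y = z})"

lemma push_eq_sum:
  assumes "finite S" "{y. f y \<noteq> 0 \<and> k y = z} \<subseteq> S"
  shows "push k f z = (\<Sum>y\<in>S. if k y = z then f y else 0)"
  unfolding push_def by (rule sum.mono_neutral_cong_left) (use assms in auto)

lemma push_zero: "push k (\<lambda>_. 0) = (\<lambda>_. 0)"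
  by (simp add: push_def)

lemma push_uminus: "push k (\<lambda>x. - f x) = (\<lambda>z. - push k f z)"
  by (simp add: push_def sum_negf)

lemma push_add:
  assumes "ffib k f" "ffib k g"
  shows "push k (\<lambda>x. f x + g x) = (\<lambda>z. push k f z + push k g z)"
proof
  fix z
  let ?S = "{y. f y \<noteq> 0 \<and> k y = z} \<union> {y. g y \<noteq> 0 \<and> k y = z}"
  have S: "finite ?S" using assms by (simp add: ffib_def)
  have "push k (\<lambda>x. f x + g x) z = (\<Sum>y\<in>?S. if k y = z then f y + g y else 0)"
    by (rule push_eq_sum[OF S]) auto
  also have "\<dots> = (\<Sum>y\<in>?S. if k y = z then f y else 0) + (\<Sum>y\<in>?S. if k y = z then g y else 0)"
    unfolding sum.distrib[symmetric] by (rule sum.cong) auto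
  also have "\<dots> = push k f z + push k g z"
    using push_eq_sum[OF S Un_upper1] push_eq_sum[OF S Un_upper2] by simp
  finally show "push k (\<lambda>x. f x + g x) z = push k f z + push k g z" .
qed

lemma ffib_zero: "ffib k (\<lambda>_. 0)" by (simp add: ffib_def)

lemma ffib_add: "ffib k f \<Longrightarrow> ffib k g \<Longrightarrow> ffib k (\<lambda>x. f x + (g x :: 'a::monoid_add))"
  unfolding ffib_def
proof
  fix z assume *: "\<forall>z. finite {y. f y \<noteq> 0 \<and> k y = z}" "\<forall>z. finite {y. g y \<noteq> 0 \<and> k y = z}"
  have "{y. f y + g y \<noteq> 0 \<and> k y = z} \<subseteq> {y. f y \<noteq> 0 \<and> k y = z} \<union> {y. g y \<noteq> 0 \<and> k y = z}" by auto
  then show "finite {y. f y + g y \<noteq> 0 \<and> k y = z}" using * by (meson finite_UnI finite_subset)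
qed

lemma ffib_sum: "finite I \<Longrightarrow> (\<And>i. i \<in> I \<Longrightarrow> ffib k (f i)) \<Longrightarrow> ffib k (\<lambda>x. \<Sum>i\<in>I. f i x :: 'a::comm_monoid_add)"
  by (induction I rule: finite_induct) (auto intro: ffib_zero ffib_add)

lemma push_sum:
  "finite I \<Longrightarrow> (\<And>i. i \<in> I \<Longrightarrow> ffib k (f i)) \<Longrightarrow>
     push k (\<lambda>x. \<Sum>i\<in>I. f i x) = (\<lambda>z. \<Sum>i\<in>I. push k (f i) z)"
proof (induction I rule: finite_induct)
  case empty
  then show ?case by (simp add: push_zero)
next
  case (insert j I)
  then have "push k (\<lambda>x. f j x + (\<Sum>i\<in>I. f i x)) = (\<lambda>z. push k (f j) z + push k (\<lambda>x. \<Sum>i\<in>I. f i x) z)"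
    by (intro push_add ffib_sum) auto
  then show ?case using insert by simp
qed

lemma push_const_on:
  assumes inj: "inj_on k V"
  shows "push k (const_on a V) = const_on a (k ` V)" and "ffib k (const_on a V)"
proof -
  have 1: "{y. const_on a V y \<noteq> 0 \<and> k y = k v} = {v}" if "a \<noteq> 0" "v \<in> V" for v
    using that inj by (auto simp: const_on_def inj_on_def)
  have 2: "{y. const_on a V y \<noteq> 0 \<and> k y = z} = {}" if "a = 0 \<or> z \<notin> k ` V" for z
    using that by (auto simp: const_on_def)
  show "ffib k (const_on a V)" unfolding ffib_def
  proof
    fix z show "finite {y. const_on a V y \<noteq> 0 \<and> k y = z}"
    proof (cases "a = 0 \<or> z \<notin> k ` V")
      case True
      then show ?thesis by (simp only: 2 finite.emptyI)
    next
      case False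
      then obtain v where v: "a \<noteq> 0" "v \<in> V" "z = k v" by blast
      show ?thesis unfolding v(3) 1[OF v(1,2)] by simp
    qed
  qed
  show "push k (const_on a V) = const_on a (k ` V)"
  proof
    fix z show "push k (const_on a V) z = const_on a (k ` V) z"
    proof (cases "a = 0 \<or> z \<notin> k ` V")
      case True
      then show ?thesis unfolding push_def 2[OF True] by (auto simp: const_on_def)
    next
      case False
      then obtain v where v: "a \<noteq> 0" "v \<in> V" "z = k v" by blast
      show ?thesis unfolding push_def v(3) 1[OF v(1,2)] using v(2) by (simp add: const_on_def)
    qed
  qed
qed

lemma push_cong:
  assumes "\<And>y. f y \<noteq> 0 \<Longrightarrow> k y = k' y"
  shows "push k f = push k' f"
proof -
  have "{y. f y \<noteq> 0 \<and> k y = z} = {y. f y \<noteq> 0 \<and> k' y = z}" for z using assms by auto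
  then show ?thesis by (simp add: push_def)
qed

text \<open>Finite fibres of the composite suffice: if \<open>k' x = z\<close>, then the part of the
  support over \<open>x\<close> lies in the finite set \<open>S\<close> over \<open>z\<close>, and
  the sum over \<open>S\<close> can be grouped by the values of \<open>k\<close>.\<close>

lemma push_comp:
  assumes "ffib (k' \<circ> k) f"
  shows "push k' (push k f) = push (k' \<circ> k) f"
proof
  fix z
  define S where "S = {y. f y \<noteq> 0 \<and> (k' \<circ> k) y = z}"
  have S: "finite S" using assms by (simp add: ffib_def S_def)
  have eq: "push k f x = (\<Sum>y\<in>{y\<in>S. k y = x}. f y)" if "k' x = z" for x
    unfolding push_def S_def by (rule sum.cong) (use that in auto)
  have "push k' (push k f) z = (\<Sum>x | push k f x \<noteq> 0 \<and> k' x = z. push k f x)"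
    by (simp add: push_def[of k'])
  also have "\<dots> = (\<Sum>x\<in>k ` S. push k f x)"
  proof (rule sum.mono_neutral_left)
    show "finite (k ` S)" using S by simp
    show "{x. push k f x \<noteq> 0 \<and> k' x = z} \<subseteq> k ` S"
    proof
      fix x assume x: "x \<in> {x. push k f x \<noteq> 0 \<and> k' x = z}"
      then have "(\<Sum>y\<in>{y\<in>S. k y = x}. f y) \<noteq> 0" using eq[of x] by (metis (mono_tags, lifting) mem_Collect_eq)
      then have "{y\<in>S. k y = x} \<noteq> {}" by (metis sum.empty)
      then show "x \<in> k ` S" by blast
    qed
    have "k' x = z" if "x \<in> k ` S" for x using that unfolding S_def by fastforce
    then show "\<forall>i\<in>k ` S - {x. push k f x \<noteq> 0 \<and> k' x = z}. push k f i = 0"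
      by blast
  qed
  also have "\<dots> = (\<Sum>x\<in>k ` S. \<Sum>y\<in>{y\<in>S. k y = x}. f y)"
  proof (rule sum.cong[OF refl])
    fix x assume "x \<in> k ` S"
    then have "k' x = z" unfolding S_def by fastforce
    then show "push k f x = (\<Sum>y\<in>{y\<in>S. k y = x}. f y)" by (rule eq)
  qed
  also have "\<dots> = (\<Sum>y\<in>S. f y)"
    by (rule sum.image_gen[OF S, symmetric])
  also have "\<dots> = push (k' \<circ> k) f z" by (simp add: push_def S_def)
  finally show "push k' (push k f) z = push (k' \<circ> k) f z" .
qed

section \<open>Multisections\<close>

text \<open>One formula for the outer faces and the inner ones: entries before the contracted place
  stay, later ones move down by one. Face identities can then be checked entry by entry.\<close>

lemma face_nth:
  assumes "2 \<le> n" "i \<le> n" "length gs = n" "j < n - 1"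
  shows "face G n i gs ! j =
    (if Suc j < i then gs ! j else if Suc j = i then gmul G (gs ! j) (gs ! Suc j) else gs ! Suc j)"
proof -
  consider "i = 0" | "i = n" "i \<noteq> 0" | "0 < i" "i < n" using assms by linarith
  then show ?thesis
  proof cases
    case 1
    then show ?thesis using assms by (simp add: face_def nth_tl)
  next
    case 2
    then show ?thesis using assms by (auto simp: face_def nth_butlast)
  next
    case 3
    then have f: "face G n i gs = take (i - 1) gs @ [gmul G (gs ! (i - 1)) (gs ! i)] @ drop (i + 1) gs"
      using assms by (simp add: face_def)
    consider "Suc j < i" | "Suc j = i" | "i < Suc j" by linarith
    then show ?thesis
    proof cases
      case 1
      then have "j < i - 1" by linarith
      then show ?thesis using 1 3 assms by (simp add: f nth_append)
    next
      case 2
      then have "i = Suc j" by simp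
      then show ?thesis using 3 assms f by (simp add: nth_append)
    next
      case c: 3
      then have "j - (i - 1) = Suc (j - i)" using 3 by linarith
      then show ?thesis using 3 c assms by (auto simp: f nth_append)
    qed
  qed
qed

lemma face_length:
  assumes "2 \<le> n" "i \<le> n" "length gs = n"
  shows "length (face G n i gs) = n - 1"
  using assms by (auto simp: face_def)

context etale_groupoid
begin

text \<open>\<open>max 1 n\<close> is the length of the lists in every degree, points being lists
  with one unit. Degree 0 can thus often be treated together with the others.\<close>

lemma nerve_iff:
  "gs \<in> nerve G n \<longleftrightarrow> length gs = max 1 n \<and> (\<forall>i < max 1 n. gs ! i \<in> elts G) \<and>
     (\<forall>i. Suc i < n \<longrightarrow> src G (gs ! i) = rng G (gs ! Suc i)) \<and> (n = 0 \<longrightarrow> gs ! 0 \<in> units G)"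
proof (cases "n = 0")
  case True
  have "gs \<in> nerve G 0 \<longleftrightarrow> length gs = 1 \<and> gs ! 0 \<in> units G"
    by (cases gs) (auto simp: nerve_def)
  then show ?thesis using True units_elts by auto
next
  case False
  have "set gs \<subseteq> elts G \<longleftrightarrow> (\<forall>i<length gs. gs ! i \<in> elts G)"
    by (metis in_set_conv_nth subset_code(1))
  then show ?thesis using False by (auto simp: nerve_def max_def)
qed

lemma nerve_length: "gs \<in> nerve G n \<Longrightarrow> length gs = max 1 n"
  and nerve_elts: "gs \<in> nerve G n \<Longrightarrow> i < max 1 n \<Longrightarrow> gs ! i \<in> elts G"
  and nerve_src_rng: "gs \<in> nerve G n \<Longrightarrow> Suc i < n \<Longrightarrow> src G (gs ! i) = rng G (gs ! Suc i)"
  by (simp_all only: nerve_iff)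

lemma nerve_hd: "gs \<in> nerve G n \<Longrightarrow> hd gs = gs ! 0"
  by (cases gs) (auto simp: nerve_iff)

text \<open>Matching sources and ranges allow an element of any one bisection to be continued in
  both directions. Hence each bisection of an ordered multisection is the full image of its
  coordinate.\<close>

lemma ordered_multisection_extend:
  assumes "ordered_multisection G Fs" "i < length Fs" "g \<in> Fs ! i"
  shows "\<exists>gs. length gs = length Fs \<and> (\<forall>j<length Fs. gs ! j \<in> Fs ! j) \<and>
     (\<forall>j. Suc j < length Fs \<longrightarrow> src G (gs ! j) = rng G (gs ! Suc j)) \<and> gs ! i = g"
  using assms
proof (induction Fs arbitrary: i g)
  case Nil
  then show ?case by simp
next
  case (Cons F Fs)
  have om: "ordered_multisection G Fs"
    using Cons.prems(1) by (fastforce simp: ordered_multisection_def)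
  have FF: "src G ` F = rng G ` (Fs ! 0)" if "Fs \<noteq> []"
  proof -
    have "Suc 0 < length (F # Fs) \<longrightarrow> src G ` ((F # Fs) ! 0) = rng G ` ((F # Fs) ! Suc 0)"
      using Cons.prems(1) unfolding ordered_multisection_def by blast
    then show ?thesis using that by simp
  qed
  have step: "\<exists>gs. length gs = length (F # Fs) \<and> (\<forall>j<length (F # Fs). gs ! j \<in> (F # Fs) ! j) \<and>
     (\<forall>j. Suc j < length (F # Fs) \<longrightarrow> src G (gs ! j) = rng G (gs ! Suc j)) \<and> gs ! i = g"
    if hs: "length hs = length Fs" "\<forall>j<length Fs. hs ! j \<in> Fs ! j"
       "\<forall>j. Suc j < length Fs \<longrightarrow> src G (hs ! j) = rng G (hs ! Suc j)"
       and k: "k \<in> F" "Fs \<noteq> [] \<Longrightarrow> src G k = rng G (hs ! 0)" and i: "(k # hs) ! i = g" for hs k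
    using hs k i by (intro exI[of _ "k # hs"]) (auto simp: nth_Cons split: nat.split)
  show ?case
  proof (cases i)
    case 0
    then have g: "g \<in> F" using Cons.prems by simp
    show ?thesis
    proof (cases "Fs = []")
      case True
      then show ?thesis using step[of "[]" g] g 0 by simp
    next
      case False
      then obtain h where h: "h \<in> Fs ! 0" "src G g = rng G h" using FF g by (metis imageE imageI)
      obtain hs where "length hs = length Fs" "\<forall>j<length Fs. hs ! j \<in> Fs ! j"
       "\<forall>j. Suc j < length Fs \<longrightarrow> src G (hs ! j) = rng G (hs ! Suc j)" "hs ! 0 = h"
        using Cons.IH[OF om _ h(1)] False by auto
      then show ?thesis using step[of hs g] g 0 h by simp
    qed
  next
    case (Suc i')
    then have i': "i' < length Fs" "g \<in> Fs ! i'" using Cons.prems by simp_all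
    then obtain hs where hs: "length hs = length Fs" "\<forall>j<length Fs. hs ! j \<in> Fs ! j"
       "\<forall>j. Suc j < length Fs \<longrightarrow> src G (hs ! j) = rng G (hs ! Suc j)" "hs ! i' = g"
      using Cons.IH[OF om] by blast
    have "Fs \<noteq> []" using i' by auto
    then have "rng G (hs ! 0) \<in> rng G ` (Fs ! 0)" using hs by simp
    then obtain k where "k \<in> F" "src G k = rng G (hs ! 0)" using FF[OF \<open>Fs \<noteq> []\<close>] by (metis imageE)
    then show ?thesis using step[of hs k] hs Suc by simp
  qed
qed

text \<open>A multisection is a set of simplices all of whose coordinates are injective with
  compact open bisections as images; this treats the cases \<open>n = 0\<close> and \<open>n > 0\<close> alike.\<close>

lemma multisections_iff:
  "U \<in> multisections G n \<longleftrightarrow> U \<subseteq> nerve G n \<and>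
     (\<forall>i < max 1 n. inj_on (\<lambda>gs. gs ! i) U \<and> cob ((\<lambda>gs. gs ! i) ` U))"
proof (cases "n = 0")
  case True
  show ?thesis
  proof
    assume "U \<in> multisections G n"
    then obtain K where K: "U = (\<lambda>u. [u]) ` K" "clopen K" using True by (auto simp: multisections_def)
    then have Ku: "K \<subseteq> units G" by (simp add: compactin_unit_top)
    have "(\<lambda>gs. gs ! 0) ` U = K" using K by (auto simp: image_image)
    moreover have "inj_on (\<lambda>gs. gs ! 0) U" using K by (auto simp: inj_on_def)
    ultimately show "U \<subseteq> nerve G n \<and> (\<forall>i < max 1 n. inj_on (\<lambda>gs. gs ! i) U \<and> cob ((\<lambda>gs. gs ! i) ` U))"
      using K Ku True cob_units_iff[OF Ku] by (auto simp: nerve_def)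
  next
    assume R: "U \<subseteq> nerve G n \<and> (\<forall>i < max 1 n. inj_on (\<lambda>gs. gs ! i) U \<and> cob ((\<lambda>gs. gs ! i) ` U))"
    let ?K = "(\<lambda>gs. gs ! 0) ` U"
    have "?K \<subseteq> units G" using R True by (auto simp: nerve_def)
    then have "clopen ?K" using cob_units_iff R True by fastforce
    moreover have "U = (\<lambda>u. [u]) ` ?K"
    proof -
      have "[gs ! 0] = gs" if "gs \<in> U" for gs using R that True by (auto simp: nerve_def)
      then show ?thesis by (simp add: image_image)
    qed
    ultimately show "U \<in> multisections G n" using True unfolding multisections_def by auto
  qed
next
  case False
  then have m: "max 1 n = n" by simp
  show ?thesis unfolding m
  proof
    assume "U \<in> multisections G n"
    then obtain Fs where Fs: "length Fs = n" "ordered_multisection G Fs"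
      and U: "U = {gs \<in> nerve G n. \<forall>i < n. gs ! i \<in> Fs ! i}"
      using False by (auto simp: multisections_def)
    have cobF: "cob (Fs ! i)" if "i < n" for i using Fs that by (auto simp: ordered_multisection_def)
    \<comment> \<open>\<open>src G\<close> is injective on one bisection and \<open>rng G\<close> on
      the next, so adjacent entries determine each other.\<close>
    have nx: "gs ! Suc i = hs ! Suc i \<longleftrightarrow> gs ! i = hs ! i"
      if "gs \<in> U" "hs \<in> U" "Suc i < n" for gs hs i
    proof -
      have "src G (gs ! i) = rng G (gs ! Suc i)" "src G (hs ! i) = rng G (hs ! Suc i)"
        using that U nerve_src_rng by auto
      moreover have "gs ! i \<in> Fs ! i" "hs ! i \<in> Fs ! i" "gs ! Suc i \<in> Fs ! Suc i" "hs ! Suc i \<in> Fs ! Suc i"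
        using that U by auto
      moreover have "inj_on (src G) (Fs ! i)" "inj_on (rng G) (Fs ! Suc i)"
        using cobF[of i] cobF[of "Suc i"] that by (simp_all add: cob_iff)
      ultimately show ?thesis by (metis inj_onD)
    qed
    have eq0: "gs ! i = hs ! i \<longleftrightarrow> gs ! 0 = hs ! 0" if "gs \<in> U" "hs \<in> U" "i < n" for gs hs i
      using that(3) by (induction i) (use nx that in auto)
    have inj: "inj_on (\<lambda>gs. gs ! i) U" if "i < n" for i
    proof (rule inj_onI)
      fix gs hs assume *: "gs \<in> U" "hs \<in> U" "gs ! i = hs ! i"
      then have "gs ! j = hs ! j" if "j < n" for j using eq0 that \<open>i < n\<close> by blast
      moreover have "gs \<in> nerve G n" "hs \<in> nerve G n" using * U by simp_all
      then have "length gs = n" "length hs = n" using nerve_length m by fastforce+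
      ultimately show "gs = hs" by (simp add: nth_equalityI)
    qed
    have "(\<lambda>gs. gs ! i) ` U = Fs ! i" if i: "i < n" for i
    proof
      show "(\<lambda>gs. gs ! i) ` U \<subseteq> Fs ! i" using U i by auto
      show "Fs ! i \<subseteq> (\<lambda>gs. gs ! i) ` U"
      proof
        fix g assume "g \<in> Fs ! i"
        then obtain gs where gs: "length gs = n" "\<forall>j<n. gs ! j \<in> Fs ! j"
          "\<forall>j. Suc j < n \<longrightarrow> src G (gs ! j) = rng G (gs ! Suc j)" "gs ! i = g"
          using ordered_multisection_extend[OF Fs(2), of i g] Fs i by auto
        have "\<forall>j<n. gs ! j \<in> elts G" using gs(2) cobF cob_subset by blast
        then have "gs \<in> U" unfolding U nerve_iff using gs False m by simp
        then show "g \<in> (\<lambda>gs. gs ! i) ` U" using gs(4) by blast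
      qed
    qed
    then show "U \<subseteq> nerve G n \<and> (\<forall>i < n. inj_on (\<lambda>gs. gs ! i) U \<and> cob ((\<lambda>gs. gs ! i) ` U))"
      using inj cobF U by auto
  next
    assume R: "U \<subseteq> nerve G n \<and> (\<forall>i < n. inj_on (\<lambda>gs. gs ! i) U \<and> cob ((\<lambda>gs. gs ! i) ` U))"
    define F where "F i = (\<lambda>gs. gs ! i) ` U" for i :: nat
    have sr: "src G ` F i = rng G ` F (Suc i)" if "Suc i < n" for i
      unfolding F_def image_image using R that nerve_src_rng by (intro image_cong) auto
    have om: "ordered_multisection G (map F [0..<n])"
      unfolding ordered_multisection_def using R sr by (auto simp: F_def)
    have "U = {gs \<in> nerve G n. \<forall>i < n. gs ! i \<in> map F [0..<n] ! i}"
    proof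
      show "U \<subseteq> {gs \<in> nerve G n. \<forall>i < n. gs ! i \<in> map F [0..<n] ! i}"
        using R by (auto simp: F_def)
      show "{gs \<in> nerve G n. \<forall>i < n. gs ! i \<in> map F [0..<n] ! i} \<subseteq> U"
      proof
        fix gs assume "gs \<in> {gs \<in> nerve G n. \<forall>i < n. gs ! i \<in> map F [0..<n] ! i}"
        then have gs: "gs \<in> nerve G n" "\<forall>i<n. gs ! i \<in> F i" by auto
        then have "gs ! 0 \<in> F 0" using False by blast
        then obtain us where us: "us \<in> U" "gs ! 0 = us ! 0" by (auto simp: F_def)
        \<comment> \<open>Agreement propagates along the simplex: equal entries have equal sources,
          the next entries then have equal ranges, and \<open>rng G\<close> is injective on the next
          coordinate bisection.\<close>
        have "gs ! i = us ! i" if "i < n" for i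
          using that
        proof (induction i)
          case 0
          then show ?case using us by simp
        next
          case (Suc i)
          have mem: "gs ! Suc i \<in> F (Suc i)" "us ! Suc i \<in> F (Suc i)" using gs us Suc by (auto simp: F_def)
          have "us \<in> nerve G n" using R us(1) by blast
          then have r: "rng G (gs ! Suc i) = rng G (us ! Suc i)"
            using nerve_src_rng[OF gs(1) Suc.prems] nerve_src_rng[of us n i] Suc by simp
          have "cob (F (Suc i))" unfolding F_def using R Suc.prems by blast
          then have "inj_on (rng G) (F (Suc i))" unfolding cob_iff by blast
          then show ?case using r mem by (rule inj_onD)
        qed
        moreover have "us \<in> nerve G n" using R us(1) by blast
        then have "length gs = n" "length us = n" using nerve_length[OF gs(1)] nerve_length[of us n] m by simp_all
        ultimately have "gs = us" by (simp add: nth_equalityI)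
        then show "gs \<in> U" using us by simp
      qed
    qed
    moreover have "length (map F [0..<n]) = n" by simp
    ultimately have "\<exists>Fs. U = {gs \<in> nerve G n. \<forall>i < n. gs ! i \<in> Fs ! i} \<and> length Fs = n \<and> ordered_multisection G Fs"
      using om by blast
    then show "U \<in> multisections G n" unfolding multisections_def using False by simp
  qed
qed

abbreviation ms :: "nat \<Rightarrow> 'a list set set" where "ms n \<equiv> multisections G n"

lemma ms_nerve: "U \<in> ms n \<Longrightarrow> gs \<in> U \<Longrightarrow> gs \<in> nerve G n"
  and ms_inj: "U \<in> ms n \<Longrightarrow> i < max 1 n \<Longrightarrow> inj_on (\<lambda>gs. gs ! i) U"
  and ms_cob: "U \<in> ms n \<Longrightarrow> i < max 1 n \<Longrightarrow> cob ((\<lambda>gs. gs ! i) ` U)"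
  unfolding multisections_iff by blast+

lemma cob_sub_iff:
  assumes "cob F" "B \<subseteq> F"
  shows "cob B \<longleftrightarrow> clopen (src G ` B)" "cob B \<longleftrightarrow> clopen (rng G ` B)"
  using assms cob_src cob_rng cob_sub_src cob_sub_rng by metis+

text \<open>The sources of coordinate \<open>j\<close> are the ranges of coordinate
  \<open>Suc j\<close>, so the test for one coordinate passes to its neighbours and any single
  coordinate decides.\<close>

lemma ms_sub_iff:
  assumes U: "U \<in> ms n" and V: "V \<subseteq> U" and i: "i < max 1 n"
  shows "V \<in> ms n \<longleftrightarrow> cob ((\<lambda>gs. gs ! i) ` V)"
proof -
  have step: "cob ((\<lambda>gs. gs ! Suc j) ` V) \<longleftrightarrow> cob ((\<lambda>gs. gs ! j) ` V)" if j: "Suc j < n" for j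
  proof -
    have "src G ` (\<lambda>gs. gs ! j) ` V = rng G ` (\<lambda>gs. gs ! Suc j) ` V"
      unfolding image_image using U V j nerve_src_rng ms_nerve by (intro image_cong) blast+
    moreover have "cob ((\<lambda>gs. gs ! j) ` V) \<longleftrightarrow> clopen (src G ` (\<lambda>gs. gs ! j) ` V)"
      using ms_cob[OF U, of j] j V by (intro cob_sub_iff[of "(\<lambda>gs. gs ! j) ` U"] image_mono) auto
    moreover have "cob ((\<lambda>gs. gs ! Suc j) ` V) \<longleftrightarrow> clopen (rng G ` (\<lambda>gs. gs ! Suc j) ` V)"
      using ms_cob[OF U, of "Suc j"] j V by (intro cob_sub_iff(2)[of "(\<lambda>gs. gs ! Suc j) ` U"] image_mono) auto
    ultimately show ?thesis by simp
  qed
  have "cob ((\<lambda>gs. gs ! j) ` V) \<longleftrightarrow> cob ((\<lambda>gs. gs ! 0) ` V)" if "j < max 1 n" for j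
    using that by (induction j) (use step in auto)
  then have "cob ((\<lambda>gs. gs ! j) ` V) \<longleftrightarrow> cob ((\<lambda>gs. gs ! i) ` V)" if "j < max 1 n" for j
    using that i by blast
  moreover have "V \<subseteq> nerve G n" using U V ms_nerve by blast
  moreover have "inj_on (\<lambda>gs. gs ! j) V" if "j < max 1 n" for j using ms_inj[OF U that] V inj_on_subset by blast
  ultimately show ?thesis using i unfolding multisections_iff by blast
qed

lemma cob_empty: "cob {}"
  by (simp add: cob_iff)

lemma ms_empty: "{} \<in> ms n"
  by (simp add: multisections_iff cob_empty)

lemma ms_base_inj: "U \<in> ms n \<Longrightarrow> inj_on (\<lambda>gs. rng G (gs ! 0)) U"
proof -
  assume U: "U \<in> ms n"
  then have "inj_on (\<lambda>gs. gs ! 0) U" "inj_on (rng G) ((\<lambda>gs. gs ! 0) ` U)"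
    using ms_inj[OF U, of 0] ms_cob[OF U, of 0] by (auto simp: cob_iff)
  then show ?thesis using comp_inj_on[of "\<lambda>gs. gs ! 0" U "rng G"] by (simp add: comp_def)
qed

text \<open>The range of the first entry parametrizes a multisection injectively, by
  \<open>ms_base_inj\<close>. Cutting a multisection into smaller ones thus amounts to cutting a
  clopen set of units.\<close>

lemma ms_sub_base_iff:
  assumes U: "U \<in> ms n" and V: "V \<subseteq> U"
  shows "V \<in> ms n \<longleftrightarrow> clopen ((\<lambda>gs. rng G (gs ! 0)) ` V)"
proof -
  have "V \<in> ms n \<longleftrightarrow> cob ((\<lambda>gs. gs ! 0) ` V)" using ms_sub_iff[OF U V] by simp
  also have "\<dots> \<longleftrightarrow> clopen (rng G ` (\<lambda>gs. gs ! 0) ` V)"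
    using ms_cob[OF U, of 0] V by (intro cob_sub_iff(2)[of "(\<lambda>gs. gs ! 0) ` U"] image_mono) auto
  finally show ?thesis by (simp only: image_image)
qed

lemma ms_restrict_base:
  assumes U: "U \<in> ms n" and K: "clopen K"
  shows "{gs \<in> U. rng G (gs ! 0) \<in> K} \<in> ms n"
proof -
  have "(\<lambda>gs. rng G (gs ! 0)) ` {gs \<in> U. rng G (gs ! 0) \<in> K} = (\<lambda>gs. rng G (gs ! 0)) ` U \<inter> K" by auto
  moreover have "clopen ((\<lambda>gs. rng G (gs ! 0)) ` U)" using U ms_sub_base_iff[OF U] by blast
  ultimately have "clopen ((\<lambda>gs. rng G (gs ! 0)) ` {gs \<in> U. rng G (gs ! 0) \<in> K})"
    using clopen_Int[OF _ K] by simp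
  then show ?thesis using ms_sub_base_iff[OF U, of "{gs \<in> U. rng G (gs ! 0) \<in> K}"] by blast
qed

lemma ms_restrict_coord:
  assumes U: "U \<in> ms n" and i: "i < max 1 n" and B: "cob B" "B \<subseteq> (\<lambda>gs. gs ! i) ` U"
  shows "{gs \<in> U. gs ! i \<in> B} \<in> ms n"
proof -
  have "(\<lambda>gs. gs ! i) ` {gs \<in> U. gs ! i \<in> B} = B" using B(2) by auto
  then show ?thesis using ms_sub_iff[OF U _ i, of "{gs \<in> U. gs ! i \<in> B}"] B(1) by auto
qed

section \<open>Etale maps out of the nerve\<close>

definition good :: "nat \<Rightarrow> ('b set \<Rightarrow> bool) \<Rightarrow> ('a list \<Rightarrow> 'b) \<Rightarrow> 'a list set \<Rightarrow> bool" where
  "good n Q f V \<longleftrightarrow> inj_on f V \<and> (\<forall>V'. V' \<subseteq> V \<longrightarrow> V' \<in> ms n \<longrightarrow> Q (f ` V'))"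

lemma good_mono: "good n Q f V \<Longrightarrow> W \<subseteq> V \<Longrightarrow> good n Q f W"
  unfolding good_def using inj_on_subset[of f V W] subset_trans[of _ W V] by blast

lemma goodD: "good n Q f V \<Longrightarrow> V' \<subseteq> V \<Longrightarrow> V' \<in> ms n \<Longrightarrow> Q (f ` V')"
  unfolding good_def by blast

text \<open>\<open>Q\<close> is the kind of set expected as image: compact open bisections for maps
  to a single coordinate, multisections for maps between nerves. In \<open>good\<close> it is
  demanded of all smaller multisections too, so that pieces can be shrunk further.\<close>

definition etg :: "nat \<Rightarrow> ('b set \<Rightarrow> bool) \<Rightarrow> ('a list \<Rightarrow> 'b) \<Rightarrow> bool" where
  "etg n Q f \<longleftrightarrow> (\<forall>U\<in>ms n. \<forall>gs\<in>U. \<exists>V. V \<subseteq> U \<and> V \<in> ms n \<and> gs \<in> V \<and> good n Q f V)"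

abbreviation etc :: "nat \<Rightarrow> ('a list \<Rightarrow> 'a) \<Rightarrow> bool" where
  "etc n \<equiv> etg n cob"

text \<open>The maps of nerves along which functions with compact support can be pushed forward.\<close>

abbreviation et :: "nat \<Rightarrow> nat \<Rightarrow> ('a list \<Rightarrow> 'a list) \<Rightarrow> bool" where
  "et n m \<equiv> etg n (\<lambda>V. V \<in> ms m)"

lemma etgI:
  assumes "\<And>U gs. U \<in> ms n \<Longrightarrow> gs \<in> U \<Longrightarrow> \<exists>V. V \<subseteq> U \<and> V \<in> ms n \<and> gs \<in> V \<and> good n Q f V"
  shows "etg n Q f"
  unfolding etg_def using assms by simp

lemma etgE:
  assumes "etg n Q f" "U \<in> ms n" "gs \<in> U"
  obtains V where "V \<subseteq> U" "V \<in> ms n" "gs \<in> V" "good n Q f V"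
  using assms unfolding etg_def by meson

text \<open>The piece is shrunk once for each of the finitely many coordinates;
  \<open>good_mono\<close> keeps what was achieved for the earlier ones. Injectivity of one
  coordinate already makes the whole map injective.\<close>

lemma et_coord:
  assumes nerve: "\<And>gs. gs \<in> nerve G n \<Longrightarrow> k gs \<in> nerve G m"
    and co: "\<And>i. i < max 1 m \<Longrightarrow> etc n (\<lambda>gs. k gs ! i)"
  shows "et n m k"
proof (rule etgI)
  fix U gs assume U: "U \<in> ms n" and gs: "gs \<in> U"
  have "\<exists>V. V \<subseteq> U \<and> V \<in> ms n \<and> gs \<in> V \<and> (\<forall>i<I. good n cob (\<lambda>gs. k gs ! i) V)" if "I \<le> max 1 m" for I
    using that
  proof (induction I)
    case 0
    then show ?case using U gs by blast
  next
    case (Suc I)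
    then obtain V where V: "V \<subseteq> U" "V \<in> ms n" "gs \<in> V" "\<forall>i<I. good n cob (\<lambda>gs. k gs ! i) V"
      by (metis Suc_leD)
    have "etc n (\<lambda>gs. k gs ! I)" using co Suc by simp
    then obtain W where W: "W \<subseteq> V" "W \<in> ms n" "gs \<in> W" "good n cob (\<lambda>gs. k gs ! I) W"
      by (rule etgE[OF _ V(2,3)])
    have "good n cob (\<lambda>gs. k gs ! i) W" if i: "i < Suc I" for i
    proof (cases "i = I")
      case True
      then show ?thesis using W by simp
    next
      case False
      then have "good n cob (\<lambda>gs. k gs ! i) V" using i V(4) by simp
      then show ?thesis by (rule good_mono[OF _ W(1)])
    qed
    then show ?case using V(1) W by (intro exI[of _ W]) simp
  qed
  from this[OF order_refl] obtain V where V: "V \<subseteq> U" "V \<in> ms n" "gs \<in> V"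
    "\<forall>i<max 1 m. good n cob (\<lambda>gs. k gs ! i) V" by (elim exE conjE)
  have inj: "inj_on (\<lambda>gs. k gs ! i) V" if "i < max 1 m" for i using V(4) that by (simp add: good_def)
  have "inj_on (\<lambda>gs. k gs ! 0) V" by (rule inj) simp
  then have "inj_on k V" by (auto simp: inj_on_def)
  moreover have "k ` V' \<in> ms m" if V': "V' \<subseteq> V" "V' \<in> ms n" for V'
    unfolding multisections_iff
  proof (intro conjI allI impI)
    show "k ` V' \<subseteq> nerve G m" using nerve ms_nerve[OF V'(2)] by (simp add: image_subset_iff)
    fix i assume i: "i < max 1 m"
    have "inj_on (\<lambda>gs. k gs ! i) V'" using inj_on_subset[OF inj[OF i] V'(1)] .
    then show "inj_on (\<lambda>gs. gs ! i) (k ` V')" by (auto simp: inj_on_def)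
    have "cob ((\<lambda>gs. k gs ! i) ` V')" by (rule goodD[OF V(4)[rule_format, OF i] V'])
    then show "cob ((\<lambda>gs. gs ! i) ` k ` V')" unfolding image_image .
  qed
  ultimately have "good n (\<lambda>V. V \<in> ms m) k V" unfolding good_def by simp
  then show "\<exists>V. V \<subseteq> U \<and> V \<in> ms n \<and> gs \<in> V \<and> good n (\<lambda>V. V \<in> ms m) k V"
    using V(1-3) by (intro exI[of _ V]) simp
qed

lemma etc_cong:
  assumes "etc n f" "\<And>gs. gs \<in> nerve G n \<Longrightarrow> f gs = f' gs"
  shows "etc n f'"
proof -
  have im: "f ` V = f' ` V" if "V \<in> ms n" for V
    using assms(2) ms_nerve[OF that] by (auto intro!: image_cong)
  have inj: "inj_on f V = inj_on f' V" if "V \<in> ms n" for V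
    using assms(2) ms_nerve[OF that] by (auto intro!: inj_on_cong)
  show ?thesis
  proof (rule etgI)
    fix U gs assume "U \<in> ms n" "gs \<in> U"
    with assms(1) obtain V where V: "V \<subseteq> U" "V \<in> ms n" "gs \<in> V" "good n cob f V" by (rule etgE)
    then have "good n cob f' V" unfolding good_def using im inj by simp
    then show "\<exists>V. V \<subseteq> U \<and> V \<in> ms n \<and> gs \<in> V \<and> good n cob f' V"
      using V(1-3) by (intro exI[of _ V]) simp
  qed
qed

text \<open>The products over a multisection form the product of two coordinate bisections, since
  matching in the middle forces the entries to come from one simplex. Compactness is read off from
  the ranges, which are those of the first factor.\<close>

lemma etc_mul:
  assumes i: "Suc i < n"
  shows "etc n (\<lambda>gs. gmul G (gs ! i) (gs ! Suc i))"
proof (rule etgI)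
  fix U gs assume U: "U \<in> ms n" and gs: "gs \<in> U"
  let ?f = "\<lambda>gs. gmul G (gs ! i) (gs ! Suc i)"
  have im: "?f ` V = {gmul G g h |g h. g \<in> (\<lambda>gs. gs ! i) ` V \<and> h \<in> (\<lambda>gs. gs ! Suc i) ` V \<and> src G g = rng G h}"
    if V: "V \<in> ms n" for V
  proof
    show "?f ` V \<subseteq> {gmul G g h |g h. g \<in> (\<lambda>gs. gs ! i) ` V \<and> h \<in> (\<lambda>gs. gs ! Suc i) ` V \<and> src G g = rng G h}"
      using nerve_src_rng[OF ms_nerve[OF V] i] by blast
    show "{gmul G g h |g h. g \<in> (\<lambda>gs. gs ! i) ` V \<and> h \<in> (\<lambda>gs. gs ! Suc i) ` V \<and> src G g = rng G h} \<subseteq> ?f ` V"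
    proof
      fix x assume "x \<in> {gmul G g h |g h. g \<in> (\<lambda>gs. gs ! i) ` V \<and> h \<in> (\<lambda>gs. gs ! Suc i) ` V \<and> src G g = rng G h}"
      then obtain a b where ab: "a \<in> V" "b \<in> V" "src G (a ! i) = rng G (b ! Suc i)" "x = gmul G (a ! i) (b ! Suc i)"
        by blast
      have "rng G (a ! Suc i) = rng G (b ! Suc i)" using nerve_src_rng[OF ms_nerve[OF V ab(1)] i] ab(3) by simp
      moreover have "inj_on (rng G) ((\<lambda>gs. gs ! Suc i) ` V)" using ms_cob[OF V, of "Suc i"] i by (simp add: cob_iff)
      ultimately have "a ! Suc i = b ! Suc i" using ab(1,2) by (simp add: inj_on_def)
      then have "x = ?f a" using ab(4) by simp
      then show "x \<in> ?f ` V" using ab(1) by (rule image_eqI)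
    qed
  qed
  have obV: "open_bisection G (?f ` V)" if V: "V \<in> ms n" for V
    unfolding im[OF V]
    using ms_cob[OF V, of i] ms_cob[OF V, of "Suc i"] i
    by (intro open_bisection_mul) (auto simp: compact_open_bisection_def)
  have rngf: "rng G (?f gs) = rng G (gs ! i)" if "gs \<in> nerve G n" for gs
    using that i nerve_src_rng[OF that i] nerve_elts[OF that, of i] nerve_elts[OF that, of "Suc i"] by simp
  have cobV: "cob (?f ` V)" if V: "V \<in> ms n" for V
  proof -
    have "rng G ` ?f ` V = rng G ` (\<lambda>gs. gs ! i) ` V"
      unfolding image_image using rngf ms_nerve[OF V] by (intro image_cong) auto
    then have "compactin (unit_top G) (rng G ` ?f ` V)"
      using cob_rng[OF ms_cob[OF V, of i]] i by simp
    then show ?thesis using obV[OF V] compactin_if_rng unfolding compact_open_bisection_def open_bisection_iff by blast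
  qed
  have "inj_on ?f U"
  proof (rule inj_onI)
    fix a b assume ab: "a \<in> U" "b \<in> U" "?f a = ?f b"
    then have "rng G (a ! i) = rng G (b ! i)" using rngf ms_nerve[OF U] by metis
    moreover have "inj_on (rng G) ((\<lambda>gs. gs ! i) ` U)" using ms_cob[OF U, of i] i by (simp add: cob_iff)
    ultimately have "a ! i = b ! i" using ab by (simp add: inj_on_def)
    then show "a = b" using ms_inj[OF U, of i] i ab by (auto dest: inj_onD)
  qed
  then have "good n cob ?f U" unfolding good_def using cobV by simp
  then show "\<exists>V. V \<subseteq> U \<and> V \<in> ms n \<and> gs \<in> V \<and> good n cob ?f V"
    using U gs by (intro exI[of _ U]) simp
qed

end

section \<open>Push-forward of compactly supported functions\<close>

context shift_groupoid
begin

text \<open>The groupoid is ample: an open bisection around \<open>g\<close> is restricted to the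
  elements whose source lies in a small clopen cylinder.\<close>

lemma ex_cob:
  assumes "openin (gtop G) V" "g \<in> V"
  shows "\<exists>B. cob B \<and> g \<in> B \<and> B \<subseteq> V"
proof -
  obtain B where B: "open_bisection G B" "g \<in> B" "B \<subseteq> V" using ex_open_bisection assms by blast
  have g: "g \<in> elts G" using B bis_elts by blast
  have "openin (unit_top G) (src G ` B)" using B openin_src_image by (simp add: open_bisection_iff)
  then obtain M where M: "cyl M (src G g) \<subseteq> src G ` B" using cyl_basis[of "src G ` B" "src G g"] B(2) by auto
  have K: "clopen (cyl M (src G g))" using clopen_cyl g by simp
  let ?B = "{h \<in> B. src G h \<in> cyl M (src G g)}"
  have o: "openin (gtop G) ?B" using B K by (intro openin_src_vimage) (auto simp: open_bisection_iff)
  have ob: "open_bisection G ?B" by (rule open_bisection_sub[OF B(1) o]) auto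
  have "src G ` ?B = cyl M (src G g)" using M by auto
  then have "compactin (gtop G) ?B" using compactin_if_src[of ?B] K ob by (simp add: open_bisection_iff)
  then have "cob ?B" using ob by (simp add: compact_open_bisection_def)
  moreover have "g \<in> ?B" using B g by (simp add: in_cyl)
  ultimately show ?thesis using B(3) by (intro exI[of _ ?B]) auto
qed

text \<open>A piece is cut down twice: \<open>V1\<close> makes \<open>F\<close> injective, and the
  bisection \<open>E\<close> around the value of \<open>F\<close> ensures that source and range stay
  injective on the image.\<close>

lemma etc_lh:
  assumes F: "local_homeomorphism (gtop G) (gtop G) F" and i: "i < max 1 n"
  shows "etc n (\<lambda>gs. F (gs ! i))"
proof (rule etgI)
  fix U gs assume U: "U \<in> ms n" and gs: "gs \<in> U"
  let ?g = "gs ! i" and ?B = "(\<lambda>gs. gs ! i) ` U"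
  have cB: "cob ?B" using ms_cob[OF U i] .
  have cF: "continuous_map (gtop G) (gtop G) F" and oF: "open_map (gtop G) (gtop G) F"
    using F by (auto simp: local_homeomorphism_iff)
  have ge: "?g \<in> topspace (gtop G)" using nerve_elts[OF ms_nerve[OF U gs] i] by (simp add: topspace_gtop)
  obtain V1 where V1: "openin (gtop G) V1" "?g \<in> V1" "inj_on F V1"
    using F ge unfolding local_homeomorphism_iff by meson
  have "F ?g \<in> topspace (gtop G)" using cF ge by (auto simp: continuous_map_def)
  then obtain E where E: "open_bisection G E" "F ?g \<in> E"
    using ex_open_bisection[OF openin_topspace] by blast
  have oE: "openin (gtop G) {x \<in> topspace (gtop G). F x \<in> E}"
    using openin_continuous_map_preimage[OF cF] E by (simp add: open_bisection_iff)
  let ?O = "?B \<inter> V1 \<inter> {x \<in> topspace (gtop G). F x \<in> E}"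
  have "openin (gtop G) ?O" using cB V1 oE by (intro openin_Int) (auto simp: cob_iff)
  moreover have "?g \<in> ?O" using gs V1 E ge by auto
  ultimately obtain B where B: "cob B" "?g \<in> B" "B \<subseteq> ?O" using ex_cob by blast
  have cobF: "cob (F ` B')" if "cob B'" "B' \<subseteq> B" for B'
  proof -
    have "openin (gtop G) (F ` B')" using oF that by (simp add: open_map_def cob_iff)
    moreover have "F ` B' \<subseteq> E" using that B by auto
    ultimately have "open_bisection G (F ` B')" using open_bisection_sub[OF E(1)] by simp
    moreover have "compactin (gtop G) (F ` B')" using image_compactin[OF _ cF] that by (simp add: cob_iff)
    ultimately show ?thesis by (simp add: compact_open_bisection_def)
  qed
  let ?V = "{gs \<in> U. gs ! i \<in> B}"
  have V: "?V \<in> ms n" using ms_restrict_coord[OF U i B(1)] B(3) by blast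
  have "inj_on (\<lambda>gs. F (gs ! i)) ?V"
  proof (rule inj_onI)
    fix a b assume ab: "a \<in> ?V" "b \<in> ?V" "F (a ! i) = F (b ! i)"
    then have "a ! i \<in> V1" "b \<in> U" "b ! i \<in> V1" using B(3) by auto
    then have "a ! i = b ! i" using V1(3) ab(3) by (auto dest: inj_onD)
    then show "a = b" using ms_inj[OF U i] ab by (auto dest: inj_onD)
  qed
  moreover have "cob ((\<lambda>gs. F (gs ! i)) ` V')" if V': "V' \<subseteq> ?V" "V' \<in> ms n" for V'
  proof -
    have "cob (F ` (\<lambda>gs. gs ! i) ` V')" using ms_cob[OF V'(2) i] V'(1) by (intro cobF) auto
    then show ?thesis by (simp only: image_image)
  qed
  ultimately have "good n cob (\<lambda>gs. F (gs ! i)) ?V" unfolding good_def by simp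
  then show "\<exists>V. V \<subseteq> U \<and> V \<in> ms n \<and> gs \<in> V \<and> good n cob (\<lambda>gs. F (gs ! i)) V"
    using V gs B(2) by (intro exI[of _ ?V]) simp
qed

lemma lh_id: "local_homeomorphism X X (\<lambda>x. x)"
  by (auto simp: local_homeomorphism_iff open_map_def inj_on_def)

lemma etc_nth: "i < max 1 n \<Longrightarrow> etc n (\<lambda>gs. gs ! i)"
  using etc_lh[OF lh_id] .

text \<open>Good pieces around the points may overlap and cannot be made disjoint inside the
  groupoid. Cutting \<open>U\<close> by the cylinder containing its first vertex gives disjoint
  pieces, and for long cylinders each of them lies in a good piece or is empty.\<close>

lemma et_partition:
  assumes k: "et n m k" and U: "U \<in> ms n"
  shows "\<exists>\<P>. finite \<P> \<and> disjoint \<P> \<and> \<Union>\<P> = U \<and> (\<forall>V\<in>\<P>. V \<in> ms n \<and> inj_on k V \<and> k ` V \<in> ms m)"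
proof -
  define R where "R A = {gs \<in> U. rng G (gs ! 0) \<in> A}" for A
  define P where "P A \<longleftrightarrow> good n (\<lambda>V. V \<in> ms m) k (R A)" for A
  have mono: "P B" if A: "P A" "B \<subseteq> A" for A B
  proof -
    have "R B \<subseteq> R A" using A by (auto simp: R_def)
    then show ?thesis using A(1) good_mono unfolding P_def by blast
  qed
  have rU: "clopen ((\<lambda>gs. rng G (gs ! 0)) ` U)" using U ms_sub_base_iff[OF U] by blast
  have loc: "\<exists>M. P (cyl M u)" if u: "u \<in> units G" for u
  proof (cases "u \<in> (\<lambda>gs. rng G (gs ! 0)) ` U")
    case True
    then obtain gs where gs: "gs \<in> U" "u = rng G (gs ! 0)" by blast
    obtain V where V: "V \<subseteq> U" "V \<in> ms n" "gs \<in> V" "good n (\<lambda>V. V \<in> ms m) k V"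
      using k U gs(1) by (rule etgE)
    have "openin (unit_top G) ((\<lambda>gs. rng G (gs ! 0)) ` V)" using V ms_sub_base_iff[OF V(2)] by blast
    moreover have "u \<in> (\<lambda>gs. rng G (gs ! 0)) ` V" using V(3) gs(2) by blast
    ultimately obtain M where M: "cyl M u \<subseteq> (\<lambda>gs. rng G (gs ! 0)) ` V" using cyl_basis by blast
    have "R (cyl M u) \<subseteq> V"
    proof
      fix hs assume "hs \<in> R (cyl M u)"
      then have hs: "hs \<in> U" "rng G (hs ! 0) \<in> (\<lambda>gs. rng G (gs ! 0)) ` V" using M by (auto simp: R_def)
      then obtain ks where ks: "ks \<in> V" "rng G (hs ! 0) = rng G (ks ! 0)" by blast
      then have "hs = ks" using ms_base_inj[OF U] hs V(1) by (auto dest: inj_onD)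
      then show "hs \<in> V" using ks by simp
    qed
    then have "P (cyl M u)" using V(4) good_mono unfolding P_def by blast
    then show ?thesis ..
  next
    case False
    have "openin (unit_top G) (units G - (\<lambda>gs. rng G (gs ! 0)) ` U)"
      using rU clopen_iff[of "(\<lambda>gs. rng G (gs ! 0)) ` U"] openin_topspace[of "unit_top G"]
      by (metis openin_diff topspace_unit_top)
    then obtain M where "cyl M u \<subseteq> units G - (\<lambda>gs. rng G (gs ! 0)) ` U"
      using cyl_basis[of "units G - (\<lambda>gs. rng G (gs ! 0)) ` U" u] False u by blast
    then have "R (cyl M u) = {}" by (auto simp: R_def)
    then have "P (cyl M u)" by (simp add: P_def good_def ms_empty)
    then show ?thesis ..
  qed
  have "\<exists>M. \<forall>M'\<ge>M. \<forall>u\<in>units G. P (cyl M' u)"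
    by (rule lebesgue, erule loc, erule (1) mono)
  then obtain M where M: "\<And>u. u \<in> units G \<Longrightarrow> P (cyl M u)"
    by (metis order_refl)
  let ?\<P> = "R ` cyl M ` units G"
  have "finite ?\<P>" using finite_cyls by simp
  moreover have "disjoint ?\<P>"
  proof (rule disjointI)
    fix a b assume "a \<in> ?\<P>" "b \<in> ?\<P>" and ne: "a \<noteq> b"
    then obtain u v where uv: "a = R (cyl M u)" "b = R (cyl M v)" by blast
    show "a \<inter> b = {}"
    proof (rule ccontr)
      assume "a \<inter> b \<noteq> {}"
      then obtain gs where "rng G (gs ! 0) \<in> cyl M u" "rng G (gs ! 0) \<in> cyl M v" using uv by (auto simp: R_def)
      then have "cyl M u = cyl M v" using cyl_eq by metis
      then show False using ne uv by simp
    qed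
  qed
  moreover have "\<Union>?\<P> = U"
  proof
    show "\<Union>?\<P> \<subseteq> U" by (auto simp: R_def)
    show "U \<subseteq> \<Union>?\<P>"
    proof
      fix gs assume gs: "gs \<in> U"
      have r: "rng G (gs ! 0) \<in> units G" using nerve_elts[OF ms_nerve[OF U gs], of 0] by simp
      then have "gs \<in> R (cyl M (rng G (gs ! 0)))" using gs by (simp add: R_def in_cyl)
      then show "gs \<in> \<Union>?\<P>" using r by blast
    qed
  qed
  moreover have "V \<in> ms n \<and> inj_on k V \<and> k ` V \<in> ms m" if VP: "V \<in> ?\<P>" for V
  proof -
    obtain u where u: "u \<in> units G" "V = R (cyl M u)" using VP by blast
    have V: "V \<in> ms n" unfolding u R_def by (rule ms_restrict_base[OF U clopen_cyl[OF u(1)]])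
    then show ?thesis using M[OF u(1)] unfolding P_def u(2)[symmetric] good_def by simp
  qed
  ultimately show ?thesis by blast
qed

abbreviation CC :: "nat \<Rightarrow> ('g list \<Rightarrow> 'a::ab_group_add) set" where "CC n \<equiv> const_span (multisections G n)"

lemma carrier_Cc: "carrier (Cc G n) = CC n"
  by (simp add: Cc_def const_span_def)

definition fin :: "nat \<Rightarrow> ('g list \<Rightarrow> 'b) \<Rightarrow> bool" where
  "fin n k \<longleftrightarrow> (\<forall>U\<in>ms n. \<forall>z. finite {y \<in> U. k y = z})"

lemma fin_ffib: "fin n k \<Longrightarrow> f \<in> CC n \<Longrightarrow> ffib k f"
proof -
  assume k: "fin n k" "f \<in> CC n"
  from k(2) show "ffib k f"
  proof (induction rule: const_span_induct)
    case (const a U)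
    have "finite {y. const_on a U y \<noteq> 0 \<and> k y = z}" for z
      using k(1) const by (auto simp: fin_def const_on_def intro: finite_subset[of _ "{y \<in> U. k y = z}"])
    then show ?case by (simp add: ffib_def)
  qed (auto intro: ffib_zero ffib_add)
qed

lemma fin_comp:
  assumes k: "et n m k" and k': "fin m k'"
  shows "fin n (k' \<circ> k)"
  unfolding fin_def
proof (intro ballI allI)
  fix U z assume U: "U \<in> ms n"
  obtain \<P> where P: "finite \<P>" "disjoint \<P>" "\<Union>\<P> = U" "\<forall>V\<in>\<P>. V \<in> ms n \<and> inj_on k V \<and> k ` V \<in> ms m"
    using et_partition[OF k U] by (elim exE conjE)
  have "finite {y \<in> V. (k' \<circ> k) y = z}" if V: "V \<in> \<P>" for V
  proof (rule finite_imageD)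
    have "k ` {y \<in> V. (k' \<circ> k) y = z} \<subseteq> {x \<in> k ` V. k' x = z}" by auto
    moreover have "finite {x \<in> k ` V. k' x = z}" using k' P(4) V unfolding fin_def by blast
    ultimately show "finite (k ` {y \<in> V. (k' \<circ> k) y = z})" by (rule finite_subset)
    have "inj_on k V" using P(4) V by simp
    then show "inj_on k {y \<in> V. (k' \<circ> k) y = z}" by (rule inj_on_subset) blast
  qed
  then have "finite (\<Union>V\<in>\<P>. {y \<in> V. (k' \<circ> k) y = z})" using P(1) by blast
  moreover have "{y \<in> U. (k' \<circ> k) y = z} = (\<Union>V\<in>\<P>. {y \<in> V. (k' \<circ> k) y = z})" using P(3) by blast
  ultimately show "finite {y \<in> U. (k' \<circ> k) y = z}" by simp
qed

lemma fin_id: "fin n (\<lambda>x. x)"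
  unfolding fin_def
proof (intro ballI allI)
  fix U and z :: "'g list"
  show "finite {y \<in> U. y = z}" by (rule finite_subset[of _ "{z}"]) auto
qed

lemma et_fin: "et n m k \<Longrightarrow> fin n k"
  using fin_comp[OF _ fin_id] by (simp add: comp_def)

text \<open>On each piece of a partition \<open>k\<close> is injective, so the push-forward of a
  constant function is constant on the image, which is again a multisection.\<close>

lemma push_CC:
  assumes k: "et n m k" and f: "f \<in> CC n"
  shows "push k f \<in> CC m"
  using f
proof (induction rule: const_span_induct)
  case zero
  then show ?case by (simp add: push_zero const_span_zero)
next
  case (const a U)
  obtain \<P> where P: "finite \<P>" "disjoint \<P>" "\<Union>\<P> = U" "\<forall>V\<in>\<P>. V \<in> ms n \<and> inj_on k V \<and> k ` V \<in> ms m"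
    using et_partition[OF k const] by (elim exE conjE)
  have "push k (const_on a U) = push k (\<lambda>x. \<Sum>V\<in>\<P>. const_on a V x)"
    using const_on_partition[OF P(1,2), of a] P(3) by simp
  also have "\<dots> = (\<lambda>z. \<Sum>V\<in>\<P>. push k (const_on a V) z)"
    using P by (intro push_sum push_const_on) auto
  also have "\<dots> = (\<lambda>z. \<Sum>V\<in>\<P>. const_on a (k ` V) z)"
  proof (intro ext sum.cong refl)
    fix z V assume "V \<in> \<P>"
    then show "push k (const_on a V) z = const_on a (k ` V) z" using P(4) by (simp add: push_const_on(1))
  qed
  also have "\<dots> \<in> CC m" using P by (intro const_span_sum const_span_const) auto
  finally show ?case .
next
  case (add f g)
  have "push k (\<lambda>x. f x + g x) = (\<lambda>z. push k f z + push k g z)"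
    by (rule push_add) (use add fin_ffib[OF et_fin[OF k]] in blast)+
  then show ?case using add by (simp add: const_span_add)
qed

lemma push_push:
  assumes "et n m k" "et m l k'" "f \<in> CC n"
  shows "push k' (push k f) = push (k' \<circ> k) f"
  using assms fin_ffib[OF fin_comp[OF assms(1) et_fin[OF assms(2)]]] push_comp by blast

lemma CC_support: "f \<in> CC n \<Longrightarrow> f y \<noteq> 0 \<Longrightarrow> y \<in> nerve G n"
proof (induction rule: const_span_induct)
  case zero
  then show ?case by simp
next
  case (const a U)
  then show ?case using ms_nerve by (auto simp: const_on_def split: if_splits)
next
  case (add f g)
  then show ?case by (cases "f y = 0") auto
qed

lemma push_cong_nerve:
  assumes "f \<in> CC n" "\<And>y. y \<in> nerve G n \<Longrightarrow> k y = k' y"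
  shows "push k f = push k' f"
  using assms CC_support by (intro push_cong) blast

section \<open>The boundary maps\<close>

lemma face_nerve:
  fixes xs :: "'g list"
  assumes n: "1 \<le> n" "i \<le> n" and gs: "xs \<in> nerve G n"
  shows "face G n i xs \<in> nerve G (n - 1)"
proof (cases "n = 1")
  case True
  then have "hd xs \<in> elts G" using gs nerve_hd nerve_elts[of xs n 0] by simp
  then show ?thesis using True by (simp add: face_def nerve_def)
next
  case False
  then have n2: "2 \<le> n" using n by simp
  have len: "length xs = n" using nerve_length[OF gs] n by simp
  have e: "xs ! j \<in> elts G" if "j < n" for j using nerve_elts[OF gs] that by simp
  have c: "src G (xs ! j) = rng G (xs ! Suc j)" if "Suc j < n" for j using nerve_src_rng[OF gs that] .
  note nth = face_nth[OF n2 n(2) len]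
  have "face G n i xs ! j \<in> elts G" if "j < n - 1" for j
  proof -
    have "j < n" "Suc j < n" using that by simp_all
    then show ?thesis using e[of j] e[of "Suc j"] c[of j] nth[OF that] by auto
  qed
  moreover have "src G (face G n i xs ! j) = rng G (face G n i xs ! Suc j)" if "Suc j < n - 1" for j
  proof -
    have j: "j < n" "Suc j < n" "Suc (Suc j) < n" "j < n - 1" using that by simp_all
    note * = e[OF j(1)] e[OF j(2)] e[OF j(3)] c[OF j(2)] c[OF j(3)]
    consider "Suc (Suc j) < i" | "i = Suc (Suc j)" | "i = Suc j" | "i < Suc j" by linarith
    then show ?thesis unfolding nth[OF j(4)] nth[OF that] by cases (use * in simp_all)
  qed
  moreover have "length (face G n i xs) = n - 1" by (rule face_length[OF n2 n(2) len])
  ultimately show ?thesis unfolding nerve_iff using n2 by simp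
qed

lemma et_face:
  assumes n: "1 \<le> n" "i \<le> n"
  shows "et n (n - 1) (face G n i)"
proof (rule et_coord)
  show "face G n i gs \<in> nerve G (n - 1)" if "gs \<in> nerve G n" for gs using face_nerve n that by blast
  fix j assume j: "j < max 1 (n - 1)"
  show "etc n (\<lambda>gs. face G n i gs ! j)"
  proof (cases "n = 1")
    case True
    then have j0: "j = 0" using j by simp
    show ?thesis
    proof (cases "i = 0")
      case i: True
      show ?thesis by (rule etc_cong[OF etc_lh[OF rng_lh, of 0]]) (use True i j0 nerve_hd in \<open>auto simp: face_def\<close>)
    next
      case i: False
      show ?thesis by (rule etc_cong[OF etc_lh[OF src_lh, of 0]]) (use True i j0 nerve_hd in \<open>auto simp: face_def\<close>)
    qed
  next
    case False
    then have n2: "2 \<le> n" and jn: "j < n - 1" using n j by simp_all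
    have nth: "face G n i gs ! j = (if Suc j < i then gs ! j else if Suc j = i then gmul G (gs ! j) (gs ! Suc j) else gs ! Suc j)"
      if "gs \<in> nerve G n" for gs
      using face_nth[OF n2 n(2) _ jn, of gs] nerve_length[OF that] n by simp
    have "etc n (\<lambda>gs. if Suc j < i then gs ! j else if Suc j = i then gmul G (gs ! j) (gs ! Suc j) else gs ! Suc j)"
      using etc_nth[of j n] etc_nth[of "Suc j" n] etc_mul[of j n] jn by (cases "Suc j < i"; cases "Suc j = i") simp_all
    then show ?thesis by (rule etc_cong) (rule nth[symmetric])
  qed
qed

end

section \<open>Alternating sums\<close>

definition alt :: "nat \<Rightarrow> 'a::ab_group_add \<Rightarrow> 'a" where
  "alt i x = (if even i then x else - x)"

lemma alt_zero [simp]: "alt i 0 = 0"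
  by (simp add: alt_def)

lemma alt_alt: "alt i (alt j x) = alt (i + j) x"
  by (simp add: alt_def)

lemma alt_Suc: "alt (Suc i) x = - alt i x"
  by (simp add: alt_def)

lemma alt_sum: "alt i (sum f S) = (\<Sum>j\<in>S. alt i (f j))"
  by (simp add: alt_def sum_negf)

text \<open>The cancellation behind the vanishing of the squared boundary: the terms with
  \<open>i < j\<close> are matched with those with \<open>j \<le> i\<close> by sending the pair
  \<open>(i, j)\<close> to \<open>(j - 1, i)\<close>, which reverses the sign.\<close>

lemma alternating_simplicial_sum:
  fixes A :: "nat \<Rightarrow> nat \<Rightarrow> 'a::ab_group_add"
  assumes A: "\<And>i j. i < j \<Longrightarrow> j \<le> Suc n \<Longrightarrow> A i j = A (j - 1) i"
  shows "(\<Sum>i\<le>n. \<Sum>j\<le>Suc n. alt (i + j) (A i j)) = 0"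
proof -
  let ?f = "\<lambda>(i, j). alt (i + j) (A i j)"
  let ?S = "{..n} \<times> {..Suc n}"
  let ?U = "{(i, j) \<in> ?S. i < j}" and ?L = "{(i, j) \<in> ?S. j \<le> i}"
  have fin: "finite ?U" "finite ?L" by (rule finite_subset[of _ ?S]; auto)+
  have "sum ?f ?L = (\<Sum>p\<in>?U. - ?f p)"
  proof (rule sum.reindex_bij_witness[of _ "\<lambda>(i, j). (j - 1, i)" "\<lambda>(i, j). (j, Suc i)"])
    fix p assume "p \<in> ?L"
    then obtain i j where p: "p = (i, j)" "i \<le> n" "j \<le> i" by auto
    have "A j (Suc i) = A i j" using A[of j "Suc i"] p by simp
    then show "- ?f ((\<lambda>(i, j). (j, Suc i)) p) = ?f p" by (simp add: p alt_Suc add.commute)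
  qed auto
  also have "\<dots> = - sum ?f ?U" by (simp add: sum_negf)
  finally have "sum ?f ?U + sum ?f ?L = 0" by simp
  moreover have "sum ?f ?S = sum ?f ?U + sum ?f ?L"
  proof (rule trans)
    show "sum ?f ?S = sum ?f (?U \<union> ?L)" by (rule arg_cong[of _ _ "sum ?f"]) auto
    show "sum ?f (?U \<union> ?L) = sum ?f ?U + sum ?f ?L" by (rule sum.union_disjoint[OF fin]) auto
  qed
  ultimately have "sum ?f ?S = 0" by (simp only:)
  then show ?thesis by (simp only: sum.cartesian_product)
qed

text \<open>Read \<open>A i j\<close> as face \<open>i\<close> of prism \<open>j\<close>, and
  \<open>B j i\<close> as prism \<open>j\<close> of face \<open>i\<close>. Terms away from the lines
  \<open>i = j\<close> and \<open>i = Suc j\<close> cancel against \<open>B\<close>; the terms on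
  these two lines telescope, by \<open>diag\<close>, to the two ends of the prism.\<close>

lemma alternating_prism_sum:
  fixes A B :: "nat \<Rightarrow> nat \<Rightarrow> 'a::ab_group_add"
  assumes n: "1 \<le> n"
    and lower: "\<And>i j. i < j \<Longrightarrow> j \<le> n \<Longrightarrow> A i j = B (j - 1) i"
    and upper: "\<And>i j. Suc j < i \<Longrightarrow> i \<le> Suc n \<Longrightarrow> A i j = B j (i - 1)"
    and diag: "\<And>i. 1 \<le> i \<Longrightarrow> i \<le> n \<Longrightarrow> A i i = A i (i - 1)"
  shows "(\<Sum>i\<le>Suc n. \<Sum>j\<le>n. alt (i + j) (A i j)) + (\<Sum>j\<le>n - 1. \<Sum>i\<le>n. alt (j + i) (B j i)) =
    A 0 0 - A (Suc n) n"
proof -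
  let ?f = "\<lambda>(i, j). alt (i + j) (A i j)" and ?g = "\<lambda>(j, i). alt (j + i) (B j i)"
  define S where "S = {..Suc n} \<times> {..n}"
  define R where "R = {..n - 1} \<times> {..n}"
  define S1 where "S1 = {(i, j) \<in> S. i < j}"
  define S2 where "S2 = (\<lambda>i. (i, i)) ` {..n}"
  define S3 where "S3 = (\<lambda>j. (Suc j, j)) ` {..n}"
  define S4 where "S4 = {(i, j) \<in> S. Suc j < i}"
  define R1 where "R1 = {(j, i) \<in> R. i \<le> j}"
  define R2 where "R2 = {(j, i) \<in> R. j < i}"
  have finSR: "finite S" "finite R" by (simp_all add: S_def R_def)
  have sub: "S1 \<subseteq> S" "S4 \<subseteq> S" "R1 \<subseteq> R" "R2 \<subseteq> R" by (auto simp: S1_def S4_def R1_def R2_def)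
  have fin: "finite S1" "finite S2" "finite S3" "finite S4" "finite R1" "finite R2"
    using finSR sub finite_subset by (blast, simp add: S2_def, simp add: S3_def, blast+)
  have S: "S = S1 \<union> (S2 \<union> (S3 \<union> S4))"
  proof (intro equalityI subsetI)
    fix p assume "p \<in> S"
    then obtain i j where p: "p = (i, j)" "i \<le> Suc n" "j \<le> n" by (auto simp: S_def)
    consider "i < j" | "i = j" | "i = Suc j" | "Suc j < i" by linarith
    then show "p \<in> S1 \<union> (S2 \<union> (S3 \<union> S4))"
      by cases (use p in \<open>auto simp: S_def S1_def S2_def S3_def S4_def\<close>)
  qed (auto simp: S_def S1_def S2_def S3_def S4_def)
  have disj: "S1 \<inter> (S2 \<union> (S3 \<union> S4)) = {}" "S2 \<inter> (S3 \<union> S4) = {}" "S3 \<inter> S4 = {}" "R1 \<inter> R2 = {}"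
    by (auto simp: S1_def S2_def S3_def S4_def R1_def R2_def)
  have sumS: "sum ?f S = sum ?f S1 + (sum ?f S2 + (sum ?f S3 + sum ?f S4))"
    unfolding S using fin disj by (simp only: sum.union_disjoint finite_UnI)
  have R: "R = R1 \<union> R2" by (auto simp: R1_def R2_def)
  have sumR: "sum ?g R = sum ?g R1 + sum ?g R2"
    unfolding R using fin disj by (simp only: sum.union_disjoint)
  have 1: "sum ?f S1 = - sum ?g R1"
    unfolding sum_negf[symmetric]
  proof (rule sum.reindex_bij_witness[of _ "\<lambda>(j, i). (i, Suc j)" "\<lambda>(i, j). (j - 1, i)"])
    fix p assume "p \<in> S1"
    then obtain i j where p: "p = (i, j)" "i < j" "j \<le> n" by (auto simp: S1_def S_def)
    then obtain j' where j': "j = Suc j'" by (cases j) auto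
    show "- ?g ((\<lambda>(i, j). (j - 1, i)) p) = ?f p" using lower[of i j] p j' by (simp add: alt_Suc add.commute)
  qed (use n in \<open>auto simp: S1_def S4_def R1_def R2_def S_def R_def\<close>)
  have 4: "sum ?f S4 = - sum ?g R2"
    unfolding sum_negf[symmetric]
  proof (rule sum.reindex_bij_witness[of _ "\<lambda>(j, i). (Suc i, j)" "\<lambda>(i, j). (j, i - 1)"])
    fix p assume "p \<in> S4"
    then obtain i j where p: "p = (i, j)" "Suc j < i" "i \<le> Suc n" by (auto simp: S4_def S_def)
    then obtain i' where i': "i = Suc i'" by (cases i) auto
    show "- ?g ((\<lambda>(i, j). (j, i - 1)) p) = ?f p" using upper[of j i] p i' by (simp add: alt_Suc add.commute)
  qed (use n in \<open>auto simp: S1_def S4_def R1_def R2_def S_def R_def\<close>)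
  have 2: "sum ?f S2 = (\<Sum>i\<le>n. A i i)"
    unfolding S2_def by (subst sum.reindex) (auto simp: inj_on_def alt_def)
  have 3: "sum ?f S3 = - (\<Sum>j\<le>n. A (Suc j) j)"
    unfolding S3_def by (subst sum.reindex) (auto simp: inj_on_def alt_def sum_negf)
  have tel: "(\<Sum>i\<le>m. A i i) - (\<Sum>j\<le>m. A (Suc j) j) = A 0 0 - A (Suc m) m" if "m \<le> n" for m
    using that
  proof (induction m)
    case (Suc m)
    then show ?case using diag[of "Suc m"] by (simp add: algebra_simps)
  qed simp
  have "sum ?f S + sum ?g R = A 0 0 - A (Suc n) n"
    using sumS sumR 1 2 3 4 tel[of n] by (simp add: algebra_simps)
  then show ?thesis unfolding S_def R_def by (simp only: sum.cartesian_product)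
qed

context shift_groupoid
begin

section \<open>The chain complex of the nerve\<close>

text \<open>The face maps of the nerve as a simplicial set: the printed convention exchanges the two
  faces of a 1-simplex, which changes the sign of the boundary in degree 1.\<close>

definition fc :: "nat \<Rightarrow> nat \<Rightarrow> 'g list \<Rightarrow> 'g list" where
  "fc n i = face G n (if n = 1 then 1 - i else i)"

lemma et_fc: "1 \<le> n \<Longrightarrow> i \<le> n \<Longrightarrow> et n (n - 1) (fc n i)"
  unfolding fc_def by (rule et_face) auto

lemma nerve_singleton:
  assumes "xs \<in> nerve G n" "n \<le> 1"
  shows "\<exists>g\<in>elts G. xs = [g] \<and> (n = 0 \<longrightarrow> g \<in> units G)"
proof -
  have "length xs = 1" using nerve_length[OF assms(1)] assms(2) by simp
  then obtain g where "xs = [g]" by (cases xs) auto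
  then show ?thesis using assms(1) unfolding nerve_iff using assms(2) by auto
qed

text \<open>The simplicial identities, compared entry by entry. Associativity is used only where
  adjacent contractions meet, that is for \<open>j = Suc i\<close>. Degree \<open>n = 1\<close> is
  separate because its faces are points and \<open>fc\<close> exchanges the two.\<close>

lemma fc_fc:
  assumes n: "1 \<le> n" and ij: "i < j" "j \<le> Suc n" and xs: "xs \<in> nerve G (Suc n)"
  shows "fc n i (fc (Suc n) j xs) = fc n (j - 1) (fc (Suc n) i xs)"
proof (cases "n = 1")
  case True
  have "length xs = 2" using nerve_length[OF xs] True by simp
  then obtain a b where ab: "xs = [a, b]" by (cases xs; cases "tl xs") auto
  have e: "a \<in> elts G" "b \<in> elts G" "src G a = rng G b"
    using nerve_elts[OF xs, of 0] nerve_elts[OF xs, of 1] nerve_src_rng[OF xs, of 0] True ab by simp_all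
  have "(i = 0 \<and> j = 1) \<or> (i = 0 \<and> j = 2) \<or> (i = 1 \<and> j = 2)" using ij True by linarith
  then show ?thesis using True ab e by (auto simp: fc_def face_def)
next
  case False
  then have n2: "2 \<le> n" "2 \<le> Suc n" using n by simp_all
  have f: "fc n i = face G n i" "fc (Suc n) i = face G (Suc n) i" for i
    using False n by (auto simp: fc_def)
  have len: "length xs = Suc n" using nerve_length[OF xs] by simp
  have i: "i \<le> n" "i \<le> Suc n" "j - 1 \<le> n" using ij by simp_all
  note l1 = face_length[OF n2(2) ij(2) len, simplified] and l2 = face_length[OF n2(2) i(2) len, simplified]
  show ?thesis unfolding f
  proof (rule nth_equalityI)
    show "length (face G n i (face G (Suc n) j xs)) = length (face G n (j - 1) (face G (Suc n) i xs))"
      using face_length[OF n2(1) i(1) l1] face_length[OF n2(1) i(3) l2] by simp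
    fix p assume "p < length (face G n i (face G (Suc n) j xs))"
    then have p: "p < n - 1" using face_length[OF n2(1) i(1) l1] by simp
    then have p': "p < Suc n - 1" "Suc p < Suc n - 1" by simp_all
    have e: "xs ! p \<in> elts G" "xs ! Suc p \<in> elts G" "xs ! Suc (Suc p) \<in> elts G"
      "src G (xs ! p) = rng G (xs ! Suc p)" "src G (xs ! Suc p) = rng G (xs ! Suc (Suc p))"
      using p nerve_elts[OF xs] nerve_src_rng[OF xs] by simp_all
    have as: "gmul G (gmul G (xs ! p) (xs ! Suc p)) (xs ! Suc (Suc p)) = gmul G (xs ! p) (gmul G (xs ! Suc p) (xs ! Suc (Suc p)))"
      using e by (intro mul_assoc')
    note a = face_nth[OF n2(1) i(1) l1 p] face_nth[OF n2(1) i(3) l2 p]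
      face_nth[OF n2(2) ij(2) len p'(1)] face_nth[OF n2(2) ij(2) len p'(2)]
      face_nth[OF n2(2) i(2) len p'(1)] face_nth[OF n2(2) i(2) len p'(2)]
    consider "Suc (Suc p) < i" | "Suc (Suc p) = i" | "Suc p = i" "Suc (Suc p) = j" | "Suc p = i" "Suc (Suc p) < j"
      | "i < Suc p" "Suc (Suc p) < j" | "i < Suc p" "Suc (Suc p) = j" | "i < Suc p" "Suc p = j" | "i < Suc p" "j < Suc p"
      using ij by linarith
    then show "face G n i (face G (Suc n) j xs) ! p = face G n (j - 1) (face G (Suc n) i xs) ! p"
      unfolding a by cases (use ij as in auto)
  qed
qed

definition sbd :: "nat \<Rightarrow> ('g list \<Rightarrow> 'a::ab_group_add) \<Rightarrow> 'g list \<Rightarrow> 'a" where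
  "sbd n f = (\<lambda>z. \<Sum>i\<le>n. alt i (push (fc n i) f z))"

lemma bd_sbd: "2 \<le> n \<Longrightarrow> bd G n f = sbd n f"
  by (auto simp: bd_def sbd_def fc_def alt_def intro!: ext sum.cong)

lemma bd_sbd1: "bd G 1 f = (\<lambda>z. - sbd 1 f z)"
  by (auto simp: bd_def sbd_def fc_def alt_def intro!: ext)

lemma const_span_alt: "f \<in> const_span S \<Longrightarrow> (\<lambda>x. alt i (f x)) \<in> const_span S"
  by (cases "even i") (simp_all add: alt_def const_span_uminus)

text \<open>One notion for two operators: the boundary, where \<open>k i\<close> are the faces, and
  the homotopy, where \<open>k i\<close> are the prisms.\<close>

definition apush :: "nat \<Rightarrow> (nat \<Rightarrow> 'g list \<Rightarrow> 'g list) \<Rightarrow> ('g list \<Rightarrow> 'a::ab_group_add) \<Rightarrow> 'g list \<Rightarrow> 'a" where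
  "apush N k f = (\<lambda>z. \<Sum>i\<le>N. alt i (push (k i) f z))"

lemma sbd_apush: "sbd n = apush n (fc n)"
  by (simp add: sbd_def apush_def fun_eq_iff)

lemma apush_CC: "(\<And>i. i \<le> N \<Longrightarrow> et n m (k i)) \<Longrightarrow> f \<in> CC n \<Longrightarrow> apush N k f \<in> CC m"
  unfolding apush_def by (intro const_span_sum const_span_alt push_CC) auto

lemma push_add': "et n m k \<Longrightarrow> f \<in> CC n \<Longrightarrow> g \<in> CC n \<Longrightarrow> push k (\<lambda>x. f x + g x) = (\<lambda>z. push k f z + push k g z)"
  using fin_ffib[OF et_fin] push_add by blast

lemma apush_add:
  assumes "\<And>i. i \<le> N \<Longrightarrow> et n m (k i)" "f \<in> CC n" "g \<in> CC n"
  shows "apush N k (\<lambda>x. f x + g x) = (\<lambda>z. apush N k f z + apush N k g z)"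
proof
  fix z
  have "apush N k (\<lambda>x. f x + g x) z = (\<Sum>i\<le>N. alt i (push (k i) f z) + alt i (push (k i) g z))"
    unfolding apush_def using push_add'[OF assms(1) assms(2,3)] by (intro sum.cong) (auto simp: alt_def)
  then show "apush N k (\<lambda>x. f x + g x) z = apush N k f z + apush N k g z"
    by (simp add: apush_def sum.distrib)
qed

lemma apush_uminus: "apush N k (\<lambda>x. - f x) = (\<lambda>z. - apush N k f z)"
  by (simp add: apush_def push_uminus alt_def sum_negf[symmetric] fun_eq_iff cong: sum.cong)
     (intro allI sum.cong; simp)

lemma apush_zero: "apush N k (\<lambda>x. 0) = (\<lambda>z. 0)"
  by (simp add: apush_def push_zero)

lemma push_alt: "push k (\<lambda>x. alt i (f x)) = (\<lambda>z. alt i (push k f z))"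
  by (auto simp: alt_def push_uminus)

lemma push_apush:
  assumes k: "\<And>i. i \<le> N \<Longrightarrow> et n m (k i)" and k': "et m l k'" and f: "f \<in> CC n"
  shows "push k' (apush N k f) = (\<lambda>z. \<Sum>i\<le>N. alt i (push (k' \<circ> k i) f z))"
proof -
  have "push k' (apush N k f) = (\<lambda>z. \<Sum>i\<in>{..N}. push k' (\<lambda>x. alt i (push (k i) f x)) z)"
    unfolding apush_def
  proof (rule push_sum)
    fix i assume "i \<in> {..N}"
    then have "(\<lambda>x. alt i (push (k i) f x)) \<in> CC m" using k f by (intro const_span_alt push_CC) auto
    then show "ffib k' (\<lambda>x. alt i (push (k i) f x))" by (rule fin_ffib[OF et_fin[OF k']])
  qed simp
  also have "\<dots> = (\<lambda>z. \<Sum>i\<le>N. alt i (push (k' \<circ> k i) f z))"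
  proof (intro ext sum.cong refl)
    fix z i assume "i \<in> {..N}"
    then have "push k' (push (k i) f) = push (k' \<circ> k i) f" using k k' f by (intro push_push) auto
    then show "push k' (\<lambda>x. alt i (push (k i) f x)) z = alt i (push (k' \<circ> k i) f z)" by (simp add: push_alt)
  qed
  finally show ?thesis .
qed

lemma apush_apush:
  assumes k: "\<And>i. i \<le> N \<Longrightarrow> et n m (k i)" and k': "\<And>j. j \<le> N' \<Longrightarrow> et m l (k' j)" and f: "f \<in> CC n"
  shows "apush N' k' (apush N k f) = (\<lambda>z. \<Sum>j\<le>N'. \<Sum>i\<le>N. alt (j + i) (push (k' j \<circ> k i) f z))"
proof
  fix z
  have "apush N' k' (apush N k f) z = (\<Sum>j\<le>N'. alt j (push (k' j) (apush N k f) z))" by (simp add: apush_def)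
  also have "\<dots> = (\<Sum>j\<le>N'. \<Sum>i\<le>N. alt (j + i) (push (k' j \<circ> k i) f z))"
  proof (rule sum.cong[OF refl])
    fix j assume "j \<in> {..N'}"
    then have "push (k' j) (apush N k f) = (\<lambda>z. \<Sum>i\<le>N. alt i (push (k' j \<circ> k i) f z))"
      using k k' f by (intro push_apush) auto
    then show "alt j (push (k' j) (apush N k f) z) = (\<Sum>i\<le>N. alt (j + i) (push (k' j \<circ> k i) f z))"
      by (simp add: alt_sum alt_alt)
  qed
  finally show "apush N' k' (apush N k f) z = (\<Sum>j\<le>N'. \<Sum>i\<le>N. alt (j + i) (push (k' j \<circ> k i) f z))" .
qed

lemma sbd_sbd:
  assumes n: "1 \<le> n" and f: "f \<in> CC (Suc n)"
  shows "sbd n (sbd (Suc n) f) = (\<lambda>_. 0)"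
proof -
  have "apush n (fc n) (apush (Suc n) (fc (Suc n)) f) =
     (\<lambda>z. \<Sum>i\<le>n. \<Sum>j\<le>Suc n. alt (i + j) (push (fc n i \<circ> fc (Suc n) j) f z))"
    using et_fc[of "Suc n"] et_fc[OF n] f by (intro apush_apush) auto
  also have "\<dots> = (\<lambda>_. 0)"
  proof
    fix z
    show "(\<Sum>i\<le>n. \<Sum>j\<le>Suc n. alt (i + j) (push (fc n i \<circ> fc (Suc n) j) f z)) = 0"
    proof (rule alternating_simplicial_sum)
      fix i j assume "i < j" "j \<le> Suc n"
      then have "push (fc n i \<circ> fc (Suc n) j) f = push (fc n (j - 1) \<circ> fc (Suc n) i) f"
        using fc_fc[OF n] by (intro push_cong_nerve[OF f]) simp
      then show "push (fc n i \<circ> fc (Suc n) j) f z = push (fc n (j - 1) \<circ> fc (Suc n) i) f z" by simp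
    qed
  qed
  finally show ?thesis by (simp add: sbd_apush)
qed

text \<open>The exponent of the sign between \<open>bd G (Suc n)\<close> and
  \<open>sbd (Suc n)\<close>; only the boundary out of degree one carries a minus.\<close>

definition bd_sign :: "nat \<Rightarrow> nat" where "bd_sign n = (if n = 0 then 1 else 0)"

lemma bd_alt: "bd G (Suc n) f = (\<lambda>z. alt (bd_sign n) (sbd (Suc n) f z))"
  by (cases n) (simp_all add: bd_sign_def alt_def bd_sbd bd_sbd1[unfolded One_nat_def])

lemma bd_zero_map: "bd G 0 f = (\<lambda>_. 0)"
  by (simp add: bd_def)

lemma sbd_CC: "1 \<le> n \<Longrightarrow> f \<in> CC n \<Longrightarrow> sbd n f \<in> CC (n - 1)"
  unfolding sbd_apush using et_fc by (intro apush_CC) auto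

lemma sbd_add: "1 \<le> n \<Longrightarrow> f \<in> CC n \<Longrightarrow> g \<in> CC n \<Longrightarrow> sbd n (\<lambda>x. f x + g x) = (\<lambda>z. sbd n f z + sbd n g z)"
  unfolding sbd_apush using et_fc by (intro apush_add) auto

lemma bd_CC: "f \<in> CC n \<Longrightarrow> bd G n f \<in> CC (n - 1)"
proof (cases n)
  case 0
  then show ?thesis by (simp add: bd_zero_map const_span_zero)
next
  case (Suc m)
  assume f: "f \<in> CC n"
  show ?thesis using sbd_CC[of n f] f Suc by (simp add: bd_alt const_span_alt)
qed

lemma bd_add: "f \<in> CC n \<Longrightarrow> g \<in> CC n \<Longrightarrow> bd G n (\<lambda>x. f x + g x) = (\<lambda>z. bd G n f z + bd G n g z)"
proof (cases n)
  case 0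
  then show ?thesis by (simp add: bd_zero_map)
next
  case (Suc m)
  assume f: "f \<in> CC n" "g \<in> CC n"
  show ?thesis unfolding Suc bd_alt using sbd_add[of "Suc m" f g] f Suc by (simp add: alt_def fun_eq_iff)
qed

lemma bd_uminus: "bd G n (\<lambda>x. - f x) = (\<lambda>z. - bd G n f z)"
proof (cases n)
  case 0
  then show ?thesis by (simp add: bd_zero_map)
next
  case (Suc m)
  show ?thesis unfolding Suc bd_alt by (simp add: sbd_apush apush_uminus alt_def fun_eq_iff)
qed

lemma bd_zero: "bd G n (\<lambda>_. 0) = (\<lambda>_. 0)"
  using bd_uminus[of n "\<lambda>_. 0"] bd_add[of "\<lambda>_. 0" n "\<lambda>_. 0"] by (simp add: const_span_zero fun_eq_iff)

lemma bd_bd: "f \<in> CC (Suc n) \<Longrightarrow> bd G n (bd G (Suc n) f) = (\<lambda>_. 0)"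
proof (cases n)
  case 0
  then show ?thesis by (simp add: bd_zero_map)
next
  case (Suc m)
  assume f: "f \<in> CC (Suc n)"
  have b: "bd G (Suc n) f = sbd (Suc n) f" using bd_sbd[of "Suc n"] Suc by simp
  show ?thesis unfolding b using Suc sbd_sbd[of n f] f by (simp add: bd_alt)
qed

section \<open>Etale functors\<close>

text \<open>Compatibility with source and range is stated with \<open>\<phi>\<close> applied to
  units on the right-hand side; this already forces units to go to units.\<close>

definition etale_functor :: "('g \<Rightarrow> 'g) \<Rightarrow> bool" where
  "etale_functor \<phi> \<longleftrightarrow> local_homeomorphism (gtop G) (gtop G) \<phi> \<and>
     (\<forall>g\<in>elts G. src G (\<phi> g) = \<phi> (src G g) \<and> rng G (\<phi> g) = \<phi> (rng G g)) \<and>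
     (\<forall>g\<in>elts G. \<forall>h\<in>elts G. src G g = rng G h \<longrightarrow> \<phi> (gmul G g h) = gmul G (\<phi> g) (\<phi> h))"

lemma etale_functorD:
  assumes "etale_functor \<phi>"
  shows "local_homeomorphism (gtop G) (gtop G) \<phi>"
    and "g \<in> elts G \<Longrightarrow> \<phi> g \<in> elts G"
    and "g \<in> elts G \<Longrightarrow> src G (\<phi> g) = \<phi> (src G g)"
    and "g \<in> elts G \<Longrightarrow> rng G (\<phi> g) = \<phi> (rng G g)"
    and "g \<in> elts G \<Longrightarrow> h \<in> elts G \<Longrightarrow> src G g = rng G h \<Longrightarrow> \<phi> (gmul G g h) = gmul G (\<phi> g) (\<phi> h)"
    and "u \<in> units G \<Longrightarrow> \<phi> u \<in> units G"
proof -
  show lh: "local_homeomorphism (gtop G) (gtop G) \<phi>" using assms by (simp add: etale_functor_def)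
  show e: "g \<in> elts G \<Longrightarrow> \<phi> g \<in> elts G" for g
    using lh by (auto simp: local_homeomorphism_iff continuous_map_def topspace_gtop)
  show s: "g \<in> elts G \<Longrightarrow> src G (\<phi> g) = \<phi> (src G g)" for g
    using assms by (simp add: etale_functor_def)
  show "g \<in> elts G \<Longrightarrow> rng G (\<phi> g) = \<phi> (rng G g)"
    using assms by (simp add: etale_functor_def)
  show "g \<in> elts G \<Longrightarrow> h \<in> elts G \<Longrightarrow> src G g = rng G h \<Longrightarrow> \<phi> (gmul G g h) = gmul G (\<phi> g) (\<phi> h)"
    using assms by (simp add: etale_functor_def)
  assume u: "u \<in> units G"
  then have "\<phi> u = src G (\<phi> u)" using s[of u] units_elts by simp
  then show "\<phi> u \<in> units G" using e[OF units_elts[OF u]] src_units by metis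
qed

lemma etale_functor_comp:
  assumes "etale_functor \<phi>" "etale_functor \<psi>"
  shows "etale_functor (\<lambda>g. \<phi> (\<psi> g))"
proof -
  note f = etale_functorD[OF assms(1)] and p = etale_functorD[OF assms(2)]
  have "local_homeomorphism (gtop G) (gtop G) (\<lambda>g. \<phi> (\<psi> g))"
    using local_homeomorphism_comp[OF p(1) f(1)] by (simp add: comp_def)
  then show ?thesis unfolding etale_functor_def using f p by simp
qed

lemma etale_functor_gshift: "etale_functor gs"
  unfolding etale_functor_def using gshift_lh gshift_unit by simp

lemma etale_functor_funpow: "etale_functor \<phi> \<Longrightarrow> etale_functor (\<phi> ^^ m)"
proof (induction m)
  case 0
  show ?case unfolding etale_functor_def by (simp add: lh_id id_def)
next
  case (Suc m)
  then show ?case using etale_functor_comp[of \<phi> "\<phi> ^^ m"] by (simp add: comp_def)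
qed

lemma map_nerve:
  assumes f: "etale_functor \<phi>" and xs: "xs \<in> nerve G n"
  shows "map \<phi> xs \<in> nerve G n"
proof -
  have "src G (map \<phi> xs ! i) = rng G (map \<phi> xs ! Suc i)" if "Suc i < n" for i
    using that nerve_src_rng[OF xs that] nerve_elts[OF xs, of i] nerve_elts[OF xs, of "Suc i"]
      nerve_length[OF xs] etale_functorD(3,4)[OF f] by simp
  then show ?thesis using xs etale_functorD(2,6)[OF f] unfolding nerve_iff by simp
qed

lemma et_map: "etale_functor \<phi> \<Longrightarrow> et n n (map \<phi>)"
proof (rule et_coord)
  assume f: "etale_functor \<phi>"
  show "map \<phi> xs \<in> nerve G n" if "xs \<in> nerve G n" for xs using map_nerve f that by blast
  fix i assume i: "i < max 1 n"
  show "etc n (\<lambda>xs. map \<phi> xs ! i)"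
    by (rule etc_cong[OF etc_lh[OF etale_functorD(1)[OF f] i]]) (use i nerve_length in simp)
qed

lemma face_map:
  assumes f: "etale_functor \<phi>" and n: "1 \<le> n" "i \<le> n" and xs: "xs \<in> nerve G n"
  shows "face G n i (map \<phi> xs) = map \<phi> (face G n i xs)"
proof (cases "n = 1")
  case True
  then obtain g where "g \<in> elts G" "xs = [g]" using nerve_singleton[OF xs] by auto
  then show ?thesis using True etale_functorD(3,4)[OF f] by (simp add: face_def)
next
  case False
  then have n2: "2 \<le> n" using n by simp
  have len: "length xs = n" "length (map \<phi> xs) = n" using nerve_length[OF xs] n by simp_all
  show ?thesis
  proof (rule nth_equalityI)
    show "length (face G n i (map \<phi> xs)) = length (map \<phi> (face G n i xs))"
      using face_length[OF n2 n(2) len(1)] face_length[OF n2 n(2) len(2)] by simp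
    fix p assume "p < length (face G n i (map \<phi> xs))"
    then have p: "p < n - 1" using face_length[OF n2 n(2) len(2)] by simp
    then have pl: "p < length (face G n i xs)" "p < n" "Suc p < n"
      using face_length[where G = G, OF n2 n(2) len(1)] by simp_all
    have m: "map \<phi> xs ! p = \<phi> (xs ! p)" "map \<phi> xs ! Suc p = \<phi> (xs ! Suc p)"
      "map \<phi> (face G n i xs) ! p = \<phi> (face G n i xs ! p)"
      using pl len by simp_all
    have e: "xs ! p \<in> elts G" "xs ! Suc p \<in> elts G" using nerve_elts[OF xs] pl by simp_all
    show "face G n i (map \<phi> xs) ! p = map \<phi> (face G n i xs) ! p"
      unfolding m face_nth[where G = G, OF n2 n(2) len(1) p] face_nth[where G = G, OF n2 n(2) len(2) p]
      using etale_functorD(5)[OF f e nerve_src_rng[OF xs pl(3)]] by auto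
  qed
qed

lemma bd_push_map:
  assumes f: "etale_functor \<phi>" and c: "c \<in> CC n"
  shows "bd G n (push (map \<phi>) c) = push (map \<phi>) (bd G n c)"
proof (cases n)
  case 0
  then show ?thesis by (simp add: bd_zero_map push_zero)
next
  case (Suc m)
  have n: "1 \<le> n" using Suc by simp
  have "sbd n (push (map \<phi>) c) = push (map \<phi>) (sbd n c)"
  proof
    fix z
    have "push (map \<phi>) (sbd n c) z = (\<Sum>i\<le>n. alt i (push (map \<phi> \<circ> fc n i) c z))"
      using push_apush[of n n "n - 1" "fc n" "n - 1" "map \<phi>" c] et_fc[OF n] et_map[OF f] c unfolding sbd_apush by simp
    also have "\<dots> = (\<Sum>i\<le>n. alt i (push (fc n i) (push (map \<phi>) c) z))"
    proof (rule sum.cong[OF refl])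
      fix i assume i: "i \<in> {..n}"
      have "push (fc n i) (push (map \<phi>) c) = push (fc n i \<circ> map \<phi>) c"
        using i et_fc[OF n] et_map[OF f] c by (intro push_push) auto
      also have "\<dots> = push (map \<phi> \<circ> fc n i) c"
        by (rule push_cong_nerve[OF c]) (use i n face_map[OF f] in \<open>simp add: fc_def\<close>)
      finally show "alt i (push (map \<phi> \<circ> fc n i) c z) = alt i (push (fc n i) (push (map \<phi>) c) z)" by simp
    qed
    finally show "sbd n (push (map \<phi>) c) z = push (map \<phi>) (sbd n c) z" by (simp add: sbd_def)
  qed
  then show ?thesis using Suc by (simp add: bd_alt push_alt)
qed

lemma push_map_CC: "etale_functor \<phi> \<Longrightarrow> f \<in> CC n \<Longrightarrow> push (map \<phi>) f \<in> CC n"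
  using push_CC et_map by blast

lemma push_map_map:
  assumes "etale_functor \<phi>" "etale_functor \<psi>" "f \<in> CC n"
  shows "push (map \<phi>) (push (map \<psi>) f) = push (map (\<lambda>g. \<phi> (\<psi> g))) f"
proof -
  have "push (map \<phi>) (push (map \<psi>) f) = push (map \<phi> \<circ> map \<psi>) f"
    using assms et_map by (intro push_push) auto
  then show ?thesis by (simp add: map_comp_map comp_def)
qed

section \<open>Natural transformations act trivially on homology\<close>

text \<open>The vertices of a simplex: the ranges of its arrows and the source of the last one. In
  degree 0 the bound \<open>max 1 n\<close> selects the range of the single entry, which is the
  point itself.\<close>

definition vtx :: "nat \<Rightarrow> nat \<Rightarrow> 'g list \<Rightarrow> 'g" where
  "vtx n i xs = (if i < max 1 n then rng G (xs ! i) else src G (xs ! (n - 1)))"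

lemma vtx_units: "xs \<in> nerve G n \<Longrightarrow> i \<le> n \<Longrightarrow> vtx n i xs \<in> units G"
  unfolding vtx_def using nerve_elts[of xs n i] nerve_elts[of xs n "n - 1"] by auto

lemma src_vtx: "xs \<in> nerve G n \<Longrightarrow> p < n \<Longrightarrow> src G (xs ! p) = vtx n (Suc p) xs"
proof -
  assume xs: "xs \<in> nerve G n" and p: "p < n"
  show ?thesis
  proof (cases "Suc p < n")
    case True
    then show ?thesis using nerve_src_rng[OF xs] by (simp add: vtx_def)
  next
    case False
    then have "n = Suc p" using p by simp
    then show ?thesis by (simp add: vtx_def)
  qed
qed

lemma rng_vtx: "p < n \<Longrightarrow> rng G (xs ! p) = vtx n p xs"
  by (simp add: vtx_def)

text \<open>Face \<open>i\<close> omits vertex \<open>i\<close> and keeps the order of the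
  others.\<close>

lemma vtx_face:
  assumes n: "2 \<le> n" and i: "i \<le> n" and xs: "xs \<in> nerve G n" and j: "j \<le> n - 1"
  shows "vtx (n - 1) j (face G n i xs) = vtx n (if i \<le> j then Suc j else j) xs"
proof -
  have len: "length xs = n" using nerve_length[OF xs] n by simp
  have e: "xs ! q \<in> elts G" if "q < n" for q using nerve_elts[OF xs] that by simp
  have c: "src G (xs ! q) = rng G (xs ! Suc q)" if "Suc q < n" for q using nerve_src_rng[OF xs that] .
  show ?thesis
  proof (cases "j < n - 1")
    case True
    then have "j < n" "Suc j < n" by simp_all
    then show ?thesis
      using face_nth[where G = G, OF n i len True] True n e[of j] e[of "Suc j"] c[of j] by (auto simp: vtx_def)
  next
    case False
    then have jn: "j = n - 1" using j by simp
    then have "n - 1 - 1 < n - 1" using n by simp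
    note nth = face_nth[where G = G, OF n i len this]
    obtain m where m: "n = Suc (Suc m)" using n by (metis Suc_le_D numeral_2_eq_2 Suc_le_mono)
    show ?thesis
      using nth n jn m i e[of m] e[of "Suc m"] c[of m] by (auto simp: vtx_def)
  qed
qed

text \<open>Prism \<open>i\<close> over a simplex: the arrows before vertex \<open>i\<close> are
  replaced by their images under \<open>\<phi>\<close>, the component of \<open>\<eta>\<close> at
  that vertex is inserted, and the remaining arrows follow unchanged, moved up by one place.\<close>

definition hm :: "('g \<Rightarrow> 'g) \<Rightarrow> ('g \<Rightarrow> 'g) \<Rightarrow> nat \<Rightarrow> nat \<Rightarrow> 'g list \<Rightarrow> 'g list" where
  "hm \<phi> \<eta> n i xs = map (\<lambda>p. if p < i then \<phi> (xs ! p) else if p = i then \<eta> (vtx n i xs) else xs ! (p - 1)) [0..<Suc n]"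

lemma hm_length [simp]: "length (hm \<phi> \<eta> n i xs) = Suc n"
  by (simp add: hm_def)

lemma hm_nth: "p \<le> n \<Longrightarrow> hm \<phi> \<eta> n i xs ! p =
    (if p < i then \<phi> (xs ! p) else if p = i then \<eta> (vtx n i xs) else xs ! (p - 1))"
  by (simp add: hm_def nth_append del: upt_Suc)

context
  fixes \<phi> \<eta> :: "'g \<Rightarrow> 'g"
  assumes phi: "etale_functor \<phi>"
    and eta_lh: "local_homeomorphism (unit_top G) (gtop G) \<eta>"
    and eta_src: "\<And>u. u \<in> units G \<Longrightarrow> src G (\<eta> u) = u"
    and eta_rng: "\<And>u. u \<in> units G \<Longrightarrow> rng G (\<eta> u) = \<phi> u"
    and natural: "\<And>g. g \<in> elts G \<Longrightarrow> gmul G (\<phi> g) (\<eta> (src G g)) = gmul G (\<eta> (rng G g)) g"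
begin

abbreviation H :: "nat \<Rightarrow> nat \<Rightarrow> 'g list \<Rightarrow> 'g list" where "H \<equiv> hm \<phi> \<eta>"

lemma eta_elts: "u \<in> units G \<Longrightarrow> \<eta> u \<in> elts G"
  using eta_lh by (auto simp: local_homeomorphism_iff continuous_map_def topspace_gtop)

lemma hm_nerve:
  assumes i: "i \<le> n" and xs: "xs \<in> nerve G n"
  shows "H n i xs \<in> nerve G (Suc n)"
proof -
  note f = etale_functorD[OF phi]
  have e: "xs ! q \<in> elts G" if "q < n" for q using nerve_elts[OF xs] that by simp
  have v: "vtx n i xs \<in> units G" using vtx_units[OF xs i] .
  have "H n i xs ! p \<in> elts G" if p: "p \<le> n" for p
    using p i e[of p] e[of "p - 1"] f(2) eta_elts[OF v] by (auto simp: hm_nth)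
  moreover have "src G (H n i xs ! p) = rng G (H n i xs ! Suc p)" if p: "Suc p \<le> n" for p
  proof -
    have pn: "p \<le> n" "p < n" using p by simp_all
    consider "Suc p < i" | "Suc p = i" | "p = i" | "i < p" by linarith
    then show ?thesis
    proof cases
      case 1
      then have "Suc p < n" using i by simp
      then show ?thesis using 1 hm_nth[OF pn(1)] hm_nth[OF p] f(3)[OF e[OF pn(2)]] f(4)[OF e[of "Suc p"]] nerve_src_rng[OF xs] by simp
    next
      case 2
      then show ?thesis using hm_nth[OF pn(1)] hm_nth[OF p] f(3)[OF e[OF pn(2)]] src_vtx[OF xs pn(2)] eta_rng[OF v] by auto
    next
      case 3
      then show ?thesis using hm_nth[OF pn(1)] hm_nth[OF p] eta_src[OF v] rng_vtx[OF pn(2)] by auto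
    next
      case 4
      then obtain p' where "p = Suc p'" by (cases p) auto
      then show ?thesis using 4 hm_nth[OF pn(1)] hm_nth[OF p] nerve_src_rng[OF xs, of p'] p by auto
    qed
  qed
  ultimately show ?thesis unfolding nerve_iff by (auto simp: less_Suc_eq_le)
qed

lemma et_hm:
  assumes i: "i \<le> n"
  shows "et n (Suc n) (H n i)"
proof (rule et_coord)
  show "H n i xs \<in> nerve G (Suc n)" if "xs \<in> nerve G n" for xs using hm_nerve[OF i that] .
  fix p assume "p < max 1 (Suc n)"
  then have p: "p \<le> n" by simp
  have es: "local_homeomorphism (gtop G) (gtop G) (\<lambda>g. \<eta> (src G g))"
    using local_homeomorphism_comp[OF local_homeo_src eta_lh] by (simp add: comp_def)
  have er: "local_homeomorphism (gtop G) (gtop G) (\<lambda>g. \<eta> (rng G g))"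
    using local_homeomorphism_comp[OF local_homeo_rng eta_lh] by (simp add: comp_def)
  have h: "H n i xs ! p = (if p < i then \<phi> (xs ! p) else if p = i then \<eta> (vtx n i xs) else xs ! (p - 1))" for xs
    by (rule hm_nth[OF p])
  consider "p < i" | "p = i" "i < max 1 n" | "p = i" "\<not> i < max 1 n" | "i < p" by linarith
  then show "etc n (\<lambda>xs. H n i xs ! p)"
  proof cases
    case 1
    then have "p < max 1 n" using i by simp
    then show ?thesis unfolding h using 1 etc_lh[OF etale_functorD(1)[OF phi]] by simp
  next
    case 2
    then show ?thesis unfolding h vtx_def using etc_lh[OF er, of i n] by simp
  next
    case 3
    then have ni: "i = n" "0 < n" using i by auto
    then have "vtx n i xs = src G (xs ! (n - 1))" for xs by (simp add: vtx_def)
    then show ?thesis unfolding h using etc_lh[OF es, of "n - 1" n] ni 3 by simp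
  next
    case 4
    then show ?thesis unfolding h using etc_nth[of "p - 1" n] p by simp
  qed
qed

text \<open>Face 0 removes the inserted arrow and leaves the original simplex. In degree 0 this says
  that the arrow at \<open>u\<close> has source \<open>u\<close>; here the exchanged faces of
  \<open>fc\<close> are the correct ones.\<close>

lemma fc_hm_first: "xs \<in> nerve G n \<Longrightarrow> fc (Suc n) 0 (H n 0 xs) = xs"
proof (cases n)
  case 0
  assume xs: "xs \<in> nerve G n"
  then obtain g where "g \<in> units G" "xs = [g]" using nerve_singleton[OF xs] 0 by auto
  then show ?thesis using 0 eta_src by (simp add: fc_def face_def hm_def vtx_def)
next
  case (Suc m)
  assume xs: "xs \<in> nerve G n"
  have n2: "2 \<le> Suc n" using Suc by simp
  have len: "length xs = n" using nerve_length[OF xs] Suc by simp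
  have f: "fc (Suc n) 0 = face G (Suc n) 0" using Suc by (simp add: fc_def)
  show ?thesis unfolding f
  proof (rule nth_equalityI)
    show l: "length (face G (Suc n) 0 (H n 0 xs)) = length xs" using face_length[OF n2, of 0 "H n 0 xs"] len by simp
    fix p assume "p < length (face G (Suc n) 0 (H n 0 xs))"
    then have "p < Suc n - 1" "Suc p \<le> n" using l len by simp_all
    then show "face G (Suc n) 0 (H n 0 xs) ! p = xs ! p" using face_nth[where G = G, OF n2, of 0 "H n 0 xs" p] by (simp add: hm_nth)
  qed
qed

lemma fc_hm_last: "xs \<in> nerve G n \<Longrightarrow> fc (Suc n) (Suc n) (H n n xs) = map \<phi> xs"
proof (cases n)
  case 0
  assume xs: "xs \<in> nerve G n"
  then obtain g where "g \<in> units G" "xs = [g]" using nerve_singleton[OF xs] 0 by auto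
  then show ?thesis using 0 eta_rng by (simp add: fc_def face_def hm_def vtx_def)
next
  case (Suc m)
  assume xs: "xs \<in> nerve G n"
  have n2: "2 \<le> Suc n" using Suc by simp
  have len: "length xs = n" using nerve_length[OF xs] Suc by simp
  have f: "fc (Suc n) (Suc n) = face G (Suc n) (Suc n)" using Suc by (simp add: fc_def)
  show ?thesis unfolding f
  proof (rule nth_equalityI)
    show l: "length (face G (Suc n) (Suc n) (H n n xs)) = length (map \<phi> xs)"
      using face_length[OF n2, of "Suc n" "H n n xs"] len by simp
    fix p assume "p < length (face G (Suc n) (Suc n) (H n n xs))"
    then have "p < Suc n - 1" "p < n" using l len by simp_all
    then show "face G (Suc n) (Suc n) (H n n xs) ! p = map \<phi> xs ! p"
      using face_nth[where G = G, OF n2, of "Suc n" "H n n xs" p] len by (simp add: hm_nth)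
  qed
qed

text \<open>Neighbouring prisms share a face. The two faces differ at most in entry
  \<open>i - 1\<close>, where one multiplies \<open>\<phi>\<close> of the arrow by
  \<open>\<eta>\<close> at its source and the other \<open>\<eta>\<close> at its range by the arrow;
  naturality equates them.\<close>

lemma fc_hm_diag:
  assumes i: "1 \<le> i" "i \<le> n" and xs: "xs \<in> nerve G n"
  shows "fc (Suc n) i (H n i xs) = fc (Suc n) i (H n (i - 1) xs)"
proof -
  have n: "1 \<le> n" using i by simp
  have n2: "2 \<le> Suc n" using n by simp
  have iS: "i \<le> Suc n" using i by simp
  have f: "fc (Suc n) i = face G (Suc n) i" using n by (simp add: fc_def)
  have e: "xs ! q \<in> elts G" if "q < n" for q using nerve_elts[OF xs] that by simp
  show ?thesis unfolding f
  proof (rule nth_equalityI)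
    show "length (face G (Suc n) i (H n i xs)) = length (face G (Suc n) i (H n (i - 1) xs))"
      using face_length[OF n2 iS, of "H n i xs"] face_length[OF n2 iS, of "H n (i - 1) xs"] by simp
    fix p assume "p < length (face G (Suc n) i (H n i xs))"
    then have p: "p < Suc n - 1" using face_length[OF n2 iS, of "H n i xs"] by simp
    then have pn: "p \<le> n" "Suc p \<le> n" "p < n" by simp_all
    have nat: "gmul G (\<phi> (xs ! p)) (\<eta> (vtx n (Suc p) xs)) = gmul G (\<eta> (vtx n p xs)) (xs ! p)"
      using natural[OF e[OF pn(3)]] src_vtx[OF xs pn(3)] rng_vtx[OF pn(3)] by simp
    note a = face_nth[where G = G, OF n2 iS hm_length p] hm_nth[OF pn(1)] hm_nth[OF pn(2)]
    consider "Suc p < i" | "i = Suc p" | "i < Suc p" by linarith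
    then show "face G (Suc n) i (H n i xs) ! p = face G (Suc n) i (H n (i - 1) xs) ! p"
      unfolding a by cases (use nat i in auto)
  qed
qed

text \<open>The face acts on the part of the prism that carries \<open>\<phi>\<close>, so
  contracting two arrows there uses that \<open>\<phi>\<close> is multiplicative. In the upper case
  below the affected arrows are unchanged ones.\<close>

lemma fc_hm_lower:
  assumes n: "1 \<le> n" and ij: "i < j" "j \<le> n" and xs: "xs \<in> nerve G n"
  shows "fc (Suc n) i (H n j xs) = H (n - 1) (j - 1) (fc n i xs)"
proof (cases "n = 1")
  case True
  then obtain g where g: "g \<in> elts G" "xs = [g]" using nerve_singleton[OF xs] by auto
  have "i = 0" "j = 1" using ij True by simp_all
  then show ?thesis using g True by (simp add: fc_def face_def hm_def vtx_def)
next
  case False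
  then have n2: "2 \<le> n" "2 \<le> Suc n" using n by simp_all
  have i: "i \<le> n" "i \<le> Suc n" using ij by simp_all
  have f: "fc (Suc n) i = face G (Suc n) i" "fc n i = face G n i" using n False by (auto simp: fc_def)
  have len: "length xs = n" using nerve_length[OF xs] n by simp
  have e: "xs ! q \<in> elts G" if "q < n" for q using nerve_elts[OF xs] that by simp
  have v: "vtx (n - 1) (j - 1) (face G n i xs) = vtx n j xs"
  proof -
    have j: "i \<le> j - 1" "Suc (j - 1) = j" "j - 1 \<le> n - 1" using ij by simp_all
    show ?thesis using vtx_face[OF n2(1) i(1) xs j(3)] unfolding j(2) using j(1) by simp
  qed
  show ?thesis unfolding f
  proof (rule nth_equalityI)
    show "length (face G (Suc n) i (H n j xs)) = length (H (n - 1) (j - 1) (face G n i xs))"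
      using face_length[OF n2(2) i(2), of "H n j xs"] n by simp
    fix p assume "p < length (face G (Suc n) i (H n j xs))"
    then have p: "p < Suc n - 1" using face_length[OF n2(2) i(2), of "H n j xs"] by simp
    then have pn: "p \<le> n" "Suc p \<le> n" "p < n" "p \<le> n - 1" by simp_all
    note a = face_nth[where G = G, OF n2(2) i(2) hm_length p] hm_nth[OF pn(1)] hm_nth[OF pn(2)] hm_nth[OF pn(4)] v
    have z: "face G n i xs ! q = (if Suc q < i then xs ! q else if Suc q = i then gmul G (xs ! q) (xs ! Suc q) else xs ! Suc q)"
      if "q < n - 1" for q using face_nth[where G = G, OF n2(1) i(1) len that] .
    have mul: "\<phi> (gmul G (xs ! p) (xs ! Suc p)) = gmul G (\<phi> (xs ! p)) (\<phi> (xs ! Suc p))" if "Suc p < n"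
      using etale_functorD(5)[OF phi e e] nerve_src_rng[OF xs that] that by simp
    consider "Suc p < j" | "Suc p = j" | "j \<le> p" by linarith
    then show "face G (Suc n) i (H n j xs) ! p = H (n - 1) (j - 1) (face G n i xs) ! p"
    proof cases
      case 1
      then have "p < n - 1" "Suc p < n" using ij by simp_all
      then show ?thesis unfolding a using 1 ij mul z[of p] by auto
    next
      case 2
      then show ?thesis unfolding a using ij by auto
    next
      case 3
      then obtain p' where p': "p = Suc p'" using ij by (cases p) auto
      then have "p' < n - 1" using pn by simp
      then show ?thesis unfolding a using 3 ij z[of p'] p' by auto
    qed
  qed
qed

lemma fc_hm_upper:
  assumes n: "1 \<le> n" and ij: "Suc j < i" "i \<le> Suc n" and xs: "xs \<in> nerve G n"
  shows "fc (Suc n) i (H n j xs) = H (n - 1) j (fc n (i - 1) xs)"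
proof (cases "n = 1")
  case True
  then obtain g where g: "g \<in> elts G" "xs = [g]" using nerve_singleton[OF xs] by auto
  have "i = 2" "j = 0" using ij True by simp_all
  then show ?thesis using g True by (simp add: fc_def face_def hm_def vtx_def)
next
  case False
  then have n2: "2 \<le> n" "2 \<le> Suc n" using n by simp_all
  have i: "i - 1 \<le> n" using ij by simp
  have f: "fc (Suc n) i = face G (Suc n) i" "fc n (i - 1) = face G n (i - 1)" using n False by (auto simp: fc_def)
  have len: "length xs = n" using nerve_length[OF xs] n by simp
  have v: "vtx (n - 1) j (face G n (i - 1) xs) = vtx n j xs"
  proof -
    have j: "\<not> i - 1 \<le> j" "j \<le> n - 1" using ij by simp_all
    show ?thesis using vtx_face[OF n2(1) i xs j(2)] j(1) by simp
  qed
  show ?thesis unfolding f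
  proof (rule nth_equalityI)
    show "length (face G (Suc n) i (H n j xs)) = length (H (n - 1) j (face G n (i - 1) xs))"
      using face_length[OF n2(2) ij(2), of "H n j xs"] n by simp
    fix p assume "p < length (face G (Suc n) i (H n j xs))"
    then have p: "p < Suc n - 1" using face_length[OF n2(2) ij(2), of "H n j xs"] by simp
    then have pn: "p \<le> n" "Suc p \<le> n" "p < n" "p \<le> n - 1" by simp_all
    note a = face_nth[where G = G, OF n2(2) ij(2) hm_length p] hm_nth[OF pn(1)] hm_nth[OF pn(2)] hm_nth[OF pn(4)] v
    have z: "face G n (i - 1) xs ! q = (if Suc q < i - 1 then xs ! q else if Suc q = i - 1 then gmul G (xs ! q) (xs ! Suc q) else xs ! Suc q)"
      if "q < n - 1" for q using face_nth[where G = G, OF n2(1) i len that] .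
    consider "p < j" | "p = j" | "j < p" by linarith
    then show "face G (Suc n) i (H n j xs) ! p = H (n - 1) j (face G n (i - 1) xs) ! p"
    proof cases
      case 1
      then have "p < n - 1" using ij by simp
      then show ?thesis unfolding a using 1 ij z[of p] by auto
    next
      case 2
      then show ?thesis unfolding a using ij by auto
    next
      case 3
      then obtain p' where p': "p = Suc p'" by (cases p) auto
      then have "p' < n - 1" using pn by simp
      then show ?thesis unfolding a using 3 ij z[of p'] p' by auto
    qed
  qed
qed

lemma homotopy_sbd:
  assumes n: "1 \<le> n" and f: "f \<in> CC n"
  shows "sbd (Suc n) (apush n (H n) f) z + apush (n - 1) (H (n - 1)) (sbd n f) z = f z - push (map \<phi>) f z"
proof -
  have "sbd (Suc n) (apush n (H n) f) =
     (\<lambda>z. \<Sum>i\<le>Suc n. \<Sum>j\<le>n. alt (i + j) (push (fc (Suc n) i \<circ> H n j) f z))"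
    unfolding sbd_apush using et_hm et_fc[of "Suc n"] f by (intro apush_apush) auto
  moreover have "apush (n - 1) (H (n - 1)) (sbd n f) =
     (\<lambda>z. \<Sum>j\<le>n - 1. \<Sum>i\<le>n. alt (j + i) (push (H (n - 1) j \<circ> fc n i) f z))"
    unfolding sbd_apush using et_hm et_fc[OF n] f by (intro apush_apush) auto
  moreover have "(\<Sum>i\<le>Suc n. \<Sum>j\<le>n. alt (i + j) (push (fc (Suc n) i \<circ> H n j) f z)) +
     (\<Sum>j\<le>n - 1. \<Sum>i\<le>n. alt (j + i) (push (H (n - 1) j \<circ> fc n i) f z)) =
     push (fc (Suc n) 0 \<circ> H n 0) f z - push (fc (Suc n) (Suc n) \<circ> H n n) f z"
  proof (rule alternating_prism_sum[OF n])
    fix i j assume ij: "i < j" "j \<le> n"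
    have "push (fc (Suc n) i \<circ> H n j) f = push (H (n - 1) (j - 1) \<circ> fc n i) f"
      using fc_hm_lower[OF n ij] by (intro push_cong_nerve[OF f]) simp
    then show "push (fc (Suc n) i \<circ> H n j) f z = push (H (n - 1) (j - 1) \<circ> fc n i) f z" by simp
  next
    fix i j assume ij: "Suc j < i" "i \<le> Suc n"
    have "push (fc (Suc n) i \<circ> H n j) f = push (H (n - 1) j \<circ> fc n (i - 1)) f"
      using fc_hm_upper[OF n ij] by (intro push_cong_nerve[OF f]) simp
    then show "push (fc (Suc n) i \<circ> H n j) f z = push (H (n - 1) j \<circ> fc n (i - 1)) f z" by simp
  next
    fix i assume i: "1 \<le> i" "i \<le> n"
    have "push (fc (Suc n) i \<circ> H n i) f = push (fc (Suc n) i \<circ> H n (i - 1)) f"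
      using fc_hm_diag[OF i] by (intro push_cong_nerve[OF f]) simp
    then show "push (fc (Suc n) i \<circ> H n i) f z = push (fc (Suc n) i \<circ> H n (i - 1)) f z" by simp
  qed
  moreover have "push (fc (Suc n) 0 \<circ> H n 0) f = push (\<lambda>x. x) f"
    using fc_hm_first by (intro push_cong_nerve[OF f]) simp
  moreover have "push (fc (Suc n) (Suc n) \<circ> H n n) f = push (map \<phi>) f"
    using fc_hm_last by (intro push_cong_nerve[OF f]) simp
  moreover have "push (\<lambda>x. x) f = f"
  proof
    fix z
    have "push (\<lambda>x. x) f z = (\<Sum>y\<in>{z}. if y = z then f y else 0)" by (rule push_eq_sum) auto
    then show "push (\<lambda>x. x) f z = f z" by simp
  qed
  ultimately show ?thesis by simp
qed

text \<open>In degree 0 no boundary is left to which the prism operator could be applied, and the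
  two faces of the single prism are the whole sum.\<close>

lemma homotopy_sbd_0:
  assumes f: "f \<in> CC 0"
  shows "sbd 1 (apush 0 (H 0) f) z = f z - push (map \<phi>) f z"
proof -
  have "sbd 1 (apush 0 (H 0) f) =
     (\<lambda>z. \<Sum>i\<le>1. \<Sum>j\<le>0. alt (i + j) (push (fc 1 i \<circ> H 0 j) f z))"
    unfolding sbd_apush using et_hm[of _ 0] et_fc[of 1] f by (intro apush_apush) auto
  moreover have "push (fc 1 0 \<circ> H 0 0) f = push (\<lambda>x. x) f"
    using fc_hm_first[of _ 0] by (intro push_cong_nerve[OF f]) simp
  moreover have "push (fc 1 1 \<circ> H 0 0) f = push (map \<phi>) f"
    using fc_hm_last[of _ 0] by (intro push_cong_nerve[OF f]) simp
  moreover have "push (\<lambda>x. x) f = f"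
  proof
    fix z
    have "push (\<lambda>x. x) f z = (\<Sum>y\<in>{z}. if y = z then f y else 0)" by (rule push_eq_sum) auto
    then show "push (\<lambda>x. x) f z = f z" by simp
  qed
  ultimately show ?thesis by (simp add: alt_def)
qed

lemma natural_transformation_homologous:
  fixes f :: "'g list \<Rightarrow> 'a::ab_group_add"
  assumes f: "f \<in> CC n" and cyc: "bd G n f = (\<lambda>_. 0)"
  shows "\<exists>h\<in>CC (Suc n). \<forall>z. f z - push (map \<phi>) f z = bd G (Suc n) h z"
proof -
  let ?h = "apush n (H n) f"
  have hC: "?h \<in> CC (Suc n)" using et_hm f by (intro apush_CC) auto
  have eq: "f z - push (map \<phi>) f z = sbd (Suc n) ?h z" for z
  proof (cases n)
    case 0
    then show ?thesis using homotopy_sbd_0[of f z] f by simp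
  next
    case (Suc m)
      have "sbd n f = (\<lambda>_. 0)" using cyc Suc by (auto simp: bd_alt alt_def fun_eq_iff split: if_splits)
    then show ?thesis using homotopy_sbd[of n f z] f Suc by (simp add: apush_zero)
  qed
  let ?e = "bd_sign n"
  \<comment> \<open>In degree one \<open>bd\<close> is the negative of \<open>sbd\<close>; giving
    the homotopy the same sign compensates for it.\<close>
  have "bd G (Suc n) (\<lambda>x. alt ?e (?h x)) z = sbd (Suc n) ?h z" for z
    by (cases "even ?e") (simp_all add: bd_alt alt_def sbd_apush apush_uminus)
  then show ?thesis using eq const_span_alt[OF hC] by (intro bexI[of _ "\<lambda>x. alt ?e (?h x)"]) auto
qed

end

end

context shift_groupoid
begin

section \<open>The shift acts bijectively on homology\<close>

abbreviation sft :: "nat \<Rightarrow> 'g \<Rightarrow> 'g" where "sft m \<equiv> gs ^^ m"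

lemma sft_functor: "etale_functor (sft m)"
  by (rule etale_functor_funpow[OF etale_functor_gshift])

lemmas sft_lh = etale_functorD(1)[OF sft_functor]
  and sft_elts = etale_functorD(2)[OF sft_functor]
  and sft_src = etale_functorD(3)[OF sft_functor]
  and sft_rng = etale_functorD(4)[OF sft_functor]
  and sft_mul = etale_functorD(5)[OF sft_functor]
  and sft_units = etale_functorD(6)[OF sft_functor]

lemma pi_sft: "u \<in> units G \<Longrightarrow> \<pi> (sft m u) i = \<pi> u (i + m)"
proof (induction m arbitrary: i)
  case (Suc m)
  then show ?case using sft_units[OF Suc.prems, of m] by (simp add: gshift_unit pi_sh_nth)
qed simp

lemma sft_lift:
  "a \<in> units G \<Longrightarrow> b \<in> units G \<Longrightarrow> h \<in> elts G \<Longrightarrow> src G h = sft m a \<Longrightarrow> rng G h = sft m b \<Longrightarrow>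
     \<exists>g\<in>elts G. src G g = a \<and> rng G g = b \<and> sft m g = h"
proof (induction m arbitrary: a b)
  case 0
  then show ?case by auto
next
  case (Suc m)
  have ab: "gs a \<in> units G" "gs b \<in> units G" using Suc.prems gshift_unit by simp_all
  have "src G h = sft m (gs a)" "rng G h = sft m (gs b)"
    using Suc.prems by (simp_all only: funpow_Suc_right comp_apply)
  then obtain g' where g': "g' \<in> elts G" "src G g' = gs a" "rng G g' = gs b" "sft m g' = h"
    using Suc.IH[OF ab Suc.prems(3)] by blast
  then obtain g where "g \<in> elts G" "src G g = a" "rng G g = b" "gs g = g'"
    using gshift_lift[OF Suc.prems(1,2) g'(1)] gshift_unit Suc.prems by auto
  then show ?case using g'(4) by (intro bexI[of _ g]) (simp_all add: funpow_Suc_right del: funpow.simps)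
qed

lemma sft_faithful:
  "g \<in> elts G \<Longrightarrow> h \<in> elts G \<Longrightarrow> src G g = src G h \<Longrightarrow> rng G g = rng G h \<Longrightarrow> sft m g = sft m h \<Longrightarrow> g = h"
proof (induction m arbitrary: g h)
  case (Suc m)
  have "gs g = gs h"
  proof (rule Suc.IH)
    show "sft m (gs g) = sft m (gs h)" using Suc.prems(5) by (simp only: funpow_Suc_right comp_apply)
  qed (use Suc.prems in simp_all)
  then show ?case using gshift_faithful Suc.prems by blast
qed simp

lemma topspace_imp_units: "continuous_map X (unit_top G) f \<Longrightarrow> x \<in> topspace X \<Longrightarrow> f x \<in> units G"
  by (auto simp: continuous_map_def)

lemma continuous_into_units:
  "continuous_map X (gtop G) f \<Longrightarrow> (\<And>x. x \<in> topspace X \<Longrightarrow> f x \<in> units G) \<Longrightarrow> continuous_map X (unit_top G) f"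
  unfolding unit_top_def continuous_map_in_subtopology by auto

text \<open>Lifting a continuous family of germs through the fully faithful local homeomorphism \<open>sft m\<close>.\<close>

lemma continuous_lift:
  assumes a: "continuous_map X (unit_top G) a" and b: "continuous_map X (unit_top G) b"
    and f: "continuous_map X (gtop G) f"
    and L: "\<And>x. x \<in> topspace X \<Longrightarrow> L x \<in> elts G \<and> src G (L x) = a x \<and> rng G (L x) = b x \<and> sft m (L x) = f x"
  shows "continuous_map X (gtop G) L"
proof -
  have cs: "continuous_map (gtop G) (gtop G) (sft m)" and os: "open_map (gtop G) (gtop G) (sft m)"
    using sft_lh[of m] by (auto simp: local_homeomorphism_iff)
  have inj: "\<exists>A. openin (unit_top G) A \<and> u \<in> A \<and> inj_on (sft m) A" if u: "u \<in> units G" for u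
  proof -
    obtain A where A: "openin (gtop G) A" "u \<in> A" "inj_on (sft m) A"
      using sft_lh[of m] units_elts[OF u] unfolding local_homeomorphism_iff topspace_gtop by meson
    have "openin (unit_top G) (A \<inter> units G)" using A openin_units by (simp add: openin_unit_top openin_Int)
    moreover have "inj_on (sft m) (A \<inter> units G)" using A(3) by (rule inj_on_subset) simp
    ultimately show ?thesis using A u by (intro exI[of _ "A \<inter> units G"]) simp
  qed
  have "openin X {x \<in> topspace X. L x \<in> W}" if W: "openin (gtop G) W" for W
  proof (subst openin_subopen, intro ballI)
    fix x assume "x \<in> {x \<in> topspace X. L x \<in> W}"
    then have x: "x \<in> topspace X" "L x \<in> W" by simp_all
    obtain A where A: "openin (unit_top G) A" "a x \<in> A" "inj_on (sft m) A"
      using inj[OF topspace_imp_units[OF a x(1)]] by blast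
    obtain B where B: "openin (unit_top G) B" "b x \<in> B" "inj_on (sft m) B"
      using inj[OF topspace_imp_units[OF b x(1)]] by blast
    \<comment> \<open>Both ends are confined to sets on which \<open>sft m\<close> is injective. An
      element of \<open>?E\<close> whose shift is \<open>f y\<close> then has the ends
      \<open>a y\<close> and \<open>b y\<close>, and by faithfulness it is
      \<open>L y\<close>.\<close>
    let ?E = "{g \<in> {g \<in> W. src G g \<in> A}. rng G g \<in> B}"
    have E: "openin (gtop G) ?E" using W A B by (intro openin_rng_vimage openin_src_vimage)
    then have sE: "openin (gtop G) (sft m ` ?E)" using os unfolding open_map_def by simp
    let ?N = "{y \<in> topspace X. f y \<in> sft m ` ?E} \<inter> ({y \<in> topspace X. a y \<in> A} \<inter> {y \<in> topspace X. b y \<in> B})"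
    have "openin X ?N"
      using openin_continuous_map_preimage[OF f sE] openin_continuous_map_preimage[OF a A(1)] openin_continuous_map_preimage[OF b B(1)] by (intro openin_Int)
    moreover have "f x \<in> sft m ` ?E" using L[OF x(1)] x(2) A(2) B(2) by (intro image_eqI[of _ _ "L x"]) simp_all
    then have "x \<in> ?N" using x A B by simp
    moreover have "?N \<subseteq> {x \<in> topspace X. L x \<in> W}"
    proof
      fix y assume y: "y \<in> ?N"
      then have yX: "y \<in> topspace X" by simp
      obtain g where g: "g \<in> W" "src G g \<in> A" "rng G g \<in> B" "sft m g = f y" using y by auto
      have ge: "g \<in> elts G" using g(1) openin_subset[OF W] by (auto simp: topspace_gtop)
      note Ly = L[OF yX]
      have "sft m (src G g) = sft m (a y)" using sft_src[OF ge, of m] sft_src[of "L y" m] g(4) Ly by simp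
      then have s: "src G g = a y" using inj_onD[OF A(3)] g(2) y by simp
      have "sft m (rng G g) = sft m (b y)" using sft_rng[OF ge, of m] sft_rng[of "L y" m] g(4) Ly by simp
      then have r: "rng G g = b y" using inj_onD[OF B(3)] g(3) y by simp
      have "g = L y" by (rule sft_faithful[of _ _ m]) (use ge Ly s r g(4) in simp_all)
      then show "y \<in> {x \<in> topspace X. L x \<in> W}" using g(1) yX by simp
    qed
    ultimately show "\<exists>T. openin X T \<and> x \<in> T \<and> T \<subseteq> {x \<in> topspace X. L x \<in> W}"
      using \<open>x \<in> ?N\<close> by (intro exI[of _ ?N]) simp
  qed
  then show ?thesis using L by (auto simp: continuous_map_def topspace_gtop)
qed

lemma lh_lift:
  assumes a: "continuous_map X (unit_top G) a" and b: "continuous_map X (unit_top G) b"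
    and f: "local_homeomorphism X (gtop G) f"
    and L: "\<And>x. x \<in> topspace X \<Longrightarrow> L x \<in> elts G \<and> src G (L x) = a x \<and> rng G (L x) = b x \<and> sft m (L x) = f x"
  shows "local_homeomorphism X (gtop G) L"
proof (rule local_homeomorphism_cancel[OF _ sft_lh[of m]])
  show "continuous_map X (gtop G) L"
    using f by (intro continuous_lift[OF a b _ L]) (simp_all add: local_homeomorphism_iff)
  show "local_homeomorphism X (gtop G) (sft m \<circ> L)"
    by (rule local_homeomorphism_eq[OF f]) (use L in simp)
qed

lemma lh_restrict_units: "local_homeomorphism (gtop G) Y f \<Longrightarrow> local_homeomorphism (unit_top G) Y f"
proof -
  assume f: "local_homeomorphism (gtop G) Y f"
  have "local_homeomorphism (unit_top G) (gtop G) (\<lambda>x. x)"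
    by (rule local_homeomorphism_into_units[OF lh_id])
  from local_homeomorphism_comp[OF this f] show ?thesis by (simp add: comp_def)
qed

text \<open>If \<open>\<phi>\<close> changes only finitely many initial letters, then \<open>\<phi>\<close> is naturally isomorphic
  to the identity.\<close>

lemma tail_preserving_homologous:
  fixes f :: "'g list \<Rightarrow> 'a::ab_group_add"
  assumes phi: "etale_functor \<phi>" and tail: "\<And>g. g \<in> elts G \<Longrightarrow> sft m (\<phi> g) = sft m g"
    and f: "f \<in> CC n" and cyc: "bd G n f = (\<lambda>_. 0)"
  shows "\<exists>h\<in>CC (Suc n). \<forall>z. f z - push (map \<phi>) f z = bd G (Suc n) h z"
proof -
  note p = etale_functorD[OF phi]
  \<comment> \<open>The points \<open>u\<close> and \<open>\<phi> u\<close> have the same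
    \<open>m\<close>-fold shift, so the unit at that shift has both as admissible ends for a
    lift.\<close>
  have "\<exists>g\<in>elts G. src G g = u \<and> rng G g = \<phi> u \<and> sft m g = sft m u" if u: "u \<in> units G" for u
  proof (rule sft_lift)
    show "u \<in> units G" "\<phi> u \<in> units G" "sft m u \<in> elts G" using u p sft_units units_elts by simp_all
    show "src G (sft m u) = sft m u" "rng G (sft m u) = sft m (\<phi> u)"
      using sft_units[OF u, of m] tail[OF units_elts[OF u]] by simp_all
  qed
  then have ex: "\<exists>g. g \<in> elts G \<and> src G g = u \<and> rng G g = \<phi> u \<and> sft m g = sft m u" if "u \<in> units G" for u
    using that unfolding Bex_def by simp
  define \<eta> where "\<eta> u = (SOME g. g \<in> elts G \<and> src G g = u \<and> rng G g = \<phi> u \<and> sft m g = sft m u)" for u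
  have eta: "\<eta> u \<in> elts G \<and> src G (\<eta> u) = u \<and> rng G (\<eta> u) = \<phi> u \<and> sft m (\<eta> u) = sft m u"
    if "u \<in> units G" for u unfolding \<eta>_def by (rule someI_ex[OF ex[OF that]])
  have "local_homeomorphism (unit_top G) (gtop G) \<eta>"
  proof (rule lh_lift)
    show "continuous_map (unit_top G) (unit_top G) (\<lambda>u. u)" by simp
    have "continuous_map (unit_top G) (gtop G) \<phi>"
      using lh_restrict_units[OF p(1)] by (simp add: local_homeomorphism_iff)
    then show "continuous_map (unit_top G) (unit_top G) \<phi>"
      by (rule continuous_into_units) (simp add: p(6))
    show "local_homeomorphism (unit_top G) (gtop G) (sft m)" by (rule lh_restrict_units[OF sft_lh])
    show "\<eta> u \<in> elts G \<and> src G (\<eta> u) = u \<and> rng G (\<eta> u) = \<phi> u \<and> sft m (\<eta> u) = sft m u"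
      if "u \<in> topspace (unit_top G)" for u using eta that by simp
  qed
  moreover have "gmul G (\<phi> g) (\<eta> (src G g)) = gmul G (\<eta> (rng G g)) g" if g: "g \<in> elts G" for g
  proof (rule sft_faithful[of _ _ m])
    note es = eta[OF src_units[OF g]] and er = eta[OF rng_units[OF g]]
    have c: "src G (\<phi> g) = rng G (\<eta> (src G g))" "src G (\<eta> (rng G g)) = rng G g"
      using es er p(3)[OF g] by simp_all
    show "gmul G (\<phi> g) (\<eta> (src G g)) \<in> elts G" "gmul G (\<eta> (rng G g)) g \<in> elts G"
      using c es er g p(2) by simp_all
    show "src G (gmul G (\<phi> g) (\<eta> (src G g))) = src G (gmul G (\<eta> (rng G g)) g)"
      "rng G (gmul G (\<phi> g) (\<eta> (src G g))) = rng G (gmul G (\<eta> (rng G g)) g)"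
      using c es er g p(2) p(4) by simp_all
    \<comment> \<open>After \<open>m\<close> shifts the arrows \<open>\<eta>\<close> become units
      and \<open>\<phi>\<close> becomes invisible, so both sides of the naturality square reduce to
      \<open>sft m g\<close>. Faithfulness of the shift then lifts the equality.\<close>
    have "sft m (gmul G (\<phi> g) (\<eta> (src G g))) = gmul G (sft m g) (sft m (src G g))"
      using sft_mul[OF p(2)[OF g] _ c(1)] es tail[OF g] by simp
    also have "\<dots> = sft m g" using mul_src[OF sft_elts[OF g, of m]] sft_src[OF g, of m] by simp
    also have "\<dots> = gmul G (sft m (rng G g)) (sft m g)" using mul_rng[OF sft_elts[OF g, of m]] sft_rng[OF g, of m] by simp
    also have "\<dots> = sft m (gmul G (\<eta> (rng G g)) g)" using sft_mul[OF _ g c(2)] er by simp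
    finally show "sft m (gmul G (\<phi> g) (\<eta> (src G g))) = sft m (gmul G (\<eta> (rng G g)) g)" .
  qed
  ultimately show ?thesis
    using eta by (intro natural_transformation_homologous[OF phi _ _ _ _ f cyc, of \<eta>]) simp_all
qed

text \<open>In a finite graph every path repeats an edge among its first \<open>k + 1\<close> ones; running through the cycle
  between the repetitions once more exhibits \<open>\<sigma>\<^sup>k(w)\<close> as an element of the range of \<open>\<sigma>\<^sup>k\<^sup>+\<^sup>1\<close>,
  even when \<open>\<sigma>\<close> is not surjective.\<close>

lemma ex_section:
  "\<exists>k q. continuous_map (unit_top G) (unit_top G) q \<and> (\<forall>u\<in>units G. sft (Suc k) (q u) = sft k u)"
proof -
  define k where "k = card (arcs D)"
  define sel where "sel w = (SOME p. fst p < snd p \<and> snd p \<le> k \<and> w (fst p) = (w (snd p) :: 'x))" for w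
  \<comment> \<open>With \<open>i\<close> and \<open>j\<close> the two places selected by
    \<open>sel\<close>, this path runs through the letters from \<open>i\<close> to
    \<open>j - 1\<close> a second time, so that from place \<open>j\<close> on it is
    \<open>w\<close> delayed by \<open>j - i\<close>.\<close>
  define b where "b w n = (if n < snd (sel w) then w n else w (n - (snd (sel w) - fst (sel w))) :: 'x)" for w n
  \<comment> \<open>Dropping all but one letter of the delay leaves a delay of exactly one, whatever
    the length of the repeated cycle.\<close>
  define c where "c w n = b w (n + (snd (sel w) - fst (sel w) - 1))" for w n
  have sel: "fst (sel w) < snd (sel w) \<and> snd (sel w) \<le> k \<and> w (fst (sel w)) = w (snd (sel w))"
    if w: "w \<in> paths D" for w
  proof -
    have "\<not> inj_on w {..k}"
    proof
      assume "inj_on w {..k}"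
      moreover have "w ` {..k} \<subseteq> arcs D" using w by (auto simp: paths_def)
      ultimately have "card {..k} \<le> k" unfolding k_def using card_inj_on_le finite_arcs by blast
      then show False by simp
    qed
    then obtain i j where "i \<le> k" "j \<le> k" "i \<noteq> j" "w i = w j" by (auto simp: inj_on_def)
    then have "\<exists>p. fst p < snd p \<and> snd p \<le> k \<and> w (fst p) = w (snd p)"
      by (metis fst_conv snd_conv linorder_neqE_nat)
    then show ?thesis unfolding sel_def by (rule someI_ex)
  qed
  have bp: "head D (b w n) = tail D (b w (Suc n)) \<and> b w n \<in> arcs D" if w: "w \<in> paths D" for w n
  proof -
    let ?i = "fst (sel w)" and ?j = "snd (sel w)"
    have s: "?i < ?j" "w ?i = w ?j" using sel[OF w] by simp_all
    have wp: "w m \<in> arcs D" "head D (w m) = tail D (w (Suc m))" for m using w by (simp_all add: paths_def)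
    consider "Suc n < ?j" | "Suc n = ?j" | "?j \<le> n" by linarith
    then show ?thesis
    proof cases
      case 1
      then show ?thesis using wp by (simp add: b_def)
    next
      case 2
      then have "b w n = w n" "b w (Suc n) = w ?i" using s(1) by (simp_all add: b_def)
      then show ?thesis using wp[of n] 2 s(2) by simp
    next
      case 3
      then have "Suc n - (?j - ?i) = Suc (n - (?j - ?i))" using s(1) by linarith
      then show ?thesis using wp 3 by (simp add: b_def)
    qed
  qed
  have cp: "c w \<in> paths D" if w: "w \<in> paths D" for w
  proof -
    have "c w (Suc n) = b w (Suc (n + (snd (sel w) - fst (sel w) - 1)))" for n
      by (simp add: c_def)
    then show ?thesis using bp[OF w] by (simp add: paths_def c_def)
  qed
  have ck: "c w (n + Suc k) = w (n + k)" if w: "w \<in> paths D" for w n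
  proof -
    let ?i = "fst (sel w)" and ?j = "snd (sel w)"
    have s: "?i < ?j" "?j \<le> k" using sel[OF w] by simp_all
    have "n + Suc k + (?j - ?i - 1) = n + k + (?j - ?i)" using s by linarith
    then have "c w (n + Suc k) = b w (n + k + (?j - ?i))" by (simp only: c_def)
    moreover have "\<not> n + k + (?j - ?i) < ?j" using s by linarith
    ultimately show ?thesis by (simp only: b_def if_False add_diff_cancel_right')
  qed
  \<comment> \<open>Continuity: the selected pair depends only on the letters with index at most
    \<open>k\<close>, and the first \<open>M\<close> letters of \<open>c w\<close> involve only
    letters of \<open>w\<close> with index below \<open>M + Suc k\<close>.\<close>
  have cont: "c w n = c w' n" if w: "w \<in> paths D" and eq: "\<forall>i<M + Suc k. w' i = w i" and n: "n < M" for w w' n M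
  proof -
    have e: "w' i = w i" if "i \<le> k" for i using eq that by simp
    have "(fst p < snd p \<and> snd p \<le> k \<and> w' (fst p) = w' (snd p)) \<longleftrightarrow>
        (fst p < snd p \<and> snd p \<le> k \<and> w (fst p) = w (snd p))" for p
      using e[of "fst p"] e[of "snd p"] by auto
    then have sl: "sel w' = sel w" unfolding sel_def by simp
    let ?i = "fst (sel w)" and ?j = "snd (sel w)"
    have s: "?i < ?j" "?j \<le> k" using sel[OF w] by simp_all
    let ?m = "n + (?j - ?i - 1)"
    show ?thesis
    proof (cases "?m < ?j")
      case True
      then have "?m < M + Suc k" using s by linarith
      then show ?thesis using eq True by (simp add: c_def b_def sl)
    next
      case False
      have "?m - (?j - ?i) < M + Suc k" using n by linarith
      then show ?thesis using eq False by (simp add: c_def b_def sl)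
    qed
  qed
  define q where "q u = pt (c (\<pi> u))" for u
  have qu: "q u \<in> units G" "\<pi> (q u) = c (\<pi> u)" if "u \<in> units G" for u
    using that cp[OF pi_paths] by (simp_all add: q_def pt_units pi_pt)
  have "sft (Suc k) (q u) = sft k u" if u: "u \<in> units G" for u
  proof (rule unit_eqI)
    show "sft (Suc k) (q u) \<in> units G" "sft k u \<in> units G" using sft_units qu u by blast+
    show "\<pi> (sft (Suc k) (q u)) = \<pi> (sft k u)"
      using pi_sft[OF qu(1)[OF u], of "Suc k"] pi_sft[OF u, of k] qu(2)[OF u] ck[OF pi_paths[OF u]]
      by (simp add: fun_eq_iff del: funpow.simps)
  qed
  moreover have "continuous_map (unit_top G) (unit_top G) q"
  proof -
    have "openin (unit_top G) {u \<in> units G. q u \<in> W}" if W: "openin (unit_top G) W" for W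
    proof (subst openin_subopen, intro ballI)
      fix u assume u: "u \<in> {u \<in> units G. q u \<in> W}"
      then obtain M where M: "cyl M (q u) \<subseteq> W" using cyl_basis[OF W] by blast
      have uu: "u \<in> units G" using u by simp
      have "cyl (M + Suc k) u \<subseteq> {u \<in> units G. q u \<in> W}"
      proof
        fix v assume v: "v \<in> cyl (M + Suc k) u"
        then have vu: "v \<in> units G" by (simp add: cyl_def)
        have "c (\<pi> u) n = c (\<pi> v) n" if "n < M" for n
          using cont[OF pi_paths[OF uu] _ that, of "\<pi> v"] v by (simp add: cyl_def)
        then have "q v \<in> cyl M (q u)" using qu[OF vu] qu[OF uu] by (simp add: cyl_def)
        then show "v \<in> {u \<in> units G. q u \<in> W}" using M vu by blast
      qed
      then show "\<exists>T. openin (unit_top G) T \<and> u \<in> T \<and> T \<subseteq> {u \<in> units G. q u \<in> W}"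
        using openin_cyl[OF uu] in_cyl[OF uu] by (intro exI[of _ "cyl (M + Suc k) u"]) simp
    qed
    then show ?thesis using qu(1) by (simp add: continuous_map_def)
  qed
  ultimately show ?thesis by blast
qed

text \<open>The value at \<open>g\<close> is the unique lift of \<open>sft k g\<close> through
  \<open>sft (Suc k)\<close> whose ends are given by \<open>q\<close>. Uniqueness of lifts makes it
  multiplicative, and \<open>lh_lift\<close> makes it a local homeomorphism although
  \<open>q\<close> is only known to be continuous.\<close>

lemma ex_quasi_inverse:
  "\<exists>\<theta> k. etale_functor \<theta> \<and> (\<forall>g\<in>elts G. sft (Suc k) (\<theta> g) = sft k g)"
proof -
  obtain k q where q: "continuous_map (unit_top G) (unit_top G) q"
    "\<And>u. u \<in> units G \<Longrightarrow> sft (Suc k) (q u) = sft k u" using ex_section by blast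
  have qu: "q u \<in> units G" if "u \<in> units G" for u using topspace_imp_units[OF q(1)] that by simp
  let ?P = "\<lambda>g h. h \<in> elts G \<and> src G h = q (src G g) \<and> rng G h = q (rng G g) \<and> sft (Suc k) h = sft k g"
  have ex: "\<exists>h. ?P g h" if g: "g \<in> elts G" for g
  proof -
    have "\<exists>h\<in>elts G. src G h = q (src G g) \<and> rng G h = q (rng G g) \<and> sft (Suc k) h = sft k g"
    proof (rule sft_lift)
      show "q (src G g) \<in> units G" "q (rng G g) \<in> units G" "sft k g \<in> elts G" using g qu sft_elts by simp_all
      show "src G (sft k g) = sft (Suc k) (q (src G g))" using q(2)[OF src_units[OF g]] sft_src[OF g, of k] by simp
      show "rng G (sft k g) = sft (Suc k) (q (rng G g))" using q(2)[OF rng_units[OF g]] sft_rng[OF g, of k] by simp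
    qed
    then show ?thesis unfolding Bex_def .
  qed
  define \<theta> where "\<theta> g = (SOME h. ?P g h)" for g
  have th: "?P g (\<theta> g)" if "g \<in> elts G" for g unfolding \<theta>_def by (rule someI_ex[OF ex[OF that]])
  have unit: "\<theta> u = q u" if u: "u \<in> units G" for u
  proof (rule sft_faithful[of _ _ "Suc k"])
    note t = th[OF units_elts[OF u]]
    show "\<theta> u \<in> elts G" "q u \<in> elts G" "src G (\<theta> u) = src G (q u)" "rng G (\<theta> u) = rng G (q u)"
      using t u qu[OF u] units_elts by simp_all
    show "sft (Suc k) (\<theta> u) = sft (Suc k) (q u)" using t q(2)[OF u] by simp
  qed
  have lh: "local_homeomorphism (gtop G) (gtop G) \<theta>"
  proof (rule lh_lift)
    show "continuous_map (gtop G) (unit_top G) (q \<circ> src G)" by (rule continuous_map_compose[OF continuous_src q(1)])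
    show "continuous_map (gtop G) (unit_top G) (q \<circ> rng G)" by (rule continuous_map_compose[OF continuous_rng q(1)])
    show "local_homeomorphism (gtop G) (gtop G) (sft k)" by (rule sft_lh)
    show "\<theta> x \<in> elts G \<and> src G (\<theta> x) = (q \<circ> src G) x \<and> rng G (\<theta> x) = (q \<circ> rng G) x \<and> sft (Suc k) (\<theta> x) = sft k x"
      if "x \<in> topspace (gtop G)" for x using th that by (simp add: topspace_gtop del: funpow.simps)
  qed
  have "\<theta> (gmul G g h) = gmul G (\<theta> g) (\<theta> h)" if gh: "g \<in> elts G" "h \<in> elts G" "src G g = rng G h" for g h
  proof (rule sft_faithful[of _ _ "Suc k"])
    note tg = th[OF gh(1)] and thh = th[OF gh(2)] and tm = th[OF mul_elts[OF gh]]
    have c: "src G (\<theta> g) = rng G (\<theta> h)" using tg thh gh(3) by simp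
    show "\<theta> (gmul G g h) \<in> elts G" using tm by simp
    show "gmul G (\<theta> g) (\<theta> h) \<in> elts G" using tg thh c by simp
    show "src G (\<theta> (gmul G g h)) = src G (gmul G (\<theta> g) (\<theta> h))"
      "rng G (\<theta> (gmul G g h)) = rng G (gmul G (\<theta> g) (\<theta> h))" using tm tg thh c gh by simp_all
    have "sft (Suc k) (\<theta> (gmul G g h)) = sft k (gmul G g h)" using tm by simp
    also have "\<dots> = gmul G (sft k g) (sft k h)" by (rule sft_mul[OF gh])
    also have "\<dots> = gmul G (sft (Suc k) (\<theta> g)) (sft (Suc k) (\<theta> h))" using tg thh by simp
    also have "\<dots> = sft (Suc k) (gmul G (\<theta> g) (\<theta> h))" using sft_mul[of "\<theta> g" "\<theta> h" "Suc k"] tg thh c by simp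
    finally show "sft (Suc k) (\<theta> (gmul G g h)) = sft (Suc k) (gmul G (\<theta> g) (\<theta> h))" .
  qed
  then have "etale_functor \<theta>" unfolding etale_functor_def using lh th unit by simp
  then show ?thesis using th by blast
qed

abbreviation T :: "('g list \<Rightarrow> 'a::ab_group_add) \<Rightarrow> 'g list \<Rightarrow> 'a" where
  "T \<equiv> push (nshift G \<pi>)"

lemma T_CC: "f \<in> CC n \<Longrightarrow> T f \<in> CC n"
  by (rule push_map_CC[OF etale_functor_gshift])

lemma bd_T: "f \<in> CC n \<Longrightarrow> bd G n (T f) = T (bd G n f)"
  by (rule bd_push_map[OF etale_functor_gshift])

text \<open>Take for \<open>c\<close> the push-forward of \<open>f\<close> along
  \<open>\<theta>\<close>. Then \<open>T c\<close> belongs to the functor \<open>gs\<close> after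
  \<open>\<theta>\<close>, which does not change the \<open>k\<close>-fold shift, so
  \<open>f\<close> and \<open>T c\<close> are homologous.\<close>

lemma T_homology_surj:
  fixes f :: "'g list \<Rightarrow> 'a::ab_group_add"
  assumes f: "f \<in> CC n" "bd G n f = (\<lambda>_. 0)"
  shows "\<exists>c\<in>CC n. bd G n c = (\<lambda>_. 0) \<and> (\<exists>h\<in>CC (Suc n). \<forall>z. f z - T c z = bd G (Suc n) h z)"
proof -
  obtain \<theta> k where th: "etale_functor \<theta>" "\<And>g. g \<in> elts G \<Longrightarrow> sft (Suc k) (\<theta> g) = sft k g"
    using ex_quasi_inverse by blast
  let ?c = "push (map \<theta>) f"
  have c: "?c \<in> CC n" "bd G n ?c = (\<lambda>_. 0)"
    using push_map_CC[OF th(1) f(1)] bd_push_map[OF th(1) f(1)] f(2) by (simp_all add: push_zero)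
  have eq: "T ?c = push (map (\<lambda>g. gs (\<theta> g))) f" by (rule push_map_map[OF etale_functor_gshift th(1) f(1)])
  have "\<exists>h\<in>CC (Suc n). \<forall>z. f z - push (map (\<lambda>g. gs (\<theta> g))) f z = bd G (Suc n) h z"
  proof (rule tail_preserving_homologous[of _ k])
    show "etale_functor (\<lambda>g. gs (\<theta> g))" by (rule etale_functor_comp[OF etale_functor_gshift th(1)])
    show "sft k (gs (\<theta> g)) = sft k g" if "g \<in> elts G" for g
      using th(2)[OF that] by (simp only: funpow_Suc_right comp_apply)
  qed (use f in simp_all)
  then show ?thesis unfolding eq[symmetric] using c by blast
qed

text \<open>Pushing \<open>T c\<close> forward along \<open>\<theta>\<close> gives a boundary. It
  also gives a cycle homologous to \<open>c\<close>, because \<open>\<theta>\<close> after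
  \<open>gs\<close> preserves the shift of order \<open>Suc k\<close>.\<close>

lemma T_homology_inj:
  fixes c :: "'g list \<Rightarrow> 'a::ab_group_add"
  assumes c: "c \<in> CC n" "bd G n c = (\<lambda>_. 0)" and h: "h \<in> CC (Suc n)" "T c = bd G (Suc n) h"
  shows "\<exists>h'\<in>CC (Suc n). c = bd G (Suc n) h'"
proof -
  obtain \<theta> k where th: "etale_functor \<theta>" "\<And>g. g \<in> elts G \<Longrightarrow> sft (Suc k) (\<theta> g) = sft k g"
    using ex_quasi_inverse by blast
  have "\<exists>h\<in>CC (Suc n). \<forall>z. c z - push (map (\<lambda>g. \<theta> (gs g))) c z = bd G (Suc n) h z"
  proof (rule tail_preserving_homologous[of _ "Suc k"])
    show "etale_functor (\<lambda>g. \<theta> (gs g))" by (rule etale_functor_comp[OF th(1) etale_functor_gshift])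
    show "sft (Suc k) (\<theta> (gs g)) = sft (Suc k) g" if "g \<in> elts G" for g
      using th(2)[OF gshift_elts[OF that]] by (simp only: funpow_Suc_right comp_apply)
  qed (use c in simp_all)
  then obtain h1 where h1: "h1 \<in> CC (Suc n)" "\<And>z. c z - push (map (\<lambda>g. \<theta> (gs g))) c z = bd G (Suc n) h1 z" by blast
  have "push (map (\<lambda>g. \<theta> (gs g))) c = push (map \<theta>) (T c)"
    by (rule push_map_map[OF th(1) etale_functor_gshift c(1), symmetric])
  also have "\<dots> = bd G (Suc n) (push (map \<theta>) h)" unfolding h(2) by (rule bd_push_map[OF th(1) h(1), symmetric])
  finally have "c z = bd G (Suc n) h1 z + bd G (Suc n) (push (map \<theta>) h) z" for z using h1(2)[of z] by (simp add: diff_eq_eq)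
  then have "c = bd G (Suc n) (\<lambda>x. h1 x + push (map \<theta>) h x)"
    unfolding bd_add[OF h1(1) push_map_CC[OF th(1) h(1)]] by (rule ext)
  then show ?thesis using const_span_add[OF h1(1) push_map_CC[OF th(1) h(1)]] by blast
qed

end

lemma begins_append:
  "begins w (v @ v') \<longleftrightarrow> begins w v \<and> begins (\<lambda>i. w (i + length v)) v'"
proof
  assume L: "begins w (v @ v')"
  have "w i = v ! i" if "i < length v" for i
    using L[unfolded begins_def, rule_format, of i] that by (simp add: nth_append)
  moreover have "w (i + length v) = v' ! i" if "i < length v'" for i
    using L[unfolded begins_def, rule_format, of "i + length v"] that by (simp add: nth_append)
  ultimately show "begins w v \<and> begins (\<lambda>i. w (i + length v)) v'" by (simp add: begins_def)
next
  assume R: "begins w v \<and> begins (\<lambda>i. w (i + length v)) v'"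
  show "begins w (v @ v')" unfolding begins_def
  proof (intro allI impI)
    fix i assume i: "i < length (v @ v')"
    show "w i = (v @ v') ! i"
    proof (cases "i < length v")
      case True
      then show ?thesis using R by (simp add: begins_def nth_append)
    next
      case False
      then have "i = (i - length v) + length v" "i - length v < length v'" using i by simp_all
      then show ?thesis using R False unfolding begins_def nth_append by metis
    qed
  qed
qed

lemma begins_map: "begins w (map w [0..<m])"
  by (simp add: begins_def)

lemma begins_unique: "begins w v \<Longrightarrow> length v = m \<Longrightarrow> v = map w [0..<m]"
  by (rule nth_equalityI) (simp_all add: begins_def)

text \<open>A version of \<open>const_on_partition\<close> indexed by a family, since it will be
  indexed by tuples of words; several of these may give the same empty piece.\<close>

lemma const_on_family:
  assumes "finite I" and disj: "\<And>i j x. i \<in> I \<Longrightarrow> j \<in> I \<Longrightarrow> x \<in> A i \<Longrightarrow> x \<in> A j \<Longrightarrow> i = j"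
  shows "const_on a (\<Union>i\<in>I. A i) = (\<lambda>x. \<Sum>i\<in>I. const_on a (A i) x)"
proof
  fix x
  show "const_on a (\<Union>i\<in>I. A i) x = (\<Sum>i\<in>I. const_on a (A i) x)"
  proof (cases "x \<in> (\<Union>i\<in>I. A i)")
    case True
    then obtain k where k: "k \<in> I" "x \<in> A k" by blast
    have "(\<Sum>i\<in>I. const_on a (A i) x) = (\<Sum>i\<in>{k}. const_on a (A i) x)"
    proof (rule sum.mono_neutral_right)
      show "\<forall>i\<in>I - {k}. const_on a (A i) x = 0"
      proof
        fix i assume "i \<in> I - {k}"
        then have "x \<notin> A i" using disj[of i k x] k by blast
        then show "const_on a (A i) x = 0" by (simp add: const_on_def)
      qed
    qed (use k assms(1) in simp_all)
    then show ?thesis using True k by (simp add: const_on_def)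
  next
    case False
    then have "(\<Sum>i\<in>I. const_on a (A i) x) = 0" by (intro sum.neutral ballI) (simp add: const_on_def)
    moreover have "const_on a (\<Union>i\<in>I. A i) x = 0" using False unfolding const_on_def by (rule if_not_P)
    ultimately show ?thesis by simp
  qed
qed

context shift_groupoid
begin

section \<open>Restrictions of multisections\<close>

lemma begins_cyl: "u \<in> units G \<Longrightarrow> begins (\<pi> u) v \<Longrightarrow> {w \<in> units G. begins (\<pi> w) v} = cyl (length v) u"
  by (auto simp: begins_def cyl_def)

lemma clopen_begins: "clopen {w \<in> units G. begins (\<pi> w) v}"
proof (cases "\<exists>u\<in>units G. begins (\<pi> u) v")
  case True
  then obtain u where u: "u \<in> units G" "begins (\<pi> u) v" by blast
  show ?thesis unfolding begins_cyl[OF u] by (rule clopen_cyl[OF u(1)])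
next
  case False
  then have e: "{w \<in> units G. begins (\<pi> w) v} = {}" by blast
  show ?thesis unfolding e by simp
qed

lemma begins_sft_eqI:
  assumes "a \<in> units G" "b \<in> units G" "begins (\<pi> a) v" "begins (\<pi> b) v" "sft (length v) a = sft (length v) b"
  shows "a = b"
proof (rule unit_eqI[OF assms(1,2)], rule ext)
  fix i show "\<pi> a i = \<pi> b i"
  proof (cases "i < length v")
    case True
    then show ?thesis using assms(3,4) by (simp add: begins_def)
  next
    case False
    then have "i = (i - length v) + length v" by simp
    then show ?thesis using pi_sft[OF assms(1), of "length v" "i - length v"]
        pi_sft[OF assms(2), of "length v" "i - length v"] assms(5) by simp
  qed
qed

lemma begins_sft: "a \<in> units G \<Longrightarrow> begins (\<pi> (sft m a)) v \<longleftrightarrow> begins (\<lambda>i. \<pi> a (i + m)) v"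
  by (simp add: begins_def pi_sft)

text \<open>With prefixes of length \<open>m\<close> fixed at both ends, an end is recovered from
  its \<open>m\<close>-fold shift. So \<open>sft m\<close> is injective on the bisection, and the
  image has injective source and range as well.\<close>

lemma cob_sft:
  assumes B: "cob B" and vu: "\<And>g. g \<in> B \<Longrightarrow> begins (\<pi> (rng G g)) v \<and> begins (\<pi> (src G g)) u"
    and len: "length v = m" "length u = m"
  shows "cob (sft m ` B)" "inj_on (sft m) B"
proof -
  have e: "g \<in> elts G" if "g \<in> B" for g using cob_subset[OF B] that by blast
  have s: "g = h" if gh: "g \<in> B" "h \<in> B" "sft m (src G g) = sft m (src G h)" for g h
  proof -
    have "src G g = src G h"
      by (rule begins_sft_eqI[of _ _ u]) (use gh vu len e in simp_all)
    then show ?thesis using B gh unfolding cob_iff by (auto dest: inj_onD)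
  qed
  have r: "g = h" if gh: "g \<in> B" "h \<in> B" "sft m (rng G g) = sft m (rng G h)" for g h
  proof -
    have "rng G g = rng G h"
      by (rule begins_sft_eqI[of _ _ v]) (use gh vu len e in simp_all)
    then show ?thesis using B gh unfolding cob_iff by (auto dest: inj_onD)
  qed
  have lh: "continuous_map (gtop G) (gtop G) (sft m)" "open_map (gtop G) (gtop G) (sft m)"
    using sft_lh[of m] by (simp_all add: local_homeomorphism_iff)
  show "inj_on (sft m) B"
  proof (rule inj_onI)
    fix g h assume gh: "g \<in> B" "h \<in> B" "sft m g = sft m h"
    then show "g = h" using s[OF gh(1,2)] sft_src[OF e[OF gh(1)], of m] sft_src[OF e[OF gh(2)], of m] by simp
  qed
  show "cob (sft m ` B)" unfolding cob_iff
  proof (intro conjI)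
    show "openin (gtop G) (sft m ` B)" using lh(2) B by (simp add: open_map_def cob_iff)
    show "compactin (gtop G) (sft m ` B)" using image_compactin[OF _ lh(1)] B by (simp add: cob_iff)
    show "inj_on (src G) (sft m ` B)"
    proof (rule inj_onI)
      fix x y assume "x \<in> sft m ` B" "y \<in> sft m ` B" and xy: "src G x = src G y"
      then obtain g h where gh: "g \<in> B" "h \<in> B" "x = sft m g" "y = sft m h" by blast
      then show "x = y" using s[OF gh(1,2)] xy sft_src[OF e[OF gh(1)], of m] sft_src[OF e[OF gh(2)], of m] by simp
    qed
    show "inj_on (rng G) (sft m ` B)"
    proof (rule inj_onI)
      fix x y assume "x \<in> sft m ` B" "y \<in> sft m ` B" and xy: "rng G x = rng G y"
      then obtain g h where gh: "g \<in> B" "h \<in> B" "x = sft m g" "y = sft m h" by blast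
      then show "x = y" using r[OF gh(1,2)] xy sft_rng[OF e[OF gh(1)], of m] sft_rng[OF e[OF gh(2)], of m] by simp
    qed
  qed
qed

definition fits :: "nat \<Rightarrow> 'x list list \<Rightarrow> 'g list \<Rightarrow> bool" where
  "fits n vs xs \<longleftrightarrow> (\<forall>i\<le>n. begins (\<pi> (vtx n i xs)) (vs ! i))"

definition words :: "nat \<Rightarrow> nat \<Rightarrow> 'x list list \<Rightarrow> bool" where
  "words n m vs \<longleftrightarrow> length vs = Suc n \<and> (\<forall>v\<in>set vs. length v = m)"

lemma words_nth: "words n m vs \<Longrightarrow> i \<le> n \<Longrightarrow> length (vs ! i) = m"
  by (simp add: words_def)

lemma map_funpow:
  fixes f :: "'c \<Rightarrow> 'c"
  shows "map f ^^ m = map (f ^^ m)"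
proof (induction m)
  case (Suc m)
  then show ?case by (simp add: comp_def fun_eq_iff)
qed (simp add: id_def)

lemma restriction_eq:
  assumes U: "U \<subseteq> nerve G n" and vs: "words n m vs"
  shows "restriction G \<pi> U vs = map (sft m) ` {xs \<in> U. fits n vs xs}"
proof -
  have "length (hd vs) = m" using vs by (cases vs) (auto simp: words_def)
  moreover have "(begins (\<pi> (rng G (hd xs))) (vs ! 0) \<and>
      (\<forall>i. 1 \<le> i \<and> i < length vs \<longrightarrow> begins (\<pi> (src G (xs ! (i - 1)))) (vs ! i))) \<longleftrightarrow> fits n vs xs" if "xs \<in> U" for xs
  proof -
    have xs: "xs \<in> nerve G n" using U that by blast
    have 0: "rng G (hd xs) = vtx n 0 xs" using nerve_hd[OF xs] by (simp add: vtx_def)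
    have 1: "src G (xs ! (i - 1)) = vtx n i xs" if "1 \<le> i" "i \<le> n" for i
      using src_vtx[OF xs, of "i - 1"] that by simp
    have l: "i < length vs \<longleftrightarrow> i \<le> n" for i using vs by (auto simp: words_def)
    have c: "(begins (\<pi> (vtx n 0 xs)) (vs ! 0) \<and>
      (\<forall>i. 1 \<le> i \<and> i \<le> n \<longrightarrow> begins (\<pi> (vtx n i xs)) (vs ! i))) \<longleftrightarrow> fits n vs xs"
      unfolding fits_def by (metis One_nat_def Suc_leI bot_nat_0.extremum gr0I)
    show ?thesis unfolding c[symmetric] 0 l using 1 by auto
  qed
  ultimately show ?thesis unfolding restriction_def map_funpow by (intro image_cong) auto
qed

lemma ms_restrict_vtx:
  assumes U: "U \<in> ms n" and K: "clopen K" and i: "i \<le> n"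
  shows "{xs \<in> U. vtx n i xs \<in> K} \<in> ms n"
proof (cases "i < max 1 n")
  case True
  let ?V = "{xs \<in> U. vtx n i xs \<in> K}"
  have "(\<lambda>xs. xs ! i) ` ?V = {g \<in> (\<lambda>xs. xs ! i) ` U. rng G g \<in> K}" using True by (auto simp: vtx_def)
  then have "cob ((\<lambda>xs. xs ! i) ` ?V)" using cob_restrict_rng[OF ms_cob[OF U True] K] by simp
  then show ?thesis using ms_sub_iff[OF U _ True, of ?V] by simp
next
  case False
  let ?V = "{xs \<in> U. vtx n i xs \<in> K}"
  have n: "n - 1 < max 1 n" by simp
  have "(\<lambda>xs. xs ! (n - 1)) ` ?V = {g \<in> (\<lambda>xs. xs ! (n - 1)) ` U. src G g \<in> K}" using False by (auto simp: vtx_def)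
  then have "cob ((\<lambda>xs. xs ! (n - 1)) ` ?V)" using cob_restrict_src[OF ms_cob[OF U n] K] by simp
  then show ?thesis using ms_sub_iff[OF U _ n, of ?V] by simp
qed

lemma ms_fits:
  assumes U: "U \<in> ms n"
  shows "{xs \<in> U. fits n vs xs} \<in> ms n"
proof -
  have "{xs \<in> U. \<forall>i<I. begins (\<pi> (vtx n i xs)) (vs ! i)} \<in> ms n" if "I \<le> Suc n" for I
    using that
  proof (induction I)
    case 0
    then show ?case using U by simp
  next
    case (Suc I)
    let ?V = "{xs \<in> U. \<forall>i<I. begins (\<pi> (vtx n i xs)) (vs ! i)}"
    have V: "?V \<in> ms n" using Suc by simp
    have "{xs \<in> U. \<forall>i<Suc I. begins (\<pi> (vtx n i xs)) (vs ! i)} =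
        {xs \<in> ?V. vtx n I xs \<in> {w \<in> units G. begins (\<pi> w) (vs ! I)}}"
      using vtx_units[OF ms_nerve[OF U], of _ I] Suc.prems by (auto simp: less_Suc_eq)
    then show ?case using ms_restrict_vtx[OF V clopen_begins, of I "vs ! I"] Suc.prems by simp
  qed
  from this[of "Suc n"] show ?thesis by (simp add: fits_def less_Suc_eq_le)
qed

lemma ms_sft:
  assumes V: "V \<in> ms n" and fit: "\<And>xs. xs \<in> V \<Longrightarrow> fits n vs xs" and vs: "words n m vs"
  shows "map (sft m) ` V \<in> ms n" "inj_on (map (sft m)) V"
proof -
  have c: "cob (sft m ` (\<lambda>xs. xs ! i) ` V) \<and> inj_on (sft m) ((\<lambda>xs. xs ! i) ` V)" if i: "i < max 1 n" for i
  proof -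
    \<comment> \<open>The index of the vertex where coordinate \<open>i\<close> has its source. In
      degree 0 the only coordinate is a unit, whose source is vertex 0 again.\<close>
    let ?j = "if n = 0 then 0 else Suc i"
    have ij: "i \<le> n" "?j \<le> n" using i by (auto simp: max_def split: if_splits)
    have b: "begins (\<pi> (rng G g)) (vs ! i) \<and> begins (\<pi> (src G g)) (vs ! ?j)" if gV: "g \<in> (\<lambda>xs. xs ! i) ` V" for g
    proof -
      obtain xs where xs: "xs \<in> V" "g = xs ! i" using gV by blast
      have nx: "xs \<in> nerve G n" using ms_nerve[OF V xs(1)] .
      have r: "rng G g = vtx n i xs" using i xs(2) by (simp add: vtx_def)
      have s: "src G g = vtx n ?j xs"
      proof (cases "n = 0")
        case True
        then have "i = 0" "xs ! 0 \<in> units G" using i nx unfolding nerve_iff by simp_all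
        then show ?thesis using True xs(2) by (simp add: vtx_def)
      next
        case False
        then show ?thesis using src_vtx[OF nx, of i] i xs(2) by simp
      qed
      show ?thesis unfolding r s using fit[OF xs(1)] ij unfolding fits_def by blast
    qed
    have l: "length (vs ! i) = m" "length (vs ! ?j) = m" using words_nth[OF vs] ij by blast+
    show ?thesis using cob_sft[OF ms_cob[OF V i] b l] by blast
  qed
  have inj: "inj_on (\<lambda>xs. sft m (xs ! i)) V" if i: "i < max 1 n" for i
    using comp_inj_on[OF ms_inj[OF V i] conjunct2[OF c[OF i]]] by (simp add: comp_def)
  have nth: "map (sft m) xs ! i = sft m (xs ! i)" if "xs \<in> V" "i < max 1 n" for xs i
    using nerve_length[OF ms_nerve[OF V that(1)]] that(2) by simp
  show "inj_on (map (sft m)) V"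
  proof (rule inj_onI)
    fix x y assume xy: "x \<in> V" "y \<in> V" "map (sft m) x = map (sft m) y"
    have "0 < max 1 n" by simp
    then show "x = y" using nth[OF xy(1), of 0] nth[OF xy(2), of 0] xy inj_onD[OF inj[of 0]] by simp
  qed
  show "map (sft m) ` V \<in> ms n" unfolding multisections_iff
  proof (intro conjI allI impI)
    show "map (sft m) ` V \<subseteq> nerve G n" using map_nerve[OF sft_functor] ms_nerve[OF V] by blast
    fix i assume i: "i < max 1 n"
    show "inj_on (\<lambda>xs. xs ! i) (map (sft m) ` V)"
    proof (rule inj_onI)
      fix x y assume "x \<in> map (sft m) ` V" "y \<in> map (sft m) ` V" and eq: "x ! i = y ! i"
      then obtain a b where ab: "a \<in> V" "b \<in> V" "x = map (sft m) a" "y = map (sft m) b" by blast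
      then have "a = b" using nth[OF ab(1) i] nth[OF ab(2) i] eq inj_onD[OF inj[OF i]] by simp
      then show "x = y" using ab by simp
    qed
    have "(\<lambda>xs. xs ! i) ` map (sft m) ` V = sft m ` (\<lambda>xs. xs ! i) ` V"
      unfolding image_image using nth i by (intro image_cong) simp_all
    then show "cob ((\<lambda>xs. xs ! i) ` map (sft m) ` V)" using c[OF i] by simp
  qed
qed

lemma restriction_ms: "U \<in> ms n \<Longrightarrow> words n m vs \<Longrightarrow> restriction G \<pi> U vs \<in> ms n"
proof -
  assume U: "U \<in> ms n" and vs: "words n m vs"
  have Un: "U \<subseteq> nerve G n" using ms_nerve[OF U] by blast
  show ?thesis
    unfolding restriction_eq[OF Un vs] by (intro ms_sft(1)[OF ms_fits[OF U] _ vs]) simp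
qed

lemma vtx_map: "xs \<in> nerve G n \<Longrightarrow> i \<le> n \<Longrightarrow> vtx n i (map (sft m) xs) = sft m (vtx n i xs)"
  using nerve_elts[of xs n i] nerve_elts[of xs n "n - 1"] nerve_length[of xs n] sft_rng sft_src
  by (auto simp: vtx_def)

text \<open>The vertices of a shifted simplex are the shifted vertices, so two successive prefix
  conditions amount to one condition on the concatenated words.\<close>

lemma restriction_restriction:
  assumes U: "U \<in> ms n" and vs: "words n m vs" and vs': "words n m' vs'"
  shows "restriction G \<pi> (restriction G \<pi> U vs) vs' = restriction G \<pi> U (map2 (@) vs vs')"
    and "words n (m + m') (map2 (@) vs vs')"
proof -
  have l: "length vs = Suc n" "length vs' = Suc n" using vs vs' by (simp_all add: words_def)
  show w: "words n (m + m') (map2 (@) vs vs')"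
    unfolding words_def
  proof (intro conjI ballI)
    show "length (map2 (@) vs vs') = Suc n" using l by simp
    fix v assume "v \<in> set (map2 (@) vs vs')"
    then obtain a b where ab: "(a, b) \<in> set (zip vs vs')" "v = a @ b" by auto
    then have "length a = m" "length b = m'"
      using vs vs' set_zip_leftD[OF ab(1)] set_zip_rightD[OF ab(1)] unfolding words_def by blast+
    then show "length v = m + m'" using ab(2) by simp
  qed
  have Un: "U \<subseteq> nerve G n" using ms_nerve[OF U] by blast
  have Rn: "restriction G \<pi> U vs \<subseteq> nerve G n" using ms_nerve[OF restriction_ms[OF U vs]] by blast
  have f: "fits n vs' (map (sft m) xs) \<and> fits n vs xs \<longleftrightarrow> fits n (map2 (@) vs vs') xs" if xs: "xs \<in> nerve G n" for xs
  proof -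
    have "(begins (\<pi> (vtx n i (map (sft m) xs))) (vs' ! i) \<and> begins (\<pi> (vtx n i xs)) (vs ! i)) \<longleftrightarrow>
        begins (\<pi> (vtx n i xs)) (map2 (@) vs vs' ! i)" if i: "i \<le> n" for i
    proof -
      have "map2 (@) vs vs' ! i = vs ! i @ vs' ! i" using i l by simp
      then show ?thesis
        using vtx_map[OF xs i, of m] begins_sft[OF vtx_units[OF xs i], of m] words_nth[OF vs i]
        by (auto simp: begins_append)
    qed
    then show ?thesis unfolding fits_def by blast
  qed
  show "restriction G \<pi> (restriction G \<pi> U vs) vs' = restriction G \<pi> U (map2 (@) vs vs')"
    unfolding restriction_eq[OF Rn vs'] restriction_eq[OF Un w]
  proof (intro equalityI subsetI)
    fix x assume "x \<in> map (sft m') ` {xs \<in> restriction G \<pi> U vs. fits n vs' xs}"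
    then obtain xs where xs: "xs \<in> U" "fits n vs xs" "fits n vs' (map (sft m) xs)" "x = map (sft m') (map (sft m) xs)"
      unfolding restriction_eq[OF Un vs] by blast
    have "x = map (sft (m + m')) xs" using xs(4) by (simp add: funpow_add add.commute[of m])
    moreover have "fits n (map2 (@) vs vs') xs" using f xs Un by blast
    ultimately show "x \<in> map (sft (m + m')) ` {xs \<in> U. fits n (map2 (@) vs vs') xs}" using xs(1) by blast
  next
    fix x assume "x \<in> map (sft (m + m')) ` {xs \<in> U. fits n (map2 (@) vs vs') xs}"
    then obtain xs where xs: "xs \<in> U" "fits n (map2 (@) vs vs') xs" "x = map (sft (m + m')) xs" by blast
    have "x = map (sft m') (map (sft m) xs)" using xs(3) by (simp add: funpow_add add.commute[of m])
    moreover have "fits n vs xs" "fits n vs' (map (sft m) xs)" using f xs Un by blast+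
    ultimately show "x \<in> map (sft m') ` {xs \<in> restriction G \<pi> U vs. fits n vs' xs}"
      unfolding restriction_eq[OF Un vs] using xs(1) by blast
  qed
qed

text \<open>Only words over the edges of the graph are listed, which makes the index set finite;
  vertices of simplices begin with no other words of that length.\<close>

definition wordsets :: "nat \<Rightarrow> nat \<Rightarrow> 'x list list set" where
  "wordsets n m = {vs. set vs \<subseteq> {v. set v \<subseteq> arcs D \<and> length v = m} \<and> length vs = Suc n}"

lemma finite_wordsets: "finite (wordsets n m)"
  unfolding wordsets_def by (intro finite_lists_length_eq finite_arcs)

lemma wordsets_words: "vs \<in> wordsets n m \<Longrightarrow> words n m vs"
  by (auto simp: wordsets_def words_def)

text \<open>Every simplex of \<open>U\<close> fits exactly one tuple of words, and on the simplices
  that fit a given tuple the iterated shift is injective. The push-forward is thus a sum of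
  functions constant on restrictions, each tuple of words being counted once.\<close>

lemma push_sft_const_on:
  assumes U: "U \<in> ms n"
  shows "push (map (sft m)) (const_on a U) = (\<lambda>z. \<Sum>vs\<in>wordsets n m. const_on a (restriction G \<pi> U vs) z)"
proof -
  let ?A = "\<lambda>vs. {xs \<in> U. fits n vs xs}"
  have Un: "U \<subseteq> nerve G n" using ms_nerve[OF U] by blast
  have "U = (\<Union>vs\<in>wordsets n m. ?A vs)"
  proof (intro equalityI subsetI)
    fix xs assume xs: "xs \<in> U"
    let ?vs = "map (\<lambda>i. map (\<pi> (vtx n i xs)) [0..<m]) [0..<Suc n]"
    have "?vs ! i = map (\<pi> (vtx n i xs)) [0..<m]" if "i \<le> n" for i
      using that nth_map[of i "[0..<Suc n]"] by (simp del: upt_Suc)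
    then have "fits n ?vs xs" unfolding fits_def by (simp add: begins_map del: upt_Suc)
    moreover have "\<pi> (vtx n i xs) j \<in> arcs D" if "i \<le> n" for i j
      using pi_paths[OF vtx_units[OF ms_nerve[OF U xs] that]] by (simp add: paths_def)
    then have "?vs \<in> wordsets n m" unfolding wordsets_def by auto
    ultimately show "xs \<in> (\<Union>vs\<in>wordsets n m. ?A vs)" using xs by blast
  qed auto
  moreover have disj: "vs = vs'"
    if vs: "vs \<in> wordsets n m" "vs' \<in> wordsets n m" "xs \<in> ?A vs" "xs \<in> ?A vs'" for vs vs' xs
  proof (rule nth_equalityI)
    show "length vs = length vs'" using vs by (simp add: wordsets_def)
    fix i assume "i < length vs"
    then have i: "i \<le> n" using vs by (simp add: wordsets_def)
    then have "begins (\<pi> (vtx n i xs)) (vs ! i)" "begins (\<pi> (vtx n i xs)) (vs' ! i)"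
      using vs by (simp_all add: fits_def)
    then show "vs ! i = vs' ! i"
      using begins_unique words_nth[OF wordsets_words[OF vs(1)] i] words_nth[OF wordsets_words[OF vs(2)] i] by metis
  qed
  ultimately have "const_on a U = (\<lambda>x. \<Sum>vs\<in>wordsets n m. const_on a (?A vs) x)"
    using const_on_family[OF finite_wordsets, of n m ?A a] by simp
  then have "push (map (sft m)) (const_on a U) = push (map (sft m)) (\<lambda>x. \<Sum>vs\<in>wordsets n m. const_on a (?A vs) x)"
    by simp
  also have "\<dots> = (\<lambda>z. \<Sum>vs\<in>wordsets n m. push (map (sft m)) (const_on a (?A vs)) z)"
    by (intro push_sum push_const_on(2) ms_sft(2)[OF ms_fits[OF U] _ wordsets_words] finite_wordsets) auto
  also have "\<dots> = (\<lambda>z. \<Sum>vs\<in>wordsets n m. const_on a (restriction G \<pi> U vs) z)"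
  proof (intro ext sum.cong refl)
    fix z vs assume vs: "vs \<in> wordsets n m"
    have "inj_on (map (sft m)) (?A vs)" by (rule ms_sft(2)[OF ms_fits[OF U] _ wordsets_words[OF vs]]) simp
    then show "push (map (sft m)) (const_on a (?A vs)) z = const_on a (restriction G \<pi> U vs) z"
      by (simp add: push_const_on(1) restriction_eq[OF Un wordsets_words[OF vs]])
  qed
  finally show ?thesis .
qed

lemma T_funpow: "f \<in> CC n \<Longrightarrow> (T ^^ m) f = push (map (sft m)) f"
proof (induction m)
  case 0
  have "push (map id) f = f"
  proof
    fix z
    have "push (map id) f z = (\<Sum>y\<in>{z}. if map id y = z then f y else 0)" by (rule push_eq_sum) auto
    then show "push (map id) f z = f z" by simp
  qed
  then show ?case by (simp add: id_def)
next
  case (Suc m)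
  then show ?case using push_map_map[OF etale_functor_gshift sft_functor[of m] Suc.prems] by (simp add: comp_def)
qed

section \<open>Finitely many restrictions of a bisection\<close>

text \<open>The restriction of a single bisection, with \<open>v\<close> the prefix of ranges and
  \<open>u\<close> the prefix of sources. Restrictions of multisections are assembled from these
  coordinate by coordinate.\<close>

definition rest :: "'x list \<Rightarrow> 'x list \<Rightarrow> 'g set \<Rightarrow> 'g set" where
  "rest v u F = sft (length v) ` {g \<in> F. begins (\<pi> (rng G g)) v \<and> begins (\<pi> (src G g)) u}"

lemma rest_cob:
  assumes F: "cob F" and len: "length v = length u"
  shows "cob (rest v u F)"
proof -
  let ?B = "{g \<in> F. begins (\<pi> (rng G g)) v \<and> begins (\<pi> (src G g)) u}"
  have "?B = {g \<in> {g \<in> F. rng G g \<in> {w \<in> units G. begins (\<pi> w) v}}. src G g \<in> {w \<in> units G. begins (\<pi> w) u}}"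
    using cob_subset[OF F] by auto
  then have "cob ?B" using cob_restrict_src[OF cob_restrict_rng[OF F clopen_begins] clopen_begins] by simp
  then show ?thesis unfolding rest_def by (rule cob_sft(1)[of _ v u]) (use len in auto)
qed

lemma rest_append:
  assumes F: "F \<subseteq> elts G" and len: "length v = length u"
  shows "rest v' u' (rest v u F) = rest (v @ v') (u @ u') F"
proof -
  have b: "begins (\<pi> (rng G (sft (length v) g))) v' \<longleftrightarrow> begins (\<lambda>i. \<pi> (rng G g) (i + length v)) v'"
    "begins (\<pi> (src G (sft (length v) g))) u' \<longleftrightarrow> begins (\<lambda>i. \<pi> (src G g) (i + length v)) u'" if "g \<in> F" for g
    using that F sft_rng[of g "length v"] sft_src[of g "length v"] by (auto simp: begins_sft)
  have f: "sft (length v') (sft (length v) g) = sft (length (v @ v')) g" for g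
    by (simp add: funpow_add add.commute[of "length v"])
  show ?thesis
  proof (intro equalityI subsetI)
    fix x assume "x \<in> rest v' u' (rest v u F)"
    then obtain g where g: "g \<in> F" "begins (\<pi> (rng G g)) v" "begins (\<pi> (src G g)) u"
      "begins (\<pi> (rng G (sft (length v) g))) v'" "begins (\<pi> (src G (sft (length v) g))) u'"
      "x = sft (length v') (sft (length v) g)" unfolding rest_def by blast
    then have "begins (\<pi> (rng G g)) (v @ v')" "begins (\<pi> (src G g)) (u @ u')"
      using b[OF g(1)] len by (simp_all add: begins_append)
    then show "x \<in> rest (v @ v') (u @ u') F" unfolding rest_def g(6) f using g(1) by blast
  next
    fix x assume "x \<in> rest (v @ v') (u @ u') F"
    then obtain g where g: "g \<in> F" "begins (\<pi> (rng G g)) (v @ v')" "begins (\<pi> (src G g)) (u @ u')"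
      "x = sft (length (v @ v')) g" unfolding rest_def by blast
    then show "x \<in> rest v' u' (rest v u F)" unfolding g(4) f[symmetric] rest_def
      using b[OF g(1)] len by (intro imageI CollectI conjI) (simp_all add: begins_append)
  qed
qed

lemma finite_rest_length:
  assumes F: "F \<subseteq> elts G"
  shows "finite {rest v u F |v u. length v = m \<and> length u = m}"
proof -
  let ?L = "{l. set l \<subseteq> arcs D \<and> length l = m}"
  have "{rest v u F |v u. length v = m \<and> length u = m} \<subseteq> insert {} ((\<lambda>(v, u). rest v u F) ` (?L \<times> ?L))"
  proof
    fix B assume "B \<in> {rest v u F |v u. length v = m \<and> length u = m}"
    then obtain v u where B: "B = rest v u F" "length v = m" "length u = m" by blast
    show "B \<in> insert {} ((\<lambda>(v, u). rest v u F) ` (?L \<times> ?L))"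
    proof (cases "B = {}")
      case False
      then obtain g where g: "g \<in> F" "begins (\<pi> (rng G g)) v" "begins (\<pi> (src G g)) u"
        unfolding B rest_def by blast
      have "\<pi> (rng G g) \<in> paths D" "\<pi> (src G g) \<in> paths D" using g(1) F pi_paths by auto
      moreover have "v = map (\<pi> (rng G g)) [0..<m]" "u = map (\<pi> (src G g)) [0..<m]"
        using begins_unique g B by blast+
      ultimately have "v \<in> ?L" "u \<in> ?L" using B by (auto simp: paths_def)
      then show ?thesis using B(1) by auto
    qed simp
  qed
  moreover have "finite (insert {} ((\<lambda>(v, u). rest v u F) ` (?L \<times> ?L)))"
    by (intro finite.insertI finite_imageI finite_cartesian_product finite_lists_length_eq finite_arcs)
  ultimately show ?thesis by (rule finite_subset)
qed

text \<open>Over a small cylinder of sources \<open>F\<close> is empty or coincides with a single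
  member of the cover, and by compactness one length of cylinders works everywhere. Long words
  confine sources to such a cylinder, so they do not distinguish \<open>F\<close> from that
  member.\<close>

lemma locally_in_cover:
  assumes F: "cob F" and E: "\<And>B. B \<in> E \<Longrightarrow> cob B" "F \<subseteq> \<Union>E"
  shows "\<exists>M. \<forall>v u. length v = length u \<and> length u \<ge> M \<longrightarrow> rest v u F = {} \<or> (\<exists>B\<in>E. rest v u F = rest v u B)"
proof -
  define P where "P A \<longleftrightarrow> {g \<in> F. src G g \<in> A} = {} \<or> (\<exists>B\<in>E. {g \<in> F. src G g \<in> A} = {g \<in> B. src G g \<in> A})" for A
  have mono: "P B" if "P A" "B \<subseteq> A" for A B
    using that(1) unfolding P_def
  proof (elim disjE bexE)
    assume "{g \<in> F. src G g \<in> A} = {}"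
    then show "{g \<in> F. src G g \<in> B} = {} \<or> (\<exists>C\<in>E. {g \<in> F. src G g \<in> B} = {g \<in> C. src G g \<in> B})" using that(2) by blast
  next
    fix C assume "C \<in> E" "{g \<in> F. src G g \<in> A} = {g \<in> C. src G g \<in> A}"
    moreover from this(2) have "{g \<in> F. src G g \<in> B} = {g \<in> C. src G g \<in> B}" using that(2) by blast
    ultimately show "{g \<in> F. src G g \<in> B} = {} \<or> (\<exists>C\<in>E. {g \<in> F. src G g \<in> B} = {g \<in> C. src G g \<in> B})" by blast
  qed
  have loc: "\<exists>M. P (cyl M u)" if u: "u \<in> units G" for u
  proof (cases "u \<in> src G ` F")
    case True
    then obtain g where g: "g \<in> F" "u = src G g" by blast
    then obtain B where B: "B \<in> E" "g \<in> B" using E(2) by blast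
    have "openin (unit_top G) (src G ` (F \<inter> B))"
      using F E(1)[OF B(1)] by (intro openin_src_image openin_Int) (simp_all add: cob_iff)
    then obtain M where M: "cyl M u \<subseteq> src G ` (F \<inter> B)" using cyl_basis[of "src G ` (F \<inter> B)" u] g B by blast
    have iF: "inj_on (src G) F" and iB: "inj_on (src G) B" using F E(1)[OF B(1)] by (simp_all add: cob_iff)
    have "{g \<in> F. src G g \<in> cyl M u} = {g \<in> B. src G g \<in> cyl M u}"
    proof (intro equalityI subsetI)
      fix h assume h: "h \<in> {g \<in> F. src G g \<in> cyl M u}"
      then obtain k where k: "k \<in> F" "k \<in> B" "src G h = src G k" using M by blast
      then have "h = k" using inj_onD[OF iF k(3)] h by simp
      then show "h \<in> {g \<in> B. src G g \<in> cyl M u}" using k h by simp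
    next
      fix h assume h: "h \<in> {g \<in> B. src G g \<in> cyl M u}"
      then obtain k where k: "k \<in> F" "k \<in> B" "src G h = src G k" using M by blast
      then have "h = k" using inj_onD[OF iB k(3)] h by simp
      then show "h \<in> {g \<in> F. src G g \<in> cyl M u}" using k h by simp
    qed
    then show ?thesis using B unfolding P_def by blast
  next
    case False
    have "closedin (unit_top G) (src G ` F)" using cob_src[OF F] clopen_iff by blast
    then have "openin (unit_top G) (units G - src G ` F)" by (metis openin_topspace openin_diff topspace_unit_top)
    then obtain M where "cyl M u \<subseteq> units G - src G ` F" using cyl_basis[of _ u] False u by blast
    then have "{g \<in> F. src G g \<in> cyl M u} = {}" by blast
    then show ?thesis unfolding P_def by blast
  qed
  have "\<exists>M. \<forall>M'\<ge>M. \<forall>u\<in>units G. P (cyl M' u)"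
    by (rule lebesgue, erule loc, erule (1) mono)
  then obtain M where M: "\<And>M' u. M' \<ge> M \<Longrightarrow> u \<in> units G \<Longrightarrow> P (cyl M' u)" by blast
  have "rest v u F = {} \<or> (\<exists>B\<in>E. rest v u F = rest v u B)" if vu: "length v = length u" "length u \<ge> M" for v u
  proof (cases "\<exists>a\<in>units G. begins (\<pi> a) u")
    case True
    then obtain a where a: "a \<in> units G" "begins (\<pi> a) u" by blast
    have c: "{g \<in> C. src G g \<in> cyl (length u) a} = {g \<in> C. begins (\<pi> (src G g)) u}" if "C \<subseteq> elts G" for C
      unfolding begins_cyl[OF a, symmetric] using that by auto
    have r: "rest v u C = sft (length v) ` {g \<in> {g \<in> C. src G g \<in> cyl (length u) a}. begins (\<pi> (rng G g)) v}" if "C \<subseteq> elts G" for C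
      unfolding c[OF that] rest_def by (rule arg_cong[of _ _ "image _"]) blast
    have Fe: "F \<subseteq> elts G" by (rule cob_subset[OF F])
    show ?thesis
    proof (cases "{g \<in> F. src G g \<in> cyl (length u) a} = {}")
      case e: True
      have "rest v u F = {}" unfolding r[OF Fe] e by simp
      then show ?thesis ..
    next
      case False
      then obtain B where B: "B \<in> E" "{g \<in> F. src G g \<in> cyl (length u) a} = {g \<in> B. src G g \<in> cyl (length u) a}"
        using M[OF vu(2) a(1)] unfolding P_def by blast
      have "rest v u F = rest v u B" unfolding r[OF Fe] r[OF cob_subset[OF E(1)[OF B(1)]]] B(2) ..
      then show ?thesis using B(1) by blast
    qed
  next
    case False
    then have "rest v u F = {}" using cob_subset[OF F] unfolding rest_def by auto
    then show ?thesis ..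
  qed
  then show ?thesis by blast
qed

lemma locally_in_cover_finite:
  assumes fin: "finite FF" and FF: "\<And>F. F \<in> FF \<Longrightarrow> cob F \<and> F \<subseteq> \<Union>E" and E: "\<And>B. B \<in> E \<Longrightarrow> cob B"
  shows "\<exists>M. \<forall>F\<in>FF. \<forall>v u. length v = length u \<and> length u \<ge> M \<longrightarrow> rest v u F = {} \<or> (\<exists>B\<in>E. rest v u F = rest v u B)"
  using fin FF
proof (induction FF rule: finite_induct)
  case empty
  then show ?case by simp
next
  case (insert F FF)
  obtain M1 where M1: "\<forall>F\<in>FF. \<forall>v u. length v = length u \<and> length u \<ge> M1 \<longrightarrow> rest v u F = {} \<or> (\<exists>B\<in>E. rest v u F = rest v u B)"
    using insert.IH insert.prems by blast
  have F: "cob F" "F \<subseteq> \<Union>E" using insert.prems by simp_all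
  obtain M2 where M2: "\<forall>v u. length v = length u \<and> length u \<ge> M2 \<longrightarrow> rest v u F = {} \<or> (\<exists>B\<in>E. rest v u F = rest v u B)"
    using locally_in_cover[OF F(1) E F(2)] by blast
  show ?case
  proof (intro exI[of _ "max M1 M2"] ballI allI impI)
    fix F' and v u :: "'x list" assume F': "F' \<in> insert F FF" and l: "length v = length u \<and> max M1 M2 \<le> length u"
    show "rest v u F' = {} \<or> (\<exists>B\<in>E. rest v u F' = rest v u B)"
    proof (cases "F' = F")
      case True
      show ?thesis unfolding True by (rule M2[rule_format]) (use l in simp)
    next
      case False
      then have "F' \<in> FF" using F' by simp
      then show ?thesis by (rule M1[rule_format]) (use l in simp)
    qed
  qed
qed

lemma compact_cob_cover:
  assumes C: "compactin (gtop G) C" and W: "openin (gtop G) W" "C \<subseteq> W"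
  shows "\<exists>E. finite E \<and> (\<forall>B\<in>E. cob B \<and> B \<subseteq> W) \<and> C \<subseteq> \<Union>E"
proof -
  let ?U = "{B. cob B \<and> B \<subseteq> W}"
  have "\<forall>B\<in>?U. openin (gtop G) B" by (simp add: cob_iff)
  moreover have "C \<subseteq> \<Union>?U"
  proof
    fix g assume "g \<in> C"
    then have "g \<in> W" using W by blast
    then show "g \<in> \<Union>?U" using ex_cob[OF W(1)] by blast
  qed
  ultimately have "\<exists>E. finite E \<and> E \<subseteq> ?U \<and> C \<subseteq> \<Union>E"
    by (intro compactinD[OF C]) simp_all
  then obtain E where "finite E" "E \<subseteq> ?U" "C \<subseteq> \<Union>E" by (elim exE conjE)
  then show ?thesis by (intro exI[of _ E]) blast
qed

lemma compactin_bounded: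
  assumes C: "compactin (gtop G) C" and W: "\<And>n::nat. openin (gtop G) (W n)" and cov: "\<And>g. g \<in> C \<Longrightarrow> \<exists>n. g \<in> W n"
  shows "\<exists>N. \<forall>g\<in>C. \<exists>n\<le>N. g \<in> W n"
proof -
  have "\<exists>E. finite E \<and> E \<subseteq> range W \<and> C \<subseteq> \<Union>E"
  proof (rule compactinD[OF C])
    show "openin (gtop G) U" if "U \<in> range W" for U using that W by (elim rangeE) simp
    show "C \<subseteq> \<Union>(range W)" using cov by blast
  qed
  then obtain E where E: "finite E" "E \<subseteq> range W" "C \<subseteq> \<Union>E" by (elim exE conjE)
  then obtain I where I: "finite I" "E = W ` I" by (meson finite_subset_image)
  have "\<exists>n\<le>Max (insert 0 I). g \<in> W n" if g: "g \<in> C" for g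
  proof -
    obtain n where "n \<in> I" "g \<in> W n" using g E(3) I(2) by blast
    then show ?thesis using I(1) by (intro exI[of _ n]) simp
  qed
  then show ?thesis by blast
qed

lemma openin_sft_vimage: "openin (gtop G) W \<Longrightarrow> openin (gtop G) {g \<in> elts G. sft m g \<in> W}"
  using openin_continuous_map_preimage[of "gtop G" "gtop G" "sft m" W] sft_lh[of m] by (simp add: local_homeomorphism_iff topspace_gtop)

lemma sft_add: "sft (m + k) g = sft m (sft k g)"
  by (simp add: funpow_add)

lemma sft_compact_open:
  assumes "openin (gtop G) W" "compactin (gtop G) W"
  shows "openin (gtop G) (sft m ` W)" "compactin (gtop G) (sft m ` W)"
  using assms sft_lh[of m] image_compactin by (auto simp: local_homeomorphism_iff open_map_def)

end

locale contracting_groupoid = shift_groupoid G D \<pi>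
  for G :: "'g topgpd" and D :: "('v, 'x) pre_digraph" and \<pi> :: "'g \<Rightarrow> nat \<Rightarrow> 'x" +
  assumes contr: "contracting G \<pi>"
begin

text \<open>An orbit may leave the compact set of the contraction again. It is first enlarged to a
  compact open set \<open>C1\<close>; the return times to \<open>C1\<close> are bounded by
  compactness, and adding the shifts of \<open>C1\<close> up to that bound makes it
  invariant.\<close>

lemma ex_attractor:
  "\<exists>E. finite E \<and> (\<forall>B\<in>E. cob B) \<and> (\<forall>g\<in>\<Union>E. gs g \<in> \<Union>E) \<and> (\<forall>g\<in>elts G. \<exists>n. sft n g \<in> \<Union>E)"
proof -
  obtain C where C: "compactin (gtop G) C" "\<And>g. g \<in> elts G \<Longrightarrow> \<exists>n. sft n g \<in> C"
    using contr unfolding contracting_def by blast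
  have "C \<subseteq> topspace (gtop G)" using C(1) compactin_subset_topspace by blast
  then obtain E0 where E0: "finite E0" "\<forall>B\<in>E0. cob B \<and> B \<subseteq> topspace (gtop G)" "C \<subseteq> \<Union>E0"
    using compact_cob_cover[OF C(1) openin_topspace] by blast
  define C1 where "C1 = \<Union>E0"
  have C1: "openin (gtop G) C1" "compactin (gtop G) C1" "C1 \<subseteq> elts G"
    unfolding C1_def using E0(1,2) by (auto simp: cob_iff topspace_gtop intro: compactin_Union)
  have ret: "\<exists>n. g \<in> {g \<in> elts G. sft (Suc n) g \<in> C1}" if g: "g \<in> C1" for g
  proof -
    have ge: "g \<in> elts G" using g C1 by blast
    \<comment> \<open>Contraction is applied to \<open>gs g\<close>, not to \<open>g\<close> itself,
      so that the return takes at least one step.\<close>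
    obtain n where "sft n (gs g) \<in> C" using C(2)[OF gshift_elts[OF ge]] by blast
    then have "sft (Suc n) g \<in> C1" using E0(3) unfolding C1_def by (simp add: funpow_swap1 subset_iff)
    then show ?thesis using ge by blast
  qed
  have "\<exists>N. \<forall>g\<in>C1. \<exists>n\<le>N. g \<in> {g \<in> elts G. sft (Suc n) g \<in> C1}"
    by (rule compactin_bounded[OF C1(2)]) (rule openin_sft_vimage[OF C1(1)], rule ret)
  then obtain N where N': "\<forall>g\<in>C1. \<exists>n\<le>N. g \<in> {g \<in> elts G. sft (Suc n) g \<in> C1}" by (elim exE)
  have N: "\<exists>n\<le>N. sft (Suc n) g \<in> C1" if "g \<in> C1" for g
    using bspec[OF N' that] by (elim exE) (simp only: mem_Collect_eq, blast)
  \<comment> \<open>Every element of \<open>C1\<close> is back in \<open>C1\<close> after at most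
    \<open>Suc N\<close> steps. Shifting beyond step \<open>Suc N\<close> may hence be restarted
    from the return and stays within these sets.\<close>
  define C2 where "C2 = (\<Union>j\<in>{..Suc N}. sft j ` C1)"
  have o2: "openin (gtop G) C2" unfolding C2_def
    by (rule openin_Union, elim imageE, hypsubst, rule sft_compact_open(1)[OF C1(1,2)])
  have c2: "compactin (gtop G) C2" unfolding C2_def
    by (rule compactin_Union, simp, elim imageE, hypsubst, rule sft_compact_open(2)[OF C1(1,2)])
  have inv: "gs g \<in> C2" if "g \<in> C2" for g
  proof -
    obtain j c where j: "j \<le> Suc N" "c \<in> C1" "g = sft j c" using \<open>g \<in> C2\<close> unfolding C2_def by blast
    show ?thesis
    proof (cases "j = Suc N")
      case False
      then have "gs g = sft (Suc j) c" "Suc j \<le> Suc N" using j by simp_all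
      then show ?thesis unfolding C2_def using j(2) by blast
    next
      case True
      obtain n where n: "n \<le> N" "sft (Suc n) c \<in> C1" using N[OF j(2)] by blast
      have "gs g = sft (Suc (Suc N)) c" using j True by simp
      also have "Suc (Suc N) = (Suc N - n) + Suc n" using n by simp
      also have "sft ((Suc N - n) + Suc n) c = sft (Suc N - n) (sft (Suc n) c)" by (rule sft_add)
      finally have "gs g \<in> sft (Suc N - n) ` C1" using n(2) by (rule image_eqI)
      then show ?thesis unfolding C2_def by (intro UN_I[of "Suc N - n"]) simp_all
    qed
  qed
  obtain E where E: "finite E" "\<forall>B\<in>E. cob B \<and> B \<subseteq> C2" "C2 \<subseteq> \<Union>E"
    using compact_cob_cover[OF c2 o2] by blast
  then have UE: "\<Union>E = C2" by blast
  have "C1 \<subseteq> C2" unfolding C2_def by (rule subset_trans[OF _ UN_upper[of 0]]) simp_all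
  then have "C \<subseteq> C2" using E0(3) unfolding C1_def by blast
  then have "\<exists>n. sft n g \<in> C2" if "g \<in> elts G" for g using C(2)[OF that] by blast
  then have abs: "\<forall>g\<in>elts G. \<exists>n. sft n g \<in> C2" by simp
  show ?thesis
  proof (intro exI[of _ E] conjI)
    show "finite E" by (rule E(1))
    show "\<forall>B\<in>E. cob B" using E(2) by simp
    show "\<forall>g\<in>\<Union>E. gs g \<in> \<Union>E" unfolding UE using inv by simp
    show "\<forall>g\<in>elts G. \<exists>n. sft n g \<in> \<Union>E" unfolding UE by (rule abs)
  qed
qed

text \<open>Inside the attractor a restriction by one letter is again covered by \<open>E\<close>,
  so a long restriction equals a restriction of some member of \<open>E\<close> by words one letter
  shorter. Only bounded lengths remain there, and a general \<open>F\<close> enters the attractor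
  after boundedly many shifts.\<close>

lemma finite_restrictions:
  "finite {rest v u F |v u. length v = length u}" if F: "cob F" for F
proof -
  obtain E where raw: "finite E" "\<forall>B\<in>E. cob B" "\<forall>g\<in>\<Union>E. gs g \<in> \<Union>E" "\<forall>g\<in>elts G. \<exists>n. sft n g \<in> \<Union>E"
    using ex_attractor by (elim exE conjE)
  note E = raw(1) bspec[OF raw(2)] bspec[OF raw(3)] bspec[OF raw(4)]
  have inv: "sft m g \<in> \<Union>E" if "g \<in> \<Union>E" for m g
  proof (induction m)
    case 0
    show ?case using that by (simp only: funpow_0)
  next
    case (Suc m)
    show ?case unfolding funpow.simps comp_apply by (rule E(3)[OF Suc])
  qed
  have oE: "openin (gtop G) (\<Union>E)"
  proof (rule openin_Union)
    fix B assume "B \<in> E"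
    then show "openin (gtop G) B" using E(2)[of B] by (simp add: cob_iff)
  qed
  define R where "R B m = {rest v u B |v u. length v = m \<and> length u = m}" for B m
  have finR: "finite (R B m)" if "cob B" for B m unfolding R_def by (rule finite_rest_length[OF cob_subset[OF that]])
  have Rcob: "cob B'" if "B' \<in> R B m" "cob B" for B B' m using that rest_cob unfolding R_def by auto
  \<comment> \<open>The one-letter restrictions of the members of \<open>E\<close>. They are
    finitely many and, the attractor being invariant, covered by \<open>E\<close>, so one bound
    \<open>M\<close> serves all of them.\<close>
  define FF where "FF = (\<Union>B\<in>E. R B 1)"
  have FFE: "cob B \<and> B \<subseteq> \<Union>E" if B: "B \<in> FF" for B
  proof -
    obtain B0 v u where B0: "B0 \<in> E" "B = rest v u B0" "length v = 1" "length u = 1"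
      using B unfolding FF_def R_def by blast
    have "B \<subseteq> \<Union>E"
    proof
      fix x assume "x \<in> B"
      then obtain g where "g \<in> B0" "x = sft (length v) g" unfolding B0(2) rest_def by blast
      then show "x \<in> \<Union>E" using inv[OF UnionI[OF B0(1)], of g "length v"] by simp
    qed
    moreover have "cob B" unfolding B0(2) by (rule rest_cob[OF E(2)[OF B0(1)]]) (simp add: B0)
    ultimately show ?thesis by blast
  qed
  have finFF: "finite FF" unfolding FF_def by (rule finite_UN_I[OF E(1)], rule finR, erule E(2))
  have "\<exists>M. \<forall>F\<in>FF. \<forall>v u. length v = length u \<and> length u \<ge> M \<longrightarrow>
      rest v u F = {} \<or> (\<exists>B\<in>E. rest v u F = rest v u B)"
    by (rule locally_in_cover_finite[OF finFF FFE E(2)])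
  then obtain M where M: "\<forall>F\<in>FF. \<forall>v u. length v = length u \<and> length u \<ge> M \<longrightarrow>
      rest v u F = {} \<or> (\<exists>B\<in>E. rest v u F = rest v u B)" by (elim exE)
  define RR where "RR = insert {} (\<Union>B\<in>E. \<Union>m\<le>M. R B m)"
  have finRR: "finite RR" unfolding RR_def
    by (rule finite.insertI, rule finite_UN_I[OF E(1)], rule finite_UN_I, simp, rule finR, erule E(2))
  \<comment> \<open>For words longer than \<open>M\<close> the first letters are split off. The
    resulting member of \<open>FF\<close> can be replaced by some \<open>C\<close> in
    \<open>E\<close> as far as the remaining \<open>n\<close> letters are concerned, and the
    induction hypothesis applies to \<open>C\<close>.\<close>
  have inRR: "rest v u B \<in> RR" if "B \<in> E" "length v = n" "length u = n" for B v u n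
    using that
  proof (induction n arbitrary: B v u)
    case 0
    then have "rest v u B \<in> R B 0" unfolding R_def by blast
    then show ?case unfolding RR_def using 0(1) by blast
  next
    case (Suc n)
    show ?case
    proof (cases "Suc n \<le> M")
      case True
      have "rest v u B \<in> R B (Suc n)" unfolding R_def using Suc.prems by blast
      then show ?thesis unfolding RR_def using Suc.prems(1) True by blast
    next
      case False
      obtain y v' where v: "v = y # v'" using Suc.prems(2) by (cases v) auto
      obtain x u' where u: "u = x # u'" using Suc.prems(3) by (cases u) auto
      have l: "length v' = n" "length u' = n" using Suc.prems v u by simp_all
      let ?F = "rest [y] [x] B"
      have eq: "rest v' u' ?F = rest v u B"
        using rest_append[of B "[y]" "[x]" v' u'] cob_subset[OF E(2)[OF Suc.prems(1)]] v u by simp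
      have "?F \<in> R B 1" unfolding R_def by force
      then have "?F \<in> FF" unfolding FF_def using Suc.prems(1) by blast
      then have "rest v' u' ?F = {} \<or> (\<exists>C\<in>E. rest v' u' ?F = rest v' u' C)"
        using M[rule_format, of ?F v' u'] l False by simp
      then show ?thesis
      proof (elim disjE bexE)
        assume "rest v' u' ?F = {}"
        then show ?thesis unfolding eq RR_def by simp
      next
        fix C assume C: "C \<in> E" "rest v' u' ?F = rest v' u' C"
        show ?thesis unfolding eq[symmetric] C(2) by (rule Suc.IH[OF C(1) l])
      qed
    qed
  qed
  have cF: "compactin (gtop G) F" using F by (simp add: cob_iff)
  have abs: "\<exists>n. g \<in> {g \<in> elts G. sft n g \<in> \<Union>E}" if "g \<in> F" for g
  proof -
    have "g \<in> elts G" using cob_subset[OF F] that by blast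
    then show ?thesis using E(4)[of g] by simp
  qed
  have "\<exists>k. \<forall>g\<in>F. \<exists>n\<le>k. g \<in> {g \<in> elts G. sft n g \<in> \<Union>E}"
    by (rule compactin_bounded[OF cF]) (rule openin_sft_vimage[OF oE], rule abs)
  then obtain k where k': "\<forall>g\<in>F. \<exists>n\<le>k. g \<in> {g \<in> elts G. sft n g \<in> \<Union>E}" by (elim exE)
  have k: "\<exists>n\<le>k. sft n g \<in> \<Union>E" if "g \<in> F" for g
    using bspec[OF k' that] by (elim exE) (simp only: mem_Collect_eq, blast)
  \<comment> \<open>A common time for all of \<open>F\<close>: elements that enter the attractor
    earlier stay in it.\<close>
  have kE: "sft k g \<in> \<Union>E" if gF: "g \<in> F" for g
  proof -
    obtain n where n: "n \<le> k" "sft n g \<in> \<Union>E" using k[OF gF] by (elim exE conjE)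
    have "sft k g = sft (k - n) (sft n g)" using sft_add[of "k - n" n g] n(1) by simp
    then show ?thesis using inv[OF n(2)] by simp
  qed
  have RE: "cob B \<and> B \<subseteq> \<Union>E" if B: "B \<in> R F k" for B
  proof
    show "cob B" by (rule Rcob[OF B F])
    obtain v u where vu: "B = rest v u F" "length v = k" using B unfolding R_def by blast
    show "B \<subseteq> \<Union>E"
    proof
      fix x assume "x \<in> B"
      then obtain g where "g \<in> F" "x = sft k g" unfolding vu(1) rest_def vu(2) by blast
      then show "x \<in> \<Union>E" using kE[of g] by simp
    qed
  qed
  have "\<exists>M. \<forall>F'\<in>R F k. \<forall>v u. length v = length u \<and> length u \<ge> M \<longrightarrow>
      rest v u F' = {} \<or> (\<exists>B\<in>E. rest v u F' = rest v u B)"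
    by (rule locally_in_cover_finite[OF finR[OF F] RE E(2)])
  then obtain M' where M': "\<forall>F'\<in>R F k. \<forall>v u. length v = length u \<and> length u \<ge> M' \<longrightarrow>
      rest v u F' = {} \<or> (\<exists>B\<in>E. rest v u F' = rest v u B)" by (elim exE)
  have "rest v u F \<in> RR \<union> (\<Union>m\<le>k + M'. R F m)" if vu: "length v = length u" for v u
  proof (cases "length u \<le> k + M'")
    case True
    have "rest v u F \<in> R F (length u)" unfolding R_def using vu by blast
    then show ?thesis using True by blast
  next
    case False
    let ?v1 = "take k v" and ?v2 = "drop k v" and ?u1 = "take k u" and ?u2 = "drop k u"
    have l: "length ?v1 = k" "length ?u1 = k" "length ?v2 = length ?u2" "length ?u2 \<ge> M'" using vu False by simp_all
    have eq: "rest v u F = rest ?v2 ?u2 (rest ?v1 ?u1 F)"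
      using rest_append[OF cob_subset[OF F], of ?v1 ?u1 ?v2 ?u2] l by simp
    have "rest ?v1 ?u1 F \<in> R F k" unfolding R_def using l by blast
    then have "rest v u F = {} \<or> (\<exists>B\<in>E. rest v u F = rest ?v2 ?u2 B)"
      unfolding eq by (rule M'[rule_format]) (use l(3,4) in simp)
    then have "rest v u F \<in> RR"
    proof (elim disjE bexE)
      assume "rest v u F = {}"
      then show ?thesis by (simp add: RR_def)
    next
      fix B assume B: "B \<in> E" "rest v u F = rest ?v2 ?u2 B"
      show ?thesis unfolding B(2) by (rule inRR[OF B(1) l(3) refl])
    qed
    then show ?thesis ..
  qed
  then have "{rest v u F |v u. length v = length u} \<subseteq> RR \<union> (\<Union>m\<le>k + M'. R F m)" by blast
  moreover have "finite (RR \<union> (\<Union>m\<le>k + M'. R F m))" using finRR finR[OF F] by simp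
  ultimately show ?thesis by (rule finite_subset)
qed

end

lemma UN_eq_const: "A \<noteq> {} \<Longrightarrow> (\<And>x. x \<in> A \<Longrightarrow> f x = c) \<Longrightarrow> (\<Union>x\<in>A. f x) = c"
  by auto

section \<open>Comparison of homology groups\<close>

text \<open>The first isomorphism theorem for \<open>j n\<close> followed by the quotient map:
  \<open>inj\<close> makes the kernel on cycles equal to the boundaries, and \<open>surj\<close>
  asks for preimages only up to a boundary. The map on cosets is recovered from the explicit form of
  that isomorphism.\<close>

lemma homology_iso:
  assumes C: "chain_complex C d" and C': "chain_complex C' d'"
    and j: "\<And>n. j n \<in> hom (C n) (C' n)"
    and comm: "\<And>n c. c \<in> carrier (C n) \<Longrightarrow> j (n - 1) (d n c) = d' n (j n c)"
    and inj: "\<And>c. c \<in> cycles C d n \<Longrightarrow> j n c \<in> boundaries C' d' n \<Longrightarrow> c \<in> boundaries C d n"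
    and surj: "\<And>x. x \<in> cycles C' d' n \<Longrightarrow>
      \<exists>c\<in>cycles C d n. \<exists>b\<in>boundaries C' d' n. x = b \<otimes>\<^bsub>C' n\<^esub> j n c"
  shows "\<exists>\<Phi> \<in> iso (homology C d n) (homology C' d' n). \<forall>c \<in> cycles C d n.
    \<Phi> (boundaries C d n #>\<^bsub>C n\<^esub> c) = boundaries C' d' n #>\<^bsub>C' n\<^esub> j n c"
proof -
  have grp: "comm_group (K m)" "group (K m)" "k m \<in> hom (K m) (K (m - 1))" if "chain_complex K k" for K k m
    using that comm_group.axioms(2) unfolding chain_complex_def by blast+
  have sub: "subgroup (cycles K k m) (K m) \<and> boundaries K k m \<lhd> (K m)\<lparr>carrier := cycles K k m\<rparr> \<and>
      group ((K m)\<lparr>carrier := cycles K k m\<rparr>) \<and> subgroup (boundaries K k m) (K m)"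
    if K: "chain_complex K k" for K :: "nat \<Rightarrow> 'x monoid" and k m
  proof -
    have h: "group_hom (K m) (K (m - 1)) (k m)" "group_hom (K (Suc m)) (K m) (k (Suc m))"
      using grp[OF K, of m] grp[OF K, of "m - 1"] grp[OF K, of "Suc m"]
      by (auto intro!: group_hom.intro simp: group_hom_axioms_def)
    have Z: "subgroup (cycles K k m) (K m)" unfolding cycles_def by (rule group_hom.subgroup_kernel[OF h(1)])
    have B: "subgroup (boundaries K k m) (K m)"
      unfolding boundaries_def by (rule group_hom.img_is_subgroup[OF h(2)])
    have "boundaries K k m \<subseteq> cycles K k m"
    proof
      fix x assume "x \<in> boundaries K k m"
      then obtain c where c: "c \<in> carrier (K (Suc m))" "x = k (Suc m) c" unfolding boundaries_def by blast
      have "x \<in> carrier (K m)" using c h(2) by (simp add: group_hom.hom_closed)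
      moreover have "k m x = \<one>\<^bsub>K (m - 1)\<^esub>" using K c unfolding chain_complex_def by blast
      ultimately show "x \<in> cycles K k m" by (simp add: cycles_def kernel_def)
    qed
    then have BZ: "subgroup (boundaries K k m) ((K m)\<lparr>carrier := cycles K k m\<rparr>)"
      by (rule group.subgroup_incl[OF grp(2)[OF K] B Z])
    have "comm_group ((K m)\<lparr>carrier := cycles K k m\<rparr>)"
    proof (rule group.group_comm_groupI)
      show "group ((K m)\<lparr>carrier := cycles K k m\<rparr>)" by (rule subgroup.subgroup_is_group[OF Z grp(2)[OF K]])
      fix x y assume "x \<in> carrier ((K m)\<lparr>carrier := cycles K k m\<rparr>)" "y \<in> carrier ((K m)\<lparr>carrier := cycles K k m\<rparr>)"
      then have "x \<in> carrier (K m)" "y \<in> carrier (K m)" using subgroup.subset[OF Z] by auto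
      then show "x \<otimes>\<^bsub>(K m)\<lparr>carrier := cycles K k m\<rparr>\<^esub> y = y \<otimes>\<^bsub>(K m)\<lparr>carrier := cycles K k m\<rparr>\<^esub> x"
        using comm_monoid.m_comm[OF comm_group.axioms(1)[OF grp(1)[OF K]]] by simp
    qed
    then have "boundaries K k m \<lhd> (K m)\<lparr>carrier := cycles K k m\<rparr>"
      using comm_group.normal_iff_subgroup BZ by blast
    then show ?thesis using Z B subgroup.subgroup_is_group[OF Z grp(2)[OF K]] by blast
  qed
  let ?Z = "(C n)\<lparr>carrier := cycles C d n\<rparr>" and ?B = "boundaries C d n"
  let ?Z' = "(C' n)\<lparr>carrier := cycles C' d' n\<rparr>" and ?B' = "boundaries C' d' n"
  have Z: "subgroup (cycles C d n) (C n)" "?B \<lhd> ?Z" "group ?Z" using sub[OF C] by blast+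
  have Z': "?B' \<lhd> ?Z'" "group ?Z'" "subgroup ?B' (C' n)" using sub[OF C'] by blast+
  have BZ: "?B \<subseteq> cycles C d n" using normal_imp_subgroup[OF Z(2)] subgroup.subset by fastforce
  have BZ': "?B' \<subseteq> cycles C' d' n" using normal_imp_subgroup[OF Z'(1)] subgroup.subset by fastforce
  have jgh: "group_hom (C m) (C' m) (j m)" for m
    using grp(2)[OF C] grp(2)[OF C'] j by (auto intro!: group_hom.intro simp: group_hom_axioms_def)
  have jc: "j n c \<in> cycles C' d' n" if c: "c \<in> cycles C d n" for c
  proof -
    have "c \<in> carrier (C n)" "d n c = \<one>\<^bsub>C (n - 1)\<^esub>" using c by (simp_all add: cycles_def kernel_def)
    then have "j n c \<in> carrier (C' n)" "d' n (j n c) = \<one>\<^bsub>C' (n - 1)\<^esub>"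
      using comm[of c n] group_hom.hom_closed[OF jgh] group_hom.hom_one[OF jgh, of "n - 1"] by simp_all
    then show ?thesis by (simp add: cycles_def kernel_def)
  qed
  have jb: "j n c \<in> ?B'" if c: "c \<in> ?B" for c
  proof -
    obtain e where e: "e \<in> carrier (C (Suc n))" "c = d (Suc n) e" using c by (auto simp: boundaries_def)
    then have "j n c = d' (Suc n) (j (Suc n) e)" using comm[of e "Suc n"] by simp
    then show ?thesis using group_hom.hom_closed[OF jgh e(1)] by (simp add: boundaries_def)
  qed
  define h where "h c = ?B' #>\<^bsub>C' n\<^esub> j n c" for c
  have rc: "?B' #>\<^bsub>?Z'\<^esub> x = ?B' #>\<^bsub>C' n\<^esub> x" "?B #>\<^bsub>?Z\<^esub> y = ?B #>\<^bsub>C n\<^esub> y" for x y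
    by (simp_all add: r_coset_def)
  have "j n \<in> hom ?Z ?Z'"
    using jc j[of n] subgroup.subset[OF Z(1)] unfolding hom_def by (auto simp: Pi_iff subset_iff)
  then have "(\<lambda>x. ?B' #>\<^bsub>?Z'\<^esub> x) \<circ> j n \<in> hom ?Z (?Z' Mod ?B')"
    by (rule hom_compose) (rule normal.r_coset_hom_Mod[OF Z'(1)])
  then have hh: "h \<in> hom ?Z (?Z' Mod ?B')" by (simp add: comp_def rc h_def[abs_def])
  have G': "group (?Z' Mod ?B')" by (rule normal.factorgroup_is_group[OF Z'(1)])
  interpret h: group_hom ?Z "?Z' Mod ?B'" h
    using Z(3) G' hh by (auto intro!: group_hom.intro simp: group_hom_axioms_def)
  have one: "\<one>\<^bsub>?Z' Mod ?B'\<^esub> = ?B'" by (simp add: FactGroup_def)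
  have hB: "h c = ?B' \<longleftrightarrow> j n c \<in> ?B'" if c: "c \<in> cycles C d n" for c
  proof
    assume "h c = ?B'"
    moreover have "j n c \<in> ?B' #>\<^bsub>?Z'\<^esub> j n c"
      using group.rcos_self[OF Z'(2), of "j n c" ?B'] jc[OF c] normal_imp_subgroup[OF Z'(1)] by simp
    ultimately show "j n c \<in> ?B'" by (simp add: h_def rc)
  next
    assume "j n c \<in> ?B'"
    then have "?B' #>\<^bsub>?Z'\<^esub> j n c = ?B'"
      using group.coset_join2[OF Z'(2), of "j n c" ?B'] jc[OF c] normal_imp_subgroup[OF Z'(1)] by simp
    then show "h c = ?B'" by (simp add: h_def rc)
  qed
  \<comment> \<open>A cycle is killed exactly when its image is a boundary; one inclusion is
    \<open>inj\<close>, the other holds because \<open>j\<close> commutes with the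
    differentials.\<close>
  have ker: "kernel ?Z (?Z' Mod ?B') h = ?B"
    unfolding kernel_def one using hB inj jb BZ by auto
  have "h ` carrier ?Z = carrier (?Z' Mod ?B')"
  proof
    show "h ` carrier ?Z \<subseteq> carrier (?Z' Mod ?B')" using h.hom_closed by blast
    show "carrier (?Z' Mod ?B') \<subseteq> h ` carrier ?Z"
    proof
      fix X assume "X \<in> carrier (?Z' Mod ?B')"
      then obtain x where x: "x \<in> cycles C' d' n" "X = ?B' #>\<^bsub>?Z'\<^esub> x"
        by (auto simp: FactGroup_def RCOSETS_def)
      obtain c b where cb: "c \<in> cycles C d n" "b \<in> ?B'" "x = b \<otimes>\<^bsub>C' n\<^esub> j n c" using surj[OF x(1)] by blast
      have "?B' #>\<^bsub>?Z'\<^esub> (b \<otimes>\<^bsub>?Z'\<^esub> j n c) = (?B' #>\<^bsub>?Z'\<^esub> b) #>\<^bsub>?Z'\<^esub> j n c"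
        using group.coset_mult_assoc[OF Z'(2), of ?B' b "j n c"] BZ' cb jc by auto
      also have "?B' #>\<^bsub>?Z'\<^esub> b = ?B'"
        using group.coset_join2[OF Z'(2), of b ?B'] cb(2) BZ' normal_imp_subgroup[OF Z'(1)] by auto
      finally have "X = h c" using x cb by (simp add: h_def rc)
      then show "X \<in> h ` carrier ?Z" using cb(1) by simp
    qed
  qed
  from h.FactGroup_iso_set[OF this]
  have iso: "(\<lambda>X. the_elem (h ` X)) \<in> iso (homology C d n) (homology C' d' n)"
    unfolding ker homology_def .
  moreover have "the_elem (h ` (?B #>\<^bsub>C n\<^esub> c)) = h c" if c: "c \<in> cycles C d n" for c
  proof -
    have "h x = h c" if x: "x \<in> ?B #>\<^bsub>?Z\<^esub> c" for x
    proof -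
      obtain b where b: "b \<in> ?B" "x = b \<otimes>\<^bsub>?Z\<^esub> c" using x by (auto simp: r_coset_def)
      have "h x = h b \<otimes>\<^bsub>?Z' Mod ?B'\<^esub> h c" unfolding b(2) using b(1) BZ c by (intro h.hom_mult) auto
      also have "h b = \<one>\<^bsub>?Z' Mod ?B'\<^esub>" unfolding one using hB jb b(1) BZ by blast
      also have "\<one>\<^bsub>?Z' Mod ?B'\<^esub> \<otimes>\<^bsub>?Z' Mod ?B'\<^esub> h c = h c"
        by (rule monoid.l_one[OF group.is_monoid[OF G'] h.hom_closed]) (use c in simp)
      finally show ?thesis .
    qed
    moreover have "c \<in> ?B #>\<^bsub>?Z\<^esub> c"
      using group.rcos_self[OF Z(3), of c ?B] c normal_imp_subgroup[OF Z(2)] by simp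
    ultimately have "h ` (?B #>\<^bsub>?Z\<^esub> c) = {h c}" by blast
    then show ?thesis by (simp add: rc)
  qed
  ultimately show ?thesis unfolding h_def by (intro bexI[of _ "\<lambda>X. the_elem (h ` X)"]) (simp_all add: h_def)
qed

context contracting_groupoid
begin

section \<open>The nucleus\<close>

lemma ms_mem:
  assumes U: "U \<in> ms n" and n: "1 \<le> n" and xs: "xs \<in> nerve G n" "\<And>i. i < n \<Longrightarrow> xs ! i \<in> (\<lambda>xs. xs ! i) ` U"
  shows "xs \<in> U"
proof -
  obtain Fs where Fs: "U = {gs \<in> nerve G n. \<forall>i < n. gs ! i \<in> Fs ! i}" using U n by (auto simp: multisections_def)
  have "(\<lambda>xs. xs ! i) ` U \<subseteq> Fs ! i" if "i < n" for i using that by (auto simp: Fs)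
  then have "xs ! i \<in> Fs ! i" if "i < n" for i using xs(2)[OF that] that by blast
  then show ?thesis using xs(1) by (simp add: Fs)
qed

text \<open>For the non-trivial inclusion the entries are lifted separately. Neighbouring lifts
  compose because the ends to be matched have the same prefix and the same shift.\<close>

lemma restriction_rest:
  assumes U: "U \<in> ms n" and n: "1 \<le> n" and vs: "words n m vs"
  shows "restriction G \<pi> U vs = {hs \<in> nerve G n. \<forall>i<n. hs ! i \<in> rest (vs ! i) (vs ! Suc i) ((\<lambda>xs. xs ! i) ` U)}"
proof (intro equalityI subsetI)
  have Un: "U \<subseteq> nerve G n" using ms_nerve[OF U] by blast
  have len: "length (vs ! i) = m" "length (vs ! Suc i) = m" if "i < n" for i
    using words_nth[OF vs] that by simp_all
  {
    fix hs assume "hs \<in> restriction G \<pi> U vs"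
    then obtain xs where xs: "xs \<in> U" "fits n vs xs" "hs = map (sft m) xs"
      unfolding restriction_eq[OF Un vs] by blast
    have nx: "xs \<in> nerve G n" using xs(1) Un by blast
    have "hs ! i \<in> rest (vs ! i) (vs ! Suc i) ((\<lambda>xs. xs ! i) ` U)" if i: "i < n" for i
    proof -
      have "hs ! i = sft (length (vs ! i)) (xs ! i)" using xs(3) nerve_length[OF nx] i len[OF i] by simp
      moreover have "begins (\<pi> (rng G (xs ! i))) (vs ! i)" "begins (\<pi> (src G (xs ! i))) (vs ! Suc i)"
        using xs(2) i rng_vtx[OF i] src_vtx[OF nx i] by (simp_all add: fits_def)
      ultimately show ?thesis unfolding rest_def using xs(1) by blast
    qed
    moreover have "hs \<in> nerve G n" unfolding xs(3) by (rule map_nerve[OF sft_functor nx])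
    ultimately show "hs \<in> {hs \<in> nerve G n. \<forall>i<n. hs ! i \<in> rest (vs ! i) (vs ! Suc i) ((\<lambda>xs. xs ! i) ` U)}" by simp
  next
    fix hs assume "hs \<in> {hs \<in> nerve G n. \<forall>i<n. hs ! i \<in> rest (vs ! i) (vs ! Suc i) ((\<lambda>xs. xs ! i) ` U)}"
    then have hs: "hs \<in> nerve G n" "\<And>i. i < n \<Longrightarrow> hs ! i \<in> rest (vs ! i) (vs ! Suc i) ((\<lambda>xs. xs ! i) ` U)" by simp_all
    define g where "g i = (SOME k. k \<in> (\<lambda>xs. xs ! i) ` U \<and> begins (\<pi> (rng G k)) (vs ! i) \<and>
      begins (\<pi> (src G k)) (vs ! Suc i) \<and> hs ! i = sft m k)" for i
    have g: "g i \<in> (\<lambda>xs. xs ! i) ` U \<and> begins (\<pi> (rng G (g i))) (vs ! i) \<and>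
      begins (\<pi> (src G (g i))) (vs ! Suc i) \<and> hs ! i = sft m (g i)" if i: "i < n" for i
      unfolding g_def
    proof (rule someI_ex)
      show "\<exists>k. k \<in> (\<lambda>xs. xs ! i) ` U \<and> begins (\<pi> (rng G k)) (vs ! i) \<and>
        begins (\<pi> (src G k)) (vs ! Suc i) \<and> hs ! i = sft m k"
        using hs(2)[OF i] len[OF i] unfolding rest_def by blast
    qed
    have ge: "g i \<in> elts G" if i: "i < n" for i
    proof -
      have "(\<lambda>xs. xs ! i) ` U \<subseteq> elts G" using ms_cob[OF U, of i] cob_subset i by simp
      then show ?thesis using g[OF i] by blast
    qed
    define xs where "xs = map g [0..<n]"
    have xn: "xs ! i = g i" if "i < n" for i using that by (simp add: xs_def)
    \<comment> \<open>Both ends begin with the word at index \<open>Suc i\<close>, which is why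
      source and range conditions in neighbouring coordinates share that word.\<close>
    have "src G (xs ! i) = rng G (xs ! Suc i)" if i: "Suc i < n" for i
    proof -
      have i': "i < n" using i by simp
      have e: "sft m (src G (g i)) = sft m (rng G (g (Suc i)))"
        using nerve_src_rng[OF hs(1) i] g[OF i'] g[OF i] sft_src[OF ge[OF i'], of m] sft_rng[OF ge[OF i], of m] by simp
      have "src G (g i) = rng G (g (Suc i))"
        by (rule begins_sft_eqI[of _ _ "vs ! Suc i"]) (use e g[OF i'] g[OF i] ge[OF i'] ge[OF i] len[OF i'] in simp_all)
      then show ?thesis using i xn by simp
    qed
    then have nx: "xs \<in> nerve G n" unfolding nerve_iff using n ge xn by (simp add: xs_def)
    have xU: "xs \<in> U" by (rule ms_mem[OF U n nx]) (use g xn in simp)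
    have "fits n vs xs" unfolding fits_def
    proof (intro allI impI)
      fix i assume i: "i \<le> n"
      show "begins (\<pi> (vtx n i xs)) (vs ! i)"
      proof (cases "i < n")
        case True
        then show ?thesis using g[OF True] rng_vtx[OF True, of xs] xn by simp
      next
        case False
        then have "i = Suc (n - 1)" "n - 1 < n" using i n by simp_all
        then show ?thesis using g[of "n - 1"] src_vtx[OF nx, of "n - 1"] xn[of "n - 1"] by simp
      qed
    qed
    moreover have "hs = map (sft m) xs"
      by (rule nth_equalityI) (use nerve_length[OF hs(1)] n g in \<open>simp_all add: xs_def\<close>)
    ultimately show "hs \<in> restriction G \<pi> U vs" unfolding restriction_eq[OF Un vs] using xU by blast
  }
qed

text \<open>In positive degree a restriction is determined by the tuple of its coordinate
  restrictions, and each coordinate bisection has only finitely many. In degree 0 the single word of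
  the tuple serves both as range and as source prefix.\<close>

lemma finite_restriction:
  assumes U: "U \<in> ms n"
  shows "finite {restriction G \<pi> U vs |vs m. words n m vs}"
proof (cases "n = 0")
  case True
  let ?K = "(\<lambda>xs. xs ! 0) ` U"
  have Un: "U \<subseteq> nerve G n" using ms_nerve[OF U] by blast
  have fin: "finite {rest v u ?K |v u. length v = length u}" using finite_restrictions ms_cob[OF U, of 0] by simp
  have "{restriction G \<pi> U vs |vs m. words n m vs} \<subseteq> (\<lambda>K. (\<lambda>u. [u]) ` K) ` {rest v u ?K |v u. length v = length u}"
  proof
    fix V assume "V \<in> {restriction G \<pi> U vs |vs m. words n m vs}"
    then obtain vs m where V: "V = restriction G \<pi> U vs" "words n m vs" by blast
    let ?v = "vs ! 0"
    have lv: "length ?v = m" using words_nth[OF V(2)] by simp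
    have s: "\<exists>g\<in>units G. xs = [g]" if "xs \<in> U" for xs
      using nerve_singleton[of xs n] Un that True by auto
    have f: "fits n vs [g] \<longleftrightarrow> begins (\<pi> (rng G g)) ?v \<and> begins (\<pi> (src G g)) ?v" if "g \<in> units G" for g
      using True that by (simp add: fits_def vtx_def)
    have "V = (\<lambda>u. [u]) ` rest ?v ?v ?K"
    proof (intro equalityI subsetI)
      fix x assume "x \<in> V"
      then obtain xs where xs: "xs \<in> U" "fits n vs xs" "x = map (sft m) xs" unfolding V(1) restriction_eq[OF Un V(2)] by blast
      obtain g where g: "g \<in> units G" "xs = [g]" using s[OF xs(1)] by blast
      have "g \<in> ?K" using xs(1) g(2) by force
      then have "sft m g \<in> rest ?v ?v ?K" using f[OF g(1)] xs(2) g(2) lv unfolding rest_def by blast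
      then show "x \<in> (\<lambda>u. [u]) ` rest ?v ?v ?K" using xs(3) g(2) by simp
    next
      fix x assume "x \<in> (\<lambda>u. [u]) ` rest ?v ?v ?K"
      then obtain xs where xs: "xs \<in> U" "begins (\<pi> (rng G (xs ! 0))) ?v" "begins (\<pi> (src G (xs ! 0))) ?v" "x = [sft m (xs ! 0)]"
        unfolding rest_def lv by blast
      obtain g where g: "g \<in> units G" "xs = [g]" using s[OF xs(1)] by blast
      have "fits n vs xs" using f[OF g(1)] xs g by simp
      moreover have "x = map (sft m) xs" using xs(4) g(2) by simp
      ultimately show "x \<in> V" unfolding V(1) restriction_eq[OF Un V(2)] using xs(1) by blast
    qed
    then show "V \<in> (\<lambda>K. (\<lambda>u. [u]) ` K) ` {rest v u ?K |v u. length v = length u}" by blast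
  qed
  then show ?thesis by (rule finite_surj[OF fin])
next
  case False
  then have n: "1 \<le> n" by simp
  define RR where "RR = (\<Union>i\<in>{..<n}. {rest v u ((\<lambda>xs. xs ! i) ` U) |v u. length v = length u})"
  have "finite RR" unfolding RR_def
  proof (rule finite_UN_I)
    fix i assume "i \<in> {..<n}"
    then show "finite {rest v u ((\<lambda>xs. xs ! i) ` U) |v u. length v = length u}"
      using finite_restrictions ms_cob[OF U, of i] by simp
  qed simp
  then have fin: "finite {Bs. set Bs \<subseteq> RR \<and> length Bs = n}" by (rule finite_lists_length_eq)
  let ?h = "\<lambda>Bs. {hs \<in> nerve G n. \<forall>i<n. hs ! i \<in> Bs ! i}"
  have "{restriction G \<pi> U vs |vs m. words n m vs} \<subseteq> ?h ` {Bs. set Bs \<subseteq> RR \<and> length Bs = n}"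
  proof
    fix V assume "V \<in> {restriction G \<pi> U vs |vs m. words n m vs}"
    then obtain vs m where V: "V = restriction G \<pi> U vs" "words n m vs" by blast
    let ?Bs = "map (\<lambda>i. rest (vs ! i) (vs ! Suc i) ((\<lambda>xs. xs ! i) ` U)) [0..<n]"
    have "rest (vs ! i) (vs ! Suc i) ((\<lambda>xs. xs ! i) ` U) \<in> RR" if "i < n" for i
    proof -
      have "length (vs ! i) = length (vs ! Suc i)" using words_nth[OF V(2)] that by simp
      then show ?thesis unfolding RR_def using that by blast
    qed
    then have Bs: "?Bs \<in> {Bs. set Bs \<subseteq> RR \<and> length Bs = n}" by auto
    have "V = ?h ?Bs" unfolding V(1) restriction_rest[OF U n V(2)] by (rule Collect_cong) simp
    then show "V \<in> ?h ` {Bs. set Bs \<subseteq> RR \<and> length Bs = n}" using Bs by (rule image_eqI)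
  qed
  then show ?thesis by (rule finite_surj[OF fin])
qed

definition recurrent :: "nat \<Rightarrow> 'g list set set" where
  "recurrent n = {V \<in> ms n. V \<noteq> {} \<and>
     (\<exists>U\<in>ms n. infinite {m. \<exists>vs. words n m vs \<and> restriction G \<pi> U vs = V})}"

lemma absorbs_iff:
  "absorbs G \<pi> n M \<longleftrightarrow> (\<forall>U\<in>ms n. \<exists>m0. \<forall>m\<ge>m0. \<forall>vs. words n m vs \<longrightarrow>
     restriction G \<pi> U vs = {} \<or> restriction G \<pi> U vs \<in> M)"
  by (simp add: absorbs_def words_def)

text \<open>\<open>U\<close> has finitely many restrictions altogether. Each nonempty one outside
  \<open>recurrent n\<close> occurs at finitely many levels only, so a single threshold lies beyond
  all of these levels.\<close>

lemma absorbs_recurrent: "absorbs G \<pi> n (recurrent n)"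
  unfolding absorbs_iff
proof
  fix U assume U: "U \<in> ms n"
  let ?S = "{restriction G \<pi> U vs |vs m. words n m vs}"
  let ?I = "\<lambda>V. {m. \<exists>vs. words n m vs \<and> restriction G \<pi> U vs = V}"
  let ?T = "{V \<in> ?S. V \<noteq> {} \<and> V \<notin> recurrent n}"
  have "finite (\<Union>V\<in>?T. ?I V)"
  proof (rule finite_UN_I)
    show "finite ?T" using finite_restriction[OF U] by simp
    fix V assume "V \<in> ?T"
    then have "V \<noteq> {}" "V \<notin> recurrent n" "V \<in> ms n" using restriction_ms[OF U] by auto
    then show "finite (?I V)" using U unfolding recurrent_def by blast
  qed
  then obtain m0 where m0: "(\<Union>V\<in>?T. ?I V) \<subseteq> {..<m0}" using finite_nat_bounded by blast
  show "\<exists>m0. \<forall>m\<ge>m0. \<forall>vs. words n m vs \<longrightarrow> restriction G \<pi> U vs = {} \<or> restriction G \<pi> U vs \<in> recurrent n"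
  proof (intro exI[of _ m0] allI impI, rule ccontr)
    fix m vs assume m: "m0 \<le> m" and vs: "words n m vs" and n: "\<not> (restriction G \<pi> U vs = {} \<or> restriction G \<pi> U vs \<in> recurrent n)"
    have "restriction G \<pi> U vs \<in> ?T" using vs n by blast
    moreover have "m \<in> ?I (restriction G \<pi> U vs)" using vs by blast
    ultimately have "m \<in> (\<Union>V\<in>?T. ?I V)" by (rule UN_I)
    then have "m < m0" using m0 by (simp only: subset_iff lessThan_iff)
    then show False using m by simp
  qed
qed

text \<open>An absorbing set contains the nonempty restrictions beyond some threshold, hence
  everything nonempty that recurs at infinitely many levels. As the recurrent sets absorb by
  themselves, they form the smallest absorbing set.\<close>

lemma nucleus_eq: "nucleus G \<pi> n = recurrent n"
proof
  show "nucleus G \<pi> n \<subseteq> recurrent n"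
    unfolding nucleus_def using absorbs_recurrent by (intro Inter_lower) (auto simp: recurrent_def)
  have "recurrent n \<subseteq> M" if M: "absorbs G \<pi> n M" for M
  proof
    fix V assume V: "V \<in> recurrent n"
    then obtain U where U: "U \<in> ms n" "infinite {m. \<exists>vs. words n m vs \<and> restriction G \<pi> U vs = V}"
      unfolding recurrent_def by blast
    obtain m0 where m0: "\<And>m vs. m \<ge> m0 \<Longrightarrow> words n m vs \<Longrightarrow> restriction G \<pi> U vs = {} \<or> restriction G \<pi> U vs \<in> M"
      using M U(1) unfolding absorbs_iff by meson
    obtain m where "m \<ge> m0" "m \<in> {m. \<exists>vs. words n m vs \<and> restriction G \<pi> U vs = V}"
      using U(2) by (meson infinite_nat_iff_unbounded_le)
    then obtain vs where "words n m vs" "restriction G \<pi> U vs = V" "m \<ge> m0" by blast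
    then show "V \<in> M" using m0 V unfolding recurrent_def by blast
  qed
  then show "recurrent n \<subseteq> nucleus G \<pi> n" unfolding nucleus_def by blast
qed

text \<open>If \<open>V\<close> is a restriction of \<open>U\<close> at level \<open>m\<close>, its
  restriction by \<open>vs'\<close> is a restriction of \<open>U\<close> at level
  \<open>m + m'\<close>; infinitely many levels stay infinitely many. This is what makes
  \<open>T\<close> preserve \<open>AA n\<close>.\<close>

lemma nucleus_restriction:
  assumes V: "V \<in> nucleus G \<pi> n" and vs': "words n m' vs'"
  shows "restriction G \<pi> V vs' = {} \<or> restriction G \<pi> V vs' \<in> nucleus G \<pi> n"
proof -
  obtain U where VU: "V \<in> ms n" "U \<in> ms n" "infinite {m. \<exists>vs. words n m vs \<and> restriction G \<pi> U vs = V}"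
    using V unfolding nucleus_eq recurrent_def by blast
  let ?W = "restriction G \<pi> V vs'"
  have "(\<lambda>m. m + m') ` {m. \<exists>vs. words n m vs \<and> restriction G \<pi> U vs = V} \<subseteq>
      {m. \<exists>vs. words n m vs \<and> restriction G \<pi> U vs = ?W}"
  proof (rule image_subsetI, rule CollectI)
    fix m assume "m \<in> {m. \<exists>vs. words n m vs \<and> restriction G \<pi> U vs = V}"
    then obtain vs where vs: "words n m vs" "restriction G \<pi> U vs = V" by blast
    show "\<exists>vs. words n (m + m') vs \<and> restriction G \<pi> U vs = ?W"
      using restriction_restriction[OF VU(2) vs(1) vs'] vs(2) by metis
  qed
  moreover have "infinite ((\<lambda>m. m + m') ` {m. \<exists>vs. words n m vs \<and> restriction G \<pi> U vs = V})"
    using VU(3) by (simp add: finite_image_iff)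
  ultimately have "infinite {m. \<exists>vs. words n m vs \<and> restriction G \<pi> U vs = ?W}" by (rule infinite_super)
  then show ?thesis using restriction_ms[OF VU(1) vs'] VU(2) unfolding nucleus_eq recurrent_def by blast
qed

section \<open>The groups of the nucleus\<close>

abbreviation AA :: "nat \<Rightarrow> ('g list \<Rightarrow> 'a::ab_group_add) set" where "AA n \<equiv> const_span (nucleus G \<pi> n)"

lemma carrier_AN: "carrier (AN G \<pi> n) = AA n"
  by (simp add: AN_def const_span_def)

lemma AA_CC: "f \<in> AA n \<Longrightarrow> f \<in> CC n"
  by (rule const_span_mono) (auto simp: nucleus_eq recurrent_def)

lemma sum_const_on_AA:
  assumes "\<And>vs. vs \<in> wordsets n m \<Longrightarrow> restriction G \<pi> U vs = {} \<or> restriction G \<pi> U vs \<in> nucleus G \<pi> n"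
  shows "(\<lambda>z. \<Sum>vs\<in>wordsets n m. const_on a (restriction G \<pi> U vs) z) \<in> AA n"
proof (rule const_span_sum[OF finite_wordsets])
  fix vs assume "vs \<in> wordsets n m"
  then consider "restriction G \<pi> U vs = {}" | "restriction G \<pi> U vs \<in> nucleus G \<pi> n" using assms by blast
  then show "const_on a (restriction G \<pi> U vs) \<in> AA n"
  proof cases
    case 1
    have "const_on a {} = (\<lambda>_::'g list. 0)" by (simp add: const_on_def)
    then show ?thesis unfolding 1 by (simp only: const_span_zero)
  next
    case 2
    then show ?thesis by (rule const_span_const)
  qed
qed

lemma T_add: "f \<in> CC n \<Longrightarrow> g \<in> CC n \<Longrightarrow> T (\<lambda>x. f x + g x) = (\<lambda>x. T f x + T g x)"
  by (rule push_add'[OF et_map[OF etale_functor_gshift]])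

lemma T_AA:
  assumes "f \<in> AA n"
  shows "T f \<in> AA n"
  using assms
proof (induction rule: const_span_induct)
  case zero
  show ?case by (simp add: push_zero const_span_zero)
next
  case (const a U)
  then have U: "U \<in> ms n" by (simp add: nucleus_eq recurrent_def)
  have "T (const_on a U) = (\<lambda>z. \<Sum>vs\<in>wordsets n 1. const_on a (restriction G \<pi> U vs) z)"
    using push_sft_const_on[OF U, of 1 a] by simp
  then show ?case using sum_const_on_AA[of n 1 U a] nucleus_restriction[OF const wordsets_words] by simp
next
  case (add f g)
  then show ?case using T_add[OF AA_CC AA_CC, of f n g] by (simp add: const_span_add)
qed

abbreviation Tp :: "nat \<Rightarrow> ('g list \<Rightarrow> 'a::ab_group_add) \<Rightarrow> 'g list \<Rightarrow> 'a" where "Tp m \<equiv> T ^^ m"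

lemma Tp_CC: "f \<in> CC n \<Longrightarrow> Tp m f \<in> CC n"
  by (induction m) (simp_all add: T_CC)

lemma Tp_AA: "f \<in> AA n \<Longrightarrow> Tp m f \<in> AA n"
  by (induction m) (simp_all add: T_AA)

lemma Tp_Tp: "Tp k (Tp m f) = Tp (k + m) f"
  by (simp add: funpow_add)

lemma Tp_add: "f \<in> CC n \<Longrightarrow> g \<in> CC n \<Longrightarrow> Tp m (\<lambda>x. f x + g x) = (\<lambda>x. Tp m f x + Tp m g x)"
proof (induction m)
  case (Suc m)
  then show ?case using T_add[OF Tp_CC[OF Suc.prems(1), of m] Tp_CC[OF Suc.prems(2), of m]] by simp
qed simp

lemma Tp_zero: "Tp m (\<lambda>_. 0) = (\<lambda>_. 0)"
  by (induction m) (simp_all add: push_zero)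

lemma bd_Tp: "f \<in> CC n \<Longrightarrow> bd G n (Tp m f) = Tp m (bd G n f)"
proof (induction m)
  case (Suc m)
  then show ?case using bd_T[OF Tp_CC[OF Suc.prems, of m]] by simp
qed simp

lemma ex_Tp_AA:
  assumes "f \<in> CC n"
  shows "\<exists>m0. \<forall>m\<ge>m0. Tp m f \<in> AA n"
  using assms
proof (induction rule: const_span_induct)
  case zero
  show ?case by (simp add: Tp_zero const_span_zero)
next
  case (const a U)
  obtain m0 where m0: "\<And>m vs. m \<ge> m0 \<Longrightarrow> words n m vs \<Longrightarrow> restriction G \<pi> U vs = {} \<or> restriction G \<pi> U vs \<in> nucleus G \<pi> n"
    using absorbs_recurrent const unfolding absorbs_iff nucleus_eq by meson
  have "Tp m (const_on a U) \<in> AA n" if "m \<ge> m0" for m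
  proof -
    have "Tp m (const_on a U) = (\<lambda>z. \<Sum>vs\<in>wordsets n m. const_on a (restriction G \<pi> U vs) z)"
      using T_funpow[OF const_span_const[OF const], of m a] push_sft_const_on[OF const, of m a] by simp
    then show ?thesis using sum_const_on_AA[of n m U a] m0[OF that wordsets_words] by simp
  qed
  then show ?case by blast
next
  case (add f g)
  then obtain m1 m2 where m: "\<And>m. m \<ge> m1 \<Longrightarrow> Tp m f \<in> AA n" "\<And>m. m \<ge> m2 \<Longrightarrow> Tp m g \<in> AA n" by blast
  have "Tp m (\<lambda>x. f x + g x) \<in> AA n" if "m \<ge> max m1 m2" for m
    unfolding Tp_add[OF add(1,2)] using that m by (intro const_span_add) simp_all
  then show ?case by blast
qed

text \<open>By iteration: the cycle \<open>c\<close> found so far is itself a shift up to a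
  boundary, and that boundary is carried along by \<open>Tp m\<close> because \<open>bd\<close>
  commutes with it.\<close>

lemma Tp_homology_surj:
  fixes f :: "'g list \<Rightarrow> 'a::ab_group_add"
  assumes f: "f \<in> CC n" "bd G n f = (\<lambda>_. 0)"
  shows "\<exists>c\<in>CC n. bd G n c = (\<lambda>_. 0) \<and> (\<exists>h\<in>CC (Suc n). \<forall>z. f z = Tp m c z + bd G (Suc n) h z)"
proof (induction m)
  case 0
  have "\<forall>z. f z = Tp 0 f z + bd G (Suc n) (\<lambda>_. 0) z" by (simp add: bd_zero)
  then show ?case using f const_span_zero by blast
next
  case (Suc m)
  then obtain c h where c: "c \<in> CC n" "bd G n c = (\<lambda>_. 0)" and h: "h \<in> CC (Suc n)" "\<And>z. f z = Tp m c z + bd G (Suc n) h z" by blast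
  obtain c' h' where c': "c' \<in> CC n" "bd G n c' = (\<lambda>_. 0)" and h': "h' \<in> CC (Suc n)" "\<And>z. c z - T c' z = bd G (Suc n) h' z"
    using T_homology_surj[OF c] by blast
  have "c = (\<lambda>z. T c' z + bd G (Suc n) h' z)" using h'(2) by (auto simp: fun_eq_iff algebra_simps)
  moreover have bC: "bd G (Suc n) h' \<in> CC n" using bd_CC[OF h'(1)] by simp
  ultimately have "Tp m c = (\<lambda>z. Tp m (T c') z + Tp m (bd G (Suc n) h') z)"
    using Tp_add[OF T_CC[OF c'(1)] bC, of m] by simp
  also have "Tp m (T c') = Tp (Suc m) c'" by (simp add: funpow_swap1)
  finally have e: "Tp m c = (\<lambda>z. Tp (Suc m) c' z + bd G (Suc n) (Tp m h') z)" using bd_Tp[OF h'(1), of m] by simp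
  have "f z = Tp (Suc m) c' z + bd G (Suc n) (\<lambda>x. Tp m h' x + h x) z" for z
    using h(2)[of z] e bd_add[OF Tp_CC[OF h'(1), of m] h(1)] by (simp add: add.assoc)
  then show ?case using c' const_span_add[OF Tp_CC[OF h'(1), of m] h(1)] by blast
qed

text \<open>One \<open>T\<close> is removed at a time from the outside: \<open>Tp m c\<close> is a
  cycle whose image under \<open>T\<close> bounds, so it bounds itself.\<close>

lemma Tp_homology_inj:
  fixes c :: "'g list \<Rightarrow> 'a::ab_group_add"
  assumes c: "c \<in> CC n" "bd G n c = (\<lambda>_. 0)"
  shows "h \<in> CC (Suc n) \<Longrightarrow> Tp m c = bd G (Suc n) h \<Longrightarrow> \<exists>h'\<in>CC (Suc n). c = bd G (Suc n) h'"
proof (induction m arbitrary: h)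
  case 0
  then show ?case by auto
next
  case (Suc m)
  have "bd G n (Tp m c) = (\<lambda>_. 0)" using bd_Tp[OF c(1), of m] c(2) by (simp add: Tp_zero)
  moreover have "T (Tp m c) = bd G (Suc n) h" using Suc.prems(2) by simp
  ultimately obtain h' where "h' \<in> CC (Suc n)" "Tp m c = bd G (Suc n) h'"
    using T_homology_inj[OF Tp_CC[OF c(1)] _ Suc.prems(1)] by blast
  then show ?case by (rule Suc.IH)
qed

section \<open>The direct limits\<close>

definition cls :: "nat \<Rightarrow> nat \<Rightarrow> ('g list \<Rightarrow> 'a::ab_group_add) \<Rightarrow> (nat \<times> ('g list \<Rightarrow> 'a)) set" where
  "cls n m f = DN_rel G \<pi> n `` {(m, f)}"

lemma DN_rel_iff: "((m, a), (m', b)) \<in> DN_rel G \<pi> n \<longleftrightarrow>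
    a \<in> AA n \<and> b \<in> AA n \<and> (\<exists>i j. m + i = m' + j \<and> Tp i a = Tp j b)"
  by (simp add: DN_rel_def dlim_rel_def carrier_AN)

lemma DN_rel_sym: "((m, a), (m', b)) \<in> DN_rel G \<pi> n \<Longrightarrow> ((m', b), (m, a)) \<in> DN_rel G \<pi> n"
  unfolding DN_rel_iff
proof (elim exE conjE, intro conjI)
  fix i j assume "m + i = m' + j" "Tp i a = Tp j b"
  then show "\<exists>i j. m' + i = m + j \<and> Tp i b = Tp j a" by (intro exI[of _ j] exI[of _ i] conjI) (rule sym, assumption)+
qed

lemma DN_rel_equiv: "equiv (UNIV \<times> AA n) (DN_rel G \<pi> n)"
proof (rule equivI)
  show "DN_rel G \<pi> n \<subseteq> (UNIV \<times> AA n) \<times> (UNIV \<times> AA n)"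
    by (auto simp: DN_rel_iff)
  show "refl_on (UNIV \<times> AA n) (DN_rel G \<pi> n)"
    by (intro refl_onI) (auto simp: DN_rel_iff)
  show "sym (DN_rel G \<pi> n)"
  proof (rule symI)
    fix x y :: "nat \<times> ('g list \<Rightarrow> 'b)" assume "(x, y) \<in> DN_rel G \<pi> n"
    then show "(y, x) \<in> DN_rel G \<pi> n" using DN_rel_sym by (cases x; cases y) simp
  qed
  show "trans (DN_rel G \<pi> n)"
  proof (rule transI)
    fix x y z :: "nat \<times> ('g list \<Rightarrow> 'b)" assume xy: "(x, y) \<in> DN_rel G \<pi> n" and yz: "(y, z) \<in> DN_rel G \<pi> n"
    obtain m a m' b m'' c where p: "x = (m, a)" "y = (m', b)" "z = (m'', c)" by (metis surj_pair)
    obtain i j where ij: "a \<in> AA n" "m + i = m' + j" "Tp i a = Tp j b" using xy unfolding p DN_rel_iff by (elim exE conjE) (rule that)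
    obtain k l where kl: "c \<in> AA n" "m' + k = m'' + l" "Tp k b = Tp l c" using yz unfolding p DN_rel_iff by (elim exE conjE) (rule that)
    have "Tp (k + i) a = Tp k (Tp j b)" unfolding ij(3)[symmetric] Tp_Tp ..
    also have "\<dots> = Tp j (Tp k b)" unfolding Tp_Tp add.commute[of k j] ..
    also have "\<dots> = Tp (j + l) c" unfolding kl(3) Tp_Tp ..
    finally have "Tp (k + i) a = Tp (j + l) c" .
    moreover have "m + (k + i) = m'' + (j + l)" using ij(2) kl(2) by linarith
    ultimately show "(x, z) \<in> DN_rel G \<pi> n" unfolding p DN_rel_iff using ij(1) kl(1) by (intro conjI exI)
  qed
qed

lemma cls_eq_iff:
  assumes "a \<in> AA n" "b \<in> AA n"
  shows "cls n m a = cls n m' b \<longleftrightarrow> (\<exists>i j. m + i = m' + j \<and> Tp i a = Tp j b)"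
  using eq_equiv_class_iff[OF DN_rel_equiv, of "(m, a)" n "(m', b)"] assms
  by (simp add: cls_def DN_rel_iff)

lemma cls_shift: "a \<in> AA n \<Longrightarrow> cls n (m + k) (Tp k a) = cls n m a"
  unfolding cls_eq_iff[OF Tp_AA] by (intro exI[of _ 0] exI[of _ k]) simp

lemma mem_cls: "(m', b) \<in> cls n m a \<longleftrightarrow> a \<in> AA n \<and> b \<in> AA n \<and> (\<exists>i j. m' + i = m + j \<and> Tp i b = Tp j a)"
  unfolding cls_def Image_singleton_iff
proof
  assume "((m, a), (m', b)) \<in> DN_rel G \<pi> n"
  then show "a \<in> AA n \<and> b \<in> AA n \<and> (\<exists>i j. m' + i = m + j \<and> Tp i b = Tp j a)"
    using DN_rel_sym[of m a m' b n] unfolding DN_rel_iff by simp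
next
  assume "a \<in> AA n \<and> b \<in> AA n \<and> (\<exists>i j. m' + i = m + j \<and> Tp i b = Tp j a)"
  then have "((m', b), (m, a)) \<in> DN_rel G \<pi> n" unfolding DN_rel_iff by simp
  then show "((m, a), (m', b)) \<in> DN_rel G \<pi> n" by (rule DN_rel_sym)
qed

lemma carrier_DN: "X \<in> carrier (DN G \<pi> n) \<longleftrightarrow> (\<exists>m. \<exists>a\<in>AA n. X = cls n m a)"
  by (auto simp: DN_def dlim_def carrier_AN cls_def DN_rel_def quotient_def)

lemma cls_carrier: "a \<in> AA n \<Longrightarrow> cls n m a \<in> carrier (DN G \<pi> n)"
  using carrier_DN by blast

lemma AN_mult: "a \<otimes>\<^bsub>AN G \<pi> n\<^esub> b = (\<lambda>x. a x + b x)" and AN_one: "\<one>\<^bsub>AN G \<pi> n\<^esub> = (\<lambda>_. 0)"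
  by (simp_all add: AN_def fun_group_def)

text \<open>\<open>dlim\<close> adds classes at the sum of the two levels, after moving each
  representative there. It has to be checked, for all representatives, that this gives the class of
  the plain sum at the common level \<open>m\<close>.\<close>

lemma cls_mult:
  assumes a: "a \<in> AA n" and b: "b \<in> AA n"
  shows "cls n m a \<otimes>\<^bsub>DN G \<pi> n\<^esub> cls n m b = cls n m (\<lambda>x. a x + b x)"
proof -
  have ab: "(\<lambda>x. a x + b x) \<in> AA n" using a b by (rule const_span_add)
  have in1: "cls n (p + q) (\<lambda>x. Tp q a' x + Tp p b' x) = cls n m (\<lambda>x. a x + b x)"
    if a': "(p, a') \<in> cls n m a" and b': "(q, b') \<in> cls n m b" for p q a' b'
  proof -
    obtain i j where i: "a' \<in> AA n" "p + i = m + j" "Tp i a' = Tp j a" using a' unfolding mem_cls by (elim exE conjE) (rule that)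
    obtain k l where k: "b' \<in> AA n" "q + k = m + l" "Tp k b' = Tp l b" using b' unfolding mem_cls by (elim exE conjE) (rule that)
    have s: "(\<lambda>x. Tp q a' x + Tp p b' x) \<in> AA n" using Tp_AA[OF i(1)] Tp_AA[OF k(1)] by (rule const_span_add)
    have "Tp (i + k) (Tp q a') = Tp (k + q) (Tp i a')" by (simp only: Tp_Tp ac_simps)
    also have "\<dots> = Tp (k + q + j) a" by (simp only: i(3) Tp_Tp)
    finally have 1: "Tp (i + k) (Tp q a') = Tp (m + l + j) a" using k(2) by (simp only: add.commute[of k q])
    have "Tp (i + k) (Tp p b') = Tp (i + p) (Tp k b')" by (simp only: Tp_Tp ac_simps)
    also have "\<dots> = Tp (i + p + l) b" by (simp only: k(3) Tp_Tp)
    finally have 2: "Tp (i + k) (Tp p b') = Tp (m + j + l) b" using i(2) by (simp only: add.commute[of i p])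
    have "Tp (i + k) (\<lambda>x. Tp q a' x + Tp p b' x) = (\<lambda>x. Tp (i + k) (Tp q a') x + Tp (i + k) (Tp p b') x)"
      by (rule Tp_add[OF AA_CC[OF Tp_AA[OF i(1)]] AA_CC[OF Tp_AA[OF k(1)]]])
    also have "\<dots> = Tp (m + j + l) (\<lambda>x. a x + b x)"
      unfolding 1 2 Tp_add[OF AA_CC[OF a] AA_CC[OF b]] by (simp only: ac_simps)
    \<comment> \<open>From \<open>p + i = m + j\<close> and \<open>q + k = m + l\<close> both
      classes meet at level \<open>p + q + i + k\<close>, which is \<open>m\<close> plus
      \<open>m + j + l\<close>.\<close>
    finally show ?thesis unfolding cls_eq_iff[OF s ab]
      using i(2) k(2) by (intro exI[of _ "i + k"] exI[of _ "m + j + l"] conjI) simp_all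
  qed
  have ne: "(m, a) \<in> cls n m a" "(m, b) \<in> cls n m b" using a b by (auto simp: mem_cls)
  have "cls n m a \<otimes>\<^bsub>DN G \<pi> n\<^esub> cls n m b = (\<Union>(p, a') \<in> cls n m a. \<Union>(q, b') \<in> cls n m b.
      cls n (p + q) (\<lambda>x. Tp q a' x + Tp p b' x))"
    by (simp add: DN_def dlim_def AN_mult cls_def DN_rel_def)
  also have "\<dots> = cls n m (\<lambda>x. a x + b x)"
  proof (rule UN_eq_const)
    show "cls n m a \<noteq> {}" using ne by blast
    fix P assume P: "P \<in> cls n m a"
    obtain p a' where pa: "P = (p, a')" by (cases P)
    have "(\<Union>(q, b') \<in> cls n m b. cls n (p + q) (\<lambda>x. Tp q a' x + Tp p b' x)) = cls n m (\<lambda>x. a x + b x)"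
    proof (rule UN_eq_const)
      show "cls n m b \<noteq> {}" using ne by blast
      fix Q assume "Q \<in> cls n m b"
      then show "(case Q of (q, b') \<Rightarrow> cls n (p + q) (\<lambda>x. Tp q a' x + Tp p b' x)) = cls n m (\<lambda>x. a x + b x)"
        using in1 P pa by (cases Q) simp
    qed
    then show "(case P of (p, a') \<Rightarrow> \<Union>(q, b') \<in> cls n m b. cls n (p + q) (\<lambda>x. Tp q a' x + Tp p b' x)) = cls n m (\<lambda>x. a x + b x)"
      by (simp add: pa)
  qed
  finally show ?thesis .
qed

lemma DN_one: "\<one>\<^bsub>DN G \<pi> n\<^esub> = cls n m ((\<lambda>_. 0) :: 'g list \<Rightarrow> 'a::ab_group_add)"
proof -
  have "\<one>\<^bsub>DN G \<pi> n\<^esub> = cls n 0 ((\<lambda>_. 0) :: 'g list \<Rightarrow> 'a)" by (simp add: DN_def dlim_def AN_one cls_def DN_rel_def)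
  moreover have "cls n (0 + m) (Tp m ((\<lambda>_. 0) :: 'g list \<Rightarrow> 'a)) = cls n 0 (\<lambda>_. 0)"
    by (rule cls_shift[OF const_span_zero])
  ultimately show ?thesis by (simp add: Tp_zero)
qed

text \<open>Stated for three elements because of associativity; for two elements one of them is
  repeated.\<close>

lemma common_level:
  assumes "X \<in> carrier (DN G \<pi> n)" "Y \<in> carrier (DN G \<pi> n)" "Z \<in> carrier (DN G \<pi> n)"
  obtains m a b c where "a \<in> AA n" "b \<in> AA n" "c \<in> AA n" "X = cls n m a" "Y = cls n m b" "Z = cls n m c"
proof -
  obtain p q r a b c where *: "a \<in> AA n" "b \<in> AA n" "c \<in> AA n" "X = cls n p a" "Y = cls n q b" "Z = cls n r c"
    using assms unfolding carrier_DN by blast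
  have "X = cls n (p + q + r) (Tp (q + r) a)" using cls_shift[OF *(1), of p "q + r"] *(4) by (simp add: add.assoc)
  moreover have "Y = cls n (p + q + r) (Tp (p + r) b)" using cls_shift[OF *(2), of q "p + r"] *(5) by (simp add: ac_simps)
  moreover have "Z = cls n (p + q + r) (Tp (p + q) c)" using cls_shift[OF *(3), of r "p + q"] *(6) by (simp add: ac_simps)
  ultimately show thesis by (rule that[OF Tp_AA[OF *(1)] Tp_AA[OF *(2)] Tp_AA[OF *(3)]])
qed

lemma comm_group_DN: "comm_group (DN G \<pi> n :: (nat \<times> ('g list \<Rightarrow> 'a::ab_group_add)) set monoid)"
proof (rule comm_groupI)
  let ?D = "DN G \<pi> n :: (nat \<times> ('g list \<Rightarrow> 'a)) set monoid"
  fix X Y Z assume XYZ: "X \<in> carrier ?D" "Y \<in> carrier ?D" "Z \<in> carrier ?D"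
  obtain m a b c where *: "a \<in> AA n" "b \<in> AA n" "c \<in> AA n" "X = cls n m a" "Y = cls n m b" "Z = cls n m c"
    by (rule common_level[OF XYZ])
  show "(X \<otimes>\<^bsub>?D\<^esub> Y) \<otimes>\<^bsub>?D\<^esub> Z = X \<otimes>\<^bsub>?D\<^esub> (Y \<otimes>\<^bsub>?D\<^esub> Z)"
    unfolding *(4-6) using *(1-3) by (simp add: cls_mult const_span_add add.assoc)
next
  let ?D = "DN G \<pi> n :: (nat \<times> ('g list \<Rightarrow> 'a)) set monoid"
  fix X Y assume XY: "X \<in> carrier ?D" "Y \<in> carrier ?D"
  obtain m a b c where *: "a \<in> AA n" "b \<in> AA n" "c \<in> AA n" "X = cls n m a" "Y = cls n m b" "Y = cls n m c"
    by (rule common_level[OF XY XY(2)])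
  show "X \<otimes>\<^bsub>?D\<^esub> Y \<in> carrier ?D"
    unfolding *(4,5) using *(1,2) by (simp add: cls_mult const_span_add cls_carrier)
  show "X \<otimes>\<^bsub>?D\<^esub> Y = Y \<otimes>\<^bsub>?D\<^esub> X"
    unfolding *(4,5) using *(1,2) by (simp add: cls_mult add.commute)
next
  let ?D = "DN G \<pi> n :: (nat \<times> ('g list \<Rightarrow> 'a)) set monoid"
  show "\<one>\<^bsub>?D\<^esub> \<in> carrier ?D" unfolding DN_one[of n 0] by (rule cls_carrier[OF const_span_zero])
  fix X assume "X \<in> carrier ?D"
  then obtain m a where a: "a \<in> AA n" "X = cls n m a" unfolding carrier_DN by blast
  show "\<one>\<^bsub>?D\<^esub> \<otimes>\<^bsub>?D\<^esub> X = X"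
    unfolding DN_one[of n m] a(2) using a(1) by (simp add: cls_mult const_span_zero)
  have "cls n m (\<lambda>x. - a x) \<otimes>\<^bsub>?D\<^esub> X = \<one>\<^bsub>?D\<^esub>"
    unfolding DN_one[of n m] a(2) using a(1) by (simp add: cls_mult const_span_uminus)
  then show "\<exists>Y\<in>carrier ?D. Y \<otimes>\<^bsub>?D\<^esub> X = \<one>\<^bsub>?D\<^esub>"
    using cls_carrier[OF const_span_uminus[OF a(1)]] by blast
qed

section \<open>The comparison map into the direct limits\<close>

lemma J_eq:
  assumes f: "f \<in> CC n" and m: "Tp m f \<in> AA n"
  shows "J G \<pi> n f = cls n m (Tp m f)"
proof -
  have "J G \<pi> n f = (\<Union>m \<in> {m. Tp m f \<in> AA n}. cls n m (Tp m f))"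
    by (simp add: J_def carrier_AN cls_def)
  also have "\<dots> = cls n m (Tp m f)"
  proof (rule UN_eq_const)
    show "{m. Tp m f \<in> AA n} \<noteq> {}" using m by blast
    fix k assume "k \<in> {m. Tp m f \<in> AA n}"
    then have k: "Tp k f \<in> AA n" by simp
    show "cls n k (Tp k f) = cls n m (Tp m f)"
      unfolding cls_eq_iff[OF k m] by (intro exI[of _ m] exI[of _ k]) (simp add: Tp_Tp add.commute)
  qed
  finally show ?thesis .
qed

text \<open>\<open>DN_bd\<close> collects the values over all representatives and all admissible
  exponents. Since \<open>bd\<close> commutes with \<open>Tp\<close>, any two of these values agree
  after further shifts, so one convenient choice computes the class.\<close>

lemma DN_bd_cls:
  assumes f: "f \<in> AA n" and k: "Tp k (bd G n f) \<in> AA (n - 1)"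
  shows "DN_bd G \<pi> n (cls n m f) = cls (n - 1) (m + k) (Tp k (bd G n f))"
proof (cases "n = 0")
  case True
  then show ?thesis using DN_one[of 0 "m + k"] by (simp add: DN_bd_def bd_zero_map Tp_zero)
next
  case False
  have eq: "cls (n - 1) (m' + k') (Tp k' (bd G n f')) = cls (n - 1) (m + k) (Tp k (bd G n f))"
    if f': "(m', f') \<in> cls n m f" and k': "Tp k' (bd G n f') \<in> AA (n - 1)" for m' f' k'
  proof -
    obtain i j where ij: "f' \<in> AA n" "m' + i = m + j" "Tp i f' = Tp j f" using f' by (auto simp: mem_cls)
    have "Tp i (bd G n f') = Tp j (bd G n f)"
      using bd_Tp[OF AA_CC[OF ij(1)], of i] bd_Tp[OF AA_CC[OF f], of j] ij(3) by simp
    then have "Tp (k + k') (Tp i (bd G n f')) = Tp (k + k') (Tp j (bd G n f))" by simp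
    then have "Tp (k + i) (Tp k' (bd G n f')) = Tp (k' + j) (Tp k (bd G n f))"
      by (simp only: Tp_Tp ac_simps)
    then show ?thesis unfolding cls_eq_iff[OF k' k]
      using ij(2) by (intro exI[of _ "k + i"] exI[of _ "k' + j"] conjI) simp_all
  qed
  have "DN_bd G \<pi> n (cls n m f) = (\<Union>(m', f') \<in> cls n m f.
      \<Union>k' \<in> {k'. Tp k' (bd G n f') \<in> AA (n - 1)}. cls (n - 1) (m' + k') (Tp k' (bd G n f')))"
    using False by (simp add: DN_bd_def carrier_AN cls_def)
  also have "\<dots> = cls (n - 1) (m + k) (Tp k (bd G n f))"
  proof (rule UN_eq_const)
    show "cls n m f \<noteq> {}" using f mem_cls[of m f n m f] by blast
    fix P assume P: "P \<in> cls n m f"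
    obtain m' f' where mf: "P = (m', f')" by (cases P)
    have f': "f' \<in> AA n" using P mf by (simp add: mem_cls)
    have "(\<Union>k' \<in> {k'. Tp k' (bd G n f') \<in> AA (n - 1)}. cls (n - 1) (m' + k') (Tp k' (bd G n f'))) =
        cls (n - 1) (m + k) (Tp k (bd G n f))"
    proof (rule UN_eq_const)
      show "{k'. Tp k' (bd G n f') \<in> AA (n - 1)} \<noteq> {}" using ex_Tp_AA[OF bd_CC[OF AA_CC[OF f']]] by blast
    qed (use eq P mf in simp)
    then show "(case P of (m', f') \<Rightarrow> \<Union>k' \<in> {k'. Tp k' (bd G n f') \<in> AA (n - 1)}. cls (n - 1) (m' + k') (Tp k' (bd G n f'))) =
        cls (n - 1) (m + k) (Tp k (bd G n f))" by (simp add: mf)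
  qed
  finally show ?thesis .
qed

lemma ex_Tp_bd: "f \<in> AA n \<Longrightarrow> \<exists>k. Tp k (bd G n f) \<in> AA (n - 1)"
  using ex_Tp_AA[OF bd_CC[OF AA_CC]] by blast

lemma Tp_AA_mono: "Tp k f \<in> AA n \<Longrightarrow> k \<le> l \<Longrightarrow> Tp l f \<in> AA n"
  using Tp_AA[of "Tp k f" n "l - k"] by (simp add: Tp_Tp)

lemma DN_bd_add:
  assumes a: "a \<in> AA n" and b: "b \<in> AA n"
  shows "DN_bd G \<pi> n (cls n m (\<lambda>x. a x + b x)) =
    DN_bd G \<pi> n (cls n m a) \<otimes>\<^bsub>DN G \<pi> (n - 1)\<^esub> DN_bd G \<pi> n (cls n m b)"
proof -
  obtain k1 k2 where k: "Tp k1 (bd G n a) \<in> AA (n - 1)" "Tp k2 (bd G n b) \<in> AA (n - 1)" using ex_Tp_bd[OF a] ex_Tp_bd[OF b] by (elim exE) (rule that)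
  let ?k = "max k1 k2"
  have k': "Tp ?k (bd G n a) \<in> AA (n - 1)" "Tp ?k (bd G n b) \<in> AA (n - 1)"
    using Tp_AA_mono[OF k(1)] Tp_AA_mono[OF k(2)] by simp_all
  have e: "Tp ?k (bd G n (\<lambda>x. a x + b x)) = (\<lambda>x. Tp ?k (bd G n a) x + Tp ?k (bd G n b) x)"
    unfolding bd_add[OF AA_CC[OF a] AA_CC[OF b]]
    by (rule Tp_add[OF bd_CC[OF AA_CC[OF a]] bd_CC[OF AA_CC[OF b]]])
  have s: "Tp ?k (bd G n (\<lambda>x. a x + b x)) \<in> AA (n - 1)" unfolding e by (rule const_span_add[OF k'])
  show ?thesis
    unfolding DN_bd_cls[OF a k'(1)] DN_bd_cls[OF b k'(2)] DN_bd_cls[OF const_span_add[OF a b] s] cls_mult[OF k'] e ..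
qed

lemma chain_complex_Cc: "chain_complex (Cc G :: nat \<Rightarrow> ('g list \<Rightarrow> 'a::ab_group_add) monoid) (bd G)"
proof -
  have m: "f \<otimes>\<^bsub>Cc G n\<^esub> g = (\<lambda>x. f x + g x)" "\<one>\<^bsub>Cc G n\<^esub> = (\<lambda>_. 0)" for n and f g :: "'g list \<Rightarrow> 'a"
    by (simp_all add: Cc_def fun_group_def)
  have "comm_group (Cc G n :: ('g list \<Rightarrow> 'a) monoid)" for n
    unfolding Cc_def using comm_group_fun_group by (intro group.abelian_subgroup_generated comm_group.axioms(2))
  moreover have "bd G n \<in> hom (Cc G n :: ('g list \<Rightarrow> 'a) monoid) (Cc G (n - 1))" for n
    by (rule homI) (simp_all del: One_nat_def add: carrier_Cc m bd_CC bd_add)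
  ultimately show ?thesis
    unfolding chain_complex_def by (auto simp: carrier_Cc m bd_zero_map bd_bd)
qed

lemma chain_complex_DN:
  "chain_complex (DN G \<pi> :: nat \<Rightarrow> (nat \<times> ('g list \<Rightarrow> 'a::ab_group_add)) set monoid) (DN_bd G \<pi>)"
  unfolding chain_complex_def
proof (intro conjI allI ballI)
  fix n show "comm_group (DN G \<pi> n :: (nat \<times> ('g list \<Rightarrow> 'a)) set monoid)" by (rule comm_group_DN)
  show "DN_bd G \<pi> n \<in> hom (DN G \<pi> n :: (nat \<times> ('g list \<Rightarrow> 'a)) set monoid) (DN G \<pi> (n - 1))"
  proof (rule homI)
    fix X :: "(nat \<times> ('g list \<Rightarrow> 'a)) set" assume X: "X \<in> carrier (DN G \<pi> n)"
    then obtain m a where a: "a \<in> AA n" "X = cls n m a" unfolding carrier_DN by blast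
    obtain k where k: "Tp k (bd G n a) \<in> AA (n - 1)" using ex_Tp_bd[OF a(1)] by blast
    show "DN_bd G \<pi> n X \<in> carrier (DN G \<pi> (n - 1))"
      unfolding a(2) DN_bd_cls[OF a(1) k] by (rule cls_carrier[OF k])
    fix Y :: "(nat \<times> ('g list \<Rightarrow> 'a)) set" assume Y: "Y \<in> carrier (DN G \<pi> n)"
    obtain m a b c where *: "a \<in> AA n" "b \<in> AA n" "c \<in> AA n" "X = cls n m a" "Y = cls n m b" "Y = cls n m c"
      by (rule common_level[OF X Y Y])
    show "DN_bd G \<pi> n (X \<otimes>\<^bsub>DN G \<pi> n\<^esub> Y) = DN_bd G \<pi> n X \<otimes>\<^bsub>DN G \<pi> (n - 1)\<^esub> DN_bd G \<pi> n Y"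
      unfolding *(4,5) cls_mult[OF *(1,2)] by (rule DN_bd_add[OF *(1,2)])
  qed
  show "DN_bd G \<pi> n (DN_bd G \<pi> (Suc n) X) = \<one>\<^bsub>DN G \<pi> (n - 1)\<^esub>"
    if X: "X \<in> carrier (DN G \<pi> (Suc n))" for X :: "(nat \<times> ('g list \<Rightarrow> 'a)) set"
  proof -
    obtain m a where a: "a \<in> AA (Suc n)" "X = cls (Suc n) m a" using X unfolding carrier_DN by blast
    obtain k where "Tp k (bd G (Suc n) a) \<in> AA (Suc n - 1)" using ex_Tp_bd[OF a(1)] by blast
    then have k: "Tp k (bd G (Suc n) a) \<in> AA n" "Tp k (bd G (Suc n) a) \<in> AA (Suc n - 1)" by simp_all
    have bC: "bd G (Suc n) a \<in> CC n" using bd_CC[OF AA_CC[OF a(1)]] by simp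
    have z: "Tp 0 (bd G n (Tp k (bd G (Suc n) a))) = (\<lambda>_. 0)"
      using bd_Tp[OF bC, of k] bd_bd[OF AA_CC[OF a(1)]] by (simp add: Tp_zero)
    have "DN_bd G \<pi> (Suc n) X = cls n (m + k) (Tp k (bd G (Suc n) a))"
      unfolding a(2) using DN_bd_cls[OF a(1) k(2)] by simp
    then have "DN_bd G \<pi> n (DN_bd G \<pi> (Suc n) X) = cls (n - 1) (m + k + 0) (\<lambda>_. 0)"
      using DN_bd_cls[OF k(1), of 0 "m + k", unfolded z, OF const_span_zero] by simp
    then show ?thesis using DN_one by metis
  qed
next
  show "DN_bd G \<pi> 0 c = \<one>\<^bsub>DN G \<pi> 0\<^esub>" for c :: "(nat \<times> ('g list \<Rightarrow> 'a)) set"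
    by (simp add: DN_bd_def)
qed

lemma J_hom: "J G \<pi> n \<in> hom (Cc G n :: ('g list \<Rightarrow> 'a::ab_group_add) monoid) (DN G \<pi> n)"
proof (rule homI)
  fix f g :: "'g list \<Rightarrow> 'a" assume "f \<in> carrier (Cc G n)"
  then have f: "f \<in> CC n" by (simp add: carrier_Cc)
  obtain m1 where m1: "\<forall>m\<ge>m1. Tp m f \<in> AA n" using ex_Tp_AA[OF f] by blast
  have "Tp m1 f \<in> AA n" using m1 by simp
  then show "J G \<pi> n f \<in> carrier (DN G \<pi> n)" using J_eq[OF f, of m1] cls_carrier by simp
  assume "g \<in> carrier (Cc G n)"
  then have g: "g \<in> CC n" by (simp add: carrier_Cc)
  obtain m2 where m2: "\<forall>m\<ge>m2. Tp m g \<in> AA n" using ex_Tp_AA[OF g] by blast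
  let ?m = "max m1 m2"
  have m: "Tp ?m f \<in> AA n" "Tp ?m g \<in> AA n" using m1[rule_format, of ?m] m2[rule_format, of ?m] by simp_all
  have e: "Tp ?m (\<lambda>x. f x + g x) = (\<lambda>x. Tp ?m f x + Tp ?m g x)" by (rule Tp_add[OF f g])
  have "Tp ?m (\<lambda>x. f x + g x) \<in> AA n" unfolding e by (rule const_span_add[OF m])
  then have "J G \<pi> n (\<lambda>x. f x + g x) = J G \<pi> n f \<otimes>\<^bsub>DN G \<pi> n\<^esub> J G \<pi> n g"
    using J_eq[OF f m(1)] J_eq[OF g m(2)] J_eq[OF const_span_add[OF f g], of ?m] e cls_mult[OF m] by simp
  moreover have "f \<otimes>\<^bsub>Cc G n\<^esub> g = (\<lambda>x. f x + g x)" by (simp add: Cc_def fun_group_def)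
  ultimately show "J G \<pi> n (f \<otimes>\<^bsub>Cc G n\<^esub> g) = J G \<pi> n f \<otimes>\<^bsub>DN G \<pi> n\<^esub> J G \<pi> n g" by simp
qed

lemma J_bd:
  assumes f: "f \<in> CC n"
  shows "J G \<pi> (n - 1) (bd G n f) = DN_bd G \<pi> n (J G \<pi> n f)"
proof -
  obtain m where m: "Tp m f \<in> AA n" using ex_Tp_AA[OF f] by blast
  obtain k where k: "Tp k (bd G n (Tp m f)) \<in> AA (n - 1)" using ex_Tp_bd[OF m] by blast
  have e: "Tp k (bd G n (Tp m f)) = Tp (m + k) (bd G n f)"
    by (simp add: bd_Tp[OF f] Tp_Tp add.commute)
  show ?thesis
    using DN_bd_cls[OF m k, of m] J_eq[OF f m] J_eq[OF bd_CC[OF f], of "m + k"] k e by simp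
qed

text \<open>Equality in the direct limit becomes, after finitely many shifts, an equality of chains
  stating that an iterate of \<open>T\<close> on \<open>c\<close> bounds. Injectivity of
  \<open>T\<close> on homology brings this back to \<open>c\<close>.\<close>

lemma J_homology_inj:
  fixes c :: "'g list \<Rightarrow> 'a::ab_group_add"
  assumes c: "c \<in> CC n" "bd G n c = (\<lambda>_. 0)" and b: "J G \<pi> n c \<in> boundaries (DN G \<pi>) (DN_bd G \<pi>) n"
  shows "\<exists>h\<in>CC (Suc n). c = bd G (Suc n) h"
proof -
  obtain X where X: "X \<in> carrier (DN G \<pi> (Suc n))" "J G \<pi> n c = DN_bd G \<pi> (Suc n) X" using b by (auto simp: boundaries_def)
  obtain m f where f: "f \<in> AA (Suc n)" "X = cls (Suc n) m f" using X(1) unfolding carrier_DN by blast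
  obtain k where k: "Tp k (bd G (Suc n) f) \<in> AA (Suc n - 1)" using ex_Tp_bd[OF f(1)] by blast
  obtain p where p: "Tp p c \<in> AA n" using ex_Tp_AA[OF c(1)] by blast
  have k': "Tp k (bd G (Suc n) f) \<in> AA n" using k by simp
  have "cls n p (Tp p c) = cls n (m + k) (Tp k (bd G (Suc n) f))"
    using X(2) f(2) DN_bd_cls[OF f(1) k, of m] J_eq[OF c(1) p] by simp
  then obtain i j where "Tp i (Tp p c) = Tp j (Tp k (bd G (Suc n) f))" unfolding cls_eq_iff[OF p k'] by blast
  then have "Tp (i + p) c = bd G (Suc n) (Tp (j + k) f)" by (simp add: Tp_Tp bd_Tp[OF AA_CC[OF f(1)]])
  then show ?thesis by (rule Tp_homology_inj[OF c Tp_CC[OF AA_CC[OF f(1)]]])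
qed

text \<open>A representative at level \<open>m'\<close> has to be compared with an
  \<open>m'\<close>-fold shift of a cycle, since that is the form of a value of \<open>J\<close>.
  Surjectivity of \<open>T\<close> on homology provides such a cycle up to a boundary.\<close>

lemma J_homology_surj:
  fixes X :: "(nat \<times> ('g list \<Rightarrow> 'a::ab_group_add)) set"
  assumes X: "X \<in> carrier (DN G \<pi> n)" "DN_bd G \<pi> n X = \<one>\<^bsub>DN G \<pi> (n - 1)\<^esub>"
  shows "\<exists>c\<in>CC n. bd G n c = (\<lambda>_. 0) \<and>
    (\<exists>b\<in>boundaries (DN G \<pi>) (DN_bd G \<pi>) n. X = b \<otimes>\<^bsub>DN G \<pi> n\<^esub> J G \<pi> n c)"
proof -
  obtain m f where f: "f \<in> AA n" "X = cls n m f" using X(1) unfolding carrier_DN by blast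
  obtain k where k: "Tp k (bd G n f) \<in> AA (n - 1)" using ex_Tp_bd[OF f(1)] by blast
  have "cls (n - 1) (m + k) (Tp k (bd G n f)) = cls (n - 1) 0 (\<lambda>_. 0)"
    using X(2) f(2) DN_bd_cls[OF f(1) k, of m] DN_one[of "n - 1" 0] by simp
  then obtain i j where "Tp i (Tp k (bd G n f)) = Tp j (\<lambda>_. 0)"
    unfolding cls_eq_iff[OF k const_span_zero] by blast
  then have z: "Tp (i + k) (bd G n f) = (\<lambda>_. 0)" by (simp add: Tp_Tp Tp_zero)
  \<comment> \<open>The boundary of \<open>f\<close> vanishes only in the limit. Raising the level
    until it vanishes as a chain replaces \<open>f\<close> by an honest cycle.\<close>
  define f' where "f' = Tp (i + k) f"
  define m' where "m' = m + (i + k)"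
  have f': "f' \<in> AA n" "bd G n f' = (\<lambda>_. 0)" "X = cls n m' f'"
    unfolding f'_def m'_def f(2) cls_shift[OF f(1)] using z Tp_AA[OF f(1)] bd_Tp[OF AA_CC[OF f(1)]] by simp_all
  obtain c h where c: "c \<in> CC n" "bd G n c = (\<lambda>_. 0)" and h: "h \<in> CC (Suc n)" "\<And>z. f' z = Tp m' c z + bd G (Suc n) h z"
    using Tp_homology_surj[OF AA_CC[OF f'(1)] f'(2), of m'] by blast
  obtain m1 where m1: "\<forall>m\<ge>m1. Tp m c \<in> AA n" using ex_Tp_AA[OF c(1)] by blast
  obtain m2 where m2: "\<forall>m\<ge>m2. Tp m h \<in> AA (Suc n)" using ex_Tp_AA[OF h(1)] by blast
  let ?j = "max m1 m2"
  have cA: "Tp (m' + ?j) c \<in> AA n" and hA: "Tp ?j h \<in> AA (Suc n)"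
    using m1[rule_format, of "m' + ?j"] m2[rule_format, of ?j] by simp_all
  have bC: "bd G (Suc n) h \<in> CC n" using bd_CC[OF h(1)] by simp
  have "f' = (\<lambda>z. Tp m' c z + bd G (Suc n) h z)" using h(2) by (rule ext)
  then have "Tp ?j f' = (\<lambda>z. Tp ?j (Tp m' c) z + Tp ?j (bd G (Suc n) h) z)"
    using Tp_add[OF Tp_CC[OF c(1), of m'] bC, of ?j] by simp
  then have e: "Tp ?j f' = (\<lambda>z. Tp (m' + ?j) c z + bd G (Suc n) (Tp ?j h) z)"
    by (simp add: Tp_Tp bd_Tp[OF h(1)] add.commute)
  have "bd G (Suc n) (Tp ?j h) = (\<lambda>z. Tp ?j f' z + - Tp (m' + ?j) c z)" unfolding e by simp
  \<comment> \<open>The boundary of an element of \<open>AA (Suc n)\<close> is a priori only a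
    chain; here it is the difference of two elements of \<open>AA n\<close>, so it represents a
    class at the same level without further shifting.\<close>
  then have bA: "bd G (Suc n) (Tp ?j h) \<in> AA n"
    using const_span_add[OF Tp_AA[OF f'(1), of ?j] const_span_uminus[OF cA]] by simp
  have "X = cls n (m' + ?j) (Tp ?j f')" unfolding f'(3) cls_shift[OF f'(1)] ..
  also have "Tp ?j f' = (\<lambda>z. bd G (Suc n) (Tp ?j h) z + Tp (m' + ?j) c z)" unfolding e by (simp only: add.commute)
  also have "cls n (m' + ?j) \<dots> = cls n (m' + ?j) (bd G (Suc n) (Tp ?j h)) \<otimes>\<^bsub>DN G \<pi> n\<^esub> cls n (m' + ?j) (Tp (m' + ?j) c)"
    by (rule cls_mult[OF bA cA, symmetric])
  also have "cls n (m' + ?j) (Tp (m' + ?j) c) = J G \<pi> n c" by (rule J_eq[OF c(1) cA, symmetric])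
  also have "cls n (m' + ?j) (bd G (Suc n) (Tp ?j h)) = DN_bd G \<pi> (Suc n) (cls (Suc n) (m' + ?j) (Tp ?j h))"
    using DN_bd_cls[OF hA, of 0 "m' + ?j"] bA by simp
  finally have "X = DN_bd G \<pi> (Suc n) (cls (Suc n) (m' + ?j) (Tp ?j h)) \<otimes>\<^bsub>DN G \<pi> n\<^esub> J G \<pi> n c" .
  moreover have "DN_bd G \<pi> (Suc n) (cls (Suc n) (m' + ?j) (Tp ?j h)) \<in> boundaries (DN G \<pi>) (DN_bd G \<pi>) n"
    unfolding boundaries_def by (rule imageI[OF cls_carrier[OF hA]])
  ultimately show ?thesis using c by blast
qed

lemma cycles_Cc: "c \<in> cycles (Cc G) (bd G) n \<longleftrightarrow> c \<in> CC n \<and> bd G n c = (\<lambda>_. 0)"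
  by (simp add: cycles_def kernel_def carrier_Cc) (simp add: Cc_def fun_group_def)

lemma J_homology_iso:
  "\<exists>\<Phi> \<in> iso (homology (Cc G :: nat \<Rightarrow> ('g list \<Rightarrow> 'a::ab_group_add) monoid) (bd G) n)
            (homology (DN G \<pi>) (DN_bd G \<pi>) n).
     \<forall>c \<in> cycles (Cc G) (bd G) n.
       \<Phi> (boundaries (Cc G) (bd G) n #>\<^bsub>Cc G n\<^esub> c)
         = boundaries (DN G \<pi>) (DN_bd G \<pi>) n #>\<^bsub>DN G \<pi> n\<^esub> J G \<pi> n c"
proof (rule homology_iso[OF chain_complex_Cc chain_complex_DN J_hom])
  show "J G \<pi> (n - 1) (bd G n c) = DN_bd G \<pi> n (J G \<pi> n c)" if "c \<in> carrier (Cc G n)" for n and c :: "'g list \<Rightarrow> 'a"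
    using J_bd that by (simp add: carrier_Cc)
  show "c \<in> boundaries (Cc G) (bd G) n"
    if cyc: "c \<in> cycles (Cc G) (bd G) n" and b: "J G \<pi> n c \<in> boundaries (DN G \<pi>) (DN_bd G \<pi>) n" for c :: "'g list \<Rightarrow> 'a"
  proof -
    have c: "c \<in> CC n" "bd G n c = (\<lambda>_. 0)" using cyc by (simp_all add: cycles_Cc)
    obtain h where "h \<in> CC (Suc n)" "c = bd G (Suc n) h" using J_homology_inj[OF c b] by blast
    then show ?thesis by (simp add: boundaries_def carrier_Cc)
  qed
  show "\<exists>c\<in>cycles (Cc G) (bd G) n. \<exists>b\<in>boundaries (DN G \<pi>) (DN_bd G \<pi>) n. x = b \<otimes>\<^bsub>DN G \<pi> n\<^esub> J G \<pi> n c"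
    if "x \<in> cycles (DN G \<pi>) (DN_bd G \<pi>) n" for x :: "(nat \<times> ('g list \<Rightarrow> 'a)) set"
  proof -
    have x: "x \<in> carrier (DN G \<pi> n)" "DN_bd G \<pi> n x = \<one>\<^bsub>DN G \<pi> (n - 1)\<^esub>"
      using that by (simp_all add: cycles_def kernel_def)
    obtain c where c: "c \<in> CC n" "bd G n c = (\<lambda>_. 0) \<and>
        (\<exists>b\<in>boundaries (DN G \<pi>) (DN_bd G \<pi>) n. x = b \<otimes>\<^bsub>DN G \<pi> n\<^esub> J G \<pi> n c)"
      using J_homology_surj[OF x] by (rule bexE)
    show ?thesis by (rule bexI[of _ c], rule conjunct2[OF c(2)]) (simp add: cycles_Cc c)
  qed
qed

end

theorem theorem8p15:
  fixes D :: "('v, 'x) pre_digraph"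
    and G :: "'g topgpd"
    and \<pi> :: "'g \<Rightarrow> nat \<Rightarrow> 'x"
  assumes "fin_digraph D"
    and "etale_groupoid G"
    and "effective G"
    and "homeomorphic_map (unit_top G) (edge_shift D) \<pi>"
    and "completely_shift_invariant D G \<pi>"
    and "contracting G \<pi>"
  shows "chain_complex (Cc G :: nat \<Rightarrow> ('g list \<Rightarrow> 'a::ab_group_add) monoid) (bd G)
    \<and> chain_complex
        (DN G \<pi> :: nat \<Rightarrow> (nat \<times> ('g list \<Rightarrow> 'a)) set monoid) (DN_bd G \<pi>)
    \<and> (\<forall>n. (J G \<pi> n :: ('g list \<Rightarrow> 'a) \<Rightarrow> _) \<in> hom (Cc G n) (DN G \<pi> n))
    \<and> (\<forall>n. \<forall>f \<in> carrier (Cc G n :: ('g list \<Rightarrow> 'a) monoid).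
          J G \<pi> (n - 1) (bd G n f) = DN_bd G \<pi> n (J G \<pi> n f))
    \<and> (\<forall>n. \<exists>\<Phi> \<in> iso (homology (Cc G :: nat \<Rightarrow> ('g list \<Rightarrow> 'a) monoid) (bd G) n)
                      (homology (DN G \<pi>) (DN_bd G \<pi>) n).
          \<forall>c \<in> cycles (Cc G) (bd G) n.
            \<Phi> (boundaries (Cc G) (bd G) n #>\<^bsub>Cc G n\<^esub> c)
              = boundaries (DN G \<pi>) (DN_bd G \<pi>) n #>\<^bsub>DN G \<pi> n\<^esub> J G \<pi> n c)"
proof -
  interpret contracting_groupoid G D \<pi>
    by (intro contracting_groupoid.intro shift_groupoid.intro shift_groupoid_axioms.intro
      contracting_groupoid_axioms.intro assms)
  show ?thesis
    by (intro conjI allI ballI chain_complex_Cc chain_complex_DN J_hom J_homology_iso) (simp del: One_nat_def add: carrier_Cc J_bd)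
qed

end
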